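(* Let $d\ge 1$ and let $\nu\ge 2$ be an integer. Let $X_1,X_2,\dots$ be i.i.d. random vectors in $\mathbb{R}^d$ with density $f$, let $c\in\mathbb{R}$ be fixed, and let $\widehat f$ be the kernel density estimator based on $X_1,\dots,X_n$ with kernel $K$ and bandwidth vector $\mathbf h=\mathbf h_n=(h_1,\dots,h_d)^T\in\mathbb{R}_+^d$. Assume the following. (i) $f$ is $\nu$ times continuously differentiable on $\mathbb{R}^d$; $f$ and all its partial derivatives of orders $1,\dots,\nu$ are bounded; $\inf_{x} f(x)<c<\sup_{x} f(x)$; and there exist $\delta_0>0$, $\epsilon_0>0$ such that $\|\nabla f(x)\|>\epsilon_0$ for all $x$ with $|f(x)-c|\le\delta_0$. (ii) $g$ is a non-negative continuous function on $\mathbb{R}^d$ which is integrable or of the form $g=f^r|f-c|^q$ for some $r,q\ge0$; $g$ is positive and bounded on $\mathcal M$; and, as $s\to0$, $\sup_{x\in\mathcal M}|g(\zeta_x(s))-g(x)|=o(1)$. (iii) $K$ is a symmetric product kernel of order $\nu$, and $K\in L^1(\mathbb{R}^d)\cap L^\infty(\mathbb{R}^d)$. (iv) $K$ is twice continuously differentiable, the envelope $F$ of the class $\mathscr K$ satisfies $\|F\|_\infty<\infty$, and there are $C_0>0$, $\eta>0$ such that $\sup_Q N(\mathscr K,L_2(Q),\epsilon\|F\|_\infty)\le C_0\epsilon^{-\eta}$ for all $0<\epsilon<1$, the supremum being over all Borel probability measures $Q$ on $\mathbb{R}^d$. (v) As $n\to\infty$, $(\log n)^{-1}n h_1\cdots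 h_d\to\infty$ and $\log(1/\|\mathbf h\|)/(\log\log n)\to\infty$; and if $d\ge2$, $h_i\asymp h_j$ for all $1\le i,j\le d$. Then, as $n\to\infty$, $$\mathbb{E}\lambda_g(\mathcal L\,\Delta\,\widehat{\mathcal L})=\int_{\mathcal M}\frac{s_n\,\gamma(|\beta_{\mathbf h}(x)|/s_n)}{\|\nabla f(x)\|}\,g(x)\,d\mathscr H(x)+o\left(\|\mathbf h\|^\nu+\frac{1}{\sqrt{nh_1\cdots h_d}}\right).$$
   Context: Level sets: $\mathcal L=\{x\in\mathbb{R}^d: f(x)\ge c\}$, $\widehat{\mathcal L}=\{x\in\mathbb{R}^d:\widehat f(x)\ge c\}$, $\mathcal M=\{x\in\mathbb{R}^d: f(x)=c\}$. $A\Delta B$ is the symmetric difference. $\lambda_g(A)=\int_A g(x)\,dx$. $\mathscr H=\mathscr H_{d-1}$ is the $(d-1)$-dimensional normalized Hausdorff measure on $\mathbb{R}^d$ (counting measure when $d=1$). $\mathbb{R}_+^d$ is the set of vectors with positive coordinates. $a_n\asymp b_n$ means $0<\liminf|a_n/b_n|\le\limsup|a_n/b_n|<\infty$. For $x$ with $\nabla f(x)\ne0$ and $s\in\mathbb{R}$, $\zeta_x(s)=x+\frac{\nabla f(x)}{\|\nabla f(x)\|}s$ (for $d=1$, $\nabla f=f'$ and $\zeta_x(s)=x+\mathrm{sign}(f'(x))s$). Estimator: $\widehat f(x)=\frac{1}{n\prod_{j=1}^d h_j}\sum_{i=1}^n K(\mathbf h^{-1}\odot(x-X_i))$, where $\mathbf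 h^{-1}=(h_1^{-1},\dots,h_d^{-1})^T$ and $\odot$ is the element-wise product. Product kernel: $K(u)=\prod_{j=1}^d\widetilde K(u_j)$ for a univariate kernel $\widetilde K$. It has order $\nu$ if $\int_{\mathbb{R}}|u^\nu\widetilde K(u)|du<\infty$, $\int\widetilde K=1$, $\int u^l\widetilde K(u)du=0$ for $l=1,\dots,\nu-1$, and $\kappa_\nu:=\int u^\nu\widetilde K(u)du\ne0$. The class $\mathscr K$ consists of all functions $y\mapsto D K(\mathbf h^{-1}\odot(x-y))$ with $\mathbf h\in\mathbb{R}_+^d$, $x\in\mathbb{R}^d$, and $DK$ ranging over $K$ and all its partial derivatives of orders 1 and 2 (derivative of $K$ evaluated at $\mathbf h^{-1}\odot(x-y)$). Its envelope is $F(y)=\sup_{\varphi\in\mathscr K}|\varphi(y)|$. $N(\mathscr K,L_2(Q),\epsilon)$ is the minimal number of $L_2(Q)$-balls of radius $\epsilon$ needed to cover $\mathscr K$. Further: $s_n>0$ with $s_n^2=\frac{c\,\|K\|_2^2}{nh_1\cdots h_d}$, $\|K\|_2^2=\int_{\mathbb{R}^d}K(u)^2du$; $\beta_{\mathbf h}(x)=\frac{\kappa_\nu}{\nu!}\sum_{k=1}^d h_k^\nu\,\frac{\partial^\nu f}{\partial x_k^\nu}(x)$; and $\gamma(u)=\sqrt{\frac2\pi}\left(u\int_0^u e^{-t^2/2}dt+e^{-u^2/2}\right)$ for $u\ge0$. *)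

theory Defs
  imports "HOL-Probability.Probability" "HOL-Library.Landau_Symbols"
begin

section \<open>Partial derivatives\<close>

definition partial_deriv :: "'d::finite \<Rightarrow> (real^'d \<Rightarrow> real) \<Rightarrow> real^'d \<Rightarrow> real" where
  "partial_deriv i F x = deriv (\<lambda>t. F (x + t *\<^sub>R axis i 1)) 0"

text \<open>A list of coordinates encodes an iterated partial derivative; its length is the order.\<close>

definition partials :: "'d::finite list \<Rightarrow> (real^'d \<Rightarrow> real) \<Rightarrow> real^'d \<Rightarrow> real" where
  "partials is F = foldr partial_deriv is F"

definition times_cont_diff :: "nat \<Rightarrow> (real^'d::finite \<Rightarrow> real) \<Rightarrow> bool" where
  "times_cont_diff k F \<longleftrightarrow>
     (\<forall>is. length is < k \<longrightarrow>
        (\<forall>i x. (\<lambda>t. partials is F (x + t *\<^sub>R axis i 1)) differentiable (at 0))) \<and>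
     (\<forall>is. length is \<le> k \<longrightarrow> continuous_on UNIV (partials is F))"

definition grad :: "(real^'d::finite \<Rightarrow> real) \<Rightarrow> real^'d \<Rightarrow> real^'d" where
  "grad F x = (\<chi> i. partial_deriv i F x)"

definition zeta :: "(real^'d::finite \<Rightarrow> real) \<Rightarrow> real^'d \<Rightarrow> real \<Rightarrow> real^'d" where
  "zeta f x s = x + s *\<^sub>R (grad f x /\<^sub>R norm (grad f x))"


section \<open>Normalized Hausdorff measure\<close>

text \<open>The exponent is a natural number, so that \<open>0 ^ 0 = 1\<close> makes every nonempty covering set
  count once when \<open>m = 0\<close>, which gives the counting measure. Boundedness is required because
  \<^const>\<open>diameter\<close> is unspecified on unbounded sets. The outer measure is a metric outer measure,
  hence countably additive on Borel sets by Caratheodory's criterion, so \<^const>\<open>measure_of\<close> does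
  not fall back to the zero measure.\<close>

definition hausdorff_pre :: "nat \<Rightarrow> real \<Rightarrow> 'a::metric_space set \<Rightarrow> ennreal" where
  "hausdorff_pre m \<delta> A =
     (INF C \<in> {C :: nat \<Rightarrow> 'a set. A \<subseteq> (\<Union>i. C i) \<and> (\<forall>i. bounded (C i) \<and> diameter (C i) \<le> \<delta>)}.
        \<Sum>i. if C i = {} then 0 else ennreal (unit_ball_vol (real m) * (diameter (C i) / 2) ^ m))"

definition hausdorff_outer :: "nat \<Rightarrow> 'a::metric_space set \<Rightarrow> ennreal" where
  "hausdorff_outer m A = (SUP \<delta> \<in> {0<..}. hausdorff_pre m \<delta> A)"

definition hausdorff_measure :: "nat \<Rightarrow> 'a::metric_space measure" where
  "hausdorff_measure m = measure_of UNIV (sets borel) (hausdorff_outer m)"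


section \<open>Kernels and the kernel density estimator\<close>

definition inv_scale :: "real^'d::finite \<Rightarrow> real^'d \<Rightarrow> real^'d" where
  "inv_scale h v = (\<chi> j. inverse (h $ j) * v $ j)"

definition kde :: "(real^'d::finite \<Rightarrow> real) \<Rightarrow> real^'d \<Rightarrow> nat \<Rightarrow> (nat \<Rightarrow> real^'d) \<Rightarrow> real^'d \<Rightarrow> real" where
  "kde K h n X x = 1 / (real n * (\<Prod>j\<in>UNIV. h $ j)) * (\<Sum>i<n. K (inv_scale h (x - X i)))"

definition kappa :: "nat \<Rightarrow> (real \<Rightarrow> real) \<Rightarrow> real" where
  "kappa \<nu> Kt = (LBINT u. u ^ \<nu> * Kt u)"

definition kernel_order :: "nat \<Rightarrow> (real \<Rightarrow> real) \<Rightarrow> bool" where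
  "kernel_order \<nu> Kt \<longleftrightarrow>
     integrable lborel Kt \<and>
     integrable lborel (\<lambda>u. u ^ \<nu> * Kt u) \<and>
     (LBINT u. Kt u) = 1 \<and>
     (\<forall>l\<in>{1..\<nu> - 1}. (LBINT u. u ^ l * Kt u) = 0) \<and>
     kappa \<nu> Kt \<noteq> 0"

definition kernel_class :: "(real^'d::finite \<Rightarrow> real) \<Rightarrow> (real^'d \<Rightarrow> real) set" where
  "kernel_class K =
     {\<lambda>y. partials is K (inv_scale h (x - y)) | is h x. length is \<le> 2 \<and> (\<forall>j. 0 < h $ j)}"

definition envelope :: "('a \<Rightarrow> real) set \<Rightarrow> 'a \<Rightarrow> ennreal" where
  "envelope S y = (SUP \<phi>\<in>S. ennreal \<bar>\<phi> y\<bar>)"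

text \<open>The envelope of a \<^const>\<open>kernel_class\<close> is constant (translate \<open>x\<close>), so its supremum is also its
  essential supremum.\<close>

definition sup_norm :: "('a \<Rightarrow> ennreal) \<Rightarrow> ennreal" where
  "sup_norm F = (SUP y. F y)"

definition L2_dist :: "'a measure \<Rightarrow> ('a \<Rightarrow> real) \<Rightarrow> ('a \<Rightarrow> real) \<Rightarrow> real" where
  "L2_dist Q \<phi> \<psi> = sqrt (\<integral>y. (\<phi> y - \<psi> y)\<^sup>2 \<partial>Q)"

text \<open>Open balls with arbitrary centres in \<open>L\<^sub>2(Q)\<close>; the value is \<open>\<infinity>\<close> if no finite cover exists.\<close>

definition covering_number :: "'a measure \<Rightarrow> ('a \<Rightarrow> real) set \<Rightarrow> real \<Rightarrow> enat" where
  "covering_number Q S \<epsilon> =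
     Inf {enat (card C) | C. finite C \<and>
            (\<forall>\<psi>\<in>C. \<psi> \<in> borel_measurable Q \<and> integrable Q (\<lambda>y. (\<psi> y)\<^sup>2)) \<and>
            (\<forall>\<phi>\<in>S. \<exists>\<psi>\<in>C. L2_dist Q \<phi> \<psi> < \<epsilon>)}"

definition borel_prob_measures :: "'a::topological_space measure set" where
  "borel_prob_measures = {Q. prob_space Q \<and> sets Q = sets borel}"


section \<open>Quantities in the expansion\<close>

text \<open>Real powers of nonnegative numbers with \<open>0\<^sup>0 = 1\<close>, whereas \<open>0 powr 0 = 0\<close>.\<close>

definition rpow :: "real \<Rightarrow> real \<Rightarrow> real" where
  "rpow a r = (if r = 0 then 1 else a powr r)"

definition order_comparable :: "(nat \<Rightarrow> real) \<Rightarrow> (nat \<Rightarrow> real) \<Rightarrow> bool" where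
  "order_comparable a b \<longleftrightarrow>
     0 < liminf (\<lambda>n. ereal \<bar>a n / b n\<bar>) \<and> limsup (\<lambda>n. ereal \<bar>a n / b n\<bar>) < \<infinity>"

definition lambda_meas :: "('a::euclidean_space \<Rightarrow> real) \<Rightarrow> 'a set \<Rightarrow> real" where
  "lambda_meas g A = (LINT x:A|lborel. g x)"

definition s_dev :: "real \<Rightarrow> (real^'d::finite \<Rightarrow> real) \<Rightarrow> real^'d \<Rightarrow> nat \<Rightarrow> real" where
  "s_dev c K h n = sqrt (c * (LBINT u. (K u)\<^sup>2) / (real n * (\<Prod>j\<in>UNIV. h $ j)))"

definition bias_beta :: "nat \<Rightarrow> (real \<Rightarrow> real) \<Rightarrow> (real^'d::finite \<Rightarrow> real) \<Rightarrow> real^'d \<Rightarrow> real^'d \<Rightarrow> real" where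
  "bias_beta \<nu> Kt f h x =
     kappa \<nu> Kt / fact \<nu> * (\<Sum>k\<in>UNIV. (h $ k) ^ \<nu> * partials (replicate \<nu> k) f x)"

definition gamma_fn :: "real \<Rightarrow> real" where
  "gamma_fn u = sqrt (2 / pi) * (u * integral {0..u} (\<lambda>t. exp (- t\<^sup>2 / 2)) + exp (- u\<^sup>2 / 2))"

end

theory Submission
  imports Defs "HOL-Real_Asymp.Real_Asymp"
begin

text \<open>By Fubini, the expected risk is the integral of \<open>g x * p\<^sub>n x\<close>, where \<open>p\<^sub>n x\<close> is the probability that
  \<open>f x\<close> and the estimator at \<open>x\<close> lie on different sides of \<open>c\<close>. Away from the level set, Chebyshev's
  inequality bounds \<open>p\<^sub>n x\<close> by a multiple of \<open>s\<^sub>n\<^sup>2 / (f x - c)\<^sup>2\<close>, which is negligible. At distance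
  \<open>O(norm h ^ \<nu> + s\<^sub>n)\<close> from it, the estimator is uniformly asymptotically normal with mean \<open>f x + \<beta> x\<close> and
  deviation \<open>s\<^sub>n\<close>, so that \<open>p\<^sub>n x\<close> is close to a Gaussian probability depending only on \<open>f x - c\<close> and \<open>\<beta> x\<close>,
  whose integral over \<open>v = f x - c\<close> is \<open>s\<^sub>n * \<gamma>(\<bar>\<beta> x\<bar> / s\<^sub>n)\<close>. A partition of unity makes \<open>\<beta>\<close> almost
  constant on each piece, and the coarea formula turns the integral over a neighbourhood of the level set into an
  integral over \<open>v\<close> and a surface integral with density \<open>1 / norm (grad f x)\<close>. This formula is obtained by
  flattening the level sets with almost isometric charts; for a hyperplane, normalized Hausdorff measure agrees
  with Lebesgue measure by the isodiametric inequality, which follows by Steiner symmetrization.\<close>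

subsection \<open>Splitting off a coordinate\<close>

text \<open>Nothing relates the bias size norm h ^ \<nu> to s_n, and the central limit theorem comes
  without a rate, so every estimate has to hold at the scale tau = norm h ^ \<nu> + s_n. Two
  identities allow this. With Z standard normal, s * \<gamma>(|b| / s) = E|s Z - b|, which is
  1-Lipschitz in b for every s. And replacing b by b' changes the Gaussian probability by an amount
  whose integral over v is |b' - b|, again for every s. Hence a bias known up to \<epsilon> * norm h
  ^ \<nu> costs only that order after integration. The bias must be made constant because the coarea
  formula treats only integrands w(x) k(f x - c). As k varies with n, the formula is proved
  uniformly: one window |v| \<le> \<delta> serves all nonnegative k supported in it, with an error
  proportional to the integral of k. The error e1 of the central limit theorem acts on a zone of
  width of order T * tau and contributes of order T * e1 * tau, small once T is fixed. A band around
  the level set is compact because an integrable Lipschitz density vanishes at infinity and c is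
  positive.\<close>

definition vinsert :: "'d::finite \<Rightarrow> ('d \<Rightarrow> real) \<Rightarrow> real \<Rightarrow> real^'d" where
  "vinsert i p t = (\<chi> k. if k = i then t else p k)"

lemma vinsert_nth [simp]: "vinsert i p t $ k = (if k = i then t else p k)"
  by (simp add: vinsert_def)

lemma borel_measurable_vec_lambda:
  fixes f :: "'a \<Rightarrow> 'd::finite \<Rightarrow> real"
  assumes "\<And>k. (\<lambda>x. f x k) \<in> borel_measurable M"
  shows "(\<lambda>x. \<chi> k. f x k) \<in> borel_measurable M"
proof (subst borel_measurable_euclidean_space, intro ballI)
  fix b :: "real^'d" assume "b \<in> Basis"
  then obtain k where "b = axis k 1" by (auto simp: Basis_vec_def)
  then show "(\<lambda>x. (\<chi> k. f x k) \<bullet> b) \<in> borel_measurable M"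
    using assms[of k] by (simp add: inner_axis)
qed

lemma borel_measurable_vec_nth' [measurable (raw)]:
  fixes f :: "'a \<Rightarrow> real^'d::finite"
  assumes "f \<in> borel_measurable M"
  shows "(\<lambda>x. f x $ k) \<in> borel_measurable M"
  using assms by (rule borel_measurable_continuous_on[rotated]) (intro continuous_intros)

lemma measurable_vinsert:
  "(\<lambda>(p, t). vinsert i p t) \<in> (Pi\<^sub>M (- {i}) (\<lambda>_. lborel) \<Otimes>\<^sub>M lborel) \<rightarrow>\<^sub>M borel"
  unfolding vinsert_def split_beta
proof (rule borel_measurable_vec_lambda)
  fix k
  show "(\<lambda>x. if k = i then snd x else fst x k) \<in> borel_measurable (Pi\<^sub>M (- {i}) (\<lambda>_. lborel) \<Otimes>\<^sub>M lborel)"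
  proof (cases "k = i")
    case True then show ?thesis by simp
  next
    case False
    have "(\<lambda>p. p k) \<in> (Pi\<^sub>M (- {i}) (\<lambda>_. lborel)) \<rightarrow>\<^sub>M lborel" using False by (intro measurable_component_singleton) simp
    then show ?thesis using False by (auto intro: measurable_compose[OF measurable_fst])
  qed
qed

lemma measurable_vinsert' [measurable]:
  "vinsert i p \<in> borel \<rightarrow>\<^sub>M borel"
  unfolding vinsert_def by (rule borel_measurable_vec_lambda) auto

text \<open>Lebesgue measure is determined by its values on boxes, and the preimage of a box is a
  box in the coordinates other than \<open>i\<close> times an interval. As the dimension is a type,
  the remaining coordinates live in \<open>Pi\<^sub>M (- {i})\<close>; in dimension 1 this is a
  single point of mass 1.\<close>

lemma lborel_split:
  "(lborel :: (real^'d::finite) measure) =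
     distr (Pi\<^sub>M (- {i}) (\<lambda>_. lborel) \<Otimes>\<^sub>M lborel) borel (\<lambda>(p, t). vinsert i p t)"
proof (rule lborel_eqI)
  interpret F: finite_product_sigma_finite "\<lambda>_. lborel :: real measure" "- {i}" by standard simp
  fix l u :: "real^'d" assume lu: "\<And>b. b \<in> Basis \<Longrightarrow> l \<bullet> b \<le> u \<bullet> b"
  then have lu': "l $ k \<le> u $ k" for k by (simp add: cart_eq_inner_axis)
  let ?N = "Pi\<^sub>M (- {i}) (\<lambda>_. lborel :: real measure)"
  have pre: "(\<lambda>(p, t). vinsert i p t) -` box l u \<inter> space (?N \<Otimes>\<^sub>M lborel) =
     (\<Pi>\<^sub>E k \<in> -{i}. {l $ k <..< u $ k}) \<times> {l $ i <..< u $ i}"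
  proof (rule set_eqI)
    fix x :: "('d \<Rightarrow> real) \<times> real"
    obtain p t where x: "x = (p, t)" by (cases x)
    have "vinsert i p t \<in> box l u \<longleftrightarrow> (\<forall>k\<in>-{i}. p k \<in> {l $ k <..< u $ k}) \<and> t \<in> {l $ i <..< u $ i}"
    proof -
      have "(\<forall>k. Q k) \<longleftrightarrow> (\<forall>k\<in>-{i}. Q k) \<and> Q i" for Q by blast
      then show ?thesis unfolding mem_box_cart by simp
    qed
    then show "x \<in> (\<lambda>(p, t). vinsert i p t) -` box l u \<inter> space (?N \<Otimes>\<^sub>M lborel) \<longleftrightarrow>
        x \<in> (\<Pi>\<^sub>E k \<in> -{i}. {l $ k <..< u $ k}) \<times> {l $ i <..< u $ i}"
      by (simp add: x space_pair_measure space_PiM PiE_iff conj_ac)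
  qed
  have "emeasure (distr (?N \<Otimes>\<^sub>M lborel) borel (\<lambda>(p, t). vinsert i p t)) (box l u) =
      emeasure (?N \<Otimes>\<^sub>M lborel) ((\<Pi>\<^sub>E k \<in> -{i}. {l $ k <..< u $ k}) \<times> {l $ i <..< u $ i})"
    by (subst emeasure_distr[OF measurable_vinsert]) (auto simp: pre)
  also have "\<dots> = emeasure ?N (\<Pi>\<^sub>E k \<in> -{i}. {l $ k <..< u $ k}) * emeasure lborel {l $ i <..< u $ i}"
    by (rule lborel.emeasure_pair_measure_Times) (auto intro!: sets_PiM_I_finite)
  also have "\<dots> = (\<Prod>k\<in>-{i}. ennreal (u $ k - l $ k)) * ennreal (u $ i - l $ i)"
    by (subst F.measure_times) (auto simp: lu')
  also have "\<dots> = ennreal (\<Prod>k\<in>UNIV. u $ k - l $ k)"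
    by (subst prod_ennreal[symmetric]) (auto simp: lu' prod.remove[of UNIV i] Compl_eq_Diff_UNIV mult.commute)
  also have "(\<Prod>k\<in>UNIV. u $ k - l $ k) = (\<Prod>b\<in>Basis. (u - l) \<bullet> b)"
    by (subst Basis_vec_def) (simp add: UNION_singleton_eq_range prod.reindex inj_on_def axis_eq_axis inner_axis)
  finally show "emeasure (distr (?N \<Otimes>\<^sub>M lborel) borel (\<lambda>(p, t). vinsert i p t)) (box l u)
     = (\<Prod>b\<in>Basis. (u - l) \<bullet> b)" .
qed simp

lemma
  fixes F :: "real^'d::finite \<Rightarrow> ennreal"
  assumes [measurable]: "F \<in> borel_measurable borel"
  shows nn_integral_split: "(\<integral>\<^sup>+z. F z \<partial>lborel) =
      (\<integral>\<^sup>+p. \<integral>\<^sup>+t. F (vinsert i p t) \<partial>lborel \<partial>Pi\<^sub>M (- {i}) (\<lambda>_. lborel))"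
    and nn_integral_split': "(\<integral>\<^sup>+z. F z \<partial>lborel) =
      (\<integral>\<^sup>+t. \<integral>\<^sup>+p. F (vinsert i p t) \<partial>Pi\<^sub>M (- {i}) (\<lambda>_. lborel) \<partial>lborel)"
proof -
  interpret F: finite_product_sigma_finite "\<lambda>_. lborel :: real measure" "- {i}" by standard simp
  interpret P: pair_sigma_finite "Pi\<^sub>M (- {i}) (\<lambda>_. lborel :: real measure)" "lborel :: real measure" ..
  note [measurable] = measurable_vinsert
  have [measurable]: "(\<lambda>(p, t). F (vinsert i p t)) \<in> borel_measurable (Pi\<^sub>M (- {i}) (\<lambda>_. lborel) \<Otimes>\<^sub>M lborel)"
    using measurable_compose[OF measurable_vinsert assms, of i] by (simp add: split_beta)
  have eq: "(\<integral>\<^sup>+z. F z \<partial>lborel) =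
      (\<integral>\<^sup>+x. (case x of (p, t) \<Rightarrow> F (vinsert i p t)) \<partial>(Pi\<^sub>M (- {i}) (\<lambda>_. lborel) \<Otimes>\<^sub>M lborel))"
    by (subst lborel_split[of i], subst nn_integral_distr[OF measurable_vinsert]) (auto simp: split_beta')
  show "(\<integral>\<^sup>+z. F z \<partial>lborel) =
      (\<integral>\<^sup>+p. \<integral>\<^sup>+t. F (vinsert i p t) \<partial>lborel \<partial>Pi\<^sub>M (- {i}) (\<lambda>_. lborel))"
    unfolding eq by (subst lborel.nn_integral_fst[symmetric]) auto
  show "(\<integral>\<^sup>+z. F z \<partial>lborel) =
      (\<integral>\<^sup>+t. \<integral>\<^sup>+p. F (vinsert i p t) \<partial>Pi\<^sub>M (- {i}) (\<lambda>_. lborel) \<partial>lborel)"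
    unfolding eq by (subst P.nn_integral_snd[symmetric]) auto
qed

subsection \<open>Hausdorff measure\<close>

lemma hausdorff_pre_le:
  assumes "A \<subseteq> (\<Union>i. C i)" "\<And>i. bounded (C i)" "\<And>i. diameter (C i) \<le> \<delta>"
  shows "hausdorff_pre m \<delta> A \<le>
    (\<Sum>i. if C i = {} then 0 else ennreal (unit_ball_vol (real m) * (diameter (C i) / 2) ^ m))"
  unfolding hausdorff_pre_def using assms by (intro INF_lower) auto

lemma hausdorff_pre_mono: "A \<subseteq> B \<Longrightarrow> hausdorff_pre m \<delta> A \<le> hausdorff_pre m \<delta> B"
  unfolding hausdorff_pre_def by (rule INF_superset_mono) auto

lemma hausdorff_pre_antimono: "\<delta> \<le> \<epsilon> \<Longrightarrow> hausdorff_pre m \<epsilon> A \<le> hausdorff_pre m \<delta> A"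
  unfolding hausdorff_pre_def by (rule INF_superset_mono) (auto intro: order_trans)

lemma hausdorff_pre_empty: "0 < \<delta> \<Longrightarrow> hausdorff_pre m \<delta> {} = 0"
  using hausdorff_pre_le[of "{}" "\<lambda>_. {}" \<delta> m] by simp

text \<open>Covers of the \<open>A n\<close> that exceed the infimum by at most e / 2 ^ (n + 1) are
  merged into one sequence through the pairing function.\<close>

lemma hausdorff_pre_UN:
  fixes A :: "nat \<Rightarrow> 'a::metric_space set"
  shows "hausdorff_pre m \<delta> (\<Union>n. A n) \<le> (\<Sum>n. hausdorff_pre m \<delta> (A n))"
proof (rule ennreal_le_epsilon)
  fix e :: real assume fin: "(\<Sum>n. hausdorff_pre m \<delta> (A n)) < top" and e: "0 < e"
  let ?s = "\<lambda>C. if C = {} then 0 else ennreal (unit_ball_vol (real m) * (diameter (C :: 'a set) / 2) ^ m)"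
  have ex: "\<exists>C. A n \<subseteq> (\<Union>i. C i) \<and> (\<forall>i. bounded (C i) \<and> diameter (C i) \<le> \<delta>) \<and>
      (\<Sum>i. ?s (C i)) \<le> hausdorff_pre m \<delta> (A n) + ennreal (e * (1/2) ^ Suc n)" for n
  proof -
    have "hausdorff_pre m \<delta> (A n) \<noteq> top"
      using fin ennreal_suminf_lessD less_top by blast
    moreover define b where "b = hausdorff_pre m \<delta> (A n) + ennreal (e * (1/2) ^ Suc n)"
    ultimately have "hausdorff_pre m \<delta> (A n) < b"
      using e by (simp add: ennreal_add_left_cancel_less less_top)
    then have "\<exists>C\<in>{C. A n \<subseteq> (\<Union>i. C i) \<and> (\<forall>i. bounded (C i) \<and> diameter (C i) \<le> \<delta>)}. (\<Sum>i. ?s (C i)) < b"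
      unfolding hausdorff_pre_def INF_less_iff .
    then obtain C where C: "C \<in> {C. A n \<subseteq> (\<Union>i. C i) \<and> (\<forall>i. bounded (C i) \<and> diameter (C i) \<le> \<delta>)}"
        "(\<Sum>i. ?s (C i)) < b"
      by (rule bexE)
    then have c1: "A n \<subseteq> (\<Union>i. C i)" and c2: "\<forall>i. bounded (C i) \<and> diameter (C i) \<le> \<delta>"
      by blast+
    show ?thesis
      unfolding b_def[symmetric] by (intro exI[of _ C] conjI c1 c2 less_imp_le[OF C(2)])
  qed
  define Q where "Q n C \<longleftrightarrow> A n \<subseteq> (\<Union>i. C i) \<and> (\<forall>i. bounded (C i) \<and> diameter (C i) \<le> \<delta>) \<and>
      (\<Sum>i. ?s (C i)) \<le> hausdorff_pre m \<delta> (A n) + ennreal (e * (1/2) ^ Suc n)" for n C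
  have "\<forall>n. \<exists>C. Q n C" using ex unfolding Q_def by (rule allI)
  then obtain C where Q: "\<forall>n. Q n (C n)" by (rule choice[THEN exE])
  have C: "\<And>n. A n \<subseteq> (\<Union>i. C n i)" "\<And>n i. bounded (C n i)" "\<And>n i. diameter (C n i) \<le> \<delta>"
     "\<And>n. (\<Sum>i. ?s (C n i)) \<le> hausdorff_pre m \<delta> (A n) + ennreal (e * (1/2) ^ Suc n)"
    using Q unfolding Q_def by blast+
  define D where "D k = (case prod_decode k of (n, i) \<Rightarrow> C n i)" for k
  have "(\<Union>n. A n) \<subseteq> (\<Union>k. D k)"
  proof
    fix x assume "x \<in> (\<Union>n. A n)"
    then obtain n i where "x \<in> C n i" using C(1) by blast
    then have "x \<in> D (prod_encode (n, i))" by (simp add: D_def)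
    then show "x \<in> (\<Union>k. D k)" by blast
  qed
  then have "hausdorff_pre m \<delta> (\<Union>n. A n) \<le> (\<Sum>k. ?s (D k))"
    by (rule hausdorff_pre_le) (auto simp: D_def C split: prod.split)
  also have "\<dots> = (\<Sum>k. (\<lambda>(n, i). ?s (C n i)) (prod_decode k))"
    unfolding D_def by (intro suminf_cong) (simp split: prod.split)
  also have "\<dots> = (\<Sum>n. \<Sum>i. ?s (C n i))"
    by (rule suminf_ennreal_2dimen) simp
  also have "\<dots> \<le> (\<Sum>n. hausdorff_pre m \<delta> (A n) + ennreal (e * (1/2) ^ Suc n))"
    by (rule suminf_le) (use C(4) in auto)
  also have "\<dots> = (\<Sum>n. hausdorff_pre m \<delta> (A n)) + (\<Sum>n. ennreal (e * (1/2) ^ Suc n))"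
    by (rule suminf_add[symmetric]) auto
  also have "(\<Sum>n. ennreal (e * (1/2) ^ Suc n)) = ennreal (\<Sum>n. e * (1/2) ^ Suc n)"
    using e sums_mult[OF power_half_series, of e] by (intro suminf_ennreal2) (auto simp: sums_iff)
  also have "(\<Sum>n. e * (1/2) ^ Suc n) = e"
    using sums_mult[OF power_half_series, of e] by (simp add: sums_iff)
  finally show "hausdorff_pre m \<delta> (\<Union>n. A n) \<le> (\<Sum>n. hausdorff_pre m \<delta> (A n)) + ennreal e" .
qed

lemma hausdorff_pre_le_outer: "0 < \<delta> \<Longrightarrow> hausdorff_pre m \<delta> A \<le> hausdorff_outer m A"
  unfolding hausdorff_outer_def by (rule SUP_upper) auto

lemma hausdorff_outer_mono: "A \<subseteq> B \<Longrightarrow> hausdorff_outer m A \<le> hausdorff_outer m B"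
  unfolding hausdorff_outer_def by (rule SUP_mono) (auto intro: hausdorff_pre_mono)

lemma hausdorff_outer_empty: "hausdorff_outer m {} = 0"
  unfolding hausdorff_outer_def by (auto simp: hausdorff_pre_empty intro!: SUP_eqI)

lemma hausdorff_outer_UN:
  "hausdorff_outer m (\<Union>n::nat. A n) \<le> (\<Sum>n. hausdorff_outer m (A n))"
  unfolding hausdorff_outer_def[of m "\<Union>n. A n"]
proof (rule SUP_least)
  fix \<delta> :: real assume "\<delta> \<in> {0<..}"
  then have "(\<Sum>n. hausdorff_pre m \<delta> (A n)) \<le> (\<Sum>n. hausdorff_outer m (A n))"
    by (intro suminf_le) (auto intro: hausdorff_pre_le_outer)
  then show "hausdorff_pre m \<delta> (\<Union>n. A n) \<le> (\<Sum>n. hausdorff_outer m (A n))"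
    using hausdorff_pre_UN order_trans by blast
qed

lemma hausdorff_outer_Un:
  "hausdorff_outer m (A \<union> B) \<le> hausdorff_outer m A + hausdorff_outer m B"
proof -
  have "A \<union> B = (\<Union>n::nat. if n = 0 then A else if n = 1 then B else {})"
    by (auto split: if_splits)
  also have "hausdorff_outer m \<dots> \<le> (\<Sum>n. hausdorff_outer m (if n = 0 then A else if n = 1 then B else {}))"
    by (rule hausdorff_outer_UN)
  also have "\<dots> = (\<Sum>n\<in>{0,1::nat}. hausdorff_outer m (if n = 0 then A else if n = 1 then B else {}))"
    by (rule suminf_finite) (auto simp: hausdorff_outer_empty)
  finally show ?thesis by simp
qed

text \<open>A covering set of diameter less than \<open>r\<close> meets at most one of
  \<open>A\<close> and \<open>B\<close>, so a fine cover of the union splits into covers of both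
  without any set being counted twice.\<close>

lemma hausdorff_outer_separated:
  fixes A B :: "'a::metric_space set"
  assumes r: "0 < r" and sep: "\<And>x y. x \<in> A \<Longrightarrow> y \<in> B \<Longrightarrow> r \<le> dist x y"
  shows "hausdorff_outer m A + hausdorff_outer m B \<le> hausdorff_outer m (A \<union> B)"
proof -
  let ?s = "\<lambda>C. if C = {} then 0 else ennreal (unit_ball_vol (real m) * (diameter (C :: 'a set) / 2) ^ m)"
  have main: "hausdorff_pre m \<delta> A + hausdorff_pre m \<delta> B \<le> hausdorff_pre m \<delta> (A \<union> B)"
    if \<delta>: "0 < \<delta>" "\<delta> < r" for \<delta>
    unfolding hausdorff_pre_def[of m \<delta> "A \<union> B"]
  proof (rule INF_greatest, clarify)
    fix C :: "nat \<Rightarrow> 'a set"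
    assume C: "A \<union> B \<subseteq> (\<Union>i. C i)" "\<forall>i. bounded (C i) \<and> diameter (C i) \<le> \<delta>"
    \<comment> \<open>Discarded sets become {}, which contributes 0 even for m = 0.\<close>
    define Ca where "Ca i = (if C i \<inter> A = {} then {} else C i)" for i
    define Cb where "Cb i = (if C i \<inter> B = {} then {} else C i)" for i
    have covA: "A \<subseteq> (\<Union>i. Ca i)" and covB: "B \<subseteq> (\<Union>i. Cb i)"
    proof safe
      fix x assume x: "x \<in> A"
      then obtain i where "x \<in> C i" using C(1) by blast
      then have "x \<in> Ca i" using x by (auto simp: Ca_def)
      then show "x \<in> (\<Union>i. Ca i)" by blast
    next
      fix x assume x: "x \<in> B"
      then obtain i where "x \<in> C i" using C(1) by blast
      then have "x \<in> Cb i" using x by (auto simp: Cb_def)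
      then show "x \<in> (\<Union>i. Cb i)" by blast
    qed
    have disj: "Ca i = {} \<or> Cb i = {}" for i
    proof (rule ccontr)
      assume "\<not> ?thesis"
      then obtain x y where xy: "x \<in> C i" "x \<in> A" "y \<in> C i" "y \<in> B"
        by (auto simp: Ca_def Cb_def split: if_splits)
      then have "dist x y \<le> diameter (C i)" using C(2) by (intro diameter_bounded_bound) auto
      then show False using sep[OF xy(2,4)] C(2) \<delta> by (smt (verit))
    qed
    have "hausdorff_pre m \<delta> A \<le> (\<Sum>i. ?s (Ca i))"
      using C \<delta> covA by (intro hausdorff_pre_le) (auto simp: Ca_def)
    moreover have "hausdorff_pre m \<delta> B \<le> (\<Sum>i. ?s (Cb i))"
      using C \<delta> covB by (intro hausdorff_pre_le) (auto simp: Cb_def)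
    ultimately have "hausdorff_pre m \<delta> A + hausdorff_pre m \<delta> B \<le> (\<Sum>i. ?s (Ca i)) + (\<Sum>i. ?s (Cb i))"
      by (rule add_mono)
    also have "\<dots> = (\<Sum>i. ?s (Ca i) + ?s (Cb i))" by (rule suminf_add) auto
    also have "\<dots> \<le> (\<Sum>i. ?s (C i))"
    proof (rule suminf_le)
      show "?s (Ca i) + ?s (Cb i) \<le> ?s (C i)" for i
      proof -
        have "?s (Ca i) \<le> ?s (C i)" "?s (Cb i) \<le> ?s (C i)" by (simp_all add: Ca_def Cb_def)
        then show ?thesis using disj[of i]
          by (elim disjE) (simp_all only: if_True add_0_left add_0_right refl)
      qed
    qed auto
    finally show "hausdorff_pre m \<delta> A + hausdorff_pre m \<delta> B \<le> (\<Sum>i. ?s (C i))" .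
  qed
  have "hausdorff_outer m A + hausdorff_outer m B = (SUP \<delta>\<in>{0<..}. hausdorff_pre m \<delta> A + hausdorff_pre m \<delta> B)"
    unfolding hausdorff_outer_def
  proof (rule SUP_add_directed_ennreal[symmetric])
    fix i j :: real assume "i \<in> {0<..}" "j \<in> {0<..}"
    then show "\<exists>k\<in>{0<..}. hausdorff_pre m i A + hausdorff_pre m j B \<le> hausdorff_pre m k A + hausdorff_pre m k B"
      by (intro bexI[of _ "min i j"] add_mono hausdorff_pre_antimono) auto
  qed
  also have "\<dots> \<le> hausdorff_outer m (A \<union> B)"
  proof (rule SUP_least)
    fix \<delta> :: real assume "\<delta> \<in> {0<..}"
    then have "hausdorff_pre m \<delta> A + hausdorff_pre m \<delta> B \<le>
       hausdorff_pre m (min \<delta> (r/2)) A + hausdorff_pre m (min \<delta> (r/2)) B"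
      by (intro add_mono hausdorff_pre_antimono) auto
    also have "\<dots> \<le> hausdorff_pre m (min \<delta> (r/2)) (A \<union> B)"
      using r \<open>\<delta> \<in> {0<..}\<close> by (intro main) auto
    also have "\<dots> \<le> hausdorff_outer m (A \<union> B)"
      using r \<open>\<delta> \<in> {0<..}\<close> by (intro hausdorff_pre_le_outer) auto
    finally show "hausdorff_pre m \<delta> A + hausdorff_pre m \<delta> B \<le> hausdorff_outer m (A \<union> B)" .
  qed
  finally show ?thesis .
qed

text \<open>Caratheodory's criterion: the annuli \<open>R k\<close> around \<open>F\<close> with indices of equal parity are positively
  separated, so their total outer measure is at most twice that of \<open>A\<close>.\<close>

lemma hausdorff_outer_closed_split:
  fixes F A :: "'a::metric_space set"
  assumes F: "closed F"
  shows "hausdorff_outer m (A \<inter> F) + hausdorff_outer m (A - F) \<le> hausdorff_outer m A"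
proof (cases "F = {} \<or> hausdorff_outer m A = top")
  case True then show ?thesis by (auto simp: hausdorff_outer_empty)
next
  case False
  then have ne: "F \<noteq> {}" and fin: "hausdorff_outer m A \<noteq> top" by auto
  define R where "R k = {x \<in> A. 1 / (real k + 2) \<le> infdist x F \<and> infdist x F < 1 / (real k + 1)}" for k :: nat
  define An where "An n = {x \<in> A. 1 / (real n + 1) \<le> infdist x F}" for n :: nat
  have sep: "1 / (real n + 1) - 1 / (real k + 1) \<le> dist x y"
    if "1 / (real n + 1) \<le> infdist x F" "infdist y F < 1 / (real k + 1)" for x y n k
    using infdist_triangle[of x F y] that by linarith
  \<comment> \<open>Points of the earlier annuli of this parity have distance at least 1 / (2 * N +
    s) from \<open>F\<close>, those of \<open>R (2 * N + s)\<close> less than 1 / (2 * N + s + 1);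
    the difference is the separation.\<close>
  have evenodd: "(\<Sum>j<N. hausdorff_outer m (R (2 * j + s))) \<le> hausdorff_outer m (\<Union>j<N. R (2 * j + s))" for N s
  proof (induction N)
    case (Suc N)
    have "hausdorff_outer m (\<Union>j<N. R (2 * j + s)) + hausdorff_outer m (R (2 * N + s)) \<le>
       hausdorff_outer m ((\<Union>j<N. R (2 * j + s)) \<union> R (2 * N + s))"
    proof (cases "N = 0")
      case True then show ?thesis by (simp add: hausdorff_outer_empty)
    next
      case False
      show ?thesis
      proof (rule hausdorff_outer_separated)
        show "0 < 1 / (real (2 * N + s - 1) + 1) - 1 / (real (2 * N + s) + 1)"
        proof -
          have "real (2 * N + s - 1) + 1 = real (2 * N + s)" "0 < real (2 * N + s)" using False by auto
          then show ?thesis by (simp add: frac_less2)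
        qed
        fix x y assume "x \<in> (\<Union>j<N. R (2 * j + s))" and y: "y \<in> R (2 * N + s)"
        then obtain j where j: "j < N" "x \<in> R (2 * j + s)" by auto
        have "1 / (real (2 * N + s - 1) + 1) \<le> 1 / (real (2 * j + s) + 2)"
          using j(1) by (intro divide_left_mono) (auto simp: of_nat_diff)
        also have "\<dots> \<le> infdist x F" using j by (simp add: R_def)
        finally show "1 / (real (2 * N + s - 1) + 1) - 1 / (real (2 * N + s) + 1) \<le> dist x y"
          using y by (intro sep) (auto simp: R_def)
      qed
    qed
    then show ?case using Suc.IH
      by (simp add: lessThan_Suc Un_commute add.commute)
         (meson add_left_mono order_trans)
  qed simp
  have part: "(\<Sum>k<n. hausdorff_outer m (R k)) \<le> 2 * hausdorff_outer m A" for n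
  proof -
    have "(\<Sum>k<n. hausdorff_outer m (R k)) \<le> (\<Sum>k<2*n. hausdorff_outer m (R k))"
      by (rule sum_mono2) auto
    also have "\<dots> = (\<Sum>j<n. hausdorff_outer m (R (2 * j + 0))) + (\<Sum>j<n. hausdorff_outer m (R (2 * j + 1)))"
      by (induction n) (auto simp: algebra_simps)
    also have "\<dots> \<le> hausdorff_outer m A + hausdorff_outer m A"
      by (intro add_mono order_trans[OF evenodd] hausdorff_outer_mono) (auto simp: R_def)
    finally show ?thesis by (simp add: mult_2)
  qed
  let ?S = "\<Sum>k. hausdorff_outer m (R k)"
  have S: "?S \<noteq> top"
  proof -
    have "?S \<le> 2 * hausdorff_outer m A"
      using part by (intro suminf_le_const) auto
    moreover have "2 * hausdorff_outer m A \<noteq> top" using fin by (simp add: ennreal_mult_eq_top_iff)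
    ultimately show ?thesis by (rule neq_top_trans[rotated])
  qed
  \<comment> \<open>Instead of subtracting a tail in \<open>ennreal\<close>, the partial sum is
    added on the left and the full sum on the right; the finite \<open>?S\<close> is cancelled at
    the end.\<close>
  have step: "hausdorff_outer m (A \<inter> F) + hausdorff_outer m (A - F) + (\<Sum>k<n. hausdorff_outer m (R k))
      \<le> hausdorff_outer m A + ?S" for n
  proof -
    have "A - F \<subseteq> An n \<union> (\<Union>k. R (k + n))"
    proof
      fix x assume x: "x \<in> A - F"
      then have pos: "0 < infdist x F" using F ne
        by (metis Diff_iff in_closed_iff_infdist_zero infdist_nonneg less_eq_real_def)
      show "x \<in> An n \<union> (\<Union>k. R (k + n))"
      proof (cases "1 / (real n + 1) \<le> infdist x F")
        case True then show ?thesis using x by (simp add: An_def)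
      next
        case False
        \<comment> \<open>The first threshold 1 / (j + 1) that the distance of \<open>x\<close>
          reaches; as j > n, the point lies in \<open>R (j - 1)\<close>, whose index is at least
          n.\<close>
        define j where "j = (LEAST j. 1 / (real j + 1) \<le> infdist x F)"
        obtain N where "1 / (real N + 1) < infdist x F" using reals_Archimedean[OF pos]
          by (metis inverse_eq_divide of_nat_Suc add.commute)
        then have j1: "1 / (real j + 1) \<le> infdist x F" unfolding j_def
          by (intro LeastI[of "\<lambda>j. 1 / (real j + 1) \<le> infdist x F" N]) auto
        have "n < j"
        proof (rule ccontr)
          assume "\<not> n < j"
          then have "1 / (real n + 1) \<le> 1 / (real j + 1)" by (intro divide_left_mono) auto
          then show False using j1 False by linarith
        qed
        have "\<not> 1 / (real (j - 1) + 1) \<le> infdist x F"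
          unfolding j_def by (rule not_less_Least) (use \<open>n < j\<close> in \<open>auto simp: j_def\<close>)
        moreover have "real (j - 1) + 1 = real j" using \<open>n < j\<close> by simp
        ultimately have "x \<in> R (j - 1)" using x j1 \<open>n < j\<close>
          by (auto simp: R_def of_nat_diff algebra_simps)
        moreover have "j - 1 = (j - 1 - n) + n" using \<open>n < j\<close> by simp
        ultimately show ?thesis by (metis UN_I UNIV_I UnCI)
      qed
    qed
    then have "hausdorff_outer m (A - F) \<le> hausdorff_outer m (An n \<union> (\<Union>k. R (k + n)))"
      by (rule hausdorff_outer_mono)
    also have "\<dots> \<le> hausdorff_outer m (An n) + (\<Sum>k. hausdorff_outer m (R (k + n)))"
      by (intro order_trans[OF hausdorff_outer_Un] add_mono hausdorff_outer_UN) auto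
    finally have 1: "hausdorff_outer m (A - F) + (\<Sum>k<n. hausdorff_outer m (R k))
        \<le> hausdorff_outer m (An n) + ?S"
      using suminf_offset[of "\<lambda>k. hausdorff_outer m (R k)" n]
      by (simp add: add.assoc)
    have "hausdorff_outer m (A \<inter> F) + hausdorff_outer m (An n) \<le> hausdorff_outer m ((A \<inter> F) \<union> An n)"
    proof (rule hausdorff_outer_separated)
      show "0 < 1 / (real n + 1)" by simp
      fix x y assume "x \<in> A \<inter> F" "y \<in> An n"
      then show "1 / (real n + 1) \<le> dist x y"
        using infdist_le[of x F y] by (auto simp: An_def dist_commute)
    qed
    also have "\<dots> \<le> hausdorff_outer m A" by (rule hausdorff_outer_mono) (auto simp: An_def)
    finally have 2: "hausdorff_outer m (A \<inter> F) + hausdorff_outer m (An n) \<le> hausdorff_outer m A" .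
    have "hausdorff_outer m (A \<inter> F) + (hausdorff_outer m (A - F) + (\<Sum>k<n. hausdorff_outer m (R k)))
       \<le> hausdorff_outer m (A \<inter> F) + (hausdorff_outer m (An n) + ?S)"
      using 1 by (rule add_left_mono)
    also have "\<dots> \<le> hausdorff_outer m A + ?S"
      using 2 by (simp add: add.assoc[symmetric] add_right_mono)
    finally show ?thesis by (simp add: add.assoc)
  qed
  have "hausdorff_outer m (A \<inter> F) + hausdorff_outer m (A - F) + ?S \<le> hausdorff_outer m A + ?S"
  proof -
    have "hausdorff_outer m (A \<inter> F) + hausdorff_outer m (A - F) + ?S =
       (SUP n. hausdorff_outer m (A \<inter> F) + hausdorff_outer m (A - F) + (\<Sum>k<n. hausdorff_outer m (R k)))"
      unfolding suminf_eq_SUP by (rule ennreal_SUP_add_right) auto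
    also have "\<dots> \<le> hausdorff_outer m A + ?S" using step by (intro SUP_least)
    finally show ?thesis .
  qed
  then show ?thesis using S ennreal_add_left_cancel_le[of ?S] by (simp add: add.commute[of _ ?S])
qed

text \<open>The sets satisfying Caratheodory's criterion form a sigma-algebra on which the outer
  measure is a measure. It contains the closed sets, hence all Borel sets, so
  \<open>measure_of\<close> returns the outer measure on them.\<close>

lemma hausdorff_measure_space: "measure_space UNIV (sets (borel :: 'a::metric_space measure)) (hausdorff_outer m)"
proof -
  interpret sigma_algebra UNIV "Pow UNIV :: 'a set set" using sigma_algebra_Pow .
  let ?L = "lambda_system UNIV (Pow UNIV) (hausdorff_outer m :: 'a set \<Rightarrow> ennreal)"
  have oms: "outer_measure_space (Pow UNIV) (hausdorff_outer m :: 'a set \<Rightarrow> ennreal)"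
    unfolding outer_measure_space_def positive_def increasing_def countably_subadditive_def
    by (auto simp: hausdorff_outer_empty hausdorff_outer_mono hausdorff_outer_UN)
  have ms: "measure_space UNIV ?L (hausdorff_outer m)"
    by (rule caratheodory_lemma[OF oms])
  have "F \<in> ?L" if "closed F" for F
    unfolding lambda_system_def
  proof (clarsimp, rule antisym)
    fix x :: "'a set"
    show "hausdorff_outer m (F \<inter> x) + hausdorff_outer m ((UNIV - F) \<inter> x) \<le> hausdorff_outer m x"
      using hausdorff_outer_closed_split[OF that, of m x]
      by (metis Compl_eq_Diff_UNIV Diff_eq inf_commute)
    have "x = (F \<inter> x) \<union> ((UNIV - F) \<inter> x)" by auto
    then show "hausdorff_outer m x \<le> hausdorff_outer m (F \<inter> x) + hausdorff_outer m ((UNIV - F) \<inter> x)"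
      using hausdorff_outer_Un by metis
  qed
  then have "sigma_sets UNIV (Collect closed) \<subseteq> ?L"
    using ms by (intro sigma_algebra.sigma_sets_subset) (auto simp: measure_space_def)
  then have "sets (borel :: 'a measure) \<subseteq> ?L"
    by (simp add: borel_eq_closed)
  then show ?thesis
    using measure_down[OF ms] sets.sigma_algebra_axioms[of "borel :: 'a measure"] by simp
qed

lemma sets_hausdorff_measure [simp, measurable_cong]: "sets (hausdorff_measure m) = sets borel"
  unfolding hausdorff_measure_def
  by (metis (full_types) sets.sigma_sets_eq sets_measure_of sets.space_closed space_borel)

lemma space_hausdorff_measure [simp]: "space (hausdorff_measure m) = UNIV"
  unfolding hausdorff_measure_def by (simp add: space_measure_of_conv)

lemma emeasure_hausdorff_measure:
  "A \<in> sets borel \<Longrightarrow> emeasure (hausdorff_measure m) A = hausdorff_outer m A"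
  using hausdorff_measure_space[of m] unfolding measure_space_def hausdorff_measure_def
  by (intro emeasure_measure_of_sigma) auto

text \<open>The images of the sets \<open>C i \<inter> A\<close> cover the image, with diameters at
  most \<open>L\<close> times as large. The factor carries no dimensional constant, which matters
  because charts with \<open>L\<close> close to 1 are used later.\<close>

lemma hausdorff_outer_lipschitz_image:
  fixes f :: "'a::metric_space \<Rightarrow> 'b::metric_space"
  assumes lip: "\<And>x y. x \<in> A \<Longrightarrow> y \<in> A \<Longrightarrow> dist (f x) (f y) \<le> L * dist x y" and L: "0 < L"
  shows "hausdorff_outer m (f ` A) \<le> ennreal (L ^ m) * hausdorff_outer m A"
  unfolding hausdorff_outer_def[of m "f ` A"]
proof (rule SUP_least)
  fix \<delta> :: real assume \<delta>: "\<delta> \<in> {0<..}"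
  have "hausdorff_pre m \<delta> (f ` A) \<le> ennreal (L ^ m) * hausdorff_pre m (\<delta> / L) A"
  proof -
    \<comment> \<open>The factor is moved to the left so that the claim becomes a lower bound for
      the infimum over all covers of \<open>A\<close>.\<close>
    have "ennreal (1 / L ^ m) * hausdorff_pre m \<delta> (f ` A) \<le> hausdorff_pre m (\<delta> / L) A"
      unfolding hausdorff_pre_def[of m "\<delta> / L"]
    proof (rule INF_greatest, clarify)
      fix C :: "nat \<Rightarrow> 'a set"
      assume C: "A \<subseteq> (\<Union>i. C i)" "\<forall>i. bounded (C i) \<and> diameter (C i) \<le> \<delta> / L"
      define D where "D i = f ` (C i \<inter> A)" for i
      have d: "dist (f x) (f y) \<le> L * diameter (C i)" if "x \<in> C i \<inter> A" "y \<in> C i \<inter> A" for x y i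
      proof -
        have "dist x y \<le> diameter (C i)" using that C(2) by (intro diameter_bounded_bound) auto
        then have "L * dist x y \<le> L * diameter (C i)" using L by (intro mult_left_mono) auto
        then show ?thesis using lip[of x y] that by auto
      qed
      have bdd: "bounded (D i)" for i
      proof (cases "C i \<inter> A = {}")
        case False
        then obtain x where "x \<in> C i \<inter> A" by blast
        then show ?thesis unfolding bounded_def D_def using d[of x i] by auto
      qed (simp add: D_def)
      have diam: "diameter (D i) \<le> L * diameter (C i)" if "D i \<noteq> {}" for i
        unfolding diameter_def[of "D i"] using that d by (auto simp: D_def intro!: cSUP_least)
      have diam0: "0 \<le> diameter (C i)" for i using C(2) by (simp add: diameter_ge_0)
      have "hausdorff_pre m \<delta> (f ` A) \<le>
         (\<Sum>i. if D i = {} then 0 else ennreal (unit_ball_vol (real m) * (diameter (D i) / 2) ^ m))"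
      proof (rule hausdorff_pre_le)
        show "f ` A \<subseteq> (\<Union>i. D i)" using C(1) unfolding D_def by blast
        fix i
        show "diameter (D i) \<le> \<delta>"
        proof (cases "D i = {}")
          case False
          have "L * diameter (C i) \<le> \<delta>" using C(2) L by (simp add: field_simps)
          then show ?thesis using diam[OF False] by linarith
        qed (use \<delta> in auto)
      qed (rule bdd)
      also have "\<dots> \<le> (\<Sum>i. ennreal (L ^ m) * (if C i = {} then 0 else ennreal (unit_ball_vol (real m) * (diameter (C i) / 2) ^ m)))"
      proof (rule suminf_le)
        fix i
        show "(if D i = {} then 0 else ennreal (unit_ball_vol (real m) * (diameter (D i) / 2) ^ m)) \<le>
          ennreal (L ^ m) * (if C i = {} then 0 else ennreal (unit_ball_vol (real m) * (diameter (C i) / 2) ^ m))"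
        proof (cases "D i = {}")
          case False
          then have "C i \<noteq> {}" by (auto simp: D_def)
          have "(diameter (D i) / 2) ^ m \<le> (L * (diameter (C i) / 2)) ^ m"
            using diam[OF False] bdd by (intro power_mono) (auto simp: diameter_ge_0)
          then have "unit_ball_vol (real m) * (diameter (D i) / 2) ^ m \<le>
              L ^ m * (unit_ball_vol (real m) * (diameter (C i) / 2) ^ m)"
            unfolding power_mult_distrib mult.left_commute[of "L ^ m"] by (rule mult_left_mono) simp
          then show ?thesis using False \<open>C i \<noteq> {}\<close> L diam0
            by (simp add: ennreal_mult'[symmetric] ennreal_leI)
        qed simp
      qed auto
      also have "\<dots> = ennreal (L ^ m) * (\<Sum>i. if C i = {} then 0 else ennreal (unit_ball_vol (real m) * (diameter (C i) / 2) ^ m))"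
        by (rule ennreal_suminf_cmult)
      finally have "ennreal (1 / L ^ m) * hausdorff_pre m \<delta> (f ` A) \<le> ennreal (1 / L ^ m) * (ennreal (L ^ m) *
          (\<Sum>i. if C i = {} then 0 else ennreal (unit_ball_vol (real m) * (diameter (C i) / 2) ^ m)))"
        by (rule mult_left_mono) simp
      then show "ennreal (1 / L ^ m) * hausdorff_pre m \<delta> (f ` A) \<le>
          (\<Sum>i. if C i = {} then 0 else ennreal (unit_ball_vol (real m) * (diameter (C i) / 2) ^ m))"
        using L by (simp add: mult.assoc[symmetric] ennreal_mult'[symmetric])
    qed
    then have "ennreal (L ^ m) * (ennreal (1 / L ^ m) * hausdorff_pre m \<delta> (f ` A)) \<le> ennreal (L ^ m) * hausdorff_pre m (\<delta> / L) A"
      by (rule mult_left_mono) simp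
    then show ?thesis
      using L by (simp add: mult.assoc[symmetric] ennreal_mult'[symmetric])
  qed
  also have "\<dots> \<le> ennreal (L ^ m) * hausdorff_outer m A"
    using \<delta> L by (intro mult_left_mono hausdorff_pre_le_outer) auto
  finally show "hausdorff_pre m \<delta> (f ` A) \<le> ennreal (L ^ m) * hausdorff_outer m A" .
qed

subsection \<open>Ball covers\<close>

text \<open>Vitali's theorems yield a countable set of balls, while Hausdorff covers are sequences.
  Indices that encode no ball get radius 0, that is an empty ball, which affects neither
  disjointness nor the sum of volumes.\<close>

lemma disjoint_balls_sequence:
  fixes C :: "('a::euclidean_space \<times> real) set"
  assumes C: "countable C" "\<And>p. p \<in> C \<Longrightarrow> 0 < snd p \<and> ball (fst p) (snd p) \<subseteq> U"
    and disj: "pairwise (\<lambda>p q. disjnt (ball (fst p) (snd p)) (ball (fst q) (snd q))) C"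
    and U: "U \<in> sets borel"
  obtains c :: "nat \<Rightarrow> 'a" and r where "\<And>k. r k = 0 \<or> (c k, r k) \<in> C" "\<And>p. p \<in> C \<Longrightarrow> \<exists>k. (c k, r k) = p"
    "(\<Sum>k. emeasure lborel (ball (c k) (r k))) \<le> emeasure lborel U"
proof
  define c where "c k = fst (from_nat_into C k)" for k
  define r where "r k = (if k \<in> to_nat_on C ` C then snd (from_nat_into C k) else 0)" for k
  have in_C: "(c k, r k) \<in> C \<and> to_nat_on C (c k, r k) = k" if "k \<in> to_nat_on C ` C" for k
    using that C(1) by (auto simp: c_def r_def)
  show alt: "r k = 0 \<or> (c k, r k) \<in> C" for k
    using in_C[of k] by (cases "k \<in> to_nat_on C ` C") (auto simp: r_def)
  show "\<exists>k. (c k, r k) = p" if "p \<in> C" for p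
    using that C(1) by (intro exI[of _ "to_nat_on C p"]) (simp add: c_def r_def)
  have "disjoint_family (\<lambda>k. ball (c k) (r k))"
    unfolding disjoint_family_on_def
  proof (intro ballI impI)
    fix k l :: nat assume "k \<noteq> l"
    show "ball (c k) (r k) \<inter> ball (c l) (r l) = {}"
    proof (cases "k \<in> to_nat_on C ` C \<and> l \<in> to_nat_on C ` C")
      case True
      then have "(c k, r k) \<in> C" "(c l, r l) \<in> C" "(c k, r k) \<noteq> (c l, r l)"
        using in_C[of k] in_C[of l] \<open>k \<noteq> l\<close> by metis+
      then show ?thesis using disj by (fastforce simp: pairwise_def disjnt_def)
    next
      case False
      then have "r k = 0 \<or> r l = 0" by (auto simp: r_def)
      then show ?thesis by auto
    qed
  qed
  then have "(\<Sum>k. emeasure lborel (ball (c k) (r k))) = emeasure lborel (\<Union>k. ball (c k) (r k))"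
    by (intro suminf_emeasure) auto
  also have "\<dots> \<le> emeasure lborel U"
  proof (intro emeasure_mono UN_least)
    fix k show "ball (c k) (r k) \<subseteq> U"
      using alt[of k] C(2)[of "(c k, r k)"] by auto
  qed (use U in auto)
  finally show "(\<Sum>k. emeasure lborel (ball (c k) (r k))) \<le> emeasure lborel U" .
qed

text \<open>Vitali's 5r-covering lemma inside an open set of measure at most e / 5 ^ D: enlarging
  disjoint balls five times multiplies their total volume by 5 ^ D.\<close>

lemma negligible_ball_cover:
  fixes N :: "'a::euclidean_space set"
  assumes N: "negligible N" "N \<subseteq> W" "open W" and e: "0 < e" and d: "0 < d"
  obtains c :: "nat \<Rightarrow> 'a" and r where "\<And>k. 0 \<le> r k \<and> r k < d \<and> ball (c k) (r k) \<subseteq> W"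
    "N \<subseteq> (\<Union>k. ball (c k) (r k))" "(\<Sum>k. emeasure lborel (ball (c k) (r k))) \<le> ennreal e"
proof -
  let ?D = "DIM('a)"
  have N0: "N \<in> null_sets lebesgue" using N(1) by (simp add: negligible_iff_null_sets)
  obtain T where T: "open T" "N \<subseteq> T" "emeasure lebesgue (T - N) < ennreal (e / 5 ^ ?D)"
  proof -
    have "N \<in> sets lebesgue" "0 < e / 5 ^ ?D" using N0 e by auto
    then show ?thesis using that by (rule sets_lebesgue_outer_open)
  qed
  define U where "U = T \<inter> W"
  have U: "open U" "N \<subseteq> U" "U \<subseteq> W" using T N by (auto simp: U_def)
  have "emeasure lborel U = emeasure lebesgue U" using U by simp
  also have "\<dots> \<le> emeasure lebesgue T" using U T by (intro emeasure_mono) (auto simp: U_def)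
  also have "\<dots> = emeasure lebesgue (T - N)"
    using N0 T(1) by (intro emeasure_Diff_null_set[symmetric]) auto
  also have "\<dots> \<le> ennreal (e / 5 ^ ?D)" using T(3) by (rule less_imp_le)
  finally have Ue: "emeasure lborel U \<le> ennreal (e / 5 ^ ?D)" .
  define K where "K = {p. 0 < snd p \<and> snd p < d / 5 \<and> ball (fst p) (5 * snd p) \<subseteq> U}"
  have "N \<subseteq> (\<Union>p\<in>K. ball (fst p) (snd p))"
  proof
    fix x assume "x \<in> N"
    then obtain s where s: "0 < s" "ball x s \<subseteq> U" using U open_contains_ball by blast
    \<comment> \<open>The radius is small enough for the fivefold ball to stay inside
      \<open>U\<close> and to have radius below \<open>d\<close>.\<close>
    then have "(x, min (s/5) (d/10)) \<in> K" using d by (auto simp: K_def subset_eq)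
    then show "x \<in> (\<Union>p\<in>K. ball (fst p) (snd p))" using s d by (intro UN_I) auto
  qed
  then obtain C where C: "countable C" "C \<subseteq> K"
     "pairwise (\<lambda>p q. disjnt (ball (fst p) (snd p)) (ball (fst q) (snd q))) C"
     "N \<subseteq> (\<Union>p\<in>C. ball (fst p) (5 * snd p))"
    by (rule Vitali_covering_lemma_balls[where B = "d/5"]) (auto simp: K_def)
  have CU: "0 < snd p \<and> ball (fst p) (snd p) \<subseteq> U" if "p \<in> C" for p
  proof -
    have "p \<in> K" using that C by auto
    moreover have "ball (fst p) (snd p) \<subseteq> ball (fst p) (5 * snd p)"
      using \<open>p \<in> K\<close> by (intro subset_ball) (auto simp: K_def)
    ultimately show ?thesis unfolding K_def by blast
  qed
  obtain c r where cr: "\<And>k. r k = 0 \<or> (c k, r k) \<in> C" "\<And>p. p \<in> C \<Longrightarrow> \<exists>k. (c k, r k) = p"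
    "(\<Sum>k. emeasure lborel (ball (c k) (r k))) \<le> emeasure lborel U"
    by (rule disjoint_balls_sequence[OF C(1) CU C(3) borel_open[OF U(1)]]; (assumption | rule that; assumption))
  have r: "0 \<le> r k \<and> 5 * r k < d \<and> ball (c k) (5 * r k) \<subseteq> W" for k
  proof (cases "r k = 0")
    case False
    then have "(c k, r k) \<in> K" using cr(1)[of k] C(2) by auto
    then have "ball (c k) (5 * r k) \<subseteq> U" "0 < r k" "r k < d / 5" by (simp_all add: K_def)
    then show ?thesis using U(3) by auto
  qed (use d in auto)
  show thesis
  proof
    show "0 \<le> 5 * r k \<and> 5 * r k < d \<and> ball (c k) (5 * r k) \<subseteq> W" for k using r[of k] by simp
    show "N \<subseteq> (\<Union>k. ball (c k) (5 * r k))"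
    proof
      fix x assume "x \<in> N"
      then obtain p where p: "p \<in> C" "x \<in> ball (fst p) (5 * snd p)" using C(4) by auto
      then obtain k where "(c k, r k) = p" using cr(2) by blast
      then show "x \<in> (\<Union>k. ball (c k) (5 * r k))" using p by auto
    qed
    have "(\<Sum>k. emeasure lborel (ball (c k) (5 * r k))) = (\<Sum>k. ennreal (5 ^ ?D) * emeasure lborel (ball (c k) (r k)))"
      using r by (simp add: emeasure_ball power_mult_distrib ennreal_mult'[symmetric] mult_ac)
    also have "\<dots> = ennreal (5 ^ ?D) * (\<Sum>k. emeasure lborel (ball (c k) (r k)))" by (rule ennreal_suminf_cmult)
    also have "\<dots> \<le> ennreal (5 ^ ?D) * ennreal (e / 5 ^ ?D)"
      using cr(3) Ue by (intro mult_left_mono) (auto intro: order_trans)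
    also have "\<dots> = ennreal e" using e by (simp add: ennreal_mult'[symmetric])
    finally show "(\<Sum>k. emeasure lborel (ball (c k) (5 * r k))) \<le> ennreal e" .
  qed
qed

text \<open>Vitali's covering theorem fills an open superset of nearly the same measure with
  disjoint balls up to a null set, which is covered separately at cost e / 2. Balls keep the later
  constants sharp: a Lipschitz map sends a ball into a ball, and slices of balls are discs.\<close>

lemma borel_ball_cover:
  fixes S :: "'a::euclidean_space set"
  assumes S: "S \<in> sets borel" "S \<subseteq> W" "open W" and e: "0 < e" and d: "0 < d"
  obtains c :: "nat \<Rightarrow> 'a" and r where "\<And>k. 0 \<le> r k \<and> r k < d \<and> ball (c k) (r k) \<subseteq> W"
    "S \<subseteq> (\<Union>k. ball (c k) (r k))" "(\<Sum>k. emeasure lborel (ball (c k) (r k))) \<le> emeasure lborel S + ennreal e"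
proof -
  obtain T where T: "open T" "S \<subseteq> T" "emeasure lborel (T - S) < ennreal (e / 2)"
    using outer_regular_lborel[OF S(1), of "e / 2"] e by auto
  define U where "U = T \<inter> W"
  have U: "open U" "S \<subseteq> U" "U \<subseteq> W" using T S by (auto simp: U_def)
  have "emeasure lborel U \<le> emeasure lborel (S \<union> (T - S))"
    using T(1) S(1) by (intro emeasure_mono) (auto simp: U_def)
  also have "\<dots> \<le> emeasure lborel S + emeasure lborel (T - S)"
    using T(1) S(1) by (intro emeasure_subadditive) auto
  also have "\<dots> \<le> emeasure lborel S + ennreal (e / 2)" using T(3) by (intro add_left_mono less_imp_le)
  finally have Ue: "emeasure lborel U \<le> emeasure lborel S + ennreal (e / 2)" .
  define K where "K = {p. 0 < snd p \<and> snd p < d \<and> ball (fst p) (snd p) \<subseteq> U}"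
  have "\<exists>p. p \<in> K \<and> x \<in> ball (fst p) (snd p) \<and> snd p < a" if x: "x \<in> U" and a: "0 < a" for x a
  proof -
    obtain s where s: "0 < s" "ball x s \<subseteq> U" using U(1) x by (rule openE)
    then have "(x, min s (min (d/2) (a/2))) \<in> K" using d a by (auto simp: K_def subset_eq)
    then show ?thesis using s d a by (intro exI[of _ "(x, min s (min (d/2) (a/2)))"]) auto
  qed
  then obtain C where C: "countable C" "C \<subseteq> K"
     "pairwise (\<lambda>p q. disjnt (ball (fst p) (snd p)) (ball (fst q) (snd q))) C"
     "negligible (U - (\<Union>p\<in>C. ball (fst p) (snd p)))"
    by (rule Vitali_covering_theorem_balls)
  have CU: "0 < snd p \<and> ball (fst p) (snd p) \<subseteq> U" if "p \<in> C" for p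
    using that C(2) by (auto simp: K_def)
  obtain c r where cr: "\<And>k. r k = 0 \<or> (c k, r k) \<in> C" "\<And>p. p \<in> C \<Longrightarrow> \<exists>k. (c k, r k) = p"
    "(\<Sum>k. emeasure lborel (ball (c k) (r k))) \<le> emeasure lborel U"
    by (rule disjoint_balls_sequence[OF C(1) CU C(3) borel_open[OF U(1)]]; (assumption | rule that; assumption))
  have r: "0 \<le> r k \<and> r k < d \<and> ball (c k) (r k) \<subseteq> W" for k
  proof (cases "r k = 0")
    case False
    then have "(c k, r k) \<in> K" using cr(1)[of k] C(2) by auto
    then have "ball (c k) (r k) \<subseteq> U" "0 < r k" "r k < d" by (simp_all add: K_def)
    then show ?thesis using U(3) by auto
  qed (use d in auto)
  obtain c' r' where cr': "\<And>k. 0 \<le> r' k \<and> r' k < d \<and> ball (c' k) (r' k) \<subseteq> W"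
    "U - (\<Union>p\<in>C. ball (fst p) (snd p)) \<subseteq> (\<Union>k. ball (c' k) (r' k))"
    "(\<Sum>k. emeasure lborel (ball (c' k) (r' k))) \<le> ennreal (e / 2)"
  proof -
    have sub: "U - (\<Union>p\<in>C. ball (fst p) (snd p)) \<subseteq> W" and e2: "0 < e / 2" using U(3) e by auto
    show ?thesis
      by (rule negligible_ball_cover[OF C(4) sub S(3) e2 d]; (assumption | rule that; assumption))
  qed
  \<comment> \<open>The two sequences are interleaved through the pairing function: row 0 holds the
    disjoint balls, row 1 those covering the null set, and all further rows have radius 0.\<close>
  define c2 where "c2 j = (case prod_decode j of (n, k) \<Rightarrow> if n = 0 then c k else c' k)" for j
  define r2 where "r2 j = (case prod_decode j of (n, k) \<Rightarrow> if n = 0 then r k else if n = 1 then r' k else 0)" for j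
  show thesis
  proof
    show "0 \<le> r2 j \<and> r2 j < d \<and> ball (c2 j) (r2 j) \<subseteq> W" for j
      using r cr'(1) d by (auto simp: c2_def r2_def split: prod.split)
    show "S \<subseteq> (\<Union>j. ball (c2 j) (r2 j))"
    proof
      fix x assume "x \<in> S"
      then have "x \<in> U" using U by auto
      show "x \<in> (\<Union>j. ball (c2 j) (r2 j))"
      proof (cases "x \<in> (\<Union>p\<in>C. ball (fst p) (snd p))")
        case True
        then obtain p where p: "p \<in> C" "x \<in> ball (fst p) (snd p)" by auto
        then obtain k where "(c k, r k) = p" using cr(2) by blast
        then have "x \<in> ball (c2 (prod_encode (0, k))) (r2 (prod_encode (0, k)))" using p by (auto simp: c2_def r2_def)
        then show ?thesis by blast
      next
        case False
        then obtain k where "x \<in> ball (c' k) (r' k)" using cr'(2) \<open>x \<in> U\<close> by blast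
        then have "x \<in> ball (c2 (prod_encode (1, k))) (r2 (prod_encode (1, k)))" by (auto simp: c2_def r2_def)
        then show ?thesis by blast
      qed
    qed
    let ?f = "\<lambda>(n::nat, k). if n = 0 then emeasure lborel (ball (c k) (r k)) else
       if n = 1 then emeasure lborel (ball (c' k) (r' k)) else 0"
    have "(\<Sum>j. emeasure lborel (ball (c2 j) (r2 j))) = (\<Sum>j. ?f (prod_decode j))"
      by (intro suminf_cong) (simp add: c2_def r2_def split: prod.split)
    also have "\<dots> = (\<Sum>n. \<Sum>k. ?f (n, k))" by (rule suminf_ennreal_2dimen) simp
    also have "\<dots> = (\<Sum>n\<in>{0, 1::nat}. \<Sum>k. ?f (n, k))" by (rule suminf_finite) auto
    also have "\<dots> = (\<Sum>k. emeasure lborel (ball (c k) (r k))) + (\<Sum>k. emeasure lborel (ball (c' k) (r' k)))" by simp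
    also have "\<dots> \<le> (emeasure lborel S + ennreal (e / 2)) + ennreal (e / 2)"
      using cr(3) cr'(3) Ue by (intro add_mono) (auto intro: order_trans)
    also have "\<dots> = emeasure lborel S + ennreal e"
      using e by (simp add: add.assoc ennreal_plus[symmetric] del: ennreal_plus)
    finally show "(\<Sum>j. emeasure lborel (ball (c2 j) (r2 j))) \<le> emeasure lborel S + ennreal e" .
  qed
qed

text \<open>The image of a ball of radius \<open>r\<close> lies in a ball of radius
  \<open>L * r\<close>, and a ball cover of nearly minimal volume loses nothing else. So the
  constant tends to 1 with \<open>L\<close>.\<close>

lemma emeasure_lipschitz_image_le:
  fixes f :: "'a::euclidean_space \<Rightarrow> 'a"
  assumes W: "open W" and lip: "\<And>x y. x \<in> W \<Longrightarrow> y \<in> W \<Longrightarrow> dist (f x) (f y) \<le> L * dist x y" and L: "0 < L"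
    and S: "S \<in> sets borel" "S \<subseteq> W" and fS: "f ` S \<in> sets borel"
  shows "emeasure lborel (f ` S) \<le> ennreal (L ^ DIM('a)) * emeasure lborel S"
proof (rule ennreal_le_epsilon)
  fix e :: real assume e: "0 < e"
  let ?D = "DIM('a)"
  have pos: "0 < e / L ^ ?D" using e L by simp
  obtain c r where cr: "\<And>k. 0 \<le> r k \<and> r k < 1 \<and> ball (c k) (r k) \<subseteq> W"
    "S \<subseteq> (\<Union>k. ball (c k) (r k))" "(\<Sum>k. emeasure lborel (ball (c k) (r k))) \<le> emeasure lborel S + ennreal (e / L ^ ?D)"
    by (rule borel_ball_cover[OF S W pos zero_less_one]) (rule that)
  have "f ` S \<subseteq> (\<Union>k. ball (f (c k)) (L * r k))"
  proof clarify
    fix x assume "x \<in> S"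
    then obtain k where k: "x \<in> ball (c k) (r k)" using cr(2) by auto
    then have "0 < r k" by (metis dist_self le_less_trans mem_ball zero_le_dist)
    then have "c k \<in> W" "x \<in> W" using cr(1)[of k] k by auto
    then have "dist (f (c k)) (f x) \<le> L * dist (c k) x" by (rule lip)
    also have "\<dots> < L * r k" using k L by simp
    finally show "f x \<in> (\<Union>k. ball (f (c k)) (L * r k))" by auto
  qed
  then have "emeasure lborel (f ` S) \<le> emeasure lborel (\<Union>k. ball (f (c k)) (L * r k))"
    by (rule emeasure_mono) auto
  also have "\<dots> \<le> (\<Sum>k. emeasure lborel (ball (f (c k)) (L * r k)))"
    by (rule emeasure_subadditive_countably) auto
  also have "\<dots> = (\<Sum>k. ennreal (L ^ ?D) * emeasure lborel (ball (c k) (r k)))"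
    using cr(1) L by (simp add: emeasure_ball power_mult_distrib ennreal_mult'[symmetric] mult_ac)
  also have "\<dots> = ennreal (L ^ ?D) * (\<Sum>k. emeasure lborel (ball (c k) (r k)))" by (rule ennreal_suminf_cmult)
  also have "\<dots> \<le> ennreal (L ^ ?D) * (emeasure lborel S + ennreal (e / L ^ ?D))"
    using cr(3) by (rule mult_left_mono) simp
  also have "\<dots> = ennreal (L ^ ?D) * emeasure lborel S + ennreal e"
    using L e by (simp add: distrib_left ennreal_mult'[symmetric])
  finally show "emeasure lborel (f ` S) \<le> ennreal (L ^ ?D) * emeasure lborel S + ennreal e" .
qed

lemma dist_power2_split:
  fixes x y :: "real^'d::finite"
  shows "(dist x y)\<^sup>2 = (\<Sum>k\<in>-{i}. (x $ k - y $ k)\<^sup>2) + (x $ i - y $ i)\<^sup>2"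
proof -
  have "(dist x y)\<^sup>2 = (\<Sum>k\<in>UNIV. (x $ k - y $ k)\<^sup>2)"
    by (simp add: dist_vec_def L2_set_def dist_real_def sum_nonneg)
  also have "\<dots> = (x $ i - y $ i)\<^sup>2 + (\<Sum>k\<in>UNIV - {i}. (x $ k - y $ k)\<^sup>2)"
    by (rule sum.remove) auto
  finally show ?thesis by (simp add: Compl_eq_Diff_UNIV)
qed

subsection \<open>Steiner symmetrization and the isodiametric inequality\<close>

text \<open>Steiner symmetrization: the section of the set along each line parallel to axis
  \<open>j\<close> is replaced by the centred open interval of the same length. The section is that
  of the line through \<open>z\<close>, as \<open>vinsert\<close> overwrites the \<open>j\<close>-th
  coordinate; a null section yields the empty interval.\<close>

definition steiner :: "'d::finite \<Rightarrow> (real^'d) set \<Rightarrow> (real^'d) set" where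
  "steiner j S = {z. ennreal (2 * \<bar>z $ j\<bar>) < emeasure lborel {t. vinsert j (($) z) t \<in> S}}"

lemma measurable_vinsert_pair [measurable]:
  "(\<lambda>x. vinsert j (($) (fst x)) (snd x)) \<in> (borel :: (real^'d::finite) measure) \<Otimes>\<^sub>M (lborel :: real measure) \<rightarrow>\<^sub>M borel"
  unfolding vinsert_def
proof (rule borel_measurable_vec_lambda)
  fix k
  show "(\<lambda>x. if k = j then snd x else fst x $ k) \<in> borel_measurable ((borel :: (real^'d) measure) \<Otimes>\<^sub>M (lborel :: real measure))"
    by (cases "k = j") auto
qed

lemma measurable_section_length:
  assumes S: "S \<in> sets borel"
  shows "(\<lambda>z. emeasure lborel {t. vinsert j (($) z) t \<in> S}) \<in> borel_measurable borel"
proof -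
  let ?Q = "(\<lambda>x. vinsert j (($) (fst x)) (snd x)) -` S \<inter> space (borel \<Otimes>\<^sub>M lborel)"
  have "?Q \<in> sets (borel \<Otimes>\<^sub>M lborel)"
    using S by (intro measurable_sets[OF measurable_vinsert_pair])
  then have "(\<lambda>z. emeasure lborel (Pair z -` ?Q)) \<in> borel_measurable borel"
    by (rule lborel.measurable_emeasure_Pair)
  also have "(\<lambda>z. emeasure lborel (Pair z -` ?Q)) = (\<lambda>z. emeasure lborel {t. vinsert j (($) z) t \<in> S})"
    by (auto simp: space_pair_measure vimage_def)
  finally show ?thesis .
qed

lemma steiner_borel [measurable]: "S \<in> sets borel \<Longrightarrow> steiner j S \<in> sets borel"
proof -
  assume "S \<in> sets borel"
  note [measurable] = measurable_section_length[OF this]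
  show "steiner j S \<in> sets borel" unfolding steiner_def by measurable
qed

lemma emeasure_symmetric_interval: "emeasure lborel {t::real. ennreal (2 * \<bar>t\<bar>) < l} = l"
proof (cases l)
  case (real r)
  then have "{t::real. ennreal (2 * \<bar>t\<bar>) < l} = {- (r/2) <..< r/2}"
    by (auto simp: ennreal_less_iff)
  then show ?thesis using real by simp
next
  case top
  then have "{t::real. ennreal (2 * \<bar>t\<bar>) < l} = UNIV" by auto
  then show ?thesis using top by (simp add: emeasure_lborel_UNIV)
qed

lemma vinsert_vinsert [simp]: "vinsert j (($) (vinsert j p s)) t = vinsert j p t"
  by (simp add: vec_eq_iff)

text \<open>Tonelli in direction \<open>j\<close>: every section keeps its length.\<close>

lemma emeasure_steiner:
  fixes S :: "(real^'d::finite) set"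
  assumes S [measurable]: "S \<in> sets borel"
  shows "emeasure lborel (steiner j S) = emeasure lborel S"
proof -
  have sec: "(\<integral>\<^sup>+t. indicator T (vinsert j p t) \<partial>lborel) = emeasure lborel {t. vinsert j p t \<in> T}"
    if [measurable]: "T \<in> sets borel" for T :: "(real^'d) set" and p
  proof -
    have "{t. vinsert j p t \<in> T} = vinsert j p -` T \<inter> space borel" by auto
    then have [measurable]: "{t. vinsert j p t \<in> T} \<in> sets borel"
      using measurable_sets[OF measurable_vinsert' that] by metis
    have "(\<integral>\<^sup>+t. indicator T (vinsert j p t) \<partial>lborel) = (\<integral>\<^sup>+t. indicator {t. vinsert j p t \<in> T} t \<partial>lborel)"
      by (intro nn_integral_cong) (auto split: split_indicator)
    then show ?thesis by simp
  qed
  have "emeasure lborel {t. vinsert j p t \<in> steiner j S} = emeasure lborel {t. vinsert j p t \<in> S}" for p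
    by (simp add: steiner_def emeasure_symmetric_interval)
  note eq = this
  have em: "emeasure lborel T = (\<integral>\<^sup>+p. emeasure lborel {t. vinsert j p t \<in> T} \<partial>Pi\<^sub>M (- {j}) (\<lambda>_. lborel))"
    if [measurable]: "T \<in> sets borel" for T :: "(real^'d) set"
  proof -
    have "emeasure lborel T = (\<integral>\<^sup>+z. indicator T z \<partial>lborel)" by simp
    also have "\<dots> = (\<integral>\<^sup>+p. \<integral>\<^sup>+t. indicator T (vinsert j p t) \<partial>lborel \<partial>Pi\<^sub>M (- {j}) (\<lambda>_. lborel))"
      by (rule nn_integral_split) measurable
    finally show ?thesis by (simp only: sec that)
  qed
  show ?thesis by (simp only: em eq steiner_borel S)
qed

text \<open>Let A and B be the sections of the set over the base points of \<open>x\<close> and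
  \<open>y\<close>. All a in A and b in B satisfy |a - b| \<le> w, hence Sup A - Inf B \<le> w and
  Sup B - Inf A \<le> w. Added up, the hulls of A and B have total length at most 2 * w, which
  bounds 2 * |x $ j| + 2 * |y $ j|. Only coordinates in \<open>J\<close> are measured, so that the
  axis of a cylinder can be left out.\<close>

lemma steiner_diameter:
  fixes S :: "(real^'d::finite) set"
  assumes D: "\<And>x y. x \<in> S \<Longrightarrow> y \<in> S \<Longrightarrow> (\<Sum>k\<in>J. (x $ k - y $ k)\<^sup>2) \<le> D\<^sup>2"
    and j: "j \<in> J" and xy: "x \<in> steiner j S" "y \<in> steiner j S"
  shows "(\<Sum>k\<in>J. (x $ k - y $ k)\<^sup>2) \<le> D\<^sup>2"
proof -
  define A where "A = {t. vinsert j (($) x) t \<in> S}"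
  define B where "B = {t. vinsert j (($) y) t \<in> S}"
  define q where "q = (\<Sum>k\<in>J - {j}. (x $ k - y $ k)\<^sup>2)"
  have split: "(\<Sum>k\<in>J. (u $ k - v $ k)\<^sup>2) = (u $ j - v $ j)\<^sup>2 + (\<Sum>k\<in>J - {j}. (u $ k - v $ k)\<^sup>2)" for u v :: "real^'d"
    using j by (intro sum.remove) auto
  have lenA: "ennreal (2 * \<bar>x $ j\<bar>) < emeasure lborel A" and lenB: "ennreal (2 * \<bar>y $ j\<bar>) < emeasure lborel B"
    using xy by (simp_all add: steiner_def A_def B_def)
  have "A \<noteq> {}" "B \<noteq> {}" using lenA lenB by auto
  have AB: "(a - b)\<^sup>2 \<le> D\<^sup>2 - q" if "a \<in> A" "b \<in> B" for a b
  proof -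
    have "(\<Sum>k\<in>J. (vinsert j (($) x) a $ k - vinsert j (($) y) b $ k)\<^sup>2) \<le> D\<^sup>2"
      using that by (intro D) (auto simp: A_def B_def)
    then show ?thesis unfolding split by (simp add: q_def)
  qed
  then have q: "0 \<le> D\<^sup>2 - q" using \<open>A \<noteq> {}\<close> \<open>B \<noteq> {}\<close> by (meson all_not_in_conv order_trans zero_le_power2)
  define w where "w = sqrt (D\<^sup>2 - q)"
  have ab: "\<bar>a - b\<bar> \<le> w" if "a \<in> A" "b \<in> B" for a b
    using AB[OF that] unfolding w_def by (simp add: real_le_rsqrt)
  \<comment> \<open>Two points of the same section are compared through a point of the other
    one.\<close>
  have self: "\<bar>a - a'\<bar> \<le> 2 * w" if "a \<in> A \<and> a' \<in> A \<or> a \<in> B \<and> a' \<in> B" for a a'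
    using \<open>A \<noteq> {}\<close> \<open>B \<noteq> {}\<close> ab that by (smt (verit, best) all_not_in_conv)
  have bdd: "bdd_above A" "bdd_below A" "bdd_above B" "bdd_below B"
  proof -
    obtain a b where a: "a \<in> A" and b: "b \<in> B" using \<open>A \<noteq> {}\<close> \<open>B \<noteq> {}\<close> by blast
    show "bdd_above A" by (rule bdd_aboveI[of _ "a + 2 * w"]) (use self a in fastforce)
    show "bdd_below A" by (rule bdd_belowI[of _ "a - 2 * w"]) (use self a in fastforce)
    show "bdd_above B" by (rule bdd_aboveI[of _ "b + 2 * w"]) (use self b in fastforce)
    show "bdd_below B" by (rule bdd_belowI[of _ "b - 2 * w"]) (use self b in fastforce)
  qed
  have len: "emeasure lborel T \<le> ennreal (Sup T - Inf T)" if "T \<noteq> {}" "bdd_above T" "bdd_below T" for T :: "real set"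
  proof -
    have "T \<subseteq> {Inf T .. Sup T}" using that by (auto intro: cInf_lower cSup_upper)
    then have "emeasure lborel T \<le> emeasure lborel {Inf T .. Sup T}" by (rule emeasure_mono) simp
    also have "\<dots> = ennreal (Sup T - Inf T)"
      using cInf_le_cSup[OF that] by simp
    finally show ?thesis .
  qed
  have A: "2 * \<bar>x $ j\<bar> < Sup A - Inf A"
    using less_le_trans[OF lenA len[OF \<open>A \<noteq> {}\<close> bdd(1,2)]] by (simp add: ennreal_less_iff)
  have B: "2 * \<bar>y $ j\<bar> < Sup B - Inf B"
    using less_le_trans[OF lenB len[OF \<open>B \<noteq> {}\<close> bdd(3,4)]] by (simp add: ennreal_less_iff)
  have "Sup A \<le> b + w" if "b \<in> B" for b
    using ab that by (intro cSup_least \<open>A \<noteq> {}\<close>) (smt (verit))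
  then have "Sup A - w \<le> Inf B" by (intro cInf_greatest \<open>B \<noteq> {}\<close>) (smt (verit))
  moreover have "Sup B \<le> a + w" if "a \<in> A" for a
    using ab that by (intro cSup_least \<open>B \<noteq> {}\<close>) (smt (verit))
  then have "Sup B - w \<le> Inf A" by (intro cInf_greatest \<open>A \<noteq> {}\<close>) (smt (verit))
  ultimately have "\<bar>x $ j - y $ j\<bar> \<le> w" using A B by linarith
  then have "(x $ j - y $ j)\<^sup>2 \<le> w\<^sup>2" using abs_le_square_iff[of "x $ j - y $ j" w] by simp
  also have "w\<^sup>2 = D\<^sup>2 - q" using q by (simp add: w_def)
  finally show ?thesis unfolding split[of x y] q_def by simp
qed

definition flip :: "'d::finite \<Rightarrow> real^'d \<Rightarrow> real^'d" where
  "flip k z = vinsert k (($) z) (- z $ k)"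

lemma steiner_flip_same: "z \<in> steiner j S \<Longrightarrow> flip j z \<in> steiner j S"
  by (simp add: steiner_def flip_def)

text \<open>Sections over a base point and over its reflection in coordinate \<open>k\<close> are
  the same set of reals. Hence the symmetry gained in one direction survives symmetrization in the
  others.\<close>

lemma steiner_flip_other:
  assumes "\<And>z. z \<in> S \<Longrightarrow> flip k z \<in> S" and z: "z \<in> steiner j S" and "k \<noteq> j"
  shows "flip k z \<in> steiner j S"
proof -
  have flip2: "flip k (flip k z) = z" for z by (simp add: flip_def vec_eq_iff)
  have "vinsert j (($) (flip k z)) t = flip k (vinsert j (($) z) t)" for t
    using \<open>k \<noteq> j\<close> by (simp add: flip_def vec_eq_iff)
  moreover have "flip k x \<in> S \<longleftrightarrow> x \<in> S" for x using assms(1) flip2 by metis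
  moreover have "flip k z $ j = z $ j" using \<open>k \<noteq> j\<close> by (simp add: flip_def)
  ultimately show ?thesis using z by (simp add: steiner_def)
qed

text \<open>The dimension is a type, so a set of dimension \<open>d - 1\<close> is represented by a cylinder over it in
  direction \<open>i\<close>; symmetrization in the other directions preserves the cylinder's range of \<open>z $ i\<close>.\<close>

lemma symmetrized_set:
  fixes S :: "(real^'d::finite) set"
  assumes S: "S \<in> sets borel" and D: "\<And>x y. x \<in> S \<Longrightarrow> y \<in> S \<Longrightarrow> (\<Sum>k\<in>-{i}. (x $ k - y $ k)\<^sup>2) \<le> D\<^sup>2"
    and I: "\<And>z. z \<in> S \<Longrightarrow> z $ i \<in> I" and J: "finite J" "J \<subseteq> -{i}"
  shows "\<exists>T\<in>sets borel. emeasure lborel T = emeasure lborel S \<and>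
     (\<forall>x\<in>T. \<forall>y\<in>T. (\<Sum>k\<in>-{i}. (x $ k - y $ k)\<^sup>2) \<le> D\<^sup>2) \<and> (\<forall>z\<in>T. z $ i \<in> I) \<and> (\<forall>k\<in>J. \<forall>z\<in>T. flip k z \<in> T)"
  using J
proof (induction J)
  case empty then show ?case using S D I by auto
next
  case (insert j J)
  then obtain T where T: "T \<in> sets borel" "emeasure lborel T = emeasure lborel S"
     "\<And>x y. x \<in> T \<Longrightarrow> y \<in> T \<Longrightarrow> (\<Sum>k\<in>-{i}. (x $ k - y $ k)\<^sup>2) \<le> D\<^sup>2" "\<And>z. z \<in> T \<Longrightarrow> z $ i \<in> I"
     "\<And>k z. k \<in> J \<Longrightarrow> z \<in> T \<Longrightarrow> flip k z \<in> T" by auto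
  have ji: "j \<in> -{i}" using insert by auto
  have "z $ i \<in> I" if "z \<in> steiner j T" for z
  proof -
    have "{t. vinsert j (($) z) t \<in> T} \<noteq> {}" 
    proof
      assume "{t. vinsert j (($) z) t \<in> T} = {}"
      then show False using that unfolding steiner_def by simp
    qed
    then obtain t where "vinsert j (($) z) t \<in> T" by auto
    from T(4)[OF this] show ?thesis using ji by auto
  qed
  moreover have "flip k z \<in> steiner j T" if "k \<in> insert j J" "z \<in> steiner j T" for k z
    using that steiner_flip_same steiner_flip_other[of T k z j] T(5) by (cases "k = j") auto
  ultimately show ?case
    using T steiner_diameter[OF T(3) ji]
    by (intro bexI[of _ "steiner j T"]) (auto simp: emeasure_steiner)
qed

text \<open>The volume of a ball in \<open>Pi\<^sub>M\<close> over a finite index set, times the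
  length of an interval; over the empty index set the ball has volume 1.\<close>

lemma emeasure_cylinder:
  fixes i :: "'d::finite"
  assumes r: "0 < r" and ab: "a \<le> b"
  shows "emeasure lborel {z::real^'d. (\<Sum>k\<in>-{i}. (z $ k)\<^sup>2) \<le> r\<^sup>2 \<and> z $ i \<in> {a..b}} =
     ennreal (unit_ball_vol (real (CARD('d) - 1)) * r ^ (CARD('d) - 1) * (b - a))"
    (is "emeasure _ ?C = _")
proof -
  let ?N = "Pi\<^sub>M (-{i}) (\<lambda>_. lborel :: real measure)"
  have [measurable]: "?C \<in> sets borel" by measurable
  have card: "card (- {i}) = CARD('d) - 1" using card_Diff_singleton[of i UNIV] by (simp add: Compl_eq_Diff_UNIV)
  have "emeasure lborel ?C = (\<integral>\<^sup>+z. indicator ?C z \<partial>lborel)" by simp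
  also have "\<dots> = (\<integral>\<^sup>+t. \<integral>\<^sup>+p. indicator ?C (vinsert i p t) \<partial>?N \<partial>lborel)"
    by (rule nn_integral_split') measurable
  also have "\<dots> = (\<integral>\<^sup>+t. indicator {a..b} t * emeasure ?N ({p. sqrt (\<Sum>k\<in>-{i}. (p k)\<^sup>2) \<le> r} \<inter> space ?N) \<partial>lborel)"
  proof (rule nn_integral_cong)
    fix t :: real
    let ?E = "{p. sqrt (\<Sum>k\<in>-{i}. (p k)\<^sup>2) \<le> r} \<inter> space ?N"
    have "?E = {p\<in>space ?N. sqrt (\<Sum>k\<in>-{i}. (p k)\<^sup>2) \<le> r}" by auto
    also have "\<dots> \<in> sets ?N" by measurable
    finally have [measurable]: "?E \<in> sets ?N" .
    have "(\<integral>\<^sup>+p. indicator ?C (vinsert i p t) \<partial>?N) = (\<integral>\<^sup>+p. indicator {a..b} t * indicator ?E p \<partial>?N)"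
    proof (rule nn_integral_cong)
      fix p assume p: "p \<in> space ?N"
      have "(\<Sum>k\<in>-{i}. (vinsert i p t $ k)\<^sup>2) = (\<Sum>k\<in>-{i}. (p k)\<^sup>2)" by (intro sum.cong) auto
      moreover have "sqrt (\<Sum>k\<in>-{i}. (p k)\<^sup>2) \<le> r \<longleftrightarrow> (\<Sum>k\<in>-{i}. (p k)\<^sup>2) \<le> r\<^sup>2"
        using r by (metis less_eq_real_def real_sqrt_le_iff real_sqrt_unique)
      ultimately show "indicator ?C (vinsert i p t) = (indicator {a..b} t * indicator ?E p :: ennreal)"
        using p by (auto simp: indicator_def)
    qed
    also have "\<dots> = indicator {a..b} t * emeasure ?N ?E" by (simp add: nn_integral_cmult)
    finally show "(\<integral>\<^sup>+p. indicator ?C (vinsert i p t) \<partial>?N) = indicator {a..b} t * emeasure ?N ?E" .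
  qed
  also have "\<dots> = emeasure lborel {a..b} * emeasure ?N ({p. sqrt (\<Sum>k\<in>-{i}. (p k)\<^sup>2) \<le> r} \<inter> space ?N)"
    by (subst nn_integral_multc) auto
  also have "\<dots> = ennreal (unit_ball_vol (real (CARD('d) - 1)) * r ^ (CARD('d) - 1) * (b - a))"
    using emeasure_cball_aux[of "-{i}" r] r ab by (simp add: card ennreal_mult'[symmetric] mult_ac)
  finally show ?thesis .
qed

text \<open>Once the set is symmetric in every coordinate of \<open>-{i}\<close>, it contains with
  \<open>z\<close> the point reflected in all of them. Their distance is twice the distance of
  \<open>z\<close> from the axis, so the set lies in a cylinder of radius D / 2.\<close>

lemma isodiametric_cylinder:
  fixes S :: "(real^'d::finite) set"
  assumes S: "S \<in> sets borel" and D: "\<And>x y. x \<in> S \<Longrightarrow> y \<in> S \<Longrightarrow> (\<Sum>k\<in>-{i}. (x $ k - y $ k)\<^sup>2) \<le> D\<^sup>2"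
    and I: "\<And>z. z \<in> S \<Longrightarrow> z $ i \<in> {a..b}" and ab: "a \<le> b" and D0: "0 \<le> D"
  shows "emeasure lborel S \<le> ennreal (unit_ball_vol (real (CARD('d) - 1)) * (D / 2) ^ (CARD('d) - 1) * (b - a))"
proof -
  have "finite (-{i})" by simp
  from symmetrized_set[OF S D I this subset_refl]
  obtain T where T: "T \<in> sets borel" "emeasure lborel T = emeasure lborel S"
     "\<And>x y. x \<in> T \<Longrightarrow> y \<in> T \<Longrightarrow> (\<Sum>k\<in>-{i}. (x $ k - y $ k)\<^sup>2) \<le> D\<^sup>2" "\<And>z. z \<in> T \<Longrightarrow> z $ i \<in> {a..b}"
     "\<And>k z. k \<in> -{i} \<Longrightarrow> z \<in> T \<Longrightarrow> flip k z \<in> T" by blast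
  have refl: "(\<chi> k. if k \<in> K then - z $ k else z $ k) \<in> T" if "finite K" "K \<subseteq> -{i}" "z \<in> T" for K z
    using that
  proof (induction K)
    case (insert k K)
    then have "flip k (\<chi> k. if k \<in> K then - z $ k else z $ k) \<in> T" by (intro T(5)) auto
    also have "flip k (\<chi> k. if k \<in> K then - z $ k else z $ k) = (\<chi> l. if l \<in> insert k K then - z $ l else z $ l)"
      using insert.hyps by (auto simp: flip_def vec_eq_iff)
    finally show ?case .
  qed simp
  have rad: "(\<Sum>k\<in>-{i}. (z $ k)\<^sup>2) \<le> (D / 2)\<^sup>2" if "z \<in> T" for z
  proof -
    let ?z = "\<chi> k. if k \<in> -{i} then - z $ k else z $ k"
    have "(\<Sum>k\<in>-{i}. (z $ k - ?z $ k)\<^sup>2) \<le> D\<^sup>2" using that refl[of "-{i}"] by (intro T(3)) auto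
    also have "(\<Sum>k\<in>-{i}. (z $ k - ?z $ k)\<^sup>2) = (\<Sum>k\<in>-{i}. 4 * (z $ k)\<^sup>2)"
      by (intro sum.cong) (auto simp: power2_eq_square)
    finally show ?thesis by (simp add: sum_distrib_left[symmetric] power_divide)
  qed
  \<comment> \<open>The radius is enlarged by 1 / (n + 1) because the volume formula asks for a
    positive radius while \<open>D\<close> may be 0.\<close>
  have bound: "emeasure lborel S \<le> ennreal (unit_ball_vol (real (CARD('d) - 1)) * (D / 2 + 1 / real (Suc n)) ^ (CARD('d) - 1) * (b - a))" for n
  proof -
    let ?r = "D / 2 + 1 / real (Suc n)"
    have "T \<subseteq> {z. (\<Sum>k\<in>-{i}. (z $ k)\<^sup>2) \<le> ?r\<^sup>2 \<and> z $ i \<in> {a..b}}"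
    proof clarify
      fix z assume z: "z \<in> T"
      have "(D / 2)\<^sup>2 \<le> ?r\<^sup>2" using D0 by (intro power_mono) auto
      then show "(\<Sum>k\<in>-{i}. (z $ k)\<^sup>2) \<le> ?r\<^sup>2 \<and> z $ i \<in> {a..b}" using rad[OF z] T(4)[OF z] by simp
    qed
    then have "emeasure lborel T \<le> emeasure lborel {z. (\<Sum>k\<in>-{i}. (z $ k)\<^sup>2) \<le> ?r\<^sup>2 \<and> z $ i \<in> {a..b}}"
      by (rule emeasure_mono) measurable
    also have "\<dots> = ennreal (unit_ball_vol (real (CARD('d) - 1)) * ?r ^ (CARD('d) - 1) * (b - a))"
      using D0 ab by (intro emeasure_cylinder) (auto intro: add_nonneg_pos)
    finally show ?thesis using T(2) by simp
  qed
  have "(\<lambda>n. unit_ball_vol (real (CARD('d) - 1)) * (D / 2 + 1 / real (Suc n)) ^ (CARD('d) - 1) * (b - a))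
    \<longlonglongrightarrow> unit_ball_vol (real (CARD('d) - 1)) * (D / 2 + 0) ^ (CARD('d) - 1) * (b - a)"
    by (intro tendsto_intros LIMSEQ_Suc[OF lim_1_over_n])
  then show ?thesis
    using bound by (intro LIMSEQ_le_const[OF tendsto_ennrealI]) auto
qed

subsection \<open>Hausdorff measure on hyperplanes\<close>

text \<open>Lebesgue measure of the hyperplane z $ i = 0, as a Borel measure on the whole space. In
  dimension 1 it is the unit mass at the origin, in agreement with counting measure.\<close>

definition plane_measure :: "'d::finite \<Rightarrow> (real^'d) measure" where
  "plane_measure i = distr (Pi\<^sub>M (- {i}) (\<lambda>_. lborel)) borel (\<lambda>p. vinsert i p 0)"

lemma measurable_vinsert_const [measurable]:
  "(\<lambda>p. vinsert i p t) \<in> Pi\<^sub>M (- {i}) (\<lambda>_. lborel :: real measure) \<rightarrow>\<^sub>M borel"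
proof -
  have "(\<lambda>p. (p, t)) \<in> Pi\<^sub>M (- {i}) (\<lambda>_. lborel) \<rightarrow>\<^sub>M (Pi\<^sub>M (- {i}) (\<lambda>_. lborel :: real measure) \<Otimes>\<^sub>M (lborel :: real measure))"
    by measurable
  from measurable_compose[OF this measurable_vinsert] show ?thesis by simp
qed

lemma sets_plane_measure [simp, measurable_cong]: "sets (plane_measure i) = sets borel"
  by (simp add: plane_measure_def)

lemma measurable_vinsert_zero [measurable]: "(\<lambda>z. vinsert i (($) z) 0) \<in> borel \<rightarrow>\<^sub>M (borel :: (real^'d::finite) measure)"
  unfolding vinsert_def by (rule borel_measurable_vec_lambda) (auto intro: borel_measurable_vec_nth')

lemma nn_integral_plane_measure:
  fixes i :: "'d::finite"
  assumes [measurable]: "w \<in> borel_measurable borel" "k \<in> borel_measurable borel"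
  shows "(\<integral>\<^sup>+z. w (vinsert i (($) z) 0) * k (z $ i) \<partial>lborel) =
     (\<integral>\<^sup>+z. w z \<partial>plane_measure i) * (\<integral>\<^sup>+t. k t \<partial>lborel)"
proof -
  have "(\<integral>\<^sup>+z. w (vinsert i (($) z) 0) * k (z $ i) \<partial>lborel) =
    (\<integral>\<^sup>+t. \<integral>\<^sup>+p. w (vinsert i p 0) * k t \<partial>Pi\<^sub>M (- {i}) (\<lambda>_. lborel) \<partial>lborel)"
    by (subst nn_integral_split'[where i = i]) (auto intro: borel_measurable_vec_nth')
  also have "\<dots> = (\<integral>\<^sup>+t. (\<integral>\<^sup>+p. w (vinsert i p 0) \<partial>Pi\<^sub>M (- {i}) (\<lambda>_. lborel)) * k t \<partial>lborel)"
    by (intro nn_integral_cong nn_integral_multc) measurable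
  also have "\<dots> = (\<integral>\<^sup>+p. w (vinsert i p 0) \<partial>Pi\<^sub>M (- {i}) (\<lambda>_. lborel)) * (\<integral>\<^sup>+t. k t \<partial>lborel)"
    by (rule nn_integral_cmult) measurable
  finally show ?thesis by (simp add: plane_measure_def nn_integral_distr)
qed

text \<open>Height 1 makes the volume of the slab equal to the measure of its base, which turns
  questions in dimension d - 1 into questions about Lebesgue measure of the ambient space.\<close>

lemma emeasure_plane_measure_slab:
  fixes i :: "'d::finite"
  assumes [measurable]: "A \<in> sets borel"
  shows "emeasure lborel {z. vinsert i (($) z) 0 \<in> A \<and> z $ i \<in> {0..1}} = emeasure (plane_measure i) A"
proof -
  have [measurable]: "{z. vinsert i (($) z) 0 \<in> A \<and> z $ i \<in> {0..1}} \<in> sets borel" by measurable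
  have "emeasure lborel {z. vinsert i (($) z) 0 \<in> A \<and> z $ i \<in> {0..1}} =
      (\<integral>\<^sup>+z. indicator {z. vinsert i (($) z) 0 \<in> A \<and> z $ i \<in> {0..1}} z \<partial>lborel)"
    by simp
  also have "\<dots> = (\<integral>\<^sup>+z. indicator A (vinsert i (($) z) 0) * indicator {0..1} (z $ i) \<partial>lborel)"
    by (intro nn_integral_cong) (auto simp: indicator_def)
  also have "\<dots> = (\<integral>\<^sup>+z. indicator A z \<partial>plane_measure i) * (\<integral>\<^sup>+t. indicator {0..1::real} t \<partial>lborel)"
    by (rule nn_integral_plane_measure) measurable
  also have "\<dots> = emeasure (plane_measure i) A" by simp
  finally show ?thesis .
qed

text \<open>The isodiametric inequality for the unit slab: distances in the coordinates other than
  \<open>i\<close> are distances between projections to the plane, and these projections lie in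
  \<open>C\<close>.\<close>

lemma plane_measure_le_diameter:
  fixes C :: "(real^'d::finite) set"
  assumes C: "closed C" "bounded C"
  shows "emeasure (plane_measure i) C \<le>
    (if C = {} then 0 else ennreal (unit_ball_vol (real (CARD('d) - 1)) * (diameter C / 2) ^ (CARD('d) - 1)))"
proof (cases "C = {}")
  case False
  have [measurable]: "C \<in> sets borel" using C by auto
  let ?S = "{z. vinsert i (($) z) 0 \<in> C \<and> z $ i \<in> {0..1}}"
  have "emeasure lborel ?S \<le> ennreal (unit_ball_vol (real (CARD('d) - 1)) * (diameter C / 2) ^ (CARD('d) - 1) * (1 - 0))"
  proof (rule isodiametric_cylinder)
    fix x y assume xy: "x \<in> ?S" "y \<in> ?S"
    have "(\<Sum>k\<in>-{i}. (x $ k - y $ k)\<^sup>2) = (dist (vinsert i (($) x) 0) (vinsert i (($) y) 0))\<^sup>2"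
      by (subst dist_power2_split[of _ _ i]) (auto intro!: sum.cong)
    also have "\<dots> \<le> (diameter C)\<^sup>2"
      using xy C by (intro power_mono diameter_bounded_bound) auto
    finally show "(\<Sum>k\<in>-{i}. (x $ k - y $ k)\<^sup>2) \<le> (diameter C)\<^sup>2" .
  qed (use C in \<open>auto simp: diameter_ge_0\<close>)
  then show ?thesis using False emeasure_plane_measure_slab[of C i] by simp
qed simp

text \<open>Each covering set is replaced by its closure, which is measurable and has the same
  diameter; by the isodiametric inequality its plane measure is at most its term in the Hausdorff
  sum. Mesh 1 already gives the bound, since that inequality holds at every diameter.\<close>

lemma plane_measure_le_hausdorff:
  fixes A :: "(real^'d::finite) set"
  assumes A: "A \<in> sets borel"
  shows "emeasure (plane_measure i) A \<le> hausdorff_outer (CARD('d) - 1) A"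
proof -
  have "emeasure (plane_measure i) A \<le> hausdorff_pre (CARD('d) - 1) 1 A"
    unfolding hausdorff_pre_def
  proof (rule INF_greatest, clarify)
    fix C :: "nat \<Rightarrow> (real^'d) set"
    assume C: "A \<subseteq> (\<Union>i. C i)" "\<forall>i. bounded (C i) \<and> diameter (C i) \<le> 1"
    have "emeasure (plane_measure i) A \<le> emeasure (plane_measure i) (\<Union>j. closure (C j))"
    proof (rule emeasure_mono)
      show "A \<subseteq> (\<Union>j. closure (C j))"
        by (rule order_trans[OF C(1)]) (intro UN_mono closure_subset subset_refl)
    qed auto
    also have "\<dots> \<le> (\<Sum>j. emeasure (plane_measure i) (closure (C j)))"
      by (rule emeasure_subadditive_countably) auto
    also have "\<dots> \<le> (\<Sum>j. if C j = {} then 0 else ennreal (unit_ball_vol (real (CARD('d) - 1)) * (diameter (C j) / 2) ^ (CARD('d) - 1)))"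
    proof (rule suminf_le)
      fix j
      show "emeasure (plane_measure i) (closure (C j)) \<le>
        (if C j = {} then 0 else ennreal (unit_ball_vol (real (CARD('d) - 1)) * (diameter (C j) / 2) ^ (CARD('d) - 1)))"
      proof -
        have "bounded (C j)" using C(2) by simp
        then show ?thesis using plane_measure_le_diameter[of "closure (C j)" i]
          by (simp only: diameter_closure bounded_closure closure_eq_empty closed_closure)
      qed
    qed auto
    finally show "emeasure (plane_measure i) A \<le>
       (\<Sum>j. if C j = {} then 0 else ennreal (unit_ball_vol (real (CARD('d) - 1)) * (diameter (C j) / 2) ^ (CARD('d) - 1)))" .
  qed
  also have "\<dots> \<le> hausdorff_outer (CARD('d) - 1) A" by (rule hausdorff_pre_le_outer) simp
  finally show ?thesis .
qed

text \<open>The slab over a closed disc of radius s < r around the origin is a cylinder of known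
  volume; translation and s tending to r give the open disc. A lower bound is the direction needed
  to charge a disc of a Hausdorff cover to the slice of a ball.\<close>

lemma plane_disc_measure_ge:
  fixes c :: "real^'d::finite"
  assumes r: "0 < r"
  shows "ennreal (unit_ball_vol (real (CARD('d) - 1)) * r ^ (CARD('d) - 1)) \<le>
     emeasure (plane_measure i) {z. (\<Sum>k\<in>-{i}. (z $ k - c $ k)\<^sup>2) < r\<^sup>2}"
proof -
  let ?A = "{z::real^'d. (\<Sum>k\<in>-{i}. (z $ k - c $ k)\<^sup>2) < r\<^sup>2}"
  let ?c = "vinsert i (($) c) 0"
  have [measurable]: "?A \<in> sets borel" by measurable
  have "ennreal (unit_ball_vol (real (CARD('d) - 1)) * (r * (1 - 1 / real (Suc (Suc n)))) ^ (CARD('d) - 1)) \<le> emeasure (plane_measure i) ?A" for n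
  proof -
    define s where "s = r * (1 - 1 / real (Suc (Suc n)))"
    have s: "0 < s" "s < r" 
    proof -
      define x where "x = 1 / real (Suc (Suc n))"
      have "0 < x" "x < 1" by (auto simp: x_def)
      then have "0 < r * (1 - x)" "0 < r * x" using r by auto
      then show "0 < s" "s < r" by (auto simp: s_def x_def right_diff_distrib)
    qed
    let ?B = "{z::real^'d. (\<Sum>k\<in>-{i}. (z $ k)\<^sup>2) \<le> s\<^sup>2 \<and> z $ i \<in> {0..1}}"
    let ?T = "{z. vinsert i (($) z) 0 \<in> ?A \<and> z $ i \<in> {0..1}}"
    have [measurable]: "?B \<in> sets borel" "?T \<in> sets borel" by measurable
    have "ennreal (unit_ball_vol (real (CARD('d) - 1)) * s ^ (CARD('d) - 1)) = emeasure lborel ?B"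
      using emeasure_cylinder[of s 0 1 i] s by simp
    also have "\<dots> \<le> emeasure lborel ((+) ?c -` ?T \<inter> space lborel)"
    proof (rule emeasure_mono)
      have "s\<^sup>2 < r\<^sup>2" using s by (intro power_strict_mono) auto
      moreover have "(\<Sum>k\<in>-{i}. (vinsert i (($) (?c + z)) 0 $ k - c $ k)\<^sup>2) = (\<Sum>k\<in>-{i}. (z $ k)\<^sup>2)" for z
        by (intro sum.cong) auto
      ultimately show "?B \<subseteq> (+) ?c -` ?T \<inter> space lborel" by auto
      show "(+) ?c -` ?T \<inter> space lborel \<in> sets lborel"
        by (intro measurable_sets[of _ _ borel]) auto
    qed
    also have "\<dots> = emeasure (distr lborel borel ((+) ?c)) ?T"
      by (subst emeasure_distr) auto
    also have "\<dots> = emeasure lborel ?T" by (simp add: lborel_distr_plus)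
    also have "\<dots> = emeasure (plane_measure i) ?A" by (rule emeasure_plane_measure_slab) measurable
    finally show ?thesis by (simp add: s_def)
  qed
  moreover have "(\<lambda>n. unit_ball_vol (real (CARD('d) - 1)) * (r * (1 - 1 / real (Suc (Suc n)))) ^ (CARD('d) - 1))
     \<longlonglongrightarrow> unit_ball_vol (real (CARD('d) - 1)) * (r * (1 - 0)) ^ (CARD('d) - 1)"
    by (intro tendsto_intros LIMSEQ_Suc[OF LIMSEQ_Suc[OF lim_1_over_n]])
  ultimately show ?thesis
    by (intro LIMSEQ_le_const2[OF tendsto_ennrealI]) auto
qed

text \<open>A cover of the slab over \<open>A\<close> by balls of almost minimal total volume has, at some height \<open>t\<close>,
  slices of almost minimal total measure; these slices are discs, which are optimal for the Hausdorff measure.\<close>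

lemma hausdorff_le_plane_measure:
  fixes A :: "(real^'d::finite) set"
  assumes A [measurable]: "A \<in> sets borel" and Ai: "\<And>z. z \<in> A \<Longrightarrow> z $ i = 0"
  shows "hausdorff_outer (CARD('d) - 1) A \<le> emeasure (plane_measure i) A"
proof (rule ennreal_le_epsilon)
  fix e :: real assume fin: "emeasure (plane_measure i) A < top" and e: "0 < e"
  let ?m = "CARD('d) - 1"
  define M where "M = emeasure (plane_measure i) A + ennreal e"
  show "hausdorff_outer ?m A \<le> emeasure (plane_measure i) A + ennreal e"
    unfolding hausdorff_outer_def M_def[symmetric]
  proof (rule SUP_least)
    fix d :: real assume "d \<in> {0<..}"
    then have d: "0 < d" by simp
    let ?S = "{z. vinsert i (($) z) 0 \<in> A \<and> z $ i \<in> {0..1}}"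
    have S: "?S \<in> sets borel" by measurable
    have "0 < e / 2" "0 < d / 2" using e d by auto
    obtain c r where cr: "\<And>k. 0 \<le> r k \<and> r k < d / 2 \<and> ball (c k) (r k) \<subseteq> UNIV"
      "?S \<subseteq> (\<Union>k. ball (c k) (r k))" "(\<Sum>k. emeasure lborel (ball (c k) (r k))) \<le> emeasure lborel ?S + ennreal (e / 2)"
      by (rule borel_ball_cover[OF S subset_UNIV open_UNIV \<open>0 < e / 2\<close> \<open>0 < d / 2\<close>]; (assumption | rule that; assumption))
    \<comment> \<open>The (d - 1)-dimensional measure of the slice of the k-th ball at height
      \<open>t\<close>; integrated over \<open>t\<close> it gives the volume of that ball.\<close>
    define s where "s k t = emeasure (Pi\<^sub>M (- {i}) (\<lambda>_. lborel)) {p \<in> space (Pi\<^sub>M (- {i}) (\<lambda>_. lborel)). vinsert i p t \<in> ball (c k) (r k)}" for k t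
    have slice_sets: "{p \<in> space (Pi\<^sub>M (- {i}) (\<lambda>_. lborel :: real measure)). vinsert i p t \<in> ball (c k) (r k)} \<in> sets (Pi\<^sub>M (- {i}) (\<lambda>_. lborel))" for t k
    proof -
      have "(\<lambda>p. vinsert i p t) -` ball (c k) (r k) \<inter> space (Pi\<^sub>M (- {i}) (\<lambda>_. lborel :: real measure)) \<in> sets (Pi\<^sub>M (- {i}) (\<lambda>_. lborel))"
        by (intro measurable_sets[OF measurable_vinsert_const]) simp
      also have "(\<lambda>p. vinsert i p t) -` ball (c k) (r k) \<inter> space (Pi\<^sub>M (- {i}) (\<lambda>_. lborel :: real measure)) =
        {p \<in> space (Pi\<^sub>M (- {i}) (\<lambda>_. lborel :: real measure)). vinsert i p t \<in> ball (c k) (r k)}" by auto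
      finally show ?thesis .
    qed
    have s_int: "s k t = (\<integral>\<^sup>+p. indicator (ball (c k) (r k)) (vinsert i p t) \<partial>Pi\<^sub>M (- {i}) (\<lambda>_. lborel))" for k t
    proof -
      have "s k t = (\<integral>\<^sup>+p. indicator {p \<in> space (Pi\<^sub>M (- {i}) (\<lambda>_. lborel)). vinsert i p t \<in> ball (c k) (r k)} p \<partial>Pi\<^sub>M (- {i}) (\<lambda>_. lborel))"
        unfolding s_def using slice_sets[of t k] by simp
      also have "\<dots> = (\<integral>\<^sup>+p. indicator (ball (c k) (r k)) (vinsert i p t) \<partial>Pi\<^sub>M (- {i}) (\<lambda>_. lborel))"
        by (intro nn_integral_cong) (auto simp: indicator_def)
      finally show ?thesis .
    qed
    have s_vol: "(\<integral>\<^sup>+t. s k t \<partial>lborel) = emeasure lborel (ball (c k) (r k))" for k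
    proof -
      have "emeasure lborel (ball (c k) (r k)) = (\<integral>\<^sup>+z. indicator (ball (c k) (r k)) z \<partial>lborel)" by simp
      also have "\<dots> = (\<integral>\<^sup>+t. \<integral>\<^sup>+p. indicator (ball (c k) (r k)) (vinsert i p t) \<partial>Pi\<^sub>M (- {i}) (\<lambda>_. lborel) \<partial>lborel)"
        by (rule nn_integral_split') (rule borel_measurable_indicator, simp)
      finally show ?thesis by (simp only: s_int)
    qed
    have [measurable]: "s k \<in> borel_measurable borel" for k
    proof -
      interpret F: finite_product_sigma_finite "\<lambda>_. lborel :: real measure" "- {i}" by standard simp
      interpret P: pair_sigma_finite "lborel :: real measure" "Pi\<^sub>M (- {i}) (\<lambda>_. lborel :: real measure)" ..
      have "(\<lambda>x. vinsert i (snd x) (fst x)) \<in> (borel \<Otimes>\<^sub>M Pi\<^sub>M (- {i}) (\<lambda>_. lborel :: real measure)) \<rightarrow>\<^sub>M borel"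
        unfolding vinsert_def
      proof (rule borel_measurable_vec_lambda)
        fix k show "(\<lambda>x. if k = i then fst x else snd x k) \<in> borel_measurable (borel \<Otimes>\<^sub>M Pi\<^sub>M (- {i}) (\<lambda>_. lborel :: real measure))"
          by (cases "k = i") (auto intro: measurable_compose[OF measurable_snd measurable_component_singleton])
      qed
      then have [measurable]: "(\<lambda>(t, p). vinsert i p t) \<in> (borel \<Otimes>\<^sub>M Pi\<^sub>M (- {i}) (\<lambda>_. lborel :: real measure)) \<rightarrow>\<^sub>M borel"
        by (simp add: split_beta')
      have [measurable]: "ball (c k) (r k) \<in> sets borel" by simp
      show ?thesis unfolding s_int by measurable
    qed
    have total: "(\<integral>\<^sup>+t. (\<Sum>k. s k t) \<partial>lborel) \<le> emeasure (plane_measure i) A + ennreal (e / 2)"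
      using cr(3) unfolding emeasure_plane_measure_slab[OF A] by (simp add: nn_integral_suminf s_vol)
    \<comment> \<open>Averaging over the unit interval: if the slices exceeded \<open>M\<close> at
      every height, so would the total volume up to equality. The ball cover was taken with e / 2 to
      leave a strict gap below \<open>M\<close>.\<close>
    have "\<exists>t\<in>{0..1}. (\<Sum>k. s k t) \<le> M"
    proof (rule ccontr)
      assume "\<not> ?thesis"
      then have "M * indicator {0..1} t \<le> (\<Sum>k. s k t)" for t by (auto simp: indicator_def not_le less_imp_le)
      then have "(\<integral>\<^sup>+t. M * indicator {0..1::real} t \<partial>lborel) \<le> (\<integral>\<^sup>+t. (\<Sum>k. s k t) \<partial>lborel)"
        by (intro nn_integral_mono)
      also have "(\<integral>\<^sup>+t. M * indicator {0..1::real} t \<partial>lborel) = M" by (simp add: nn_integral_cmult)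
      finally have "M \<le> emeasure (plane_measure i) A + ennreal (e / 2)" using total by simp
      moreover have "ennreal (e / 2) < ennreal e" using e by (simp add: ennreal_lessI)
      ultimately show False using fin unfolding M_def by (auto simp: ennreal_add_left_cancel_le dest: leD)
    qed
    then obtain t where t: "t \<in> {0..1}" "(\<Sum>k. s k t) \<le> M" by blast
    \<comment> \<open>The slice of the k-th ball at height \<open>t\<close>, moved down to the plane
      of \<open>A\<close>. If nonempty, it is a disc of radius sqrt ((r k)^2 - (t - c k $ i)^2),
      called \<open>\<rho>\<close> below.\<close>
    define C where "C k = {z. z $ i = 0 \<and> vinsert i (($) z) t \<in> ball (c k) (r k)}" for k
    have Cball: "C k \<subseteq> {z. z $ i = 0 \<and> (\<Sum>l\<in>-{i}. (z $ l - c k $ l)\<^sup>2) < (r k)\<^sup>2 - (t - c k $ i)\<^sup>2}"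
      and Cball': "{z. (\<Sum>l\<in>-{i}. (z $ l - c k $ l)\<^sup>2) < (r k)\<^sup>2 - (t - c k $ i)\<^sup>2} \<subseteq> {z. vinsert i (($) z) t \<in> ball (c k) (r k)}" for k
    proof -
      have "vinsert i (($) z) t \<in> ball (c k) (r k) \<longleftrightarrow>
          (\<Sum>l\<in>-{i}. (z $ l - c k $ l)\<^sup>2) < (r k)\<^sup>2 - (t - c k $ i)\<^sup>2" for z
      proof -
        have "vinsert i (($) z) t \<in> ball (c k) (r k) \<longleftrightarrow> (dist (vinsert i (($) z) t) (c k))\<^sup>2 < (r k)\<^sup>2"
          using cr(1)[of k] power2_less_imp_less[of "dist (vinsert i (($) z) t) (c k)" "r k"]
              power_strict_mono[of "dist (vinsert i (($) z) t) (c k)" "r k" 2]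
          by (auto simp: dist_commute[of "c k"])
        also have "(dist (vinsert i (($) z) t) (c k))\<^sup>2 = (\<Sum>l\<in>-{i}. (z $ l - c k $ l)\<^sup>2) + (t - c k $ i)\<^sup>2"
          by (subst dist_power2_split[of _ _ i]) (auto intro!: sum.cong)
        finally show ?thesis by (simp add: less_diff_eq)
      qed
      then show "C k \<subseteq> {z. z $ i = 0 \<and> (\<Sum>l\<in>-{i}. (z $ l - c k $ l)\<^sup>2) < (r k)\<^sup>2 - (t - c k $ i)\<^sup>2}"
        "{z. (\<Sum>l\<in>-{i}. (z $ l - c k $ l)\<^sup>2) < (r k)\<^sup>2 - (t - c k $ i)\<^sup>2} \<subseteq> {z. vinsert i (($) z) t \<in> ball (c k) (r k)}"
        by (auto simp: C_def)
    qed
    have rho: "\<exists>\<rho>>0. \<rho> \<le> r k \<and> \<rho>\<^sup>2 = (r k)\<^sup>2 - (t - c k $ i)\<^sup>2" if ne: "C k \<noteq> {}" for k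
    proof -
      obtain z where "(\<Sum>l\<in>-{i}. (z $ l - c k $ l)\<^sup>2) < (r k)\<^sup>2 - (t - c k $ i)\<^sup>2" using ne Cball[of k] by blast
      moreover have "0 \<le> (\<Sum>l\<in>-{i}. (z $ l - c k $ l)\<^sup>2)" by (simp add: sum_nonneg)
      ultimately have "0 < (r k)\<^sup>2 - (t - c k $ i)\<^sup>2" by linarith
      then show ?thesis using cr(1)[of k]
        by (intro exI[of _ "sqrt ((r k)\<^sup>2 - (t - c k $ i)\<^sup>2)"]) (auto intro: real_le_lsqrt)
    qed
    have dist_C: "dist x y \<le> 2 * \<rho>" if xy: "x \<in> C k" "y \<in> C k" and \<rho>0: "0 < \<rho>" and \<rho>2: "\<rho>\<^sup>2 = (r k)\<^sup>2 - (t - c k $ i)\<^sup>2" for x y k \<rho>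
    proof -
      have "dist z (vinsert i (($) (c k)) 0) \<le> \<rho>" if "z \<in> C k" for z
      proof -
        have "(dist z (vinsert i (($) (c k)) 0))\<^sup>2 = (\<Sum>l\<in>-{i}. (z $ l - c k $ l)\<^sup>2)"
          using that by (subst dist_power2_split[of _ _ i]) (auto simp: C_def intro!: sum.cong)
        also have "\<dots> \<le> \<rho>\<^sup>2"
        proof (rule less_imp_le)
          show "(\<Sum>l\<in>-{i}. (z $ l - c k $ l)\<^sup>2) < \<rho>\<^sup>2"
            unfolding \<rho>2 using subsetD[OF Cball that] by blast
        qed
        finally show ?thesis by (rule power2_le_imp_le) (use \<rho>0 in simp)
      qed
      from this[OF xy(1)] this[OF xy(2)] show ?thesis
        by (metis add_mono dist_commute dist_triangle_le mult_2)
    qed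
    have bddC: "bounded (C k)" for k
    proof (cases "C k = {}")
      case False
      then obtain x where "x \<in> C k" by blast
      obtain \<rho> where "\<rho> > 0" "\<rho>\<^sup>2 = (r k)\<^sup>2 - (t - c k $ i)\<^sup>2" using rho[OF False] by blast
      then show ?thesis unfolding bounded_def using dist_C[OF \<open>x \<in> C k\<close>] by blast
    qed simp
    have diamC: "diameter (C k) \<le> 2 * \<rho>" if "C k \<noteq> {}" "0 < \<rho>" "\<rho>\<^sup>2 = (r k)\<^sup>2 - (t - c k $ i)\<^sup>2" for k \<rho>
      using that dist_C[of _ k _ \<rho>] by (intro diameter_le) (auto simp: dist_norm)
    have "hausdorff_pre ?m d A \<le> (\<Sum>k. if C k = {} then 0 else ennreal (unit_ball_vol (real ?m) * (diameter (C k) / 2) ^ ?m))"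
    proof (rule hausdorff_pre_le)
      show "A \<subseteq> (\<Union>k. C k)"
      proof
        fix z assume z: "z \<in> A"
        have "vinsert i (($) (vinsert i (($) z) t)) 0 = z" using Ai[OF z] by (simp add: vec_eq_iff)
        then have "vinsert i (($) z) t \<in> ?S" using z t by simp
        then obtain k where "vinsert i (($) z) t \<in> ball (c k) (r k)" using cr(2) by blast
        then have "z \<in> C k" using Ai[OF z] by (simp add: C_def)
        then show "z \<in> (\<Union>k. C k)" by blast
      qed
      fix k show "diameter (C k) \<le> d"
      proof (cases "C k = {}")
        case False
        then obtain \<rho> where "\<rho> > 0" "\<rho> \<le> r k" "\<rho>\<^sup>2 = (r k)\<^sup>2 - (t - c k $ i)\<^sup>2" using rho by blast
        then show ?thesis using diamC[OF False, of \<rho>] cr(1)[of k] by linarith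
      qed (use d in simp)
    qed (rule bddC)
    also have "\<dots> \<le> (\<Sum>k. s k t)"
    proof (rule suminf_le)
      fix k
      show "(if C k = {} then 0 else ennreal (unit_ball_vol (real ?m) * (diameter (C k) / 2) ^ ?m)) \<le> s k t"
      proof (cases "C k = {}")
        case False
        then obtain \<rho> where \<rho>: "\<rho> > 0" "\<rho>\<^sup>2 = (r k)\<^sup>2 - (t - c k $ i)\<^sup>2" using rho by blast
        have "(diameter (C k) / 2) ^ ?m \<le> \<rho> ^ ?m"
          using diamC[OF False \<rho>] bddC by (intro power_mono) (auto simp: diameter_ge_0)
        then have "ennreal (unit_ball_vol (real ?m) * (diameter (C k) / 2) ^ ?m) \<le> ennreal (unit_ball_vol (real ?m) * \<rho> ^ ?m)"
          by (intro ennreal_leI mult_left_mono) auto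
        also have "\<dots> \<le> emeasure (plane_measure i) {z. (\<Sum>l\<in>-{i}. (z $ l - c k $ l)\<^sup>2) < \<rho>\<^sup>2}"
          by (rule plane_disc_measure_ge) (rule \<rho>)
        also have "\<dots> = emeasure (Pi\<^sub>M (- {i}) (\<lambda>_. lborel)) ((\<lambda>p. vinsert i p 0) -` {z. (\<Sum>l\<in>-{i}. (z $ l - c k $ l)\<^sup>2) < \<rho>\<^sup>2} \<inter> space (Pi\<^sub>M (- {i}) (\<lambda>_. lborel)))"
          unfolding plane_measure_def by (rule emeasure_distr) measurable
        also have "\<dots> \<le> s k t"
          unfolding s_def
        proof (rule emeasure_mono)
          show "(\<lambda>p. vinsert i p 0) -` {z. (\<Sum>l\<in>-{i}. (z $ l - c k $ l)\<^sup>2) < \<rho>\<^sup>2} \<inter> space (Pi\<^sub>M (- {i}) (\<lambda>_. lborel)) \<subseteq>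
            {p \<in> space (Pi\<^sub>M (- {i}) (\<lambda>_. lborel)). vinsert i p t \<in> ball (c k) (r k)}"
          proof safe
            fix p assume "(\<Sum>l\<in>-{i}. (vinsert i p 0 $ l - c k $ l)\<^sup>2) < \<rho>\<^sup>2"
            then show "vinsert i p t \<in> ball (c k) (r k)"
              using subsetD[OF Cball'[of k], of "vinsert i p 0"] unfolding \<rho>(2) by (simp del: mem_ball)
          qed
        qed (rule slice_sets)
        finally show ?thesis using False by simp
      qed simp
    qed auto
    also have "\<dots> \<le> M" by (rule t)
    finally show "hausdorff_pre ?m d A \<le> M" .
  qed
qed

lemma hausdorff_outer_plane:
  fixes A :: "(real^'d::finite) set"
  assumes "A \<in> sets borel" "\<And>z. z \<in> A \<Longrightarrow> z $ i = 0"
  shows "hausdorff_outer (CARD('d) - 1) A = emeasure (plane_measure i) A"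
  by (rule antisym[OF hausdorff_le_plane_measure plane_measure_le_hausdorff]) (use assms in auto)

subsection \<open>Flattening level sets\<close>

lemma partial_deriv_line:
  fixes F :: "real^'d::finite \<Rightarrow> real"
  assumes diff: "\<And>x. (\<lambda>t. F (x + t *\<^sub>R axis i 1)) differentiable (at 0)"
  shows "((\<lambda>t. F (y + t *\<^sub>R axis i 1)) has_field_derivative partial_deriv i F (y + s *\<^sub>R axis i 1)) (at s)"
proof -
  have "((\<lambda>t. F ((y + s *\<^sub>R axis i 1) + t *\<^sub>R axis i 1)) has_field_derivative
      partial_deriv i F (y + s *\<^sub>R axis i 1)) (at (s - s))"
    unfolding partial_deriv_def using diff[of "y + s *\<^sub>R axis i 1"]
    by (simp add: DERIV_deriv_iff_real_differentiable)
  then have "((\<lambda>t. F ((y + s *\<^sub>R axis i 1) + (t - s) *\<^sub>R axis i 1)) has_field_derivative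
      partial_deriv i F (y + s *\<^sub>R axis i 1)) (at s)"
    using DERIV_shift[of "\<lambda>t. F ((y + s *\<^sub>R axis i 1) + t *\<^sub>R axis i 1)" _ s "- s"] by simp
  then show ?thesis by (simp add: algebra_simps)
qed

text \<open>The increment is split into steps along the axes. On each of them the mean value
  inequality applies to F minus its linear part, whose slope is at most \<open>e'\<close> by
  continuity of the partial derivatives.\<close>

lemma has_derivative_of_partials:
  fixes F :: "real^'d::finite \<Rightarrow> real"
  assumes diff: "\<And>i x. (\<lambda>t. F (x + t *\<^sub>R axis i 1)) differentiable (at 0)"
    and cont: "\<And>i. continuous_on UNIV (partial_deriv i F)"
  shows "(F has_derivative (\<lambda>v. grad F x \<bullet> v)) (at x)"
  unfolding has_derivative_at_alt
proof (intro conjI allI impI)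
  show "bounded_linear (\<lambda>v. grad F x \<bullet> v)" by (rule bounded_linear_inner_right)
  fix e :: real assume e: "0 < e"
  define e' where "e' = e / real CARD('d)"
  have e': "0 < e'" using e by (simp add: e'_def)
  have "\<exists>d>0. \<forall>y. dist y x < d \<longrightarrow> dist (partial_deriv i F y) (partial_deriv i F x) < e'" for i
    using cont[of i] e' by (auto simp: continuous_on_iff)
  then obtain d where d: "\<And>i. 0 < d i" "\<And>i y. dist y x < d i \<Longrightarrow> dist (partial_deriv i F y) (partial_deriv i F x) < e'"
    by metis
  define D where "D = Min (range d)"
  have D: "0 < D" "\<And>i. D \<le> d i" unfolding D_def using d(1) by auto
  \<comment> \<open>\<open>P J v\<close> keeps the coordinates in \<open>J\<close>, so that adding
    one index to \<open>J\<close> is one step along an axis.\<close>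
  define P where "P J v = (\<chi> k. if k \<in> J then v $ k else 0)" for J and v :: "real^'d"
  have normP: "norm (P J v) \<le> norm v" for J v
    by (rule norm_le_componentwise_cart) (simp add: P_def)
  have step: "\<bar>F (x + P J v) - F x - (\<Sum>k\<in>J. v $ k * partial_deriv k F x)\<bar> \<le> (\<Sum>k\<in>J. e' * \<bar>v $ k\<bar>)"
    if v: "norm v < D" and "finite J" for J v
    using \<open>finite J\<close>
  proof (induction J)
    case empty then show ?case by (simp add: P_def vec_eq_iff[symmetric] zero_vec_def[symmetric])
  next
    case (insert j J)
    let ?y = "x + P J v"
    have ins: "P (insert j J) v = P J v + v $ j *\<^sub>R axis j 1"
      using insert.hyps by (auto simp: P_def vec_eq_iff axis_def)
    have "\<bar>(F (?y + v $ j *\<^sub>R axis j 1) - v $ j * partial_deriv j F x) - (F (?y + 0 *\<^sub>R axis j 1) - 0 * partial_deriv j F x)\<bar>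
       \<le> e' * \<bar>v $ j - 0\<bar>"
      unfolding real_norm_def[symmetric]
    proof (rule field_differentiable_bound[where S = "closed_segment 0 (v $ j)"
          and f = "\<lambda>t. F (?y + t *\<^sub>R axis j 1) - t * partial_deriv j F x"
          and f' = "\<lambda>t. partial_deriv j F (?y + t *\<^sub>R axis j 1) - partial_deriv j F x"])
      fix t assume t: "t \<in> closed_segment 0 (v $ j)"
      show "((\<lambda>t. F (?y + t *\<^sub>R axis j 1) - t * partial_deriv j F x) has_field_derivative
          partial_deriv j F (?y + t *\<^sub>R axis j 1) - partial_deriv j F x) (at t within closed_segment 0 (v $ j))"
        by (intro DERIV_subset[OF DERIV_diff[OF partial_deriv_line[OF diff]]])
           (auto intro!: derivative_eq_intros)
      have "\<bar>t\<bar> \<le> \<bar>v $ j\<bar>" using t by (auto simp: closed_segment_eq_real_ivl split: if_splits)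
      then have "norm (P J v + t *\<^sub>R axis j 1) \<le> norm v"
        using insert.hyps by (intro norm_le_componentwise_cart) (auto simp: P_def axis_def)
      then have "dist (?y + t *\<^sub>R axis j 1) x < d j"
        using v D(2)[of j] by (simp add: dist_norm add.assoc)
      then show "norm (partial_deriv j F (?y + t *\<^sub>R axis j 1) - partial_deriv j F x) \<le> e'"
        using d(2) by (fastforce simp: dist_norm)
    qed (auto simp: convex_closed_segment)
    then have "\<bar>F (x + P (insert j J) v) - F ?y - v $ j * partial_deriv j F x\<bar> \<le> e' * \<bar>v $ j\<bar>"
      by (simp add: ins add.assoc)
    then show ?case using insert by simp
  qed
  show "\<exists>d>0. \<forall>y. norm (y - x) < d \<longrightarrow> norm (F y - F x - grad F x \<bullet> (y - x)) \<le> e * norm (y - x)"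
  proof (intro exI conjI allI impI)
    show "0 < D" by (rule D)
    fix y assume y: "norm (y - x) < D"
    have "P UNIV (y - x) = y - x" by (simp add: P_def vec_eq_iff)
    moreover have "(\<Sum>k\<in>UNIV. (y - x) $ k * partial_deriv k F x) = grad F x \<bullet> (y - x)"
      by (simp add: inner_vec_def grad_def mult.commute)
    ultimately have "\<bar>F y - F x - grad F x \<bullet> (y - x)\<bar> \<le> (\<Sum>k\<in>UNIV. e' * \<bar>(y - x) $ k\<bar>)"
      using step[OF y finite_class.finite_UNIV] by simp
    also have "\<dots> \<le> (\<Sum>k\<in>(UNIV::'d set). e' * norm (y - x))"
      using e' component_le_norm_cart[of "y - x"] by (intro sum_mono mult_left_mono) auto
    also have "\<dots> = e * norm (y - x)" by (simp add: e'_def)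
    finally show "norm (F y - F x - grad F x \<bullet> (y - x)) \<le> e * norm (y - x)" by simp
  qed
qed

lemma has_derivative_times_cont_diff:
  fixes f :: "real^'d::finite \<Rightarrow> real"
  assumes "times_cont_diff k f" "1 \<le> k"
  shows "(f has_derivative (\<lambda>v. grad f x \<bullet> v)) (at x)" and "continuous_on UNIV (grad f)"
proof -
  have diff: "(\<lambda>t. f (x + t *\<^sub>R axis i 1)) differentiable (at 0)" for i x
    using assms unfolding times_cont_diff_def by (auto simp: partials_def dest: spec[of _ "[]"])
  have cont: "continuous_on UNIV (partial_deriv i f)" for i
  proof -
    have "continuous_on UNIV (partials [i] f)" using assms unfolding times_cont_diff_def by auto
    then show ?thesis by (simp add: partials_def)
  qed
  show "(f has_derivative (\<lambda>v. grad f x \<bullet> v)) (at x)" by (rule has_derivative_of_partials[OF diff cont])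
  show "continuous_on UNIV (grad f)" unfolding grad_def by (intro continuous_on_vec_lambda cont)
qed

text \<open>Near a point with nonzero gradient, the map \<open>x + ((f x - c) / l - x \<bullet> e) e\<close> with
  \<open>l = norm (G y)\<close>, \<open>e = G y / l\<close> is almost an isometry and flattens the level sets of \<open>f\<close>;
  a rotation then moves \<open>e\<close> to a coordinate axis.\<close>

lemma level_set_flattening:
  fixes f :: "real^'d::finite \<Rightarrow> real" and G :: "real^'d \<Rightarrow> real^'d"
  assumes deriv: "\<And>x. (f has_derivative (\<lambda>v. G x \<bullet> v)) (at x)" and cont: "continuous_on UNIV G"
    and G0: "G y \<noteq> 0" and L: "1 < L"
  obtains r :: real and \<Theta> :: "real^'d \<Rightarrow> real^'d" where "0 < r"
    "\<And>x x'. x \<in> ball y r \<Longrightarrow> x' \<in> ball y r \<Longrightarrow> dist (\<Theta> x) (\<Theta> x') \<le> L * dist x x'"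
    "\<And>x x'. x \<in> ball y r \<Longrightarrow> x' \<in> ball y r \<Longrightarrow> dist x x' \<le> L * dist (\<Theta> x) (\<Theta> x')"
    "open (\<Theta> ` ball y r)" "\<And>x. \<Theta> x $ i = (f x - c) / norm (G y)"
    "\<And>x. x \<in> ball y r \<Longrightarrow> norm (G x) \<le> L * norm (G y) \<and> norm (G y) \<le> L * norm (G x)"
proof -
  define l where "l = norm (G y)"
  define e where "e = G y /\<^sub>R l"
  have l: "0 < l" using G0 by (simp add: l_def)
  have e: "norm e = 1" using l by (simp add: e_def l_def)
  \<comment> \<open>With this value 1 - eps = 1 / L and 1 + eps \<le> L, so that one estimate yields
    both Lipschitz bounds.\<close>
  define eps where "eps = 1 - 1 / L"
  have eps: "0 < eps" "1 - eps = 1 / L" "1 + eps \<le> L"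
  proof -
    show "0 < eps" "1 - eps = 1 / L" using L by (auto simp: eps_def)
    have "0 \<le> (L - 1)\<^sup>2 / L" using L by auto
    also have "(L - 1)\<^sup>2 / L = L - (1 + eps)" using L by (simp add: eps_def power2_eq_square field_simps)
    finally show "1 + eps \<le> L" by simp
  qed
  obtain R :: "real^'d \<Rightarrow> real^'d" where R: "orthogonal_transformation R" "R e = axis i 1"
    using orthogonal_transformation_exists[of e "axis i 1"] e by (auto simp: norm_axis_1)
  obtain r where r: "0 < r" "\<And>x. dist x y < r \<Longrightarrow> dist (G x) (G y) < eps * l"
    using cont eps l unfolding continuous_on_iff by (metis UNIV_I mult_pos_pos)
  \<comment> \<open>Adding \<open>g x *\<^sub>R e\<close> makes the \<open>e\<close>-component equal
    to (f x - c) / l. The gradient of \<open>g\<close> is G x / l - e, which vanishes at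
    \<open>y\<close> and is at most \<open>eps\<close> nearby.\<close>
  define g where "g x = (f x - c) / l - x \<bullet> e" for x
  define Psi where "Psi x = x + g x *\<^sub>R e" for x
  have g_lip: "\<bar>g x - g x'\<bar> \<le> eps * dist x x'" if "x \<in> ball y r" "x' \<in> ball y r" for x x'
    unfolding dist_norm real_norm_def[symmetric]
  proof (rule differentiable_bound[where f' = "\<lambda>x v. (G x /\<^sub>R l - e) \<bullet> v" and S = "ball y r"])
    fix z assume z: "z \<in> ball y r"
    have "(g has_derivative (\<lambda>v. (G z \<bullet> v) / l - v \<bullet> e)) (at z)"
      unfolding g_def using deriv[of z] l by (auto intro!: derivative_eq_intros)
    moreover have "(\<lambda>v. (G z \<bullet> v) / l - v \<bullet> e) = (\<lambda>v. (G z /\<^sub>R l - e) \<bullet> v)"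
      by (simp add: inner_diff_left inner_commute[of _ e] divide_inverse mult.commute)
    ultimately show "(g has_derivative (\<lambda>v. (G z /\<^sub>R l - e) \<bullet> v)) (at z within ball y r)"
      by (metis has_derivative_at_withinI)
    have "G z /\<^sub>R l - e = (G z - G y) /\<^sub>R l" by (simp add: e_def scaleR_diff_right)
    then have "norm (G z /\<^sub>R l - e) = norm (G z - G y) / l" using l by (simp add: divide_inverse mult.commute)
    also have "\<dots> \<le> eps" using r(2)[of z] z l by (simp add: dist_norm dist_commute field_simps norm_minus_commute)
    finally have "norm (G z /\<^sub>R l - e) \<le> eps" .
    moreover have "onorm (\<lambda>v. (G z /\<^sub>R l - e) \<bullet> v) \<le> norm (G z /\<^sub>R l - e)"
      by (rule onorm_le) (simp add: Cauchy_Schwarz_ineq2)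
    ultimately show "onorm (\<lambda>v. (G z /\<^sub>R l - e) \<bullet> v) \<le> eps" by linarith
  qed (use that in auto)
  have near: "\<bar>dist (Psi x) (Psi x') - dist x x'\<bar> \<le> eps * dist x x'" if "x \<in> ball y r" "x' \<in> ball y r" for x x'
  proof -
    have "Psi x - Psi x' = (x - x') + (g x - g x') *\<^sub>R e" by (simp add: Psi_def algebra_simps)
    then have "\<bar>norm (Psi x - Psi x') - norm (x - x')\<bar> \<le> norm ((g x - g x') *\<^sub>R e)"
      using norm_triangle_ineq3[of "Psi x - Psi x'" "x - x'"] by simp
    also have "\<dots> = \<bar>g x - g x'\<bar>" using e by simp
    also have "\<dots> \<le> eps * dist x x'" by (rule g_lip[OF that])
    finally show ?thesis by (simp add: dist_norm)
  qed
  define Th where "Th x = R (Psi x)" for x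
  have dist_Th: "dist (Th x) (Th x') = dist (Psi x) (Psi x')" for x x'
    using R(1) by (simp add: Th_def dist_norm orthogonal_transformation_norm
        linear_diff[OF orthogonal_transformation_linear[OF R(1)], symmetric])
  have up: "dist (Th x) (Th x') \<le> L * dist x x'" if "x \<in> ball y r" "x' \<in> ball y r" for x x'
  proof -
    have "dist (Th x) (Th x') \<le> (1 + eps) * dist x x'"
      using near[OF that] by (simp add: dist_Th distrib_right)
    also have "\<dots> \<le> L * dist x x'" using eps by (intro mult_right_mono) auto
    finally show ?thesis .
  qed
  have low: "dist x x' \<le> L * dist (Th x) (Th x')" if "x \<in> ball y r" "x' \<in> ball y r" for x x'
  proof -
    have "(1 - eps) * dist x x' \<le> dist (Th x) (Th x')"
      using near[OF that] by (simp add: dist_Th left_diff_distrib)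
    then show ?thesis using L by (simp add: eps(2) field_simps)
  qed
  have inj: "inj_on Th (ball y r)"
    using low by (intro inj_onI) (metis dist_self mult_zero_right zero_less_dist_iff not_less)
  have contTh: "continuous_on (ball y r) Th"
    using up L by (intro lipschitz_on_continuous_on[of L] lipschitz_onI) auto
  show thesis
  proof
    \<comment> \<open>A continuous injective map between spaces of equal dimension: invariance of
      domain takes the place of the inverse function theorem.\<close>
    show "open (Th ` ball y r)" by (rule invariance_of_domain[OF contTh open_ball inj])
    fix x
    have "Th x $ i = R (Psi x) \<bullet> R e" by (simp add: Th_def R(2) inner_axis)
    also have "\<dots> = Psi x \<bullet> e" using R(1) by (simp add: orthogonal_transformation_def)
    also have "\<dots> = (f x - c) / l" using e by (simp add: Psi_def g_def inner_add_left dot_square_norm)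
    finally show "Th x $ i = (f x - c) / norm (G y)" by (simp add: l_def)
    assume "x \<in> ball y r"
    then have "norm (G x - G y) \<le> eps * l" using r(2)[of x] by (simp add: dist_norm dist_commute norm_minus_commute)
    then have "norm (G x) \<le> (1 + eps) * l" "(1 - eps) * l \<le> norm (G x)"
      using norm_triangle_ineq2[of "G x" "G y"] norm_triangle_ineq3[of "G x" "G y"]
      by (auto simp: l_def algebra_simps)
    moreover have "(1 + eps) * l \<le> L * l" using eps l by (intro mult_right_mono) auto
    ultimately show "norm (G x) \<le> L * norm (G y) \<and> norm (G y) \<le> L * norm (G x)"
      using L by (simp add: eps(2) l_def field_simps)
  qed (use r up low in auto)
qed

text \<open>Passes from a comparison of two measures on sets to their integrals, by induction over
  simple functions and monotone limits.\<close>

lemma nn_integral_le_of_emeasure_le: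
  assumes sets: "sets N = sets M" and le: "\<And>E. E \<in> sets M \<Longrightarrow> emeasure N E \<le> a * emeasure M E"
    and F: "F \<in> borel_measurable M"
  shows "(\<integral>\<^sup>+x. F x \<partial>N) \<le> a * (\<integral>\<^sup>+x. F x \<partial>M)"
  using F
proof (induction rule: borel_measurable_induct)
  case (cong f g)
  have "space N = space M" using sets by (rule sets_eq_imp_space_eq)
  then show ?case using cong by (metis nn_integral_cong)
next
  case (set A)
  then show ?case using le[of A] sets by simp
next
  case (mult u c)
  have [measurable]: "u \<in> borel_measurable M" "u \<in> borel_measurable N" using mult sets by (auto cong: measurable_cong_sets)
  have "c * (\<integral>\<^sup>+x. u x \<partial>N) \<le> c * (a * (\<integral>\<^sup>+x. u x \<partial>M))" using mult by (intro mult_left_mono) auto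
  then show ?case by (simp add: nn_integral_cmult mult.left_commute[of a])
next
  case (add u v)
  have [measurable]: "u \<in> borel_measurable M" "u \<in> borel_measurable N" "v \<in> borel_measurable M" "v \<in> borel_measurable N"
    using add sets by (auto cong: measurable_cong_sets)
  show ?case using add by (simp add: nn_integral_add distrib_left add_mono)
next
  case (seq U)
  have [measurable]: "U i \<in> borel_measurable M" "U i \<in> borel_measurable N" for i
    using seq sets by (auto cong: measurable_cong_sets)
  have "(\<integral>\<^sup>+x. (SUP i. U i) x \<partial>N) = (SUP i. \<integral>\<^sup>+x. U i x \<partial>N)"
    using seq by (simp add: nn_integral_monotone_convergence_SUP image_comp)
  also have "\<dots> \<le> a * (\<integral>\<^sup>+x. (SUP i. U i) x \<partial>M)"
  proof (rule SUP_least)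
    fix i
    have "(\<integral>\<^sup>+x. U i x \<partial>N) \<le> a * (\<integral>\<^sup>+x. U i x \<partial>M)" by (rule seq)
    also have "\<dots> \<le> a * (\<integral>\<^sup>+x. (SUP i. U i) x \<partial>M)"
      by (intro mult_left_mono nn_integral_mono) (auto simp: image_comp intro: SUP_upper)
    finally show "(\<integral>\<^sup>+x. U i x \<partial>N) \<le> a * (\<integral>\<^sup>+x. (SUP i. U i) x \<partial>M)" .
  qed
  finally show ?case .
qed

section \<open>Bilipschitz charts: measures, Hausdorff measures and integrals\<close>

locale bilipschitz_chart =
  fixes W :: "(real^'d::finite) set" and \<Theta> :: "real^'d \<Rightarrow> real^'d" and L :: real
  assumes W: "open W" and L: "1 < L"
    and up: "\<And>x x'. x \<in> W \<Longrightarrow> x' \<in> W \<Longrightarrow> dist (\<Theta> x) (\<Theta> x') \<le> L * dist x x'"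
    and low: "\<And>x x'. x \<in> W \<Longrightarrow> x' \<in> W \<Longrightarrow> dist x x' \<le> L * dist (\<Theta> x) (\<Theta> x')"
    and V: "open (\<Theta> ` W)"
begin

lemma inj: "inj_on \<Theta> W"
proof (rule inj_onI)
  fix x y assume "x \<in> W" "y \<in> W" "\<Theta> x = \<Theta> y"
  then show "x = y" using low[of x y] by simp
qed

definition inverse_chart :: "real^'d \<Rightarrow> real^'d" where "inverse_chart = inv_into W \<Theta>"

lemma inverse_chart: "x \<in> W \<Longrightarrow> inverse_chart (\<Theta> x) = x" "z \<in> \<Theta> ` W \<Longrightarrow> inverse_chart z \<in> W \<and> \<Theta> (inverse_chart z) = z"
  unfolding inverse_chart_def using inj by (auto simp: inv_into_into f_inv_into_f)

lemma cont: "continuous_on W \<Theta>" and cont_inverse: "continuous_on (\<Theta> ` W) inverse_chart"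
proof -
  show "continuous_on W \<Theta>"
    using up L by (intro lipschitz_on_continuous_on[of L] lipschitz_onI) auto
  show "continuous_on (\<Theta> ` W) inverse_chart"
    using low L by (intro lipschitz_on_continuous_on[of L] lipschitz_onI) (auto simp: inverse_chart)
qed

text \<open>\<open>\<Theta>\<close> is continuous only on \<open>W\<close>; its extension by 0 is
  Borel on the whole space.\<close>

lemma borel_preimage: "E \<in> sets borel \<Longrightarrow> {x\<in>W. \<Theta> x \<in> E} \<in> sets borel"
proof -
  assume E: "E \<in> sets borel"
  have "(\<lambda>x. if x \<in> W then \<Theta> x else 0) \<in> borel_measurable borel"
    using W cont by (intro borel_measurable_continuous_on_if) auto
  from measurable_sets[OF this E] have "(\<lambda>x. if x \<in> W then \<Theta> x else 0) -` E \<inter> W \<in> sets borel"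
    using W by (auto intro: sets.Int)
  also have "(\<lambda>x. if x \<in> W then \<Theta> x else 0) -` E \<inter> W = {x\<in>W. \<Theta> x \<in> E}" by auto
  finally show ?thesis .
qed

lemma image_preimage: "\<Theta> ` {x\<in>W. \<Theta> x \<in> E} = E \<inter> \<Theta> ` W" by auto

lemma preimage_image: "inverse_chart ` (E \<inter> \<Theta> ` W) = {x\<in>W. \<Theta> x \<in> E}"
proof -
  have "inverse_chart ` (E \<inter> \<Theta> ` W) = (inverse_chart \<circ> \<Theta>) ` {x\<in>W. \<Theta> x \<in> E}"
    unfolding image_preimage[symmetric] by (simp add: image_comp)
  also have "\<dots> = {x\<in>W. \<Theta> x \<in> E}" using inverse_chart(1) by force
  finally show ?thesis .
qed

lemma emeasure_chart:
  assumes E: "E \<in> sets borel"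
  shows "emeasure lborel {x\<in>W. \<Theta> x \<in> E} \<le> ennreal (L ^ CARD('d)) * emeasure lborel (E \<inter> \<Theta> ` W)"
    and "emeasure lborel (E \<inter> \<Theta> ` W) \<le> ennreal (L ^ CARD('d)) * emeasure lborel {x\<in>W. \<Theta> x \<in> E}"
proof -
  have "emeasure lborel (inverse_chart ` (E \<inter> \<Theta> ` W)) \<le> ennreal (L ^ DIM(real^'d)) * emeasure lborel (E \<inter> \<Theta> ` W)"
  proof (rule emeasure_lipschitz_image_le[OF V])
    show "dist (inverse_chart x) (inverse_chart y) \<le> L * dist x y" if "x \<in> \<Theta> ` W" "y \<in> \<Theta> ` W" for x y
      using that low by (auto simp: inverse_chart)
  qed (use L E V borel_preimage[OF E] in \<open>auto simp: preimage_image\<close>)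
  then show "emeasure lborel {x\<in>W. \<Theta> x \<in> E} \<le> ennreal (L ^ CARD('d)) * emeasure lborel (E \<inter> \<Theta> ` W)"
    by (simp add: preimage_image)
  have "emeasure lborel (\<Theta> ` {x\<in>W. \<Theta> x \<in> E}) \<le> ennreal (L ^ DIM(real^'d)) * emeasure lborel {x\<in>W. \<Theta> x \<in> E}"
    by (rule emeasure_lipschitz_image_le[OF W up]) (use L E V borel_preimage[OF E] in \<open>auto simp: image_preimage\<close>)
  then show "emeasure lborel (E \<inter> \<Theta> ` W) \<le> ennreal (L ^ CARD('d)) * emeasure lborel {x\<in>W. \<Theta> x \<in> E}"
    by (simp add: image_preimage)
qed

lemma hausdorff_chart:
  assumes E: "E \<in> sets borel"
  shows "hausdorff_outer m {x\<in>W. \<Theta> x \<in> E} \<le> ennreal (L ^ m) * hausdorff_outer m (E \<inter> \<Theta> ` W)"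
    and "hausdorff_outer m (E \<inter> \<Theta> ` W) \<le> ennreal (L ^ m) * hausdorff_outer m {x\<in>W. \<Theta> x \<in> E}"
proof -
  have "hausdorff_outer m (inverse_chart ` (E \<inter> \<Theta> ` W)) \<le> ennreal (L ^ m) * hausdorff_outer m (E \<inter> \<Theta> ` W)"
  proof (rule hausdorff_outer_lipschitz_image)
    show "dist (inverse_chart x) (inverse_chart y) \<le> L * dist x y" if "x \<in> E \<inter> \<Theta> ` W" "y \<in> E \<inter> \<Theta> ` W" for x y
      using that low by (auto simp: inverse_chart)
  qed (use L in auto)
  then show "hausdorff_outer m {x\<in>W. \<Theta> x \<in> E} \<le> ennreal (L ^ m) * hausdorff_outer m (E \<inter> \<Theta> ` W)"
    by (simp add: preimage_image)
  have "hausdorff_outer m (\<Theta> ` {x\<in>W. \<Theta> x \<in> E}) \<le> ennreal (L ^ m) * hausdorff_outer m {x\<in>W. \<Theta> x \<in> E}"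
    by (rule hausdorff_outer_lipschitz_image) (use L up in auto)
  then show "hausdorff_outer m (E \<inter> \<Theta> ` W) \<le> ennreal (L ^ m) * hausdorff_outer m {x\<in>W. \<Theta> x \<in> E}"
    by (simp add: image_preimage)
qed

text \<open>A function on the chart domain and its transport agree up to powers of \<open>L\<close> under any two measures
  comparable on corresponding sets.\<close>

lemma nn_integral_chart:
  assumes \<mu>: "sets \<mu> = sets borel" "sets \<mu>' = sets borel"
    and le1: "\<And>E. E \<in> sets borel \<Longrightarrow> emeasure \<mu> {x\<in>W. \<Theta> x \<in> E} \<le> a * emeasure \<mu>' (E \<inter> \<Theta> ` W)"
    and le2: "\<And>E. E \<in> sets borel \<Longrightarrow> emeasure \<mu>' (E \<inter> \<Theta> ` W) \<le> a * emeasure \<mu> {x\<in>W. \<Theta> x \<in> E}"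
    and F: "F \<in> borel_measurable borel" and F0: "\<And>z. z \<notin> \<Theta> ` W \<Longrightarrow> F z = 0"
    and u: "\<And>x. x \<in> W \<Longrightarrow> u x = F (\<Theta> x)" "\<And>x. x \<notin> W \<Longrightarrow> u x = 0"
  shows "(\<integral>\<^sup>+x. u x \<partial>\<mu>) \<le> a * (\<integral>\<^sup>+z. F z \<partial>\<mu>')" "(\<integral>\<^sup>+z. F z \<partial>\<mu>') \<le> a * (\<integral>\<^sup>+x. u x \<partial>\<mu>)"
proof -
  have [measurable_cong]: "sets \<mu> = sets borel" "sets \<mu>' = sets borel" by fact+
  have [measurable]: "W \<in> sets borel" "\<Theta> ` W \<in> sets borel" "F \<in> borel_measurable borel" using W V F by auto
  let ?T = "\<lambda>x. if x \<in> W then \<Theta> x else 0"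
  have T [measurable]: "?T \<in> borel_measurable borel"
    using W cont by (intro borel_measurable_continuous_on_if) auto
  \<comment> \<open>\<open>N\<close> is the image under \<open>\<Theta>\<close> of
    \<open>\<mu>\<close> restricted to \<open>W\<close>. It lives on the same space as the
    restriction \<open>N'\<close> of \<open>\<mu>'\<close>, so the two can be compared set by
    set.\<close>
  define N where "N = distr (density \<mu> (indicator W)) borel ?T"
  define N' where "N' = density \<mu>' (indicator (\<Theta> ` W))"
  have sN: "sets N = sets borel" "sets N' = sets borel" by (simp_all add: N_def N'_def \<mu>)
  have T' [measurable]: "?T \<in> \<mu> \<rightarrow>\<^sub>M borel" using T by (simp cong: measurable_cong_sets)
  have F' [measurable]: "F \<in> borel_measurable \<mu>'" using F by (simp cong: measurable_cong_sets)
  have N: "emeasure N E = emeasure \<mu> {x\<in>W. \<Theta> x \<in> E}" if E: "E \<in> sets borel" for E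
  proof -
    have [measurable]: "{x\<in>W. \<Theta> x \<in> E} \<in> sets \<mu>" using borel_preimage[OF E] \<mu> by simp
    have "?T -` E \<inter> space (density \<mu> (indicator W)) \<in> sets \<mu>" using measurable_sets[OF T' E] by simp
    then have "emeasure N E = (\<integral>\<^sup>+x. indicator W x * indicator (?T -` E \<inter> space \<mu>) x \<partial>\<mu>)"
      unfolding N_def using E by (subst emeasure_distr) (auto simp: emeasure_density)
    also have "\<dots> = (\<integral>\<^sup>+x. indicator {x\<in>W. \<Theta> x \<in> E} x \<partial>\<mu>)"
      using sets_eq_imp_space_eq[OF \<mu>(1)] by (intro nn_integral_cong) (auto simp: indicator_def)
    finally show ?thesis by simp
  qed
  have N': "emeasure N' E = emeasure \<mu>' (E \<inter> \<Theta> ` W)" if E: "E \<in> sets borel" for E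
  proof -
    have [measurable]: "E \<in> sets \<mu>'" "\<Theta> ` W \<in> sets \<mu>'" using E V \<mu> by auto
    have "emeasure N' E = (\<integral>\<^sup>+x. indicator (\<Theta> ` W) x * indicator E x \<partial>\<mu>')"
      unfolding N'_def by (rule emeasure_density) auto
    also have "\<dots> = (\<integral>\<^sup>+x. indicator (E \<inter> \<Theta> ` W) x \<partial>\<mu>')"
      by (intro nn_integral_cong) (auto simp: indicator_def)
    also have "\<dots> = emeasure \<mu>' (E \<inter> \<Theta> ` W)" by (rule nn_integral_indicator) auto
    finally show ?thesis .
  qed
  have intN: "(\<integral>\<^sup>+z. F z \<partial>N) = (\<integral>\<^sup>+x. u x \<partial>\<mu>)"
  proof -
    have "(\<integral>\<^sup>+z. F z \<partial>N) = (\<integral>\<^sup>+x. indicator W x * F (?T x) \<partial>\<mu>)"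
      unfolding N_def by (subst nn_integral_distr) (auto simp: nn_integral_density)
    also have "\<dots> = (\<integral>\<^sup>+x. u x \<partial>\<mu>)" using u by (intro nn_integral_cong) (auto simp: indicator_def)
    finally show ?thesis .
  qed
  have intN': "(\<integral>\<^sup>+z. F z \<partial>N') = (\<integral>\<^sup>+z. F z \<partial>\<mu>')"
  proof -
    have [measurable]: "\<Theta> ` W \<in> sets \<mu>'" using V \<mu> by auto
    have "(\<integral>\<^sup>+z. F z \<partial>N') = (\<integral>\<^sup>+x. indicator (\<Theta> ` W) x * F x \<partial>\<mu>')"
      unfolding N'_def by (subst nn_integral_density) auto
    also have "\<dots> = (\<integral>\<^sup>+z. F z \<partial>\<mu>')" using F0 by (intro nn_integral_cong) (auto simp: indicator_def)
    finally show ?thesis .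
  qed
  show "(\<integral>\<^sup>+x. u x \<partial>\<mu>) \<le> a * (\<integral>\<^sup>+z. F z \<partial>\<mu>')"
    unfolding intN[symmetric] intN'[symmetric]
    by (rule nn_integral_le_of_emeasure_le) (use sN le1 F N N' in \<open>auto cong: measurable_cong_sets\<close>)
  show "(\<integral>\<^sup>+z. F z \<partial>\<mu>') \<le> a * (\<integral>\<^sup>+x. u x \<partial>\<mu>)"
    unfolding intN[symmetric] intN'[symmetric]
    by (rule nn_integral_le_of_emeasure_le) (use sN le2 F N N' in \<open>auto cong: measurable_cong_sets\<close>)
qed

text \<open>The transported function vanishes on the open complement of the compact image of
  \<open>K\<close>, and this complement and the open image of \<open>W\<close> cover the space.
  Continuity on both open sets suffices.\<close>

lemma transport_continuous:
  fixes u :: "real^'d \<Rightarrow> real"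
  assumes u: "continuous_on UNIV u" and K: "compact K" "K \<subseteq> W" "\<And>x. x \<notin> K \<Longrightarrow> u x = 0"
  shows "continuous_on UNIV (\<lambda>z. if z \<in> \<Theta> ` W then u (inverse_chart z) else 0)"
proof -
  have cK: "compact (\<Theta> ` K)" using K cont by (intro compact_continuous_image continuous_on_subset[OF cont])
  have "continuous_on (\<Theta> ` W \<union> - (\<Theta> ` K)) (\<lambda>z. if z \<in> \<Theta> ` W then u (inverse_chart z) else 0)"
  proof (rule continuous_on_open_Un)
    show "continuous_on (\<Theta> ` W) (\<lambda>z. if z \<in> \<Theta> ` W then u (inverse_chart z) else 0)"
      by (rule continuous_on_eq[OF continuous_on_compose2[OF u cont_inverse]]) auto
    show "continuous_on (- (\<Theta> ` K)) (\<lambda>z. if z \<in> \<Theta> ` W then u (inverse_chart z) else 0)"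
    proof (rule continuous_on_eq[OF continuous_on_const[of _ 0]])
      fix z assume z: "z \<in> - \<Theta> ` K"
      show "0 = (if z \<in> \<Theta> ` W then u (inverse_chart z) else 0)"
      proof (cases "z \<in> \<Theta> ` W")
        case True
        then have "inverse_chart z \<notin> K" using z inverse_chart(2)[OF True] by (metis Compl_iff imageI)
        then show ?thesis using K(3) by simp
      qed simp
    qed
  qed (use V cK in \<open>auto simp: compact_imp_closed\<close>)
  moreover have "\<Theta> ` W \<union> - (\<Theta> ` K) = UNIV" using K(2) by auto
  ultimately show ?thesis by simp
qed

end

subsection \<open>A coarea formula near a level set\<close>

text \<open>The weight 1 / norm (G x) makes this the density at level \<open>c\<close> of the image
  under \<open>f\<close> of the measure with Lebesgue density \<open>u\<close>.\<close>

definition coarea_integral :: "(real^'d::finite \<Rightarrow> real) \<Rightarrow> (real^'d \<Rightarrow> real^'d) \<Rightarrow> real \<Rightarrow> (real^'d \<Rightarrow> real) \<Rightarrow> ennreal" where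
  "coarea_integral f G c u =
     (\<integral>\<^sup>+x. ennreal (u x / norm (G x)) * indicator {x. f x = c} x \<partial>hausdorff_measure (CARD('d) - 1))"

lemma emeasure_plane_measure_Int:
  assumes [measurable]: "E \<in> sets borel"
  shows "emeasure (plane_measure i) (E \<inter> {z. z $ i = 0}) = emeasure (plane_measure i) E"
proof -
  have [measurable]: "{z::real^'a. z $ i = 0} \<in> sets borel" by measurable
  show ?thesis unfolding plane_measure_def
    by (subst (1 2) emeasure_distr) (auto intro!: arg_cong[where f = "emeasure _"])
qed

text \<open>In a flattening chart f - c becomes l * z $ i, and Tonelli separates the integral over z
  $ i from the one over the plane. The chart distorts volume by at most L ^ D and surface measure by
  L ^ (D - 1), and the gradient varies by a factor \<open>L\<close>: together L ^ (2 * D). The error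
  \<open>\<epsilon>\<close> comes from replacing the weight by its value on the plane. It is
  proportional to the integral of \<open>k\<close>, so \<open>\<delta>\<close> does not depend on
  \<open>k\<close>.\<close>

lemma coarea_local:
  fixes f :: "real^'d::finite \<Rightarrow> real" and G :: "real^'d \<Rightarrow> real^'d"
  assumes deriv: "\<And>x. (f has_derivative (\<lambda>v. G x \<bullet> v)) (at x)" and contG: "continuous_on UNIV G"
    and G0: "G y \<noteq> 0" and L: "1 < L"
  shows "\<exists>r>0. \<forall>u K. continuous_on UNIV u \<longrightarrow> (\<forall>x. 0 \<le> u x) \<longrightarrow> compact K \<longrightarrow> K \<subseteq> ball y r \<longrightarrow> (\<forall>x. x \<notin> K \<longrightarrow> u x = 0) \<longrightarrow>
     coarea_integral f G c u < top \<and>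
     (\<forall>\<epsilon>>0. \<exists>\<delta>>0. \<forall>k\<in>borel_measurable borel. (\<forall>v. \<delta> < \<bar>v\<bar> \<longrightarrow> k v = 0) \<longrightarrow>
        (\<integral>\<^sup>+x. ennreal (u x) * k (f x - c) \<partial>lborel) \<le>
            (ennreal (L ^ (2 * CARD('d))) * coarea_integral f G c u + ennreal \<epsilon>) * (\<integral>\<^sup>+v. k v \<partial>lborel) \<and>
        coarea_integral f G c u * (\<integral>\<^sup>+v. k v \<partial>lborel) \<le>
            ennreal (L ^ (2 * CARD('d))) * (\<integral>\<^sup>+x. ennreal (u x) * k (f x - c) \<partial>lborel) + ennreal \<epsilon> * (\<integral>\<^sup>+v. k v \<partial>lborel))"
proof -
  let ?D = "CARD('d)" and ?m = "CARD('d) - 1"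
  have Dm: "?D = Suc ?m" by simp
  have LD: "L ^ ?D = L * L ^ ?m" by (metis Dm power_Suc)
  define i :: 'd where "i = undefined"
  obtain r \<Theta> where r: "0 < r"
    and up: "\<And>x x'. x \<in> ball y r \<Longrightarrow> x' \<in> ball y r \<Longrightarrow> dist (\<Theta> x) (\<Theta> x') \<le> L * dist x x'"
    and low: "\<And>x x'. x \<in> ball y r \<Longrightarrow> x' \<in> ball y r \<Longrightarrow> dist x x' \<le> L * dist (\<Theta> x) (\<Theta> x')"
    and V: "open (\<Theta> ` ball y r)" and \<Theta>: "\<And>x. \<Theta> x $ i = (f x - c) / norm (G y)"
    and Gl: "\<And>x. x \<in> ball y r \<Longrightarrow> norm (G x) \<le> L * norm (G y) \<and> norm (G y) \<le> L * norm (G x)"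
    by (rule level_set_flattening[OF deriv contG G0 L, of i c]; (assumption | rule that; assumption))
  define W where "W = ball y r"
  interpret bilipschitz_chart W \<Theta> L
    unfolding W_def by standard (use L up low V in auto)
  define l where "l = norm (G y)"
  have l: "0 < l" using G0 by (simp add: l_def)
  have f_meas [measurable]: "f \<in> borel_measurable borel"
    by (rule borel_measurable_continuous_onI, rule has_derivative_continuous_on) (rule has_derivative_at_withinI[OF deriv])
  have G_meas [measurable]: "G \<in> borel_measurable borel" using contG by (rule borel_measurable_continuous_onI)
  have M [measurable]: "{x. f x = c} \<in> sets borel" by measurable
  have f_Th: "f x - c = l * \<Theta> x $ i" for x using l by (simp add: \<Theta> l_def)
  have fz: "f x = c \<longleftrightarrow> \<Theta> x $ i = 0" for x using f_Th[of x] l by auto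
  show ?thesis
  proof (rule exI[of _ r], intro conjI r allI impI)
    fix u :: "real^'d \<Rightarrow> real" and K
    assume u: "continuous_on UNIV u" and u0: "\<forall>x. 0 \<le> u x" and K: "compact K" "K \<subseteq> ball y r" "\<forall>x. x \<notin> K \<longrightarrow> u x = 0"
    have [measurable]: "u \<in> borel_measurable borel" using u by (rule borel_measurable_continuous_onI)
    define w where "w z = (if z \<in> \<Theta> ` W then u (inverse_chart z) else 0)" for z
    have w_cont: "continuous_on UNIV w" unfolding w_def
      by (rule transport_continuous[OF u K(1)]) (use K in \<open>auto simp: W_def\<close>)
    have w_meas [measurable]: "w \<in> borel_measurable borel" using w_cont by (rule borel_measurable_continuous_onI)
    have w0: "0 \<le> w z" for z using u0 by (simp add: w_def)
    have wu: "u x = w (\<Theta> x)" if "x \<in> W" for x using that by (simp add: w_def inverse_chart)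
    have uW: "u x = 0" if "x \<notin> W" for x using that K by (auto simp: W_def)
    let ?\<Lambda> = "coarea_integral f G c u"
    \<comment> \<open>\<open>S\<close> and \<open>T\<close> integrate the weight over the plane and
      over the level set, still without the factor 1 / norm (G x).\<close>
    define S where "S = (\<integral>\<^sup>+z. ennreal (w z) \<partial>plane_measure i)"
    define T where "T = (\<integral>\<^sup>+x. ennreal (u x) \<partial>density (hausdorff_measure ?m) (indicator {x. f x = c}))"
    \<comment> \<open>In the chart the level set is the hyperplane z $ i = 0, where Hausdorff
      measure and plane measure agree.\<close>
    have hd: "emeasure (density (hausdorff_measure ?m) (indicator {x. f x = c})) {x\<in>W. \<Theta> x \<in> E} =
        hausdorff_outer ?m {x\<in>W. \<Theta> x \<in> E \<inter> {z. z $ i = 0}}" if E: "E \<in> sets borel" for E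
    proof -
      have [measurable]: "{x\<in>W. \<Theta> x \<in> E} \<in> sets borel" by (rule borel_preimage[OF E])
      have Ei: "E \<inter> {z. z $ i = 0} \<in> sets borel" using E by measurable
      have [measurable]: "{x\<in>W. \<Theta> x \<in> E \<inter> {z. z $ i = 0}} \<in> sets borel" by (rule borel_preimage[OF Ei])
      have "emeasure (density (hausdorff_measure ?m) (indicator {x. f x = c})) {x\<in>W. \<Theta> x \<in> E} =
        (\<integral>\<^sup>+x. indicator {x. f x = c} x * indicator {x\<in>W. \<Theta> x \<in> E} x \<partial>hausdorff_measure ?m)"
        by (rule emeasure_density) (auto simp: borel_preimage[OF E] cong: measurable_cong_sets)
      also have "\<dots> = (\<integral>\<^sup>+x. indicator {x\<in>W. \<Theta> x \<in> E \<inter> {z. z $ i = 0}} x \<partial>hausdorff_measure ?m)"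
        by (intro nn_integral_cong) (auto simp: fz indicator_def)
      also have "\<dots> = emeasure (hausdorff_measure ?m) {x\<in>W. \<Theta> x \<in> E \<inter> {z. z $ i = 0}}"
        by (rule nn_integral_indicator) (simp only: sets_hausdorff_measure borel_preimage[OF Ei])
      finally show ?thesis by (simp only: emeasure_hausdorff_measure[OF borel_preimage[OF Ei]])
    qed
    have pl: "emeasure (plane_measure i) (E \<inter> \<Theta> ` W) = hausdorff_outer ?m ((E \<inter> {z. z $ i = 0}) \<inter> \<Theta> ` W)"
      if E: "E \<in> sets borel" for E
    proof -
      have EV: "E \<inter> \<Theta> ` W \<in> sets borel" using E V by auto
      have eq: "(E \<inter> {z. z $ i = 0}) \<inter> \<Theta> ` W = (E \<inter> \<Theta> ` W) \<inter> {z. z $ i = 0}" by auto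
      have "hausdorff_outer ?m ((E \<inter> \<Theta> ` W) \<inter> {z. z $ i = 0}) = emeasure (plane_measure i) ((E \<inter> \<Theta> ` W) \<inter> {z. z $ i = 0})"
        using EV by (intro hausdorff_outer_plane) auto
      then show ?thesis unfolding eq by (simp add: emeasure_plane_measure_Int EV)
    qed
    have ST: "T \<le> ennreal (L ^ ?m) * S" "S \<le> ennreal (L ^ ?m) * T"
    proof -
      have s: "sets (density (hausdorff_measure ?m) (indicator {x. f x = c})) = sets (borel :: (real^'d) measure)" by simp
      have le1: "emeasure (density (hausdorff_measure ?m) (indicator {x. f x = c})) {x\<in>W. \<Theta> x \<in> E} \<le>
          ennreal (L ^ ?m) * emeasure (plane_measure i) (E \<inter> \<Theta> ` W)"
        and le2: "emeasure (plane_measure i) (E \<inter> \<Theta> ` W) \<le> ennreal (L ^ ?m) *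
          emeasure (density (hausdorff_measure ?m) (indicator {x. f x = c})) {x\<in>W. \<Theta> x \<in> E}" if E: "E \<in> sets borel" for E
      proof -
        have Ei: "E \<inter> {z. z $ i = 0} \<in> sets borel" using E by measurable
        show "emeasure (density (hausdorff_measure ?m) (indicator {x. f x = c})) {x\<in>W. \<Theta> x \<in> E} \<le>
          ennreal (L ^ ?m) * emeasure (plane_measure i) (E \<inter> \<Theta> ` W)"
          unfolding hd[OF E] pl[OF E] by (rule hausdorff_chart(1)[OF Ei])
        show "emeasure (plane_measure i) (E \<inter> \<Theta> ` W) \<le> ennreal (L ^ ?m) *
          emeasure (density (hausdorff_measure ?m) (indicator {x. f x = c})) {x\<in>W. \<Theta> x \<in> E}"
          unfolding hd[OF E] pl[OF E] by (rule hausdorff_chart(2)[OF Ei])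
      qed
      have F: "(\<lambda>z. ennreal (w z)) \<in> borel_measurable borel" by measurable
      have F0: "ennreal (w z) = 0" if "z \<notin> \<Theta> ` W" for z using that by (simp add: w_def)
      have u1: "ennreal (u x) = ennreal (w (\<Theta> x))" if "x \<in> W" for x using wu[OF that] by simp
      have u2: "ennreal (u x) = 0" if "x \<notin> W" for x using uW[OF that] by simp
      show "T \<le> ennreal (L ^ ?m) * S" unfolding T_def S_def
        by (rule nn_integral_chart(1)[OF s sets_plane_measure le1 le2 F F0 u1 u2])
      show "S \<le> ennreal (L ^ ?m) * T" unfolding T_def S_def
        by (rule nn_integral_chart(2)[OF s sets_plane_measure le1 le2 F F0 u1 u2])
    qed
    have T_eq: "T = (\<integral>\<^sup>+x. ennreal (u x) * indicator {x. f x = c} x \<partial>hausdorff_measure ?m)"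
      unfolding T_def by (subst nn_integral_density) (auto simp: mult.commute cong: measurable_cong_sets)
    have \<Lambda>T: "?\<Lambda> \<le> ennreal (L / l) * T" "T \<le> ennreal (L * l) * ?\<Lambda>"
    proof -
      have pt: "u x / norm (G x) \<le> L / l * u x \<and> u x \<le> L * l * (u x / norm (G x))" for x
      proof (cases "x \<in> W")
        case True
        then have g: "norm (G x) \<le> L * l" "l \<le> L * norm (G x)" using Gl[of x] by (auto simp: W_def l_def)
        then have g0: "0 < norm (G x)" using l L by (smt (verit) mult_nonneg_nonpos)
        have "1 / norm (G x) \<le> L / l" using g g0 l by (simp add: field_simps)
        from mult_left_mono[OF this, of "u x"] have 1: "u x / norm (G x) \<le> L / l * u x" using u0 by (simp add: mult.commute)
        have "1 \<le> L * l / norm (G x)" using g g0 by simp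
        from mult_left_mono[OF this, of "u x"] have "u x \<le> L * l * (u x / norm (G x))" using u0 by (simp add: mult_ac)
        with 1 show ?thesis by simp
      qed (simp add: uW)
      have "?\<Lambda> \<le> (\<integral>\<^sup>+x. ennreal (L / l) * (ennreal (u x) * indicator {x. f x = c} x) \<partial>hausdorff_measure ?m)"
        unfolding coarea_integral_def mult.assoc[symmetric] using pt L l u0
        by (intro nn_integral_mono mult_right_mono) (auto simp: ennreal_mult'[symmetric] intro!: ennreal_leI)
      also have "\<dots> = ennreal (L / l) * T" unfolding T_eq by (rule nn_integral_cmult) (auto cong: measurable_cong_sets)
      finally show "?\<Lambda> \<le> ennreal (L / l) * T" .
      have "T \<le> (\<integral>\<^sup>+x. ennreal (L * l) * (ennreal (u x / norm (G x)) * indicator {x. f x = c} x) \<partial>hausdorff_measure ?m)"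
        unfolding T_eq mult.assoc[symmetric] using pt L l u0
        by (intro nn_integral_mono mult_right_mono) (auto simp: ennreal_mult'[symmetric] intro!: ennreal_leI)
      also have "\<dots> = ennreal (L * l) * ?\<Lambda>" unfolding coarea_integral_def by (rule nn_integral_cmult) (auto cong: measurable_cong_sets)
      finally show "T \<le> ennreal (L * l) * ?\<Lambda>" .
    qed
    have \<Lambda>S: "?\<Lambda> \<le> ennreal (L ^ ?D / l) * S" "S \<le> ennreal (L ^ ?D * l) * ?\<Lambda>"
    proof -
      have "?\<Lambda> \<le> ennreal (L / l) * (ennreal (L ^ ?m) * S)"
        using \<Lambda>T(1) ST(1) by (meson mult_left_mono order_trans zero_le)
      then show "?\<Lambda> \<le> ennreal (L ^ ?D / l) * S"
        using L l unfolding LD by (simp add: mult.assoc[symmetric] ennreal_mult'[symmetric])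
      have "S \<le> ennreal (L ^ ?m) * (ennreal (L * l) * ?\<Lambda>)"
        using \<Lambda>T(2) ST(2) by (meson mult_left_mono order_trans zero_le)
      then show "S \<le> ennreal (L ^ ?D * l) * ?\<Lambda>"
        using L l unfolding LD by (simp add: mult.assoc[symmetric] ennreal_mult'[symmetric] mult.commute)
    qed
    obtain R where R: "\<Theta> ` K \<subseteq> cball 0 R" "0 < R"
    proof -
      have "compact (\<Theta> ` K)" using K cont by (intro compact_continuous_image continuous_on_subset[OF cont]) (auto simp: W_def)
      then have "bounded (\<Theta> ` K)" by (rule compact_imp_bounded)
      then obtain a where a: "0 < a" "\<And>x. x \<in> \<Theta> ` K \<Longrightarrow> norm x \<le> a" unfolding bounded_pos by blast
      have "\<Theta> ` K \<subseteq> cball 0 a" using a(2) by (auto simp: dist_norm)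
      then show ?thesis using that a(1) by blast
    qed
    have wR: "w z = 0" if "z \<notin> cball 0 R" for z
    proof (cases "z \<in> \<Theta> ` W")
      case True
      then have "inverse_chart z \<notin> K" using R(1) that inverse_chart(2)[OF True] by (metis imageI subsetD)
      then show ?thesis using K(3) by (simp add: w_def)
    qed (simp add: w_def)
    \<comment> \<open>If |z $ i| < 1 and the weight is nonzero at \<open>z\<close> or at its
      projection, then the projection lies in this ball. Its finite plane measure \<open>P\<close>
      therefore bounds the projection error.\<close>
    define b :: "real^'d \<Rightarrow> ennreal" where "b = indicator (cball 0 (R + 1))"
    have [measurable]: "b \<in> borel_measurable borel" unfolding b_def by (rule borel_measurable_indicator) simp
    define P where "P = enn2real (emeasure (plane_measure i) (cball 0 (R + 1)))"
    have P: "(\<integral>\<^sup>+z. b z \<partial>plane_measure i) = ennreal P" "0 \<le> P"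
    proof -
      have "emeasure (plane_measure i) (cball (0::real^'d) (R + 1)) < top"
        by (rule le_less_trans[OF plane_measure_le_diameter]) auto
      then show "(\<integral>\<^sup>+z. b z \<partial>plane_measure i) = ennreal P" by (simp add: b_def P_def)
    qed (simp add: P_def)
    have "S < top"
    proof -
      have "bounded (w ` cball 0 R)"
        using w_cont by (intro compact_imp_bounded compact_continuous_image) (auto intro: continuous_on_subset)
      then obtain B where B: "0 < B" "\<And>z. z \<in> cball 0 R \<Longrightarrow> \<bar>w z\<bar> \<le> B" unfolding bounded_pos by auto
      have "ennreal (w z) \<le> ennreal B * b z" for z
      proof (cases "z \<in> cball 0 R")
        case True
        have "w z \<le> B" using B(2)[OF True] by simp
        then show ?thesis using True by (simp add: b_def ennreal_leI)
      qed (simp add: wR)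
      then have "S \<le> (\<integral>\<^sup>+z. ennreal B * b z \<partial>plane_measure i)" unfolding S_def by (intro nn_integral_mono)
      also have "\<dots> = ennreal B * ennreal P" by (subst nn_integral_cmult) (auto simp: P cong: measurable_cong_sets)
      also have "\<dots> < top" by (simp add: ennreal_mult_less_top)
      finally show ?thesis .
    qed
    then show "?\<Lambda> < top" using \<Lambda>S(1) by (simp add: ennreal_mult_less_top le_less_trans)
    fix \<epsilon> :: real assume eps: "0 < \<epsilon>"
    \<comment> \<open>Chosen so that the projection error, after the factors L ^ D and 1 / l, is at
      most \<open>\<epsilon>\<close>.\<close>
    define \<eta> where "\<eta> = \<epsilon> * l / (L ^ ?D * (P + 1))"
    have eta: "0 < \<eta>" "L ^ ?D * (\<eta> * P) / l \<le> \<epsilon>"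
    proof -
      show "0 < \<eta>" using eps l L P by (simp add: \<eta>_def)
      have "L ^ ?D * (\<eta> * P) / l = \<epsilon> * (P / (P + 1))" using l L by (simp add: \<eta>_def)
      also have "\<dots> \<le> \<epsilon> * 1" using eps P by (intro mult_left_mono) auto
      finally show "L ^ ?D * (\<eta> * P) / l \<le> \<epsilon>" by simp
    qed
    have "uniformly_continuous_on (cball 0 (R + 2)) w"
      using w_cont by (intro compact_uniformly_continuous) (auto intro: continuous_on_subset)
    then obtain d where d: "0 < d" "\<And>z z'. z \<in> cball 0 (R + 2) \<Longrightarrow> z' \<in> cball 0 (R + 2) \<Longrightarrow> dist z' z < d \<Longrightarrow> dist (w z') (w z) < \<eta>"
      using eta(1) unfolding uniformly_continuous_on_def by metis
    have close: "\<bar>w z - w (vinsert i (($) z) 0)\<bar> \<le> \<eta> * enn2real (b (vinsert i (($) z) 0))" if z: "\<bar>z $ i\<bar> < min d 1" for z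
    proof -
      let ?z = "vinsert i (($) z) 0"
      have "(\<Sum>k\<in>-{i}. (z $ k - ?z $ k)\<^sup>2) = 0" by (rule sum.neutral) auto
      then have "(dist z ?z)\<^sup>2 = \<bar>z $ i\<bar>\<^sup>2" by (subst dist_power2_split[of _ _ i]) simp
      then have dz: "dist z ?z = \<bar>z $ i\<bar>" by (rule power2_eq_imp_eq) auto
      show ?thesis
      proof (cases "?z \<in> cball 0 (R + 1)")
        case True
        moreover have "z \<in> cball 0 (R + 2)" "?z \<in> cball 0 (R + 2)"
          using True dz z norm_triangle_sub[of z ?z] by (auto simp: dist_norm)
        ultimately show ?thesis using d(2)[of ?z z] dz z by (simp add: b_def dist_real_def)
      next
        case False
        then have "z \<notin> cball 0 R" "?z \<notin> cball 0 R"
          using dz z norm_triangle_sub[of ?z z] by (auto simp: dist_norm norm_minus_commute)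
        then show ?thesis using wR eta by simp
      qed
    qed
    \<comment> \<open>If k (l * z $ i) is nonzero, then l * |z $ i| \<le> \<delta>, so |z $ i| is
      less than both \<open>d\<close> and 1; halving makes this strict.\<close>
    define \<delta> where "\<delta> = l * min d 1 / 2"
    show "\<exists>\<delta>>0. \<forall>k\<in>borel_measurable borel. (\<forall>v. \<delta> < \<bar>v\<bar> \<longrightarrow> k v = 0) \<longrightarrow>
        (\<integral>\<^sup>+x. ennreal (u x) * k (f x - c) \<partial>lborel) \<le>
            (ennreal (L ^ (2 * CARD('d))) * coarea_integral f G c u + ennreal \<epsilon>) * (\<integral>\<^sup>+v. k v \<partial>lborel) \<and>
        coarea_integral f G c u * (\<integral>\<^sup>+v. k v \<partial>lborel) \<le>
            ennreal (L ^ (2 * CARD('d))) * (\<integral>\<^sup>+x. ennreal (u x) * k (f x - c) \<partial>lborel) + ennreal \<epsilon> * (\<integral>\<^sup>+v. k v \<partial>lborel)"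
    proof (intro exI[of _ \<delta>] conjI ballI impI)
      show "0 < \<delta>" using l d by (simp add: \<delta>_def)
      fix k :: "real \<Rightarrow> ennreal" assume [measurable]: "k \<in> borel_measurable borel" and ksupp: "\<forall>v. \<delta> < \<bar>v\<bar> \<longrightarrow> k v = 0"
      define A where "A = (\<integral>\<^sup>+x. ennreal (u x) * k (f x - c) \<partial>lborel)"
      define I where "I = (\<integral>\<^sup>+z. ennreal (w z) * k (l * z $ i) \<partial>lborel)"
      define Ik where "Ik = (\<integral>\<^sup>+v. k v \<partial>lborel)"
      have \<kappa>: "(\<integral>\<^sup>+t. k (l * t) \<partial>lborel) = ennreal (1 / l) * Ik"
      proof -
        have "Ik = ennreal l * (\<integral>\<^sup>+t. k (l * t) \<partial>lborel)"
          unfolding Ik_def using nn_integral_real_affine[of k l 0] l by simp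
        then show ?thesis using l by (simp add: mult.assoc[symmetric] ennreal_mult'[symmetric])
      qed
      have wz [measurable]: "(\<lambda>z. ennreal (w z) * k (l * z $ i)) \<in> borel_measurable borel" by measurable
      have AI: "A \<le> ennreal (L ^ ?D) * I" "I \<le> ennreal (L ^ ?D) * A"
      proof -
        have F0: "ennreal (w z) * k (l * z $ i) = 0" if "z \<notin> \<Theta> ` W" for z using that by (simp add: w_def)
        have u1: "ennreal (u x) * k (f x - c) = ennreal (w (\<Theta> x)) * k (l * \<Theta> x $ i)" if "x \<in> W" for x
          using wu[OF that] f_Th[of x] by simp
        have u2: "ennreal (u x) * k (f x - c) = 0" if "x \<notin> W" for x using uW[OF that] by simp
        show "A \<le> ennreal (L ^ ?D) * I" unfolding A_def I_def
          by (rule nn_integral_chart(1)[OF sets_lborel sets_lborel emeasure_chart wz F0 u1 u2])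
        show "I \<le> ennreal (L ^ ?D) * A" unfolding A_def I_def
          by (rule nn_integral_chart(2)[OF sets_lborel sets_lborel emeasure_chart wz F0 u1 u2])
      qed
      have kz: "k (l * z $ i) = 0" if "\<not> \<bar>z $ i\<bar> < min d 1" for z :: "real^'d"
      proof -
        have "\<delta> < l * min d 1" using l d by (simp add: \<delta>_def)
        also have "\<dots> \<le> l * \<bar>z $ i\<bar>" using that l by (intro mult_left_mono) auto
        also have "\<dots> = \<bar>l * z $ i\<bar>" using l by (simp add: abs_mult)
        finally show ?thesis using ksupp by blast
      qed
      have b_real: "b z = ennreal (enn2real (b z))" for z by (simp add: b_def indicator_def)
      have up': "ennreal (w z) * k (l * z $ i) \<le> (ennreal (w (vinsert i (($) z) 0)) + ennreal \<eta> * b (vinsert i (($) z) 0)) * k (l * z $ i)"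
        and low': "ennreal (w (vinsert i (($) z) 0)) * k (l * z $ i) \<le> ennreal (w z) * k (l * z $ i) + ennreal \<eta> * b (vinsert i (($) z) 0) * k (l * z $ i)" for z
      proof -
        have "ennreal (w z) \<le> ennreal (w (vinsert i (($) z) 0)) + ennreal \<eta> * b (vinsert i (($) z) 0) \<and>
            ennreal (w (vinsert i (($) z) 0)) \<le> ennreal (w z) + ennreal \<eta> * b (vinsert i (($) z) 0) \<or> k (l * z $ i) = 0"
        proof (cases "\<bar>z $ i\<bar> < min d 1")
          case True
          show ?thesis using close[OF True] w0 eta
            by (subst (1 2) b_real) (auto simp: ennreal_mult'[symmetric] ennreal_plus[symmetric] simp del: ennreal_plus intro!: ennreal_leI)
        qed (use kz in auto)
        then show "ennreal (w z) * k (l * z $ i) \<le> (ennreal (w (vinsert i (($) z) 0)) + ennreal \<eta> * b (vinsert i (($) z) 0)) * k (l * z $ i)"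
          "ennreal (w (vinsert i (($) z) 0)) * k (l * z $ i) \<le> ennreal (w z) * k (l * z $ i) + ennreal \<eta> * b (vinsert i (($) z) 0) * k (l * z $ i)"
          by (elim disjE conjE; simp add: distrib_right[symmetric] mult_right_mono)+
      qed
      have "I \<le> (\<integral>\<^sup>+z. (ennreal (w (vinsert i (($) z) 0)) + ennreal \<eta> * b (vinsert i (($) z) 0)) * k (l * z $ i) \<partial>lborel)"
        unfolding I_def by (intro nn_integral_mono up')
      also have "\<dots> = (\<integral>\<^sup>+z. ennreal (w z) + ennreal \<eta> * b z \<partial>plane_measure i) * (\<integral>\<^sup>+t. k (l * t) \<partial>lborel)"
        by (rule nn_integral_plane_measure[of "\<lambda>z. ennreal (w z) + ennreal \<eta> * b z" "\<lambda>t. k (l * t)"]) auto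
      also have "(\<integral>\<^sup>+z. ennreal (w z) + ennreal \<eta> * b z \<partial>plane_measure i) = S + ennreal (\<eta> * P)"
        unfolding S_def using eta P by (subst nn_integral_add) (auto simp: nn_integral_cmult P ennreal_mult'[symmetric] cong: measurable_cong_sets)
      finally have I1: "I \<le> (S + ennreal (\<eta> * P)) * (ennreal (1 / l) * Ik)" by (simp add: \<kappa>)
      have "S * (ennreal (1 / l) * Ik) = (\<integral>\<^sup>+z. ennreal (w (vinsert i (($) z) 0)) * k (l * z $ i) \<partial>lborel)"
        unfolding S_def \<kappa>[symmetric] by (rule nn_integral_plane_measure[of "\<lambda>z. ennreal (w z)" "\<lambda>t. k (l * t)", symmetric]) auto
      also have "\<dots> \<le> (\<integral>\<^sup>+z. ennreal (w z) * k (l * z $ i) + ennreal \<eta> * b (vinsert i (($) z) 0) * k (l * z $ i) \<partial>lborel)"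
        by (intro nn_integral_mono low')
      also have "\<dots> = I + (\<integral>\<^sup>+z. ennreal \<eta> * b (vinsert i (($) z) 0) * k (l * z $ i) \<partial>lborel)"
        unfolding I_def by (rule nn_integral_add) auto
      also have "(\<integral>\<^sup>+z. ennreal \<eta> * b (vinsert i (($) z) 0) * k (l * z $ i) \<partial>lborel) =
          (\<integral>\<^sup>+z. ennreal \<eta> * b z \<partial>plane_measure i) * (\<integral>\<^sup>+t. k (l * t) \<partial>lborel)"
        by (rule nn_integral_plane_measure[of "\<lambda>z. ennreal \<eta> * b z" "\<lambda>t. k (l * t)"]) auto
      also have "\<dots> = ennreal (\<eta> * P) * (ennreal (1 / l) * Ik)"
        using eta P by (simp add: \<kappa> nn_integral_cmult ennreal_mult'[symmetric] cong: measurable_cong_sets)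
      finally have I2: "S * (ennreal (1 / l) * Ik) \<le> I + ennreal (\<eta> * P) * (ennreal (1 / l) * Ik)" .
      have c1: "ennreal (L ^ ?D) * (ennreal (L ^ ?D * l) * ennreal (1 / l)) = ennreal (L ^ (2 * ?D))"
        using L l by (simp add: ennreal_mult'[symmetric] mult_2 power_add)
      have c2: "ennreal (L ^ ?D) * (ennreal (\<eta> * P) * ennreal (1 / l)) \<le> ennreal \<epsilon>"
        using eta L l P by (simp add: ennreal_mult'[symmetric] ennreal_leI)
      have "A \<le> ennreal (L ^ ?D) * ((S + ennreal (\<eta> * P)) * (ennreal (1 / l) * Ik))"
        using AI(1) I1 by (meson mult_left_mono order_trans zero_le)
      also have "\<dots> \<le> ennreal (L ^ ?D) * ((ennreal (L ^ ?D * l) * ?\<Lambda> + ennreal (\<eta> * P)) * (ennreal (1 / l) * Ik))"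
        using \<Lambda>S(2) by (intro mult_left_mono mult_right_mono add_right_mono) auto
      also have "\<dots> = ennreal (L ^ ?D) * (ennreal (L ^ ?D * l) * ennreal (1 / l)) * ?\<Lambda> * Ik + ennreal (L ^ ?D) * (ennreal (\<eta> * P) * ennreal (1 / l)) * Ik"
        by (simp add: distrib_left distrib_right mult_ac)
      also have "\<dots> \<le> ennreal (L ^ (2 * ?D)) * ?\<Lambda> * Ik + ennreal \<epsilon> * Ik"
        unfolding c1 using c2 by (intro add_left_mono mult_right_mono) auto
      finally show "(\<integral>\<^sup>+x. ennreal (u x) * k (f x - c) \<partial>lborel) \<le>
            (ennreal (L ^ (2 * ?D)) * ?\<Lambda> + ennreal \<epsilon>) * (\<integral>\<^sup>+v. k v \<partial>lborel)"
        unfolding A_def[symmetric] Ik_def[symmetric] by (simp add: distrib_right)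
      have "?\<Lambda> * Ik \<le> ennreal (L ^ ?D / l) * S * Ik" using \<Lambda>S(1) by (rule mult_right_mono) simp
      also have "\<dots> = ennreal (L ^ ?D) * (S * (ennreal (1 / l) * Ik))"
        using L l ennreal_mult'[of "L ^ ?D" "1 / l"] by (simp add: mult_ac)
      also have "\<dots> \<le> ennreal (L ^ ?D) * (ennreal (L ^ ?D) * A + ennreal (\<eta> * P) * (ennreal (1 / l) * Ik))"
        using I2 AI(2) by (intro mult_left_mono) (auto intro: order_trans add_right_mono)
      also have "\<dots> = ennreal (L ^ ?D) * ennreal (L ^ ?D) * A + ennreal (L ^ ?D) * (ennreal (\<eta> * P) * ennreal (1 / l)) * Ik"
        by (simp add: distrib_left mult_ac)
      also have "\<dots> \<le> ennreal (L ^ (2 * ?D)) * A + ennreal \<epsilon> * Ik"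
        using c2 L by (intro add_mono mult_right_mono) (auto simp: ennreal_mult'[symmetric] mult_2 power_add)
      finally show "?\<Lambda> * (\<integral>\<^sup>+v. k v \<partial>lborel) \<le>
            ennreal (L ^ (2 * ?D)) * (\<integral>\<^sup>+x. ennreal (u x) * k (f x - c) \<partial>lborel) + ennreal \<epsilon> * (\<integral>\<^sup>+v. k v \<partial>lborel)"
        unfolding A_def[symmetric] Ik_def[symmetric] .
    qed
  qed
qed

text \<open>Normalized bumps. The summand \<open>infdist x K\<close> in the denominator vanishes on
  \<open>K\<close>, where the sum has to be 1, and keeps the denominator positive elsewhere, so that
  the functions are continuous on the whole space.\<close>

lemma partition_of_unity_balls:
  fixes K :: "'a::metric_space set" and r :: "'a \<Rightarrow> real"
  assumes K: "compact K" and r: "\<And>y. y \<in> K \<Longrightarrow> 0 < r y"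
  obtains Y and p :: "'a \<Rightarrow> 'a \<Rightarrow> real" where "finite Y" "Y \<subseteq> K"
    "\<And>y. continuous_on UNIV (p y)" "\<And>y x. 0 \<le> p y x"
    "\<And>y x. p y x \<noteq> 0 \<Longrightarrow> dist y x < r y" "\<And>x. x \<in> K \<Longrightarrow> (\<Sum>y\<in>Y. p y x) = 1"
    "\<And>x. (\<Sum>y\<in>Y. p y x) \<le> 1"
proof (cases "K = {}")
  case True
  show ?thesis by (rule that[of "{}" "\<lambda>_ _. 0"]) (auto simp: True)
next
  case False
  have "K \<subseteq> (\<Union>y\<in>K. ball y (r y))" using r by force
  then obtain Y where Y: "Y \<subseteq> K" "finite Y" "K \<subseteq> (\<Union>y\<in>Y. ball y (r y))"
    using compactE_image[OF K, of K "\<lambda>y. ball y (r y)"] by auto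
  define b where "b y x = max 0 (r y - dist y x)" for y x :: 'a
  define s where "s x = (\<Sum>y\<in>Y. b y x) + infdist x K" for x
  have b0: "0 \<le> b y x" for y x by (simp add: b_def)
  have s_pos: "0 < s x" for x
  proof (cases "x \<in> K")
    case True
    then obtain y where y: "y \<in> Y" "x \<in> ball y (r y)" using Y by auto
    then have "0 < b y x" by (simp add: b_def)
    also have "\<dots> \<le> (\<Sum>y\<in>Y. b y x)" using y Y b0 by (intro member_le_sum) auto
    also have "\<dots> \<le> s x" by (simp add: s_def infdist_nonneg)
    finally show ?thesis .
  next
    case out: False
    have "closed K" using K by (rule compact_imp_closed)
    then have "0 < infdist x K" using out False in_closed_iff_infdist_zero[of K x] infdist_nonneg[of x K] by fastforce
    then show ?thesis using b0 by (simp add: s_def add_nonneg_pos sum_nonneg)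
  qed
  show ?thesis
  proof (rule that[of Y "\<lambda>y x. b y x / s x"])
    show "continuous_on UNIV (\<lambda>x. b y x / s x)" for y
      unfolding b_def s_def using s_pos[unfolded s_def b_def]
      by (intro continuous_intros) (metis less_irrefl)
    show "0 \<le> b y x / s x" for y x using b0 s_pos by (simp add: less_imp_le)
    show "dist y x < r y" if "b y x / s x \<noteq> 0" for y x using that by (auto simp: b_def max_def split: if_splits)
    show "(\<Sum>y\<in>Y. b y x / s x) = 1" if "x \<in> K" for x
      using that s_pos[of x] by (simp add: sum_divide_distrib[symmetric] s_def)
    show "(\<Sum>y\<in>Y. b y x / s x) \<le> 1" for x
      using s_pos[of x] infdist_nonneg[of x K] by (simp add: sum_divide_distrib[symmetric] s_def)
  qed (use Y in auto)
qed

text \<open>A partition of unity reduces the claim to small balls. There the constant is L ^ (2 * D)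
  with any L > 1, and \<open>L\<close> close to 1 turns it into an error proportional to the
  integral of \<open>k\<close>. One \<open>\<delta>\<close> serves all \<open>k\<close>, because
  \<open>k\<close> will depend on the sample size.\<close>

lemma coarea_limit:
  fixes f :: "real^'d::finite \<Rightarrow> real" and G :: "real^'d \<Rightarrow> real^'d"
  assumes deriv: "\<And>x. (f has_derivative (\<lambda>v. G x \<bullet> v)) (at x)" and contG: "continuous_on UNIV G"
    and K: "compact K" and G0: "\<And>x. x \<in> K \<Longrightarrow> f x = c \<Longrightarrow> G x \<noteq> 0"
    and u: "continuous_on UNIV u" "\<And>x. 0 \<le> u x" "\<And>x. x \<notin> K \<Longrightarrow> u x = 0"
  shows coarea_integral_finite: "coarea_integral f G c u < top"
    and "\<And>\<epsilon>. 0 < \<epsilon> \<Longrightarrow> \<exists>\<delta>>0. \<forall>k\<in>borel_measurable borel. (\<forall>v. \<delta> < \<bar>v\<bar> \<longrightarrow> k v = 0) \<longrightarrow>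
        (\<integral>\<^sup>+x. ennreal (u x) * k (f x - c) \<partial>lborel) \<le> (coarea_integral f G c u + ennreal \<epsilon>) * (\<integral>\<^sup>+v. k v \<partial>lborel) \<and>
        coarea_integral f G c u * (\<integral>\<^sup>+v. k v \<partial>lborel) \<le>
            (\<integral>\<^sup>+x. ennreal (u x) * k (f x - c) \<partial>lborel) + ennreal \<epsilon> * (\<integral>\<^sup>+v. k v \<partial>lborel)"
proof -
  let ?D = "CARD('d)"
  let ?\<Lambda> = "coarea_integral f G c"
  have f_cont: "continuous_on UNIV f"
    by (rule has_derivative_continuous_on) (rule has_derivative_at_withinI[OF deriv])
  have [measurable]: "f \<in> borel_measurable borel" "G \<in> borel_measurable borel"
    using f_cont contG by (auto intro: borel_measurable_continuous_onI)
  define Lc where "Lc L y r \<longleftrightarrow> (\<forall>u K. continuous_on UNIV u \<longrightarrow> (\<forall>x. 0 \<le> u x) \<longrightarrow> compact K \<longrightarrow> K \<subseteq> ball y r \<longrightarrow> (\<forall>x. x \<notin> K \<longrightarrow> u x = 0) \<longrightarrow>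
     ?\<Lambda> u < top \<and>
     (\<forall>\<epsilon>>0. \<exists>\<delta>>0. \<forall>k\<in>borel_measurable borel. (\<forall>v. \<delta> < \<bar>v\<bar> \<longrightarrow> k v = 0) \<longrightarrow>
        (\<integral>\<^sup>+x. ennreal (u x) * k (f x - c) \<partial>lborel) \<le>
            (ennreal (L ^ (2 * ?D)) * ?\<Lambda> u + ennreal \<epsilon>) * (\<integral>\<^sup>+v. k v \<partial>lborel) \<and>
        ?\<Lambda> u * (\<integral>\<^sup>+v. k v \<partial>lborel) \<le>
            ennreal (L ^ (2 * ?D)) * (\<integral>\<^sup>+x. ennreal (u x) * k (f x - c) \<partial>lborel) + ennreal \<epsilon> * (\<integral>\<^sup>+v. k v \<partial>lborel)))"
    for L y r
  have local: "\<exists>r>0. Lc L y r" if y: "y \<in> K" and L: "1 < L" for y L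
  proof (cases "f y = c")
    case True
    show ?thesis unfolding Lc_def by (rule coarea_local[OF deriv contG G0[OF y True] L])
  next
    case False
    \<comment> \<open>Near a point off the level set both sides vanish, as soon as \<open>k\<close>
      is supported in |v| \<le> |f y - c| / 2.\<close>
    obtain r where r: "0 < r" "\<And>x. dist x y < r \<Longrightarrow> dist (f x) (f y) < \<bar>f y - c\<bar> / 2"
      using f_cont False unfolding continuous_on_iff
      by (metis UNIV_I half_gt_zero zero_less_abs_iff right_minus_eq)
    have far: "\<bar>f y - c\<bar> / 2 < \<bar>f x - c\<bar>" if "x \<in> ball y r" for x
      
    proof -
      have "\<bar>f x - f y\<bar> < \<bar>f y - c\<bar> / 2" using r(2)[of x] that by (simp add: dist_real_def dist_commute)
      moreover have "\<bar>f y - c\<bar> \<le> \<bar>f x - c\<bar> + \<bar>f x - f y\<bar>" by linarith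
      moreover have "q < p / 2 \<Longrightarrow> p \<le> r + q \<Longrightarrow> p / 2 < r" for p q r :: real by linarith
      ultimately show ?thesis by blast
    qed
    have "Lc L y r" unfolding Lc_def
    proof (intro allI impI, goal_cases)
      case (1 u K)
      have u0: "u x = 0" if "\<not> \<bar>f y - c\<bar> / 2 < \<bar>f x - c\<bar>" for x
        using far[of x] 1 that by blast
      have "?\<Lambda> u = (\<integral>\<^sup>+x. 0 \<partial>(hausdorff_measure (?D - 1) :: (real^'d) measure))"
        unfolding coarea_integral_def using u0 by (intro nn_integral_cong) (auto simp: indicator_def)
      then have \<Lambda>0: "?\<Lambda> u = 0" by simp
      have A0: "(\<integral>\<^sup>+x. ennreal (u x) * k (f x - c) \<partial>lborel) = 0" if "\<forall>v. \<bar>f y - c\<bar> / 2 < \<bar>v\<bar> \<longrightarrow> k v = 0" for k :: "real \<Rightarrow> ennreal"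
      proof -
        have "(\<integral>\<^sup>+x. ennreal (u x) * k (f x - c) \<partial>lborel) = (\<integral>\<^sup>+x. 0 \<partial>(lborel :: (real^'d) measure))"
          using u0 that by (intro nn_integral_cong) (metis ennreal_0 mult_zero_left mult_zero_right)
        then show ?thesis by simp
      qed
      show ?case unfolding \<Lambda>0 using A0 False
        by (auto intro!: exI[of _ "\<bar>f y - c\<bar> / 2"])
    qed
    then show ?thesis using r by blast
  qed
  have glob: "?\<Lambda> u < top \<and> (\<forall>\<epsilon>>0. \<exists>\<delta>>0. \<forall>k\<in>borel_measurable borel. (\<forall>v. \<delta> < \<bar>v\<bar> \<longrightarrow> k v = 0) \<longrightarrow>
        (\<integral>\<^sup>+x. ennreal (u x) * k (f x - c) \<partial>lborel) \<le>
            (ennreal (L ^ (2 * ?D)) * ?\<Lambda> u + ennreal \<epsilon>) * (\<integral>\<^sup>+v. k v \<partial>lborel) \<and>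
        ?\<Lambda> u * (\<integral>\<^sup>+v. k v \<partial>lborel) \<le>
            ennreal (L ^ (2 * ?D)) * (\<integral>\<^sup>+x. ennreal (u x) * k (f x - c) \<partial>lborel) + ennreal \<epsilon> * (\<integral>\<^sup>+v. k v \<partial>lborel))"
    if L: "1 < L" for L
  proof -
    have "\<forall>y. \<exists>r. y \<in> K \<longrightarrow> 0 < r \<and> Lc L y r" using local[OF _ L] by blast
    then obtain r where r: "\<forall>y. y \<in> K \<longrightarrow> 0 < r y \<and> Lc L y (r y)" by (rule choice[THEN exE])
    \<comment> \<open>Half the radius puts the supports of the pieces into compact subsets of the
      balls where the local statement holds.\<close>
    have r2: "0 < r y / 2" if "y \<in> K" for y using r that by simp
    obtain Y and p :: "real^'d \<Rightarrow> real^'d \<Rightarrow> real" where Y: "finite Y" "Y \<subseteq> K"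
      and pc: "\<And>y. continuous_on UNIV (p y)" and p0: "\<And>y x. 0 \<le> p y x"
      and ps: "\<And>y x. p y x \<noteq> 0 \<Longrightarrow> dist y x < r y / 2" and p1: "\<And>x. x \<in> K \<Longrightarrow> (\<Sum>y\<in>Y. p y x) = 1"
      by (rule partition_of_unity_balls[OF K r2]; (assumption | rule that; assumption))
    define v where "v y x = p y x * u x" for y x
    have v: "continuous_on UNIV (v y)" "0 \<le> v y x" for y x
      unfolding v_def using u pc p0 by (auto intro!: continuous_intros)
    have [measurable]: "v y \<in> borel_measurable borel" for y using v(1) by (rule borel_measurable_continuous_onI)
    have uv: "u x = (\<Sum>y\<in>Y. v y x)" for x
      unfolding v_def sum_distrib_right[symmetric] using p1[of x] u(3)[of x] by (cases "x \<in> K") auto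
    have each: "?\<Lambda> (v y) < top \<and>
     (\<forall>\<epsilon>>0. \<exists>\<delta>>0. \<forall>k\<in>borel_measurable borel. (\<forall>v. \<delta> < \<bar>v\<bar> \<longrightarrow> k v = 0) \<longrightarrow>
        (\<integral>\<^sup>+x. ennreal (v y x) * k (f x - c) \<partial>lborel) \<le>
            (ennreal (L ^ (2 * ?D)) * ?\<Lambda> (v y) + ennreal \<epsilon>) * (\<integral>\<^sup>+v. k v \<partial>lborel) \<and>
        ?\<Lambda> (v y) * (\<integral>\<^sup>+v. k v \<partial>lborel) \<le>
            ennreal (L ^ (2 * ?D)) * (\<integral>\<^sup>+x. ennreal (v y x) * k (f x - c) \<partial>lborel) + ennreal \<epsilon> * (\<integral>\<^sup>+v. k v \<partial>lborel))" if "y \<in> Y" for y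
    proof -
      have "Lc L y (r y)" using r Y that by blast
      moreover have "compact (K \<inter> cball y (r y / 2))" using K by (intro compact_Int_closed) auto
      moreover have "K \<inter> cball y (r y / 2) \<subseteq> ball y (r y)" using r Y that by fastforce
      moreover have "v y x = 0" if "x \<notin> K \<inter> cball y (r y / 2)" for x
        using that u(3)[of x] ps[of y x] by (cases "p y x = 0") (auto simp: v_def)
      ultimately show ?thesis unfolding Lc_def using v by blast
    qed
    have \<Lambda>sum: "?\<Lambda> u = (\<Sum>y\<in>Y. ?\<Lambda> (v y))"
    proof -
      have "ennreal (u x / norm (G x)) * indicator {x. f x = c} x = (\<Sum>y\<in>Y. ennreal (v y x / norm (G x)) * indicator {x. f x = c} x)" for x
        using v(2) by (simp add: uv sum_divide_distrib sum_ennreal sum_distrib_right[symmetric])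
      then show ?thesis unfolding coarea_integral_def
        by (simp only:) (rule nn_integral_sum, auto cong: measurable_cong_sets)
    qed
    have Asum: "(\<integral>\<^sup>+x. ennreal (u x) * k (f x - c) \<partial>lborel) = (\<Sum>y\<in>Y. \<integral>\<^sup>+x. ennreal (v y x) * k (f x - c) \<partial>lborel)"
      if [measurable]: "k \<in> borel_measurable borel" for k
    proof -
      have "ennreal (u x) * k (f x - c) = (\<Sum>y\<in>Y. ennreal (v y x) * k (f x - c))" for x
        using v(2) by (simp add: uv sum_ennreal sum_distrib_right[symmetric])
      then show ?thesis by (simp only:) (rule nn_integral_sum, auto)
    qed
    show ?thesis
    proof (intro conjI allI impI)
      show "?\<Lambda> u < top" unfolding \<Lambda>sum using each Y(1) by simp
      fix \<epsilon> :: real assume eps: "0 < \<epsilon>"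
      define e where "e = \<epsilon> / (real (card Y) + 1)"
      have e: "0 < e" "real (card Y) * e \<le> \<epsilon>" using eps by (auto simp: e_def field_simps)
      have "\<forall>y. \<exists>\<delta>. y \<in> Y \<longrightarrow> \<delta> > 0 \<and> (\<forall>k\<in>borel_measurable borel. (\<forall>v. \<delta> < \<bar>v\<bar> \<longrightarrow> k v = 0) \<longrightarrow>
        (\<integral>\<^sup>+x. ennreal (v y x) * k (f x - c) \<partial>lborel) \<le>
            (ennreal (L ^ (2 * ?D)) * ?\<Lambda> (v y) + ennreal e) * (\<integral>\<^sup>+v. k v \<partial>lborel) \<and>
        ?\<Lambda> (v y) * (\<integral>\<^sup>+v. k v \<partial>lborel) \<le>
            ennreal (L ^ (2 * ?D)) * (\<integral>\<^sup>+x. ennreal (v y x) * k (f x - c) \<partial>lborel) + ennreal e * (\<integral>\<^sup>+v. k v \<partial>lborel))"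
        using each e(1) by blast
      from choice[OF this] obtain \<delta>' where \<delta>': "\<And>y. y \<in> Y \<Longrightarrow> \<delta>' y > 0"
        "\<And>y k. y \<in> Y \<Longrightarrow> k\<in>borel_measurable borel \<Longrightarrow> (\<forall>v. \<delta>' y < \<bar>v\<bar> \<longrightarrow> k v = 0) \<Longrightarrow>
        (\<integral>\<^sup>+x. ennreal (v y x) * k (f x - c) \<partial>lborel) \<le>
            (ennreal (L ^ (2 * ?D)) * ?\<Lambda> (v y) + ennreal e) * (\<integral>\<^sup>+v. k v \<partial>lborel) \<and>
        ?\<Lambda> (v y) * (\<integral>\<^sup>+v. k v \<partial>lborel) \<le>
            ennreal (L ^ (2 * ?D)) * (\<integral>\<^sup>+x. ennreal (v y x) * k (f x - c) \<partial>lborel) + ennreal e * (\<integral>\<^sup>+v. k v \<partial>lborel)"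
        by blast
      define \<delta> where "\<delta> = Min (insert 1 (\<delta>' ` Y))"
      have \<delta>: "0 < \<delta>" "\<And>y. y \<in> Y \<Longrightarrow> \<delta> \<le> \<delta>' y" unfolding \<delta>_def using Y(1) \<delta>'(1) by auto
      have cY: "of_nat (card Y) * ennreal e \<le> ennreal \<epsilon>"
        using e by (simp add: ennreal_of_nat_eq_real_of_nat ennreal_mult'[symmetric] ennreal_leI)
      show "\<exists>\<delta>>0. \<forall>k\<in>borel_measurable borel. (\<forall>v. \<delta> < \<bar>v\<bar> \<longrightarrow> k v = 0) \<longrightarrow>
        (\<integral>\<^sup>+x. ennreal (u x) * k (f x - c) \<partial>lborel) \<le>
            (ennreal (L ^ (2 * ?D)) * ?\<Lambda> u + ennreal \<epsilon>) * (\<integral>\<^sup>+v. k v \<partial>lborel) \<and>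
        ?\<Lambda> u * (\<integral>\<^sup>+v. k v \<partial>lborel) \<le>
            ennreal (L ^ (2 * ?D)) * (\<integral>\<^sup>+x. ennreal (u x) * k (f x - c) \<partial>lborel) + ennreal \<epsilon> * (\<integral>\<^sup>+v. k v \<partial>lborel)"
      proof (rule exI[of _ \<delta>], intro conjI ballI impI)
        show "0 < \<delta>" by (rule \<delta>)
        fix k :: "real \<Rightarrow> ennreal" assume k: "k \<in> borel_measurable borel" and ks: "\<forall>v. \<delta> < \<bar>v\<bar> \<longrightarrow> k v = 0"
        have ks': "\<forall>v. \<delta>' y < \<bar>v\<bar> \<longrightarrow> k v = 0" if "y \<in> Y" for y using ks \<delta>(2)[OF that] by (meson le_less_trans)
        note b = \<delta>'(2)[OF _ k ks']
        let ?I = "\<integral>\<^sup>+v. k v \<partial>lborel"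
        have "(\<integral>\<^sup>+x. ennreal (u x) * k (f x - c) \<partial>lborel) \<le> (\<Sum>y\<in>Y. (ennreal (L ^ (2 * ?D)) * ?\<Lambda> (v y) + ennreal e) * ?I)"
          unfolding Asum[OF k] using b by (intro sum_mono) blast
        also have "\<dots> = (ennreal (L ^ (2 * ?D)) * ?\<Lambda> u + of_nat (card Y) * ennreal e) * ?I"
          by (simp add: sum_distrib_right[symmetric] sum.distrib \<Lambda>sum sum_distrib_left)
        also have "\<dots> \<le> (ennreal (L ^ (2 * ?D)) * ?\<Lambda> u + ennreal \<epsilon>) * ?I"
          using cY by (intro mult_right_mono add_left_mono) auto
        finally show "(\<integral>\<^sup>+x. ennreal (u x) * k (f x - c) \<partial>lborel) \<le> (ennreal (L ^ (2 * ?D)) * ?\<Lambda> u + ennreal \<epsilon>) * ?I" .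
        have "?\<Lambda> u * ?I = (\<Sum>y\<in>Y. ?\<Lambda> (v y) * ?I)" by (simp add: \<Lambda>sum sum_distrib_right)
        also have "\<dots> \<le> (\<Sum>y\<in>Y. ennreal (L ^ (2 * ?D)) * (\<integral>\<^sup>+x. ennreal (v y x) * k (f x - c) \<partial>lborel) + ennreal e * ?I)"
          using b by (intro sum_mono) blast
        also have "\<dots> = ennreal (L ^ (2 * ?D)) * (\<integral>\<^sup>+x. ennreal (u x) * k (f x - c) \<partial>lborel) + of_nat (card Y) * ennreal e * ?I"
          by (simp add: Asum[OF k] sum.distrib sum_distrib_left mult.assoc)
        also have "\<dots> \<le> ennreal (L ^ (2 * ?D)) * (\<integral>\<^sup>+x. ennreal (u x) * k (f x - c) \<partial>lborel) + ennreal \<epsilon> * ?I"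
          using cY by (intro add_left_mono mult_right_mono) auto
        finally show "?\<Lambda> u * ?I \<le> ennreal (L ^ (2 * ?D)) * (\<integral>\<^sup>+x. ennreal (u x) * k (f x - c) \<partial>lborel) + ennreal \<epsilon> * ?I" .
      qed
    qed
  qed
  show fin: "?\<Lambda> u < top" using glob[of 2] by simp
  define lam where "lam = enn2real (?\<Lambda> u)"
  have lam: "?\<Lambda> u = ennreal lam" "0 \<le> lam" using fin by (simp_all add: lam_def)
  fix \<epsilon> :: real assume eps: "0 < \<epsilon>"
  \<comment> \<open>\<open>t\<close> is the relative error L ^ (2 * D) - 1, chosen small against the
    finite value \<open>lam\<close> of the surface integral.\<close>
  define t where "t = min 1 (\<epsilon> / 4 / (lam + 1))"
  have t: "0 < t" "t \<le> 1" "t * lam \<le> \<epsilon> / 4"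
  proof -
    show "0 < t" "t \<le> 1" using eps lam by (auto simp: t_def)
    have "t * lam \<le> \<epsilon> / 4 / (lam + 1) * (lam + 1)" using lam \<open>0 < t\<close> by (intro mult_mono) (auto simp: t_def)
    also have "\<dots> = \<epsilon> / 4" using lam(2) by (subst times_divide_eq_left, subst nonzero_mult_div_cancel_right) auto
    finally show "t * lam \<le> \<epsilon> / 4" .
  qed
  define L where "L = root (2 * ?D) (1 + t)"
  have L: "1 < L" "L ^ (2 * ?D) = 1 + t" using t by (auto simp: L_def)
  define e where "e = \<epsilon> / 4"
  have e: "0 < e" using eps by (simp add: e_def)
  obtain \<delta> where \<delta>: "0 < \<delta>" "\<And>k. k\<in>borel_measurable borel \<Longrightarrow> (\<forall>v. \<delta> < \<bar>v\<bar> \<longrightarrow> k v = 0) \<Longrightarrow>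
        (\<integral>\<^sup>+x. ennreal (u x) * k (f x - c) \<partial>lborel) \<le> (ennreal (1 + t) * ennreal lam + ennreal e) * (\<integral>\<^sup>+v. k v \<partial>lborel) \<and>
        ennreal lam * (\<integral>\<^sup>+v. k v \<partial>lborel) \<le>
            ennreal (1 + t) * (\<integral>\<^sup>+x. ennreal (u x) * k (f x - c) \<partial>lborel) + ennreal e * (\<integral>\<^sup>+v. k v \<partial>lborel)"
    using glob[OF L(1)] e unfolding L(2) lam(1) by blast
  show "\<exists>\<delta>>0. \<forall>k\<in>borel_measurable borel. (\<forall>v. \<delta> < \<bar>v\<bar> \<longrightarrow> k v = 0) \<longrightarrow>
        (\<integral>\<^sup>+x. ennreal (u x) * k (f x - c) \<partial>lborel) \<le> (?\<Lambda> u + ennreal \<epsilon>) * (\<integral>\<^sup>+v. k v \<partial>lborel) \<and>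
        ?\<Lambda> u * (\<integral>\<^sup>+v. k v \<partial>lborel) \<le>
            (\<integral>\<^sup>+x. ennreal (u x) * k (f x - c) \<partial>lborel) + ennreal \<epsilon> * (\<integral>\<^sup>+v. k v \<partial>lborel)"
  proof (rule exI[of _ \<delta>], intro conjI ballI impI)
    fix k :: "real \<Rightarrow> ennreal" assume k: "k \<in> borel_measurable borel" and ks: "\<forall>v. \<delta> < \<bar>v\<bar> \<longrightarrow> k v = 0"
    let ?I = "\<integral>\<^sup>+v. k v \<partial>lborel" and ?A = "\<integral>\<^sup>+x. ennreal (u x) * k (f x - c) \<partial>lborel"
    note b = \<delta>(2)[OF k ks]
    have "(1 + t) * lam + e \<le> lam + \<epsilon>" using t(3) eps by (simp add: algebra_simps e_def)
    then have c1: "ennreal (1 + t) * ennreal lam + ennreal e \<le> ?\<Lambda> u + ennreal \<epsilon>"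
      using t lam e eps by (simp add: ennreal_mult'[symmetric] ennreal_plus[symmetric] ennreal_leI del: ennreal_plus)
    then show "?A \<le> (?\<Lambda> u + ennreal \<epsilon>) * ?I"
      using b by (meson mult_right_mono order_trans zero_le)
    \<comment> \<open>The excess \<open>ennreal t * ?A\<close> is estimated by the first inequality
      and so becomes a multiple of \<open>?I\<close>.\<close>
    have "?\<Lambda> u * ?I \<le> ?A + ennreal t * ?A + ennreal e * ?I"
      using b t lam(1) by (simp add: distrib_right)
    also have "\<dots> \<le> ?A + ennreal t * ((ennreal (1 + t) * ennreal lam + ennreal e) * ?I) + ennreal e * ?I"
      using b by (intro add_right_mono add_left_mono mult_left_mono) auto
    also have "\<dots> = ?A + (ennreal t * (ennreal (1 + t) * ennreal lam + ennreal e) + ennreal e) * ?I"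
      by (simp add: distrib_right add.assoc mult.assoc)
    also have "\<dots> \<le> ?A + ennreal \<epsilon> * ?I"
    proof -
      have "t * ((1 + t) * lam) \<le> 2 * (t * lam)"
      proof -
        have "(1 + t) * (t * lam) \<le> 2 * (t * lam)" using t lam by (intro mult_right_mono) auto
        then show ?thesis by (simp add: mult_ac)
      qed
      moreover have "t * e \<le> e" using t e by simp
      ultimately have "t * ((1 + t) * lam + e) + e \<le> \<epsilon>" using t(3) by (simp add: distrib_left e_def)
      then have "ennreal t * (ennreal (1 + t) * ennreal lam + ennreal e) + ennreal e \<le> ennreal \<epsilon>"
        using t lam e by (simp add: ennreal_mult'[symmetric] ennreal_plus[symmetric] ennreal_leI del: ennreal_plus)
      then show ?thesis by (intro add_left_mono mult_right_mono) auto
    qed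
    finally show "?\<Lambda> u * ?I \<le> ?A + ennreal \<epsilon> * ?I" .
  qed (rule \<delta>)
qed

subsection \<open>Uniform central limit theorem for row-wise i.i.d. arrays\<close>

text \<open>By Levy's continuity theorem. A summand bounded by \<open>B n\<close> has a third
  absolute moment of at most \<open>B n\<close> times its variance, so the quadratic expansion of
  the characteristic functions has total error of order \<open>B n\<close>, which tends to
  0.\<close>

lemma (in prob_space) clt_row_iid:
  fixes Z :: "nat \<Rightarrow> nat \<Rightarrow> 'a \<Rightarrow> real"
  assumes indep: "\<And>n. indep_vars (\<lambda>_. borel) (Z n) UNIV"
    and distr: "\<And>n i. distr M borel (Z n i) = distr M borel (Z n 0)"
    and mean: "\<And>n. expectation (Z n 0) = 0"
    and bdd: "\<And>n x. x \<in> space M \<Longrightarrow> \<bar>Z n 0 x\<bar> \<le> B n"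
    and B0: "B \<longlonglongrightarrow> 0"
    and var: "(\<lambda>n. real n * expectation (\<lambda>x. (Z n 0 x)\<^sup>2)) \<longlonglongrightarrow> 1"
  shows "weak_conv_m (\<lambda>n. distr M borel (\<lambda>x. \<Sum>i<n. Z n i x)) std_normal_distribution"
proof (rule levy_continuity)
  have rv [measurable]: "random_variable borel (Z n i)" for n i
    using indep[of n] unfolding indep_vars_def2 by simp
  show "real_distribution (distr M borel (\<lambda>x. \<Sum>i<n. Z n i x))" for n
    by (rule real_distribution_distr) measurable
  show "real_distribution std_normal_distribution" by (rule real_dist_normal_dist)
  fix t
  define v where "v n = expectation (\<lambda>x. (Z n 0 x)\<^sup>2)" for n
  have v0: "0 \<le> v n" for n by (simp add: v_def)
  have Bn: "0 \<le> B n" for n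
  proof -
    obtain x where "x \<in> space M" using not_empty by blast
    then show ?thesis using bdd[of x n] by linarith
  qed
  have int: "integrable M (Z n 0)" "integrable M (\<lambda>x. (Z n 0 x)\<^sup>2)" for n
  proof -
    show "integrable M (Z n 0)" by (rule integrable_const_bound[of _ "B n"]) (use bdd in auto)
    have "(Z n 0 x)\<^sup>2 \<le> (B n)\<^sup>2" if "x \<in> space M" for x
      using bdd[OF that, of n] by (simp add: abs_le_square_iff[symmetric] abs_le_iff)
    then show "integrable M (\<lambda>x. (Z n 0 x)\<^sup>2)" by (intro integrable_const_bound[of _ "(B n)\<^sup>2"]) auto
  qed
  define \<psi> where "\<psi> n = char (distr M borel (Z n 0)) t" for n
  have prodf: "char (distr M borel (\<lambda>x. \<Sum>i<n. Z n i x)) t = \<psi> n ^ n" for n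
  proof -
    have "char (distr M borel (\<lambda>x. \<Sum>i<n. Z n i x)) t = (\<Prod>i<n. char (distr M borel (Z n i)) t)"
      by (rule char_distr_sum) (rule indep_vars_subset[OF indep], simp)
    also have "\<dots> = \<psi> n ^ n" by (subst distr) (simp add: \<psi>_def)
    finally show ?thesis .
  qed
  have approx: "cmod (\<psi> n - (1 - t\<^sup>2 * v n / 2)) \<le> t\<^sup>2 / 6 * (\<bar>t\<bar> * B n * v n)" for n
  proof -
    have "cmod (\<psi> n - (1 - t\<^sup>2 * v n / 2)) \<le> t\<^sup>2 / 6 * expectation (\<lambda>x. min (6 * (Z n 0 x)\<^sup>2) (\<bar>t\<bar> * \<bar>Z n 0 x\<bar> ^ 3))"
      unfolding \<psi>_def by (rule char_approx3'[OF rv int mean _ refl]) (simp add: mean v_def)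
    also have "\<dots> \<le> t\<^sup>2 / 6 * (\<bar>t\<bar> * B n * v n)"
    proof (rule mult_left_mono)
      have "expectation (\<lambda>x. min (6 * (Z n 0 x)\<^sup>2) (\<bar>t\<bar> * \<bar>Z n 0 x\<bar> ^ 3)) \<le> expectation (\<lambda>x. \<bar>t\<bar> * B n * (Z n 0 x)\<^sup>2)"
      proof (rule integral_mono)
        show "integrable M (\<lambda>x. min (6 * (Z n 0 x)\<^sup>2) (\<bar>t\<bar> * \<bar>Z n 0 x\<bar> ^ 3))"
          by (rule Bochner_Integration.integrable_bound[OF integrable_mult_right[OF int(2)[of n], of 6]]) auto
        show "integrable M (\<lambda>x. \<bar>t\<bar> * B n * (Z n 0 x)\<^sup>2)" using int by (intro integrable_mult_right)
        fix x assume "x \<in> space M"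
        then have *: "\<bar>t\<bar> * \<bar>Z n 0 x\<bar> * (Z n 0 x)\<^sup>2 \<le> \<bar>t\<bar> * B n * (Z n 0 x)\<^sup>2"
          using bdd by (intro mult_right_mono mult_left_mono) auto
        then show "min (6 * (Z n 0 x)\<^sup>2) (\<bar>t\<bar> * \<bar>Z n 0 x\<bar> ^ 3) \<le> \<bar>t\<bar> * B n * (Z n 0 x)\<^sup>2"
        proof -
          have "\<bar>Z n 0 x\<bar> ^ 3 = \<bar>Z n 0 x\<bar> * \<bar>Z n 0 x\<bar>\<^sup>2" by (simp only: power3_eq_cube power2_eq_square mult.assoc)
          then have "\<bar>t\<bar> * \<bar>Z n 0 x\<bar> ^ 3 = \<bar>t\<bar> * \<bar>Z n 0 x\<bar> * (Z n 0 x)\<^sup>2" by simp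
          then show ?thesis using * by (simp only: min.coboundedI2)
        qed
      qed
      then show "expectation (\<lambda>x. min (6 * (Z n 0 x)\<^sup>2) (\<bar>t\<bar> * \<bar>Z n 0 x\<bar> ^ 3)) \<le> \<bar>t\<bar> * B n * v n"
        using int by (simp add: v_def)
    qed simp
    finally show ?thesis .
  qed
  define a where "a n = t\<^sup>2 * v n / 2" for n
  have na: "(\<lambda>n. real n * a n) \<longlonglongrightarrow> t\<^sup>2 / 2"
  proof -
    have "(\<lambda>n. t\<^sup>2 / 2 * (real n * v n)) \<longlonglongrightarrow> t\<^sup>2 / 2 * 1" using var unfolding v_def by (intro tendsto_mult tendsto_const)
    then show ?thesis by (simp add: a_def mult_ac)
  qed
  have v_B: "v n \<le> (B n)\<^sup>2" for n
  proof -
    have "v n \<le> expectation (\<lambda>x. (B n)\<^sup>2)" unfolding v_def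
      using int bdd[of _ n] Bn by (intro integral_mono) (auto simp: abs_le_square_iff[symmetric])
    then show ?thesis by (simp add: prob_space)
  qed
  have a0: "a \<longlonglongrightarrow> 0"
  proof -
    have "(\<lambda>n. t\<^sup>2 * (B n)\<^sup>2 / 2) \<longlonglongrightarrow> t\<^sup>2 * 0\<^sup>2 / 2" by (intro tendsto_intros B0) simp
    then show ?thesis
      by (intro tendsto_sandwich[of "\<lambda>_. 0" a sequentially "\<lambda>n. t\<^sup>2 * (B n)\<^sup>2 / 2"])
         (auto simp: a_def v0 intro!: mult_left_mono v_B divide_right_mono always_eventually)
  qed
  have limpow: "(\<lambda>n. (1 - a n) ^ n) \<longlonglongrightarrow> exp (- (t\<^sup>2 / 2))"
  proof -
    have lim: "(\<lambda>n. real n * ln (1 - a n)) \<longlonglongrightarrow> - (t\<^sup>2 / 2)"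
    proof -
      have ev: "\<forall>\<^sub>F n in sequentially. \<bar>a n\<bar> \<le> 1/2"
        using order_tendstoD(2)[OF tendsto_rabs_zero[OF a0], of "1/2"] by (auto elim!: eventually_mono)
      have "(\<lambda>n. real n * ln (1 - a n) + real n * a n) \<longlonglongrightarrow> 0"
      proof (rule Lim_null_comparison)
        show "\<forall>\<^sub>F n in sequentially. norm (real n * ln (1 - a n) + real n * a n) \<le> real n * a n * (2 * a n)"
          using ev
        proof eventually_elim
          case (elim n)
          have "\<bar>ln (1 + - a n) - - a n\<bar> \<le> 2 * (- a n)\<^sup>2"
            by (rule abs_ln_one_plus_x_minus_x_bound) (use elim in simp)
          then have "real n * \<bar>ln (1 + - a n) - - a n\<bar> \<le> real n * (2 * (- a n)\<^sup>2)" by (intro mult_left_mono) auto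
          then show ?case by (simp add: distrib_left[symmetric] abs_mult power2_eq_square mult_ac)
        qed
        have "(\<lambda>n. real n * a n * (2 * a n)) \<longlonglongrightarrow> t\<^sup>2 / 2 * (2 * 0)" by (intro tendsto_intros na a0)
        then show "(\<lambda>n. real n * a n * (2 * a n)) \<longlonglongrightarrow> 0" by simp
      qed
      from tendsto_diff[OF this na] show ?thesis by simp
    qed
    have "(\<lambda>n. exp (real n * ln (1 - a n))) \<longlonglongrightarrow> exp (- (t\<^sup>2 / 2))" by (intro tendsto_intros lim)
    moreover have "\<forall>\<^sub>F n in sequentially. exp (real n * ln (1 - a n)) = (1 - a n) ^ n"
      using order_tendstoD(2)[OF a0 zero_less_one] by eventually_elim (simp add: exp_of_nat_mult)
    ultimately show ?thesis by (rule Lim_transform_eventually)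
  qed
  \<comment> \<open>Passing to n-th powers costs only a factor n for numbers in the unit disc; 1 - a
    n lies there once a n < 2.\<close>
  have diff: "(\<lambda>n. \<psi> n ^ n - (complex_of_real (1 - a n)) ^ n) \<longlonglongrightarrow> 0"
  proof (rule Lim_null_comparison)
    show "\<forall>\<^sub>F n in sequentially. norm (\<psi> n ^ n - (complex_of_real (1 - a n)) ^ n) \<le> t\<^sup>2 / 6 * \<bar>t\<bar> * (B n * (real n * v n))"
      using order_tendstoD(2)[OF a0, of 2, simplified]
    proof eventually_elim
      case (elim n)
      interpret Z: real_distribution "distr M borel (Z n 0)" by (rule real_distribution_distr) simp
      have "0 \<le> a n" by (simp add: a_def v0)
      have "norm (\<psi> n ^ n - (complex_of_real (1 - a n)) ^ n) \<le> real n * norm (\<psi> n - complex_of_real (1 - a n))"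
        using elim \<open>0 \<le> a n\<close>
        by (intro norm_power_diff) (auto simp: \<psi>_def Z.cmod_char_le_1 simp del: of_real_diff)
      also have "\<dots> \<le> real n * (t\<^sup>2 / 6 * (\<bar>t\<bar> * B n * v n))"
        using approx[of n] by (intro mult_left_mono) (auto simp: a_def)
      finally show ?case by (simp add: mult_ac)
    qed
    have "(\<lambda>n. t\<^sup>2 / 6 * \<bar>t\<bar> * (B n * (real n * v n))) \<longlonglongrightarrow> t\<^sup>2 / 6 * \<bar>t\<bar> * (0 * 1)"
      using var unfolding v_def by (intro tendsto_intros B0)
    then show "(\<lambda>n. t\<^sup>2 / 6 * \<bar>t\<bar> * (B n * (real n * v n))) \<longlonglongrightarrow> 0" by simp
  qed
  have "(\<lambda>n. complex_of_real ((1 - a n) ^ n)) \<longlonglongrightarrow> complex_of_real (exp (- (t\<^sup>2 / 2)))"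
    using limpow by (rule tendsto_of_real)
  from tendsto_add[OF diff this] have "(\<lambda>n. \<psi> n ^ n) \<longlonglongrightarrow> complex_of_real (exp (- (t\<^sup>2 / 2)))" by simp
  then show "(\<lambda>n. char (distr M borel (\<lambda>x. \<Sum>i<n. Z n i x)) t) \<longlonglongrightarrow> char std_normal_distribution t"
    unfolding prodf by (simp add: char_std_normal_distribution)
qed

text \<open>Polya's theorem. The limit is uniformly continuous on [a, b], so finitely many pointwise
  limits on a fine grid suffice; between the grid points and in the tails monotonicity takes
  over.\<close>

lemma cdf_uniform_convergence:
  assumes M: "\<And>n. real_distribution (M n)" and N: "real_distribution N"
    and conv: "weak_conv_m M N" and cont: "\<And>x. isCont (cdf N) x" and e: "0 < e"
  shows "\<forall>\<^sub>F n in sequentially. \<forall>x. \<bar>cdf (M n) x - cdf N x\<bar> \<le> e"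
proof -
  interpret N: real_distribution N by fact
  interpret M: real_distribution "M n" for n by fact
  have lim: "(\<lambda>n. cdf (M n) x) \<longlonglongrightarrow> cdf N x" for x
    using conv cont unfolding weak_conv_m_def weak_conv_def by blast
  obtain a where a: "cdf N a < e / 2"
    using order_tendstoD(2)[OF N.cdf_lim_at_bot, of "e/2"] e by (auto simp: eventually_at_bot_linorder)
  obtain b0 where b0: "1 - e / 2 < cdf N b0"
    using order_tendstoD(1)[OF N.cdf_lim_at_top_prob, of "1 - e/2"] e by (auto simp: eventually_at_top_linorder)
  define b where "b = max b0 a"
  have b: "1 - e / 2 < cdf N b" "a \<le> b"
    using b0 N.cdf_nondecreasing[of b0 b] by (auto simp: b_def)
  have "uniformly_continuous_on {a..b} (cdf N)"
    using cont by (intro compact_uniformly_continuous) (auto intro: continuous_at_imp_continuous_on)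
  then obtain d where d: "0 < d" "\<And>x y. x \<in> {a..b} \<Longrightarrow> y \<in> {a..b} \<Longrightarrow> dist y x < d \<Longrightarrow> dist (cdf N y) (cdf N x) < e / 2"
    using e unfolding uniformly_continuous_on_def by (metis half_gt_zero)
  obtain m :: nat where m: "(b - a) / d < real m" using reals_Archimedean2 by blast
  then have m0: "0 < m" using b(2) d(1) by (metis divide_nonneg_pos diff_ge_0_iff_ge gr0I not_less of_nat_0)
  define x where "x k = a + real k * (b - a) / real m" for k
  have x: "x 0 = a" "x m = b" "x k \<le> x (Suc k)" "x (Suc k) - x k < d" "k \<le> m \<Longrightarrow> x k \<in> {a..b}" for k
  proof -
    show "x 0 = a" "x m = b" using m0 by (auto simp: x_def)
    have "x (Suc k) - x k = (b - a) / real m" by (simp add: x_def add_divide_distrib distrib_right)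
    moreover have "0 \<le> (b - a) / real m" "(b - a) / real m < d"
      using m d(1) m0 b(2) by (auto simp: field_simps)
    ultimately show "x k \<le> x (Suc k)" "x (Suc k) - x k < d" by linarith+
    assume "k \<le> m"
    then have "real k * (b - a) / real m \<le> real m * (b - a) / real m" using b(2) by (intro divide_right_mono mult_right_mono) auto
    then show "x k \<in> {a..b}" using b(2) m0 by (auto simp: x_def)
  qed
  have "\<forall>\<^sub>F n in sequentially. \<forall>k\<in>{..m}. \<bar>cdf (M n) (x k) - cdf N (x k)\<bar> < e / 2"
    using tendstoD[OF lim, of "e / 2"] e by (intro eventually_ball_finite) (auto simp: dist_real_def)
  then show ?thesis
  proof eventually_elim
    case (elim n)
    show ?case
    proof
      fix z
      consider "z \<le> a" | "b \<le> z" | "a < z" "z < b" by linarith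
      then show "\<bar>cdf (M n) z - cdf N z\<bar> \<le> e"
      proof cases
        case 1
        then have "cdf (M n) z \<le> cdf (M n) a" "cdf N z \<le> cdf N a" by (auto intro: M.cdf_nondecreasing N.cdf_nondecreasing)
        moreover have "\<bar>cdf (M n) a - cdf N a\<bar> < e / 2" using elim x(1) by (metis atMost_iff le0)
        ultimately show ?thesis using a M.cdf_nonneg[of n z] N.cdf_nonneg[of z] by linarith
      next
        case 2
        then have "cdf (M n) b \<le> cdf (M n) z" "cdf N b \<le> cdf N z" by (auto intro: M.cdf_nondecreasing N.cdf_nondecreasing)
        moreover have "\<bar>cdf (M n) b - cdf N b\<bar> < e / 2" using elim x(2) by (metis atMost_iff order_refl)
        ultimately show ?thesis using b M.cdf_bounded_prob[of n z] N.cdf_bounded_prob[of z] by linarith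
      next
        case 3
        define k where "k = (LEAST k. z \<le> x k)"
        have "z \<le> x m" using 3 x(2) by simp
        then have zk: "z \<le> x k" and km: "k \<le> m" unfolding k_def by (rule LeastI, rule Least_le)
        have "k \<noteq> 0" using zk 3 x(1) by (metis not_less)
        then obtain j where j: "k = Suc j" using not0_implies_Suc by blast
        have "\<not> z \<le> x j" using not_less_Least[of j "\<lambda>k. z \<le> x k"] j unfolding k_def by simp
        then have jz: "x j < z" by simp
        have mem: "x j \<in> {a..b}" "x k \<in> {a..b}" using x(5) km j by auto
        have "dist (cdf N (x k)) (cdf N (x j)) < e / 2"
          using d(2)[OF mem] x(3,4)[of j] j by (simp add: dist_real_def)
        moreover have "cdf N (x j) \<le> cdf N z" "cdf N z \<le> cdf N (x k)" "cdf (M n) (x j) \<le> cdf (M n) z" "cdf (M n) z \<le> cdf (M n) (x k)"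
          using zk jz by (auto intro: M.cdf_nondecreasing N.cdf_nondecreasing)
        moreover have "\<bar>cdf (M n) (x j) - cdf N (x j)\<bar> < e / 2" "\<bar>cdf (M n) (x k) - cdf N (x k)\<bar> < e / 2"
          using elim km j by auto
        ultimately have "cdf (M n) z - cdf N z \<le> e \<and> cdf N z - cdf (M n) z \<le> e"
          unfolding dist_real_def abs_less_iff by linarith
        then show ?thesis by (simp add: abs_le_iff)
      qed
    qed
  qed
qed

subsection \<open>Bias\<close>

lemma lborel_integral_split:
  fixes F :: "real^'d::finite \<Rightarrow> real"
  assumes F: "integrable lborel F"
  shows "(\<integral>z. F z \<partial>lborel) = (\<integral>p. \<integral>t. F (vinsert i p t) \<partial>lborel \<partial>Pi\<^sub>M (- {i}) (\<lambda>_. lborel))"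
proof -
  interpret F: finite_product_sigma_finite "\<lambda>_. lborel :: real measure" "- {i}" by standard simp
  interpret P: pair_sigma_finite "Pi\<^sub>M (- {i}) (\<lambda>_. lborel :: real measure)" "lborel :: real measure" ..
  let ?N = "Pi\<^sub>M (- {i}) (\<lambda>_. lborel :: real measure) \<Otimes>\<^sub>M (lborel :: real measure)"
  have [measurable]: "F \<in> borel_measurable borel" using F by simp
  have "integrable (distr ?N borel (\<lambda>(p, t). vinsert i p t)) F" using F by (subst (asm) lborel_split[of i])
  then have int: "integrable ?N (\<lambda>x. F ((\<lambda>(p, t). vinsert i p t) x))"
    by (subst (asm) integrable_distr_eq[OF measurable_vinsert]) auto
  have "(\<integral>z. F z \<partial>lborel) = (\<integral>x. F ((\<lambda>(p, t). vinsert i p t) x) \<partial>?N)"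
    by (subst lborel_split[of i], rule integral_distr[OF measurable_vinsert]) simp
  also have "\<dots> = (\<integral>p. \<integral>t. F (vinsert i p t) \<partial>lborel \<partial>Pi\<^sub>M (- {i}) (\<lambda>_. lborel))"
    using P.integral_fst'[OF int] by simp
  finally show ?thesis .
qed

lemma lborel_uminus: "(lborel :: 'a::euclidean_space measure) = distr lborel borel uminus"
  using lborel_affine[of "-1" "0 :: 'a"] by (simp add: density_1)

section \<open>Moments of a symmetric product kernel\<close>

locale product_kernel =
  fixes K :: "real^'d::finite \<Rightarrow> real" and Kt :: "real \<Rightarrow> real" and \<nu> :: nat
  assumes nu: "2 \<le> \<nu>"
    and K_prod: "\<And>u. K u = (\<Prod>j\<in>UNIV. Kt (u $ j))"
    and K_sym: "\<And>u. K (- u) = K u"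
    and K_order: "kernel_order \<nu> Kt"
    and K_L1: "integrable lborel K"
begin

lemma Kt_int: "integrable lborel Kt" "integrable lborel (\<lambda>u. u ^ \<nu> * Kt u)" "(\<integral>u. Kt u \<partial>lborel) = 1"
  "\<And>l. 1 \<le> l \<Longrightarrow> l < \<nu> \<Longrightarrow> (\<integral>u. u ^ l * Kt u \<partial>lborel) = 0" "(\<integral>u. u ^ \<nu> * Kt u \<partial>lborel) = kappa \<nu> Kt"
  using K_order nu unfolding kernel_order_def kappa_def by auto

lemma K_measurable [measurable]: "K \<in> borel_measurable borel" using K_L1 by simp

lemma Kt_measurable [measurable]: "Kt \<in> borel_measurable borel" using Kt_int(1) by simp

lemma Kt_moment: "l \<le> \<nu> \<Longrightarrow> integrable lborel (\<lambda>u. u ^ l * Kt u)"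
proof -
  assume l: "l \<le> \<nu>"
  show ?thesis
  proof (rule Bochner_Integration.integrable_bound)
    show "integrable lborel (\<lambda>u. \<bar>Kt u\<bar> + \<bar>u ^ \<nu> * Kt u\<bar>)" using Kt_int(1,2) by auto
    show "AE u in lborel. norm (u ^ l * Kt u) \<le> norm (\<bar>Kt u\<bar> + \<bar>u ^ \<nu> * Kt u\<bar>)"
    proof (rule AE_I2)
      fix u :: real
      have "\<bar>u\<bar> ^ l \<le> 1 + \<bar>u\<bar> ^ \<nu>"
      proof (cases "\<bar>u\<bar> \<le> 1")
        case True
        then have "\<bar>u\<bar> ^ l \<le> 1" by (intro power_le_one) auto
        then show ?thesis by (simp add: add_increasing2)
      next
        case False
        then have "\<bar>u\<bar> ^ l \<le> \<bar>u\<bar> ^ \<nu>" using l by (intro power_increasing) auto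
        then show ?thesis by simp
      qed
      then have "\<bar>u\<bar> ^ l * \<bar>Kt u\<bar> \<le> (1 + \<bar>u\<bar> ^ \<nu>) * \<bar>Kt u\<bar>" by (intro mult_right_mono) auto
      then show "norm (u ^ l * Kt u) \<le> norm (\<bar>Kt u\<bar> + \<bar>u ^ \<nu> * Kt u\<bar>)"
        by (simp add: abs_mult power_abs distrib_right)
    qed
  qed auto
qed

lemma K_vinsert: "K (vinsert j p t) = Kt t * (\<Prod>k\<in>-{j}. Kt (p k))"
proof -
  have "K (vinsert j p t) = Kt (vinsert j p t $ j) * (\<Prod>k\<in>UNIV - {j}. Kt (vinsert j p t $ k))"
    unfolding K_prod by (rule prod.remove) auto
  also have "(\<Prod>k\<in>UNIV - {j}. Kt (vinsert j p t $ k)) = (\<Prod>k\<in>-{j}. Kt (p k))"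
    by (rule prod.cong) auto
  finally show ?thesis by simp
qed

text \<open>The integral factors into a one-dimensional moment and the mass of the other
  coordinates. That mass is finite because \<open>K\<close> is integrable and the one-dimensional
  mass is not 0, the integral of \<open>Kt\<close> being 1.\<close>

lemma K_moment_int: "l \<le> \<nu> \<Longrightarrow> integrable lborel (\<lambda>u. K u * (u $ j) ^ l)"
proof -
  assume l: "l \<le> \<nu>"
  let ?P = "Pi\<^sub>M (- {j}) (\<lambda>_. lborel :: real measure)"
  have fact: "(\<integral>\<^sup>+u. ennreal \<bar>K u * (u $ j) ^ m\<bar> \<partial>lborel) =
      (\<integral>\<^sup>+p. ennreal \<bar>\<Prod>k\<in>-{j}. Kt (p k)\<bar> \<partial>?P) * (\<integral>\<^sup>+t. ennreal \<bar>t ^ m * Kt t\<bar> \<partial>lborel)" for m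
  proof -
    have [measurable]: "(\<lambda>p. \<Prod>k\<in>-{j}. Kt (p k)) \<in> borel_measurable ?P"
      by (intro borel_measurable_prod measurable_compose[OF measurable_component_singleton]) auto
    have "(\<integral>\<^sup>+u. ennreal \<bar>K u * (u $ j) ^ m\<bar> \<partial>lborel) =
        (\<integral>\<^sup>+p. \<integral>\<^sup>+t. ennreal \<bar>K (vinsert j p t) * (vinsert j p t $ j) ^ m\<bar> \<partial>lborel \<partial>?P)"
      by (rule nn_integral_split) auto
    also have "\<dots> = (\<integral>\<^sup>+p. ennreal \<bar>\<Prod>k\<in>-{j}. Kt (p k)\<bar> * (\<integral>\<^sup>+t. ennreal \<bar>t ^ m * Kt t\<bar> \<partial>lborel) \<partial>?P)"
      by (intro nn_integral_cong, subst nn_integral_cmult[symmetric])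
         (auto simp: K_vinsert abs_mult ennreal_mult'[symmetric] mult_ac)
    also have "\<dots> = (\<integral>\<^sup>+p. ennreal \<bar>\<Prod>k\<in>-{j}. Kt (p k)\<bar> \<partial>?P) * (\<integral>\<^sup>+t. ennreal \<bar>t ^ m * Kt t\<bar> \<partial>lborel)"
      by (rule nn_integral_multc) auto
    finally show ?thesis .
  qed
  have "(\<integral>\<^sup>+p. ennreal \<bar>\<Prod>k\<in>-{j}. Kt (p k)\<bar> \<partial>?P) < top"
  proof (rule ccontr)
    assume "\<not> ?thesis"
    then have top: "(\<integral>\<^sup>+p. ennreal \<bar>\<Prod>k\<in>-{j}. Kt (p k)\<bar> \<partial>?P) = top" by (simp add: less_top[symmetric])
    have "(\<integral>\<^sup>+u. ennreal \<bar>K u * (u $ j) ^ 0\<bar> \<partial>lborel) < top"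
      using K_L1 by (simp add: integrable_iff_bounded)
    then have "top * (\<integral>\<^sup>+t. ennreal \<bar>Kt t\<bar> \<partial>lborel) < (top :: ennreal)" unfolding fact top by simp
    then have "(\<integral>\<^sup>+t. ennreal \<bar>Kt t\<bar> \<partial>lborel) = 0" by (auto simp: ennreal_top_mult split: if_splits)
    moreover have "ennreal \<bar>\<integral>t. Kt t \<partial>lborel\<bar> \<le> (\<integral>\<^sup>+t. ennreal \<bar>Kt t\<bar> \<partial>lborel)"
      using integral_norm_bound_ennreal[OF Kt_int(1)] by simp
    ultimately show False using Kt_int(3) by simp
  qed
  moreover have "(\<integral>\<^sup>+t. ennreal \<bar>t ^ l * Kt t\<bar> \<partial>lborel) < top"
    using Kt_moment[OF l] by (simp add: integrable_iff_bounded)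
  ultimately have "(\<integral>\<^sup>+u. ennreal \<bar>K u * (u $ j) ^ l\<bar> \<partial>lborel) < top"
    unfolding fact by (simp add: ennreal_mult_less_top)
  then show ?thesis by (simp add: integrable_iff_bounded)
qed

text \<open>Fubini in direction \<open>j\<close>. The integral over the remaining coordinates is
  identified by the case l = 0, in which the one-dimensional factor is 1.\<close>

lemma K_moment:
  fixes G :: "real^'d \<Rightarrow> real"
  assumes l: "l \<le> \<nu>" and G [measurable]: "G \<in> borel_measurable borel" and bdd: "\<And>u. \<bar>G u\<bar> \<le> B"
    and indep: "\<And>p s t. G (vinsert j p s) = G (vinsert j p t)"
  shows "(\<integral>u. K u * (u $ j) ^ l * G u \<partial>lborel) = (\<integral>t. t ^ l * Kt t \<partial>lborel) * (\<integral>u. K u * G u \<partial>lborel)"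
proof -
  have int: "integrable lborel (\<lambda>u. K u * (u $ j) ^ m * G u)" if "m \<le> \<nu>" for m
  proof (rule Bochner_Integration.integrable_bound)
    show "integrable lborel (\<lambda>u. B * (K u * (u $ j) ^ m))" using K_moment_int[OF that] by simp
    show "AE u in lborel. norm (K u * (u $ j) ^ m * G u) \<le> norm (B * (K u * (u $ j) ^ m))"
    proof (rule AE_I2)
      fix u
      have "\<bar>G u\<bar> \<le> \<bar>B\<bar>" using bdd[of u] by simp
      then have "\<bar>K u * (u $ j) ^ m\<bar> * \<bar>G u\<bar> \<le> \<bar>K u * (u $ j) ^ m\<bar> * \<bar>B\<bar>" by (rule mult_left_mono) simp
      then show "norm (K u * (u $ j) ^ m * G u) \<le> norm (B * (K u * (u $ j) ^ m))" by (simp add: abs_mult mult_ac)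
    qed
  qed auto
  have eq: "(\<integral>u. K u * (u $ j) ^ m * G u \<partial>lborel) =
     (\<integral>t. t ^ m * Kt t \<partial>lborel) * (\<integral>p. (\<Prod>k\<in>-{j}. Kt (p k)) * G (vinsert j p 0) \<partial>Pi\<^sub>M (- {j}) (\<lambda>_. lborel))" if "m \<le> \<nu>" for m
  proof -
    have "(\<integral>u. K u * (u $ j) ^ m * G u \<partial>lborel) =
       (\<integral>p. \<integral>t. K (vinsert j p t) * (vinsert j p t $ j) ^ m * G (vinsert j p t) \<partial>lborel \<partial>Pi\<^sub>M (- {j}) (\<lambda>_. lborel))"
      by (rule lborel_integral_split[OF int[OF that]])
    also have "\<dots> = (\<integral>p. (\<integral>t. t ^ m * Kt t \<partial>lborel) * ((\<Prod>k\<in>-{j}. Kt (p k)) * G (vinsert j p 0)) \<partial>Pi\<^sub>M (- {j}) (\<lambda>_. lborel))"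
    proof (rule Bochner_Integration.integral_cong[OF refl])
      fix p
      have "K (vinsert j p t) * (vinsert j p t $ j) ^ m * G (vinsert j p t) =
          (t ^ m * Kt t) * ((\<Prod>k\<in>-{j}. Kt (p k)) * G (vinsert j p 0))" for t
        using indep[of p t 0] by (simp add: K_vinsert mult_ac)
      then show "(\<integral>t. K (vinsert j p t) * (vinsert j p t $ j) ^ m * G (vinsert j p t) \<partial>lborel) =
         (\<integral>t. t ^ m * Kt t \<partial>lborel) * ((\<Prod>k\<in>-{j}. Kt (p k)) * G (vinsert j p 0))"
        by (simp only: integral_mult_left_zero)
    qed
    also have "\<dots> = (\<integral>t. t ^ m * Kt t \<partial>lborel) * (\<integral>p. (\<Prod>k\<in>-{j}. Kt (p k)) * G (vinsert j p 0) \<partial>Pi\<^sub>M (- {j}) (\<lambda>_. lborel))"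
      by (rule integral_mult_right_zero)
    finally show ?thesis .
  qed
  show ?thesis using eq[OF l] eq[of 0] by (simp add: Kt_int)
qed

text \<open>Over the full product measure the integral is a product of one-dimensional integrals,
  each equal to 1.\<close>

lemma K_one: "(\<integral>u. K u \<partial>lborel) = 1"
proof -
  define M where "M = Pi\<^sub>M (UNIV :: 'd set) (\<lambda>_. lborel :: real measure)"
  interpret F: finite_product_sigma_finite "\<lambda>_. lborel :: real measure" "UNIV :: 'd set" by standard simp
  have meas: "(\<lambda>p. \<chi> k. p k) \<in> M \<rightarrow>\<^sub>M (borel :: (real^'d) measure)"
    unfolding M_def by (intro borel_measurable_vec_lambda) simp
  have eq: "(lborel :: (real^'d) measure) = distr M borel (\<lambda>p. \<chi> k. p k)"
  proof (rule lborel_eqI)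
    fix l u :: "real^'d" assume lu: "\<And>b. b \<in> Basis \<Longrightarrow> l \<bullet> b \<le> u \<bullet> b"
    then have lu': "l $ k \<le> u $ k" for k by (simp add: cart_eq_inner_axis)
    have pre: "(\<lambda>p. \<chi> k. p k) -` box l u \<inter> space M = (\<Pi>\<^sub>E k \<in> UNIV. {l $ k <..< u $ k})"
      by (auto simp: M_def mem_box_cart space_PiM PiE_iff)
    have "emeasure (distr M borel (\<lambda>p. \<chi> k. p k)) (box l u) = emeasure M ((\<lambda>p. \<chi> k. p k) -` box l u \<inter> space M)"
      by (rule emeasure_distr[OF meas]) simp
    also have "\<dots> = emeasure M (\<Pi>\<^sub>E k \<in> UNIV. {l $ k <..< u $ k})" by (simp only: pre)
    also have "\<dots> = (\<Prod>k\<in>UNIV. ennreal (u $ k - l $ k))"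
      unfolding M_def by (subst F.measure_times) (auto simp: lu')
    also have "\<dots> = ennreal (\<Prod>k\<in>UNIV. u $ k - l $ k)" using lu' by (subst prod_ennreal) auto
    also have "(\<Prod>k\<in>UNIV. u $ k - l $ k) = (\<Prod>b\<in>Basis. (u - l) \<bullet> b)"
      by (subst Basis_vec_def) (simp add: UNION_singleton_eq_range prod.reindex inj_on_def axis_eq_axis inner_axis)
    finally show "emeasure (distr M borel (\<lambda>p. \<chi> k. p k)) (box l u) = (\<Prod>b\<in>Basis. (u - l) \<bullet> b)" .
  qed simp
  have "(\<integral>u. K u \<partial>lborel) = (\<integral>p. K (\<chi> k. p k) \<partial>M)"
    by (subst eq) (rule integral_distr[OF meas K_measurable])
  also have "\<dots> = (\<integral>p. (\<Prod>k\<in>UNIV. Kt (p k)) \<partial>M)" by (simp add: K_prod)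
  also have "\<dots> = (\<Prod>k\<in>(UNIV::'d set). \<integral>t. Kt t \<partial>lborel)"
    unfolding M_def by (rule F.product_integral_prod) (auto simp: Kt_int)
  finally show ?thesis by (simp add: Kt_int)
qed

lemma K_moment_nu: "(\<integral>u. K u * (u $ j) ^ \<nu> \<partial>lborel) = kappa \<nu> Kt"
  using K_moment[of \<nu> "\<lambda>_. 1" 1 j] by (simp add: Kt_int K_one)

text \<open>The reflection u \<mapsto> - u preserves both Lebesgue measure and \<open>K\<close>.
  This removes the sign (-1) ^ \<nu> that arises because the kernel averages f (x - scale h
  u).\<close>

lemma kappa_sign: "(-1) ^ \<nu> * kappa \<nu> Kt = kappa \<nu> Kt"
proof -
  have "kappa \<nu> Kt = (\<integral>u. K u * (u $ j) ^ \<nu> \<partial>lborel)" for j by (simp add: K_moment_nu)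
  also have "\<dots> j = (\<integral>u. K u * (u $ j) ^ \<nu> \<partial>distr lborel borel uminus)" for j
    using arg_cong[OF lborel_uminus, of "\<lambda>M. \<integral>u. K u * (u $ j) ^ \<nu> \<partial>M"] by simp
  also have "\<dots> j = (\<integral>u. K (- u) * ((- u) $ j) ^ \<nu> \<partial>lborel)" for j
    by (rule integral_distr) auto
  also have "\<dots> j = (\<integral>u. (-1) ^ \<nu> * (K u * (u $ j) ^ \<nu>) \<partial>lborel)" for j
    by (intro Bochner_Integration.integral_cong) (auto simp: K_sym power_minus[of "_ $ _"] mult_ac)
  also have "\<dots> j = (-1) ^ \<nu> * kappa \<nu> Kt" for j by (simp add: K_moment_nu)
  finally show ?thesis by simp
qed

end

definition scale :: "real^'d::finite \<Rightarrow> real^'d \<Rightarrow> real^'d" where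
  "scale h u = (\<chi> j. h $ j * u $ j)"

text \<open>The points x - restr J (scale h u) lead from x, for J = {}, to x - scale h u, for J =
  UNIV, one coordinate at a time.\<close>

definition restr :: "'d::finite set \<Rightarrow> real^'d \<Rightarrow> real^'d" where
  "restr J v = (\<chi> k. if k \<in> J then v $ k else 0)"

lemma norm_scale_le: "norm (scale h u) \<le> norm h * norm u"
proof -
  have "norm (scale h u) \<le> norm (norm h *\<^sub>R u)"
    by (rule norm_le_componentwise_cart)
       (auto simp: scale_def abs_mult intro!: mult_right_mono component_le_norm_cart)
  then show ?thesis by simp
qed

lemma continuous_on_scale [continuous_intros]: "continuous_on S (scale h)"
  unfolding scale_def by (intro continuous_on_vec_lambda continuous_intros)

lemma continuous_on_restr [continuous_intros]: "continuous_on S (restr J)"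
proof -
  have "continuous_on S (\<lambda>v. if k \<in> J then v $ k else 0 :: real)" for k
    by (cases "k \<in> J") (auto intro!: continuous_intros)
  then show ?thesis unfolding restr_def by (rule continuous_on_vec_lambda)
qed

text \<open>Expansion along one axis involves pure derivatives only, so that no mixed partial
  derivatives enter the bias.\<close>

lemma taylor_line:
  fixes f :: "real^'d::finite \<Rightarrow> real"
  assumes f: "times_cont_diff \<nu> f"
  obtains \<theta> where "\<bar>\<theta>\<bar> \<le> \<bar>y\<bar>" "f (z + y *\<^sub>R axis j 1) =
    (\<Sum>m<\<nu>. partials (replicate m j) f z / fact m * y ^ m) +
      partials (replicate \<nu> j) f (z + \<theta> *\<^sub>R axis j 1) / fact \<nu> * y ^ \<nu>"
proof -
  let ?d = "\<lambda>m t. partials (replicate m j) f (z + t *\<^sub>R axis j 1)"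
  have "\<exists>t. \<bar>t\<bar> \<le> \<bar>y\<bar> \<and> (\<lambda>t. f (z + t *\<^sub>R axis j 1)) y =
      (\<Sum>m<\<nu>. ?d m 0 / fact m * y ^ m) + ?d \<nu> t / fact \<nu> * y ^ \<nu>"
  proof (rule Maclaurin_bi_le)
    show "?d 0 = (\<lambda>t. f (z + t *\<^sub>R axis j 1))" by (simp add: partials_def)
    show "\<forall>m t. m < \<nu> \<and> \<bar>t\<bar> \<le> \<bar>y\<bar> \<longrightarrow> DERIV (?d m) t :> ?d (Suc m) t"
    proof (intro allI impI)
      fix m t assume m: "m < \<nu> \<and> \<bar>t\<bar> \<le> \<bar>y\<bar>"
      have "(\<lambda>t. partials (replicate m j) f (x + t *\<^sub>R axis j 1)) differentiable (at 0)" for x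
        using f m unfolding times_cont_diff_def by simp
      from partial_deriv_line[OF this] show "DERIV (?d m) t :> ?d (Suc m) t"
        by (simp add: partials_def)
    qed
  qed
  then show ?thesis using that by auto
qed

context product_kernel
begin

lemma K_moment_times_int:
  assumes l: "l \<le> \<nu>" and [measurable]: "G \<in> borel_measurable borel" and bdd: "\<And>u. \<bar>G u\<bar> \<le> B"
  shows "integrable lborel (\<lambda>u. K u * (u $ j) ^ l * G u)"
proof (rule Bochner_Integration.integrable_bound)
  show "integrable lborel (\<lambda>u. B * (K u * (u $ j) ^ l))" using K_moment_int[OF l] by simp
  show "AE u in lborel. norm (K u * (u $ j) ^ l * G u) \<le> norm (B * (K u * (u $ j) ^ l))"
  proof (rule AE_I2)
    fix u
    have "\<bar>G u\<bar> \<le> \<bar>B\<bar>" using bdd[of u] by simp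
    then have "\<bar>K u * (u $ j) ^ l\<bar> * \<bar>G u\<bar> \<le> \<bar>K u * (u $ j) ^ l\<bar> * \<bar>B\<bar>" by (rule mult_left_mono) simp
    then show "norm (K u * (u $ j) ^ l * G u) \<le> norm (B * (K u * (u $ j) ^ l))" by (simp add: abs_mult mult_ac)
  qed
qed auto

text \<open>By dominated convergence. For norm u > R the displacement scale h u may be too large for
  continuity of the derivatives; there they are merely bounded, and the small tail moment makes up
  for it.\<close>

lemma K_moment_tail:
  assumes e: "0 < e"
  obtains R where "0 < R" "(\<integral>u. \<bar>K u * (u $ j) ^ \<nu>\<bar> * indicator {u. R < norm u} u \<partial>lborel) \<le> e"
proof -
  have [measurable]: "{u::real^'d. a < norm u} \<in> sets borel" for a by measurable
  have "(\<lambda>n. \<integral>u. \<bar>K u * (u $ j) ^ \<nu>\<bar> * indicator {u. real n < norm u} u \<partial>lborel) \<longlonglongrightarrow> (\<integral>(u::real^'d). 0 \<partial>lborel)"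
  proof (rule integral_dominated_convergence[where w = "\<lambda>u. \<bar>K u * (u $ j) ^ \<nu>\<bar>"])
    show "AE u in lborel. (\<lambda>n. \<bar>K u * (u $ j) ^ \<nu>\<bar> * indicator {u. real n < norm u} u) \<longlonglongrightarrow> 0"
    proof (rule AE_I2)
      fix u :: "real^'d"
      obtain N :: nat where "norm u \<le> real N" using real_arch_simple by blast
      then have "\<forall>\<^sub>F n in sequentially. \<bar>K u * (u $ j) ^ \<nu>\<bar> * indicator {u. real n < norm u} u = 0"
        by (intro eventually_sequentiallyI[of N]) (auto simp: indicator_def)
      then show "(\<lambda>n. \<bar>K u * (u $ j) ^ \<nu>\<bar> * indicator {u. real n < norm u} u) \<longlonglongrightarrow> 0"
        by (rule tendsto_eventually)
    qed
    show "integrable lborel (\<lambda>u. \<bar>K u * (u $ j) ^ \<nu>\<bar>)" using K_moment_int[of \<nu> j] by simp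
  qed (auto simp: indicator_def)
  then have "(\<lambda>n. \<integral>u. \<bar>K u * (u $ j) ^ \<nu>\<bar> * indicator {u. real n < norm u} u \<partial>lborel) \<longlonglongrightarrow> 0" by simp
  from order_tendstoD(2)[OF this e] obtain N where
    N: "\<And>n. N \<le> n \<Longrightarrow> (\<integral>u. \<bar>K u * (u $ j) ^ \<nu>\<bar> * indicator {u. real n < norm u} u \<partial>lborel) < e"
    by (auto simp: eventually_sequentially)
  show ?thesis by (rule that[of "real (Suc N)"]) (use N[of "Suc N"] in auto)
qed

text \<open>Induction on the set \<open>J\<close> of coordinates that are perturbed: the Taylor terms of order between 1 and
  \<open>\<nu> - 1\<close> in a newly added coordinate have vanishing kernel moments.\<close>

lemma bias_expansion:
  assumes f: "times_cont_diff \<nu> f" and fb: "\<And>is. length is \<le> \<nu> \<Longrightarrow> bounded (range (partials is f))"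
    and C: "compact C" and e: "0 < e"
  shows "\<exists>\<delta>>0. \<forall>h. (\<forall>j. 0 < h $ j) \<longrightarrow> norm h < \<delta> \<longrightarrow>
    (\<forall>x\<in>C. \<bar>(\<integral>u. K u * f (x - scale h u) \<partial>lborel) - f x - bias_beta \<nu> Kt f h x\<bar> \<le> e * norm h ^ \<nu>)"
proof -
  let ?D = "\<lambda>m j. partials (replicate m j) f"
  have D_cont: "continuous_on UNIV (?D m j)" if "m \<le> \<nu>" for m j
    using f that unfolding times_cont_diff_def by simp
  have D_meas [measurable]: "?D m j \<in> borel_measurable borel" if "m \<le> \<nu>" for m j
    using D_cont[OF that] by (rule borel_measurable_continuous_onI)
  have D_bdd: "\<exists>B\<ge>0. \<forall>x. \<bar>?D m j x\<bar> \<le> B" if "m \<le> \<nu>" for m j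
    using fb[of "replicate m j"] that unfolding bounded_pos by (auto intro: less_imp_le)
  have f0: "partials [] f = f" by (simp add: partials_def)
  have [measurable]: "f \<in> borel_measurable borel" using D_meas[of 0] by (simp add: f0)
  have [measurable]: "(\<lambda>u. x - restr J (scale h u)) \<in> borel_measurable borel" for x :: "real^'d" and J h
    by (intro borel_measurable_continuous_onI continuous_intros continuous_on_compose2[OF continuous_on_restr continuous_on_scale]) auto
  have main: "\<exists>\<delta>>0. \<forall>h. (\<forall>j. 0 < h $ j) \<longrightarrow> norm h < \<delta> \<longrightarrow>
    (\<forall>x\<in>C. \<bar>(\<integral>u. K u * f (x - restr J (scale h u)) \<partial>lborel) - f x - kappa \<nu> Kt / fact \<nu> * (\<Sum>k\<in>J. (h $ k) ^ \<nu> * ?D \<nu> k x)\<bar> \<le> e * norm h ^ \<nu>)"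
    if "finite J" "0 < e" for J e
    using that
  proof (induction J arbitrary: e)
    case empty
    have "restr {} v = 0" for v :: "real^'d" by (simp add: restr_def vec_eq_iff)
    then show ?case using empty by (auto simp: K_one intro!: exI[of _ 1])
  next
    case (insert j J)
    obtain B where B: "0 \<le> B" "\<And>x. \<bar>?D \<nu> j x\<bar> \<le> B" using D_bdd[of \<nu> j] by auto
    define V where "V = (\<integral>u. \<bar>K u * (u $ j) ^ \<nu>\<bar> \<partial>lborel)"
    have V: "0 \<le> V" by (simp add: V_def)
    \<comment> \<open>Splits e / 2 between the inner part, where the derivative varies by at most
      \<open>\<eta>\<close>, and the tail, whose moment is at most \<open>\<eta>\<close> and where
      it varies by at most 2 * B.\<close>
    define \<eta> where "\<eta> = e / 2 / (V + 2 * B + 1)"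
    have eta: "0 < \<eta>" "\<eta> * V + 2 * B * \<eta> \<le> e / 2"
    proof -
      show "0 < \<eta>" using insert.prems V B by (simp add: \<eta>_def)
      then have "\<eta> * V + 2 * B * \<eta> \<le> \<eta> * (V + 2 * B + 1)" by (simp add: algebra_simps)
      also have "\<dots> = e / 2" using V B unfolding \<eta>_def by (subst times_divide_eq_left, subst nonzero_mult_div_cancel_right) auto
      finally show "\<eta> * V + 2 * B * \<eta> \<le> e / 2" .
    qed
    obtain R where R: "0 < R" "(\<integral>u. \<bar>K u * (u $ j) ^ \<nu>\<bar> * indicator {u. R < norm u} u \<partial>lborel) \<le> \<eta>"
      using K_moment_tail[OF eta(1)] by blast
    \<comment> \<open>The closed 1-neighbourhood of \<open>C\<close>, a compact set that contains
      the intermediate points of the Taylor expansion for norm u \<le> R.\<close>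
    define C' where "C' = {x + w |x w. x \<in> C \<and> w \<in> cball 0 1}"
    have "compact C'" unfolding C'_def using C by (intro compact_sums) auto
    then have "uniformly_continuous_on C' (?D \<nu> j)"
      using D_cont[of \<nu> j] by (intro compact_uniformly_continuous) (auto intro: continuous_on_subset)
    then obtain d where d: "0 < d" "\<And>x y. x \<in> C' \<Longrightarrow> y \<in> C' \<Longrightarrow> dist y x < d \<Longrightarrow> dist (?D \<nu> j y) (?D \<nu> j x) < \<eta>"
      using eta(1) unfolding uniformly_continuous_on_def by metis
    obtain \<delta>1 where \<delta>1: "\<delta>1 > 0" "\<And>h x. \<forall>j. 0 < h $ j \<Longrightarrow> norm h < \<delta>1 \<Longrightarrow> x \<in> C \<Longrightarrow>
      \<bar>(\<integral>u. K u * f (x - restr J (scale h u)) \<partial>lborel) - f x - kappa \<nu> Kt / fact \<nu> * (\<Sum>k\<in>J. (h $ k) ^ \<nu> * ?D \<nu> k x)\<bar> \<le> e / 2 * norm h ^ \<nu>"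
      using insert.IH[of "e / 2"] insert.prems by auto
    define \<delta> where "\<delta> = min \<delta>1 (min d 1 / (R + 1))"
    show ?case
    proof (rule exI[of _ \<delta>], intro conjI allI impI ballI)
      show "0 < \<delta>" using \<delta>1 d R by (simp add: \<delta>_def)
      fix h :: "real^'d" and x assume h: "\<forall>j. 0 < h $ j" "norm h < \<delta>" and x: "x \<in> C"
      define Z where "Z u = x - restr J (scale h u)" for u
      have Zm [measurable]: "Z \<in> borel_measurable borel" unfolding Z_def by measurable
      have Z_ins: "x - restr (insert j J) (scale h u) = Z u + (- h $ j * u $ j) *\<^sub>R axis j 1" for u
        using insert.hyps by (auto simp: Z_def restr_def scale_def vec_eq_iff axis_def)
      have Z_indep: "Z (vinsert j p s) = Z (vinsert j p t)" for p s t
        using insert.hyps by (auto simp: Z_def restr_def scale_def vec_eq_iff)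
      define y where "y u = - h $ j * u $ j" for u :: "real^'d"
      \<comment> \<open>The top-order term that is subtracted is evaluated at \<open>x\<close>
        itself, so that its kernel average is exactly the j-th summand of the bias.\<close>
      define Rm where "Rm u = f (Z u + y u *\<^sub>R axis j 1) - (\<Sum>m<\<nu>. ?D m j (Z u) / fact m * y u ^ m) - ?D \<nu> j x / fact \<nu> * y u ^ \<nu>" for u
      have pt: "\<bar>Rm u\<bar> \<le> (h $ j) ^ \<nu> / fact \<nu> * (\<bar>u $ j\<bar> ^ \<nu> * (\<eta> + 2 * B * indicator {u. R < norm u} u))" for u
      proof -
        obtain \<theta> where \<theta>: "\<bar>\<theta>\<bar> \<le> \<bar>y u\<bar>" "f (Z u + y u *\<^sub>R axis j 1) =
           (\<Sum>m<\<nu>. ?D m j (Z u) / fact m * y u ^ m) + ?D \<nu> j (Z u + \<theta> *\<^sub>R axis j 1) / fact \<nu> * y u ^ \<nu>"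
          by (rule taylor_line[OF f])
        let ?w = "Z u + \<theta> *\<^sub>R axis j 1"
        have Rm: "Rm u = (?D \<nu> j ?w - ?D \<nu> j x) / fact \<nu> * y u ^ \<nu>"
          unfolding Rm_def \<theta>(2) by (simp add: diff_divide_distrib left_diff_distrib)
        have dw: "norm (?w - x) \<le> norm h * norm u"
        proof -
          have "norm (?w - x) \<le> norm (scale h u)"
          proof (rule norm_le_componentwise_cart)
            fix k
            show "norm ((?w - x) $ k) \<le> norm (scale h u $ k)"
              using \<theta>(1) insert.hyps by (auto simp: Z_def restr_def axis_def y_def scale_def)
          qed
          then show ?thesis using norm_scale_le order_trans by blast
        qed
        have "\<bar>?D \<nu> j ?w - ?D \<nu> j x\<bar> \<le> \<eta> + 2 * B * indicator {u. R < norm u} u"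
        proof (cases "R < norm u")
          case True
          have "\<bar>?D \<nu> j ?w - ?D \<nu> j x\<bar> \<le> \<bar>?D \<nu> j ?w\<bar> + \<bar>?D \<nu> j x\<bar>" by simp
          also have "\<dots> \<le> B + B" by (intro add_mono B)
          finally show ?thesis using True eta(1) by simp
        next
          case False
          have "norm h * norm u \<le> norm h * R" using False by (intro mult_left_mono) auto
          also have "\<dots> \<le> norm h * (R + 1)" by (intro mult_left_mono) auto
          also have "\<dots> < min d 1" using h(2) R(1) by (simp add: \<delta>_def pos_less_divide_eq)
          finally have w: "norm (?w - x) < min d 1" using dw by linarith
          have "?w = x + (?w - x)" "?w - x \<in> cball 0 1" using w by auto
          then have "?w \<in> C'" unfolding C'_def using x by blast
          moreover have "x = x + 0" "(0::real^'d) \<in> cball 0 1" by auto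
          then have "x \<in> C'" unfolding C'_def using x by blast
          ultimately show ?thesis using d(2)[of x ?w] w False by (simp add: dist_norm)
        qed
        then have "\<bar>?D \<nu> j ?w - ?D \<nu> j x\<bar> / fact \<nu> * \<bar>y u\<bar> ^ \<nu> \<le> (\<eta> + 2 * B * indicator {u. R < norm u} u) / fact \<nu> * \<bar>y u\<bar> ^ \<nu>"
          by (intro mult_right_mono divide_right_mono) auto
        moreover have "\<bar>y u\<bar> ^ \<nu> = (h $ j) ^ \<nu> * \<bar>u $ j\<bar> ^ \<nu>"
          using h(1) by (simp add: y_def abs_mult power_mult_distrib less_imp_le)
        ultimately show ?thesis unfolding Rm by (simp add: abs_mult power_abs mult_ac)
      qed
      have Gint: "integrable lborel (\<lambda>u. K u * (u $ j) ^ m * ?D m j (Z u))" if m: "m < \<nu>" for m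
      proof -
        obtain Bm where Bm: "\<And>x. \<bar>?D m j x\<bar> \<le> Bm" using D_bdd[of m j] m by auto
        have [measurable]: "?D m j \<in> borel_measurable borel" using m by (intro D_meas) simp
        have "(\<lambda>u. ?D m j (Z u)) \<in> borel_measurable borel" by measurable
        then show ?thesis using m Bm by (intro K_moment_times_int[where B = Bm]) auto
      qed
      \<comment> \<open>\<open>Z u\<close> does not involve u $ j, so the moment in coordinate
        \<open>j\<close> factors out; it vanishes for 1 \<le> m < \<nu>.\<close>
      have Gval: "(\<integral>u. K u * (u $ j) ^ m * ?D m j (Z u) \<partial>lborel) = (if m = 0 then \<integral>u. K u * f (Z u) \<partial>lborel else 0)" if m: "m < \<nu>" for m
      proof (cases "m = 0")
        case False
        obtain Bm where Bm: "\<And>x. \<bar>?D m j x\<bar> \<le> Bm" using D_bdd[of m j] m by auto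
        have [measurable]: "?D m j \<in> borel_measurable borel" using m by (intro D_meas) simp
        have "(\<integral>u. K u * (u $ j) ^ m * ?D m j (Z u) \<partial>lborel) = (\<integral>t. t ^ m * Kt t \<partial>lborel) * (\<integral>u. K u * ?D m j (Z u) \<partial>lborel)"
        proof (rule K_moment[where B = Bm])
          show "?D m j (Z (vinsert j p s)) = ?D m j (Z (vinsert j p t))" for p s t by (rule arg_cong[OF Z_indep])
        qed (use m Bm in auto)
        then show ?thesis using Kt_int(4)[of m] m False by simp
      qed (simp add: f0)
      obtain B0 where B0: "\<And>x. \<bar>f x\<bar> \<le> B0" using D_bdd[of 0 j] by (auto simp: f0)
      have Fint: "integrable lborel (\<lambda>u. K u * f (Z u + y u *\<^sub>R axis j 1))"
      proof -
        have [measurable]: "y \<in> borel_measurable borel" unfolding y_def by measurable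
        have "(\<lambda>u. f (Z u + y u *\<^sub>R axis j 1)) \<in> borel_measurable borel" by measurable
        from K_moment_times_int[OF _ this, of 0 B0 j] B0 show ?thesis by simp
      qed
      have polyint: "integrable lborel (\<lambda>u. (- h $ j) ^ m / fact m * (K u * (u $ j) ^ m * ?D m j (Z u)))" if "m < \<nu>" for m
        using Gint[OF that] by simp
      have nuint: "integrable lborel (\<lambda>u. ?D \<nu> j x / fact \<nu> * (- h $ j) ^ \<nu> * (K u * (u $ j) ^ \<nu>))"
        using K_moment_int[of \<nu> j] by simp
      have KR: "K u * Rm u = K u * f (Z u + y u *\<^sub>R axis j 1) - (\<Sum>m<\<nu>. (- h $ j) ^ m / fact m * (K u * (u $ j) ^ m * ?D m j (Z u)))
          - ?D \<nu> j x / fact \<nu> * (- h $ j) ^ \<nu> * (K u * (u $ j) ^ \<nu>)" for u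
        unfolding Rm_def y_def right_diff_distrib sum_distrib_left power_mult_distrib
        by (simp add: mult_ac)
      have KRint: "integrable lborel (\<lambda>u. K u * Rm u)"
        unfolding KR using Fint polyint nuint by (intro Bochner_Integration.integrable_diff Bochner_Integration.integrable_sum) auto
      have sumint: "integrable lborel (\<lambda>u. \<Sum>m<\<nu>. (- h $ j) ^ m / fact m * (K u * (u $ j) ^ m * ?D m j (Z u)))"
        using polyint by (intro Bochner_Integration.integrable_sum) auto
      have sumval: "(\<integral>u. (\<Sum>m<\<nu>. (- h $ j) ^ m / fact m * (K u * (u $ j) ^ m * ?D m j (Z u))) \<partial>lborel) =
          (\<Sum>m<\<nu>. (- h $ j) ^ m / fact m * (\<integral>u. K u * (u $ j) ^ m * ?D m j (Z u) \<partial>lborel))"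
        using polyint by (subst Bochner_Integration.integral_sum) (auto simp del: times_divide_eq_left intro!: sum.cong)
      have "(\<integral>u. K u * Rm u \<partial>lborel) = (\<integral>u. K u * f (Z u + y u *\<^sub>R axis j 1) \<partial>lborel)
          - (\<Sum>m<\<nu>. (- h $ j) ^ m / fact m * (\<integral>u. K u * (u $ j) ^ m * ?D m j (Z u) \<partial>lborel))
          - ?D \<nu> j x / fact \<nu> * (- h $ j) ^ \<nu> * (\<integral>u. K u * (u $ j) ^ \<nu> \<partial>lborel)"
        unfolding KR
        by (simp only: Bochner_Integration.integral_diff[OF Bochner_Integration.integrable_diff[OF Fint sumint] nuint]
            Bochner_Integration.integral_diff[OF Fint sumint] sumval integral_mult_right_zero)
      also have "(\<Sum>m<\<nu>. (- h $ j) ^ m / fact m * (\<integral>u. K u * (u $ j) ^ m * ?D m j (Z u) \<partial>lborel)) = (\<Sum>m<\<nu>. if m = 0 then \<integral>u. K u * f (Z u) \<partial>lborel else 0)"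
        by (intro sum.cong) (auto simp: Gval)
      also have "\<dots> = (\<integral>u. K u * f (Z u) \<partial>lborel)" using nu by simp
      also have "?D \<nu> j x / fact \<nu> * (- h $ j) ^ \<nu> * (\<integral>u. K u * (u $ j) ^ \<nu> \<partial>lborel) = kappa \<nu> Kt / fact \<nu> * ((h $ j) ^ \<nu> * ?D \<nu> j x)"
      proof -
        have "(- h $ j) ^ \<nu> * kappa \<nu> Kt = (h $ j) ^ \<nu> * kappa \<nu> Kt"
        proof -
          have "(- h $ j) ^ \<nu> * kappa \<nu> Kt = (h $ j) ^ \<nu> * ((-1) ^ \<nu> * kappa \<nu> Kt)"
            by (simp add: power_minus[of "h $ j"] mult_ac)
          then show ?thesis by (simp only: kappa_sign)
        qed
        then show ?thesis by (simp add: K_moment_nu)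
      qed
      finally have diff: "(\<integral>u. K u * f (Z u + y u *\<^sub>R axis j 1) \<partial>lborel) - (\<integral>u. K u * f (Z u) \<partial>lborel)
          - kappa \<nu> Kt / fact \<nu> * ((h $ j) ^ \<nu> * ?D \<nu> j x) = (\<integral>u. K u * Rm u \<partial>lborel)" by simp
      have small: "\<bar>\<integral>u. K u * Rm u \<partial>lborel\<bar> \<le> e / 2 * norm h ^ \<nu>"
      proof -
        have [measurable]: "{u::real^'d. R < norm u} \<in> sets borel" by measurable
        have Vint: "integrable lborel (\<lambda>u. \<bar>K u * (u $ j) ^ \<nu>\<bar>)" using K_moment_int[of \<nu> j] by simp
        have VRint: "integrable lborel (\<lambda>u. \<bar>K u * (u $ j) ^ \<nu>\<bar> * indicator {u. R < norm u} u)"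
          by (rule Bochner_Integration.integrable_bound[OF Vint]) (auto simp: indicator_def)
        have "\<bar>\<integral>u. K u * Rm u \<partial>lborel\<bar> \<le> (\<integral>u. \<bar>K u * Rm u\<bar> \<partial>lborel)"
          using integral_norm_bound[of lborel "\<lambda>u. K u * Rm u"] by simp
        also have "\<dots> \<le> (\<integral>u. (h $ j) ^ \<nu> / fact \<nu> * (\<eta> * \<bar>K u * (u $ j) ^ \<nu>\<bar> + 2 * B * (\<bar>K u * (u $ j) ^ \<nu>\<bar> * indicator {u. R < norm u} u)) \<partial>lborel)"
        proof (rule integral_mono)
          fix u
          have "\<bar>K u\<bar> * \<bar>Rm u\<bar> \<le> \<bar>K u\<bar> * ((h $ j) ^ \<nu> / fact \<nu> * (\<bar>u $ j\<bar> ^ \<nu> * (\<eta> + 2 * B * indicator {u. R < norm u} u)))"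
            by (intro mult_left_mono pt) simp
          then show "\<bar>K u * Rm u\<bar> \<le> (h $ j) ^ \<nu> / fact \<nu> * (\<eta> * \<bar>K u * (u $ j) ^ \<nu>\<bar> + 2 * B * (\<bar>K u * (u $ j) ^ \<nu>\<bar> * indicator {u. R < norm u} u))"
            by (simp add: abs_mult power_abs algebra_simps)
        qed (use KRint Vint VRint in auto)
        also have "\<dots> = (h $ j) ^ \<nu> / fact \<nu> * (\<eta> * V + 2 * B * (\<integral>u. \<bar>K u * (u $ j) ^ \<nu>\<bar> * indicator {u. R < norm u} u \<partial>lborel))"
          using Vint VRint by (simp add: V_def)
        also have "\<dots> \<le> norm h ^ \<nu> * (\<eta> * V + 2 * B * \<eta>)"
        proof (rule mult_mono)
          have "(h $ j) ^ \<nu> / fact \<nu> \<le> (h $ j) ^ \<nu> / 1" using h(1) by (intro divide_left_mono) (auto simp: less_imp_le fact_ge_1)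
          also have "\<dots> \<le> norm h ^ \<nu>" using h(1) component_le_norm_cart[of h j] by (simp, intro power_mono) (auto simp: less_imp_le)
          finally show "(h $ j) ^ \<nu> / fact \<nu> \<le> norm h ^ \<nu>" .
          show "\<eta> * V + 2 * B * (\<integral>u. \<bar>K u * (u $ j) ^ \<nu>\<bar> * indicator {u. R < norm u} u \<partial>lborel) \<le> \<eta> * V + 2 * B * \<eta>"
            using R(2) B(1) by (intro add_left_mono mult_left_mono) auto
        qed (use eta V B in \<open>auto intro!: add_nonneg_nonneg mult_nonneg_nonneg\<close>)
        also have "\<dots> \<le> norm h ^ \<nu> * (e / 2)" using eta(2) by (intro mult_left_mono) auto
        finally show ?thesis by (simp add: mult.commute)
      qed
      have IH: "\<bar>(\<integral>u. K u * f (Z u) \<partial>lborel) - f x - kappa \<nu> Kt / fact \<nu> * (\<Sum>k\<in>J. (h $ k) ^ \<nu> * ?D \<nu> k x)\<bar> \<le> e / 2 * norm h ^ \<nu>"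
        using \<delta>1(2)[of h x] h x unfolding Z_def \<delta>_def by simp
      have goal_eq: "(\<integral>u. K u * f (x - restr (insert j J) (scale h u)) \<partial>lborel) - f x - kappa \<nu> Kt / fact \<nu> * (\<Sum>k\<in>insert j J. (h $ k) ^ \<nu> * ?D \<nu> k x) =
         (\<integral>u. K u * Rm u \<partial>lborel) + ((\<integral>u. K u * f (Z u) \<partial>lborel) - f x - kappa \<nu> Kt / fact \<nu> * (\<Sum>k\<in>J. (h $ k) ^ \<nu> * ?D \<nu> k x))"
        unfolding diff[symmetric] Z_ins y_def[symmetric] using insert.hyps by (simp add: distrib_left)
      show "\<bar>(\<integral>u. K u * f (x - restr (insert j J) (scale h u)) \<partial>lborel) - f x - kappa \<nu> Kt / fact \<nu> * (\<Sum>k\<in>insert j J. (h $ k) ^ \<nu> * ?D \<nu> k x)\<bar> \<le> e * norm h ^ \<nu>"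
        unfolding goal_eq using small IH by linarith
    qed
  qed
  have "restr UNIV v = v" for v :: "real^'d" by (simp add: restr_def vec_eq_iff)
  then show ?thesis using main[of UNIV e] e by (simp add: bias_beta_def)
qed

end

subsection \<open>Fluctuations\<close>

text \<open>The substitution y = x - scale h u is affine with diagonal linear part; the absolute
  value of its determinant is the product of the bandwidths.\<close>

lemma lborel_inv_scale:
  fixes h x :: "real^'d::finite"
  assumes h: "\<And>j. 0 < h $ j"
  shows "(lborel :: (real^'d) measure) =
    density (distr lborel borel (\<lambda>u. x - scale h u)) (\<lambda>_. ennreal (\<Prod>j\<in>UNIV. h $ j))"
proof -
  have T: "x + (\<Sum>b\<in>Basis. ((- (h \<bullet> b)) * (u \<bullet> b)) *\<^sub>R b) = x - scale h u" for u
  proof -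
    have "(\<Sum>b\<in>Basis. ((- (h \<bullet> b)) * (u \<bullet> b)) *\<^sub>R b) = (\<Sum>k\<in>UNIV. (- (h $ k * u $ k)) *\<^sub>R (axis k 1 :: real^'d))"
      by (subst Basis_vec_def) (simp add: UNION_singleton_eq_range sum.reindex inj_on_def axis_eq_axis inner_axis)
    also have "\<dots> = - scale h u"
      by (auto simp: vec_eq_iff scale_def axis_def sum_negf sum.If_cases if_distrib[of "\<lambda>t. _ * t"] cong: if_cong)
    finally show ?thesis by simp
  qed
  have p: "(\<Prod>b\<in>Basis. \<bar>- (h \<bullet> b)\<bar>) = (\<Prod>j\<in>UNIV. h $ j)"
    using h by (subst Basis_vec_def) (simp add: UNION_singleton_eq_range prod.reindex inj_on_def axis_eq_axis inner_axis less_imp_le)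
  have nz: "- (h \<bullet> b) \<noteq> 0" if b: "b \<in> Basis" for b :: "real^'d"
  proof -
    obtain k where "b = axis k 1" using b by (auto simp: Basis_vec_def)
    then show ?thesis using h[of k] by (simp add: inner_axis)
  qed
  from lborel_affine_euclidean[of "\<lambda>b. - (h \<bullet> b)" x, OF nz] show ?thesis unfolding T p by simp
qed

lemma inv_scale_diff:
  assumes "\<And>j. 0 < h $ j"
  shows "inv_scale h (x - (x - scale h u)) = u"
proof -
  have "inverse (h $ j) * (h $ j * u $ j) = u $ j" for j using assms[of j] by simp
  then show ?thesis by (simp add: inv_scale_def scale_def vec_eq_iff)
qed

lemma continuous_on_inv_scale [continuous_intros]:
  "continuous_on S f \<Longrightarrow> continuous_on S (\<lambda>x. inv_scale h (f x))"
  unfolding inv_scale_def by (intro continuous_on_vec_lambda continuous_intros)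

lemma borel_measurable_scale [measurable]: "scale h \<in> borel_measurable borel"
  by (intro borel_measurable_continuous_onI continuous_intros)

lemma integral_inv_scale:
  fixes \<phi> f :: "real^'d::finite \<Rightarrow> real"
  assumes h: "\<And>j. 0 < h $ j" and [measurable]: "\<phi> \<in> borel_measurable borel" "f \<in> borel_measurable borel"
  shows "(\<integral>y. f y * \<phi> (inv_scale h (x - y)) \<partial>lborel) = (\<Prod>j\<in>UNIV. h $ j) * (\<integral>u. \<phi> u * f (x - scale h u) \<partial>lborel)"
proof -
  have [measurable]: "(\<lambda>y. inv_scale h (x - y)) \<in> borel_measurable borel"
    by (intro borel_measurable_continuous_onI continuous_intros)
  have T [measurable]: "(\<lambda>u. x - scale h u) \<in> borel_measurable borel"
    by (intro borel_measurable_continuous_onI continuous_intros)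
  have p: "0 \<le> (\<Prod>j\<in>UNIV. h $ j)" using h by (intro prod_nonneg) (simp add: less_imp_le)
  have "(\<integral>y. f y * \<phi> (inv_scale h (x - y)) \<partial>lborel) =
      (\<integral>y. (\<Prod>j\<in>UNIV. h $ j) *\<^sub>R (f y * \<phi> (inv_scale h (x - y))) \<partial>distr lborel borel (\<lambda>u. x - scale h u))"
    by (subst lborel_inv_scale[OF h, of x], rule integral_density) (use p in auto)
  also have "\<dots> = (\<integral>u. (\<Prod>j\<in>UNIV. h $ j) *\<^sub>R (f (x - scale h u) * \<phi> (inv_scale h (x - (x - scale h u)))) \<partial>lborel)"
    by (rule integral_distr) auto
  also have "\<dots> = (\<Prod>j\<in>UNIV. h $ j) * (\<integral>u. \<phi> u * f (x - scale h u) \<partial>lborel)"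
    by (simp only: inv_scale_diff[OF h] real_scaleR_def integral_mult_right_zero mult.commute[of "f _"])
  finally show ?thesis .
qed

lemma (in prob_space) second_moment_iid_sum:
  fixes Y :: "nat \<Rightarrow> 'a \<Rightarrow> real"
  assumes indep: "indep_vars (\<lambda>_. borel) Y UNIV" and mean: "\<And>i. expectation (Y i) = 0"
    and bdd: "\<And>i x. \<bar>Y i x\<bar> \<le> b" and v: "\<And>i. expectation (\<lambda>x. (Y i x)\<^sup>2) = v"
  shows "expectation (\<lambda>x. (\<Sum>i<n. Y i x)\<^sup>2) = real n * v"
proof (induction n)
  case (Suc n)
  have [measurable]: "random_variable borel (Y i)" for i using indep unfolding indep_vars_def2 by simp
  have intY: "integrable M (Y i)" for i by (rule integrable_const_bound[of _ b]) (use bdd in auto)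
  have sb: "\<bar>\<Sum>i<n. Y i x\<bar> \<le> real n * b" for x n
  proof -
    have "\<bar>\<Sum>i<n. Y i x\<bar> \<le> (\<Sum>i<n. \<bar>Y i x\<bar>)" by (rule sum_abs)
    also have "\<dots> \<le> (\<Sum>i<n. b)" by (intro sum_mono bdd)
    finally show ?thesis by simp
  qed
  have sq: "integrable M (\<lambda>x. (f x)\<^sup>2)" if "\<And>x. \<bar>f x\<bar> \<le> a" "random_variable borel f" for f :: "'a \<Rightarrow> real" and a
  proof (rule integrable_const_bound[of _ "a\<^sup>2"])
    show "AE x in M. norm ((f x)\<^sup>2) \<le> a\<^sup>2"
    proof (rule AE_I2)
      fix x
      have "\<bar>f x\<bar>\<^sup>2 \<le> a\<^sup>2" using that(1)[of x] by (intro power_mono) auto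
      then show "norm ((f x)\<^sup>2) \<le> a\<^sup>2" by simp
    qed
  qed (use that in measurable)
  have intS: "integrable M (\<lambda>x. \<Sum>i<n. Y i x)" using intY by auto
  have "indep_var borel (Y n) borel (\<lambda>x. \<Sum>i\<in>{..<n}. Y i x)"
    by (rule indep_vars_sum) (auto intro: indep_vars_subset[OF indep])
  from indep_var_lebesgue_integral[OF this intY intS] indep_var_integrable[OF this intY intS]
  have cross: "expectation (\<lambda>x. Y n x * (\<Sum>i<n. Y i x)) = 0" "integrable M (\<lambda>x. Y n x * (\<Sum>i<n. Y i x))"
    by (simp_all add: mean)
  have "(\<Sum>i<Suc n. Y i x)\<^sup>2 = (\<Sum>i<n. Y i x)\<^sup>2 + (2 * (Y n x * (\<Sum>i<n. Y i x)) + (Y n x)\<^sup>2)" for x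
    by (simp add: power2_sum mult_ac)
  then have "expectation (\<lambda>x. (\<Sum>i<Suc n. Y i x)\<^sup>2) = expectation (\<lambda>x. (\<Sum>i<n. Y i x)\<^sup>2) + (2 * 0 + v)"
    using sq[OF sb] sq[OF bdd] cross by (simp add: v)
  then show ?case using Suc by (simp add: distrib_right)
qed simp

abbreviation "\<Phi>N \<equiv> cdf std_normal_distribution"

lemma isCont_Phi: "isCont \<Phi>N x"
proof -
  interpret N: real_distribution std_normal_distribution by (rule real_dist_normal_dist)
  have "emeasure std_normal_distribution {x} = (\<integral>\<^sup>+y. ennreal (std_normal_density y) * indicator {x} y \<partial>lborel)"
    by (rule emeasure_density) auto
  also have "\<dots> = (\<integral>\<^sup>+y. 0 \<partial>(lborel :: real measure))"
    by (rule nn_integral_cong_AE) (use AE_lborel_singleton[of x] in \<open>eventually_elim, auto\<close>)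
  finally show ?thesis unfolding N.isCont_cdf by (simp add: measure_def)
qed

section \<open>Mean, variance and asymptotic normality of the estimator\<close>

locale kde_sample = product_kernel K Kt \<nu> + prob_space P
  for K :: "real^'d::finite \<Rightarrow> real" and Kt \<nu> and P :: "'w measure" +
  fixes X :: "nat \<Rightarrow> 'w \<Rightarrow> real^'d" and f :: "real^'d \<Rightarrow> real" and c :: real and h :: "nat \<Rightarrow> real^'d"
    and B Bf Lf :: real
  assumes indep: "indep_vars (\<lambda>_. borel) X UNIV"
    and f_nonneg: "\<And>x. 0 \<le> f x"
    and density: "\<And>i. distributed P lborel (X i) (\<lambda>x. ennreal (f x))"
    and K_bdd: "\<And>u. \<bar>K u\<bar> \<le> B"
    and f_bdd: "\<And>x. f x \<le> Bf" and f_lip: "\<And>x y. \<bar>f x - f y\<bar> \<le> Lf * norm (x - y)" and Lf: "0 \<le> Lf"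
    and c_pos: "0 < c"
    and h_pos: "\<And>n j. 0 < h n $ j"
    and h_lim: "(\<lambda>n. norm (h n)) \<longlonglongrightarrow> 0"
    and N_lim: "LIM n sequentially. real n * (\<Prod>j\<in>UNIV. h n $ j) :> at_top"
begin

definition "vol n = (\<Prod>j\<in>UNIV. h n $ j)"
definition "\<kappa>2 = (\<integral>u. (K u)\<^sup>2 \<partial>lborel)"
definition "sd n = s_dev c K (h n) n"
definition "fh n x \<omega> = kde K (h n) n (\<lambda>i. X i \<omega>) x"
text \<open>The expectation of the estimator after the substitution y = x - scale (h n) u. Likewise
  \<open>msq n x\<close> is the second moment of a single kernel term divided by
  \<open>vol n\<close>, so that msq n x / (n * vol n) bounds the variance of the estimator.\<close>

definition "mean n x = (\<integral>u. K u * f (x - scale (h n) u) \<partial>lborel)"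
definition "msq n x = (\<integral>u. (K u)\<^sup>2 * f (x - scale (h n) u) \<partial>lborel)"

lemma B_nonneg: "0 \<le> B" using K_bdd[of 0] by linarith

lemma vol_pos: "0 < vol n" unfolding vol_def using h_pos by (intro prod_pos) auto

lemma f_cont: "continuous_on UNIV f"
  using f_lip Lf by (intro lipschitz_on_continuous_on[of Lf] lipschitz_onI) (auto simp: dist_norm)

lemma f_meas [measurable]: "f \<in> borel_measurable borel" using f_cont by (rule borel_measurable_continuous_onI)

lemma X_meas [measurable]: "X i \<in> borel_measurable P" using indep unfolding indep_vars_def2 by simp

lemma Ksq_int: "integrable lborel (\<lambda>u. (K u)\<^sup>2)"
proof (rule Bochner_Integration.integrable_bound[OF integrable_mult_right[OF K_L1, of B]])
  show "AE u in lborel. norm ((K u)\<^sup>2) \<le> norm (B * K u)"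
  proof (rule AE_I2)
    fix u
    have "\<bar>K u\<bar> * \<bar>K u\<bar> \<le> B * \<bar>K u\<bar>" using K_bdd by (intro mult_right_mono) auto
    then show "norm ((K u)\<^sup>2) \<le> norm (B * K u)" using B_nonneg by (simp add: power2_eq_square abs_mult)
  qed
qed auto

text \<open>A kernel of zero L2 norm would vanish almost everywhere, against its integral 1.\<close>

lemma \<kappa>2_pos: "0 < \<kappa>2"
proof (rule ccontr)
  assume "\<not> 0 < \<kappa>2"
  moreover have "0 \<le> \<kappa>2" by (simp add: \<kappa>2_def)
  ultimately have "\<kappa>2 = 0" by simp
  then have "AE u in lborel. (K u)\<^sup>2 = 0"
    unfolding \<kappa>2_def using integral_nonneg_eq_0_iff_AE[OF Ksq_int] by simp
  then have "AE u in lborel. K u = 0" by (rule AE_mp) (rule AE_I2, simp)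
  then have "(\<integral>u. K u \<partial>lborel) = (\<integral>(u::real^'d). 0 \<partial>lborel)" by (intro integral_cong_AE) auto
  then show False using K_one by simp
qed

lemma sd_sq: "(sd n)\<^sup>2 = c * \<kappa>2 / (real n * vol n)" "0 \<le> sd n"
proof -
  have "0 \<le> c * \<kappa>2 / (real n * vol n)" using c_pos \<kappa>2_pos vol_pos[of n] by (intro divide_nonneg_nonneg) auto
  then show "(sd n)\<^sup>2 = c * \<kappa>2 / (real n * vol n)" "0 \<le> sd n"
    unfolding sd_def s_dev_def \<kappa>2_def[symmetric] vol_def[symmetric] by auto
qed

lemma sd_pos: "0 < n \<Longrightarrow> 0 < sd n"
proof -
  assume "0 < n"
  then have "0 < (sd n)\<^sup>2" unfolding sd_sq using c_pos \<kappa>2_pos vol_pos[of n] by simp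
  then show ?thesis using sd_sq(2)[of n] by (simp add: less_le)
qed

lemma expectation_kernel:
  assumes [measurable]: "\<phi> \<in> borel_measurable borel"
  shows "expectation (\<lambda>\<omega>. \<phi> (inv_scale (h n) (x - X i \<omega>))) = vol n * (\<integral>u. \<phi> u * f (x - scale (h n) u) \<partial>lborel)"
proof -
  have [measurable]: "(\<lambda>y. inv_scale (h n) (x - y)) \<in> borel_measurable borel"
    by (intro borel_measurable_continuous_onI continuous_intros)
  have "expectation (\<lambda>\<omega>. \<phi> (inv_scale (h n) (x - X i \<omega>))) = (\<integral>y. f y * \<phi> (inv_scale (h n) (x - y)) \<partial>lborel)"
    by (rule distributed_integral[OF density, symmetric]) (auto simp: f_nonneg)
  then show ?thesis unfolding vol_def by (simp add: integral_inv_scale[OF h_pos])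
qed

definition "Y n x i \<omega> = K (inv_scale (h n) (x - X i \<omega>)) - vol n * mean n x"

lemma inv_scale_meas [measurable]: "(\<lambda>y. inv_scale (h n) (x - y)) \<in> borel_measurable borel"
  by (intro borel_measurable_continuous_onI continuous_intros)

lemma Y_meas [measurable]: "Y n x i \<in> borel_measurable P"
  unfolding Y_def by measurable

lemma K_shift_int: "integrable P (\<lambda>\<omega>. K (inv_scale (h n) (x - X i \<omega>)))"
  "integrable P (\<lambda>\<omega>. (K (inv_scale (h n) (x - X i \<omega>)))\<^sup>2)"
proof -
  show "integrable P (\<lambda>\<omega>. K (inv_scale (h n) (x - X i \<omega>)))"
    by (rule integrable_const_bound[of _ B]) (use K_bdd in auto)
  have "(K u)\<^sup>2 \<le> B\<^sup>2" for u using power_mono[OF K_bdd[of u], of 2] by simp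
  then show "integrable P (\<lambda>\<omega>. (K (inv_scale (h n) (x - X i \<omega>)))\<^sup>2)"
    by (intro integrable_const_bound[of _ "B\<^sup>2"]) auto
qed

lemma Y_mean: "expectation (Y n x i) = 0"
  unfolding Y_def using K_shift_int(1)[of n x i] expectation_kernel[of K n x i]
  by (simp add: prob_space mean_def)

lemma mean_bound: "\<bar>vol n * mean n x\<bar> \<le> B"
proof -
  have "\<bar>expectation (\<lambda>\<omega>. K (inv_scale (h n) (x - X 0 \<omega>)))\<bar> \<le> expectation (\<lambda>\<omega>. \<bar>K (inv_scale (h n) (x - X 0 \<omega>))\<bar>)"
    using integral_norm_bound[of P "\<lambda>\<omega>. K (inv_scale (h n) (x - X 0 \<omega>))"] by simp
  also have "\<dots> \<le> expectation (\<lambda>\<omega>. B)"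
    using K_shift_int(1)[of n x 0] K_bdd by (intro integral_mono) auto
  finally show ?thesis using expectation_kernel[of K n x 0] by (simp add: prob_space mean_def)
qed

lemma Y_bdd: "\<bar>Y n x i \<omega>\<bar> \<le> 2 * B"
  unfolding Y_def using K_bdd[of "inv_scale (h n) (x - X i \<omega>)"] mean_bound[of n x] by linarith

lemma Y_var: "expectation (\<lambda>\<omega>. (Y n x i \<omega>)\<^sup>2) = vol n * msq n x - (vol n * mean n x)\<^sup>2"
proof -
  have "expectation (\<lambda>\<omega>. K (inv_scale (h n) (x - X i \<omega>))) = vol n * mean n x"
    unfolding mean_def by (rule expectation_kernel) simp
  moreover have "expectation (\<lambda>\<omega>. (K (inv_scale (h n) (x - X i \<omega>)))\<^sup>2) = vol n * msq n x"
    unfolding msq_def by (rule expectation_kernel[of "\<lambda>u. (K u)\<^sup>2"]) simp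
  moreover have "(Y n x i \<omega>)\<^sup>2 = (K (inv_scale (h n) (x - X i \<omega>)))\<^sup>2
      - (2 * (vol n * mean n x)) * K (inv_scale (h n) (x - X i \<omega>)) + (vol n * mean n x)\<^sup>2" for \<omega>
    unfolding Y_def by (simp add: power2_diff)
  ultimately show ?thesis
    using K_shift_int[of n x i] by (simp add: prob_space) (simp add: power2_eq_square)
qed

lemma Y_indep: "indep_vars (\<lambda>_. borel) (Y n x) UNIV"
  unfolding Y_def by (rule indep_vars_compose2[OF indep]) measurable

lemma Y_distr: "distr P borel (Y n x i) = distr P borel (Y n x 0)"
proof -
  have "distr P lborel (X i) = distr P lborel (X 0)"
    using density[of i] density[of 0] by (simp add: distributed_distr_eq_density)
  then have "distr (distr P lborel (X i)) borel (\<lambda>y. K (inv_scale (h n) (x - y)) - vol n * mean n x) =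
     distr (distr P lborel (X 0)) borel (\<lambda>y. K (inv_scale (h n) (x - y)) - vol n * mean n x)" by simp
  then show ?thesis by (subst (asm) (1 2) distr_distr) (auto simp: Y_def[abs_def] comp_def)
qed

lemma fh_centered: "0 < n \<Longrightarrow> fh n x \<omega> - mean n x = (\<Sum>i<n. Y n x i \<omega>) / (real n * vol n)"
  unfolding fh_def kde_def Y_def vol_def[symmetric] using vol_pos[of n]
  by (simp add: sum_subtractf diff_divide_distrib)

lemma fh_meas [measurable]: "fh n x \<in> borel_measurable P"
  unfolding fh_def kde_def by measurable

lemma msq_nonneg: "0 \<le> msq n x"
  unfolding msq_def by (simp add: f_nonneg)

lemma fh_second_moment: "0 < n \<Longrightarrow> expectation (\<lambda>\<omega>. (fh n x \<omega> - mean n x)\<^sup>2) \<le> msq n x / (real n * vol n)"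
proof -
  assume n: "0 < n"
  have N: "0 < real n * vol n" using n vol_pos by simp
  have "expectation (\<lambda>\<omega>. (fh n x \<omega> - mean n x)\<^sup>2) = expectation (\<lambda>\<omega>. (\<Sum>i<n. Y n x i \<omega>)\<^sup>2) / (real n * vol n)\<^sup>2"
    by (simp add: fh_centered[OF n] power_divide)
  also have "\<dots> = real n * (vol n * msq n x - (vol n * mean n x)\<^sup>2) / (real n * vol n)\<^sup>2"
    by (subst second_moment_iid_sum[OF Y_indep Y_mean Y_bdd Y_var]) simp
  also have "\<dots> \<le> real n * (vol n * msq n x) / (real n * vol n)\<^sup>2"
    by (intro divide_right_mono mult_left_mono) auto
  also have "\<dots> = msq n x / (real n * vol n)" using N by (simp add: power2_eq_square)
  finally show ?thesis .
qed

lemma fh_chebyshev: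
  assumes n: "0 < n" and a: "0 < a"
  shows "prob {\<omega>\<in>space P. a \<le> \<bar>fh n x \<omega> - mean n x\<bar>} \<le> msq n x / (real n * vol n) / a\<^sup>2"
proof -
  have int: "integrable P (\<lambda>\<omega>. (fh n x \<omega> - mean n x)\<^sup>2)"
  proof (rule integrable_const_bound)
    show "AE \<omega> in P. norm ((fh n x \<omega> - mean n x)\<^sup>2) \<le> (real n * (2 * B) / (real n * vol n))\<^sup>2"
    proof (rule AE_I2)
      fix \<omega>
      have "\<bar>\<Sum>i<n. Y n x i \<omega>\<bar> \<le> (\<Sum>i<n. \<bar>Y n x i \<omega>\<bar>)" by (rule sum_abs)
      also have "\<dots> \<le> (\<Sum>i<n. 2 * B)" by (intro sum_mono Y_bdd)
      finally have "\<bar>\<Sum>i<n. Y n x i \<omega>\<bar> \<le> real n * (2 * B)" by simp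
      then have "\<bar>fh n x \<omega> - mean n x\<bar> \<le> real n * (2 * B) / (real n * vol n)"
      proof -
        assume S: "\<bar>\<Sum>i<n. Y n x i \<omega>\<bar> \<le> real n * (2 * B)"
        have "0 < real n * vol n" using n vol_pos[of n] by simp
        then show ?thesis using divide_right_mono[OF S, of "real n * vol n"]
          by (simp only: fh_centered[OF n] abs_divide abs_of_pos less_imp_le)
      qed
      then have "\<bar>fh n x \<omega> - mean n x\<bar>\<^sup>2 \<le> (real n * (2 * B) / (real n * vol n))\<^sup>2" by (intro power_mono) auto
      then show "norm ((fh n x \<omega> - mean n x)\<^sup>2) \<le> (real n * (2 * B) / (real n * vol n))\<^sup>2" by simp
    qed
  qed measurable
  have "prob {\<omega>\<in>space P. a \<le> \<bar>fh n x \<omega> - mean n x\<bar>} \<le> expectation (\<lambda>\<omega>. (fh n x \<omega> - mean n x)\<^sup>2) / a\<^sup>2"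
    by (rule second_moment_method[OF _ int a]) measurable
  also have "\<dots> \<le> msq n x / (real n * vol n) / a\<^sup>2"
    using fh_second_moment[OF n, of x] by (intro divide_right_mono) auto
  finally show ?thesis .
qed

lemma shift_int:
  assumes \<psi>: "integrable lborel \<psi>"
  shows "integrable lborel (\<lambda>u. \<psi> u * f (x - scale (h n) u))"
proof (rule Bochner_Integration.integrable_bound[OF integrable_mult_right[OF \<psi>, of Bf]])
  have Bf: "0 \<le> Bf" using f_nonneg f_bdd order_trans by blast
  show "AE u in lborel. norm (\<psi> u * f (x - scale (h n) u)) \<le> norm (Bf * \<psi> u)"
  proof (rule AE_I2)
    fix u
    have "\<bar>\<psi> u\<bar> * f (x - scale (h n) u) \<le> \<bar>\<psi> u\<bar> * Bf" by (intro mult_left_mono f_bdd) simp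
    then show "norm (\<psi> u * f (x - scale (h n) u)) \<le> norm (Bf * \<psi> u)"
      using f_nonneg Bf by (simp add: abs_mult mult.commute)
  qed
qed (use \<psi> in measurable)

text \<open>An approximate identity, uniform in \<open>x\<close>: the increment of \<open>f\<close>
  is at most 2 * Bf and at most Lf * norm (h n) * norm u. Neither bound involves \<open>x\<close>,
  and dominated convergence applies to the integral of their minimum.\<close>

lemma smoothing_limit:
  assumes \<psi>: "integrable lborel \<psi>"
  shows "\<exists>a. a \<longlonglongrightarrow> 0 \<and> (\<forall>n x. \<bar>(\<integral>u. \<psi> u * f (x - scale (h n) u) \<partial>lborel) - f x * (\<integral>u. \<psi> u \<partial>lborel)\<bar> \<le> a n)"
proof -
  have [measurable]: "\<psi> \<in> borel_measurable borel" using \<psi> by simp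
  have [measurable]: "(\<lambda>u. x - scale (h n) u) \<in> borel_measurable borel" for n x
    by (intro borel_measurable_continuous_onI continuous_intros)
  have Bf: "0 \<le> Bf" using f_nonneg f_bdd order_trans by blast
  define a where "a n = (\<integral>u. \<bar>\<psi> u\<bar> * min (2 * Bf) (Lf * (norm (h n) * norm u)) \<partial>lborel)" for n
  have w: "norm (\<bar>\<psi> u\<bar> * min (2 * Bf) (Lf * (norm (h n) * norm u))) \<le> 2 * Bf * \<bar>\<psi> u\<bar>" for u n
  proof -
    have "\<bar>\<psi> u\<bar> * min (2 * Bf) (Lf * (norm (h n) * norm u)) \<le> \<bar>\<psi> u\<bar> * (2 * Bf)" by (intro mult_left_mono) auto
    moreover have "0 \<le> \<bar>\<psi> u\<bar> * min (2 * Bf) (Lf * (norm (h n) * norm u))" using Bf Lf by (intro mult_nonneg_nonneg) auto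
    ultimately show ?thesis by (simp add: mult_ac)
  qed
  have w_int: "integrable lborel (\<lambda>u. 2 * Bf * \<bar>\<psi> u\<bar>)" using \<psi> by simp
  have a_int: "integrable lborel (\<lambda>u. \<bar>\<psi> u\<bar> * min (2 * Bf) (Lf * (norm (h n) * norm u)))" for n
    by (rule Bochner_Integration.integrable_bound[OF w_int]) (use w[of _ n] Bf in \<open>auto simp: abs_mult\<close>)
  have "a \<longlonglongrightarrow> (\<integral>(u::real^'d). 0 \<partial>lborel)"
    unfolding a_def
  proof (rule integral_dominated_convergence[OF _ _ w_int])
    show "AE u in lborel. (\<lambda>n. \<bar>\<psi> u\<bar> * min (2 * Bf) (Lf * (norm (h n) * norm u))) \<longlonglongrightarrow> 0"
    proof (rule AE_I2)
      fix u
      have "(\<lambda>n. \<bar>\<psi> u\<bar> * min (2 * Bf) (Lf * (norm (h n) * norm u))) \<longlonglongrightarrow> \<bar>\<psi> u\<bar> * min (2 * Bf) (Lf * (0 * norm u))"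
        by (intro tendsto_intros tendsto_min h_lim)
      moreover have "min (2 * Bf) (Lf * (0 * norm u)) = 0" using Bf by simp
      ultimately show "(\<lambda>n. \<bar>\<psi> u\<bar> * min (2 * Bf) (Lf * (norm (h n) * norm u))) \<longlonglongrightarrow> 0" by (simp only: mult_zero_right)
    qed
  qed (use w in auto)
  then have "a \<longlonglongrightarrow> 0" by simp
  moreover have "\<bar>(\<integral>u. \<psi> u * f (x - scale (h n) u) \<partial>lborel) - f x * (\<integral>u. \<psi> u \<partial>lborel)\<bar> \<le> a n" for n x
  proof -
    have fint: "integrable lborel (\<lambda>u. \<psi> u * f (x - scale (h n) u))"
      by (rule shift_int[OF \<psi>])
    have "(\<integral>u. \<psi> u * f (x - scale (h n) u) \<partial>lborel) - f x * (\<integral>u. \<psi> u \<partial>lborel) =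
        (\<integral>u. \<psi> u * (f (x - scale (h n) u) - f x) \<partial>lborel)"
      using fint \<psi> by (simp add: right_diff_distrib mult.commute)
    also have "\<bar>\<dots>\<bar> \<le> (\<integral>u. \<bar>\<psi> u * (f (x - scale (h n) u) - f x)\<bar> \<partial>lborel)"
      using integral_norm_bound[of lborel "\<lambda>u. \<psi> u * (f (x - scale (h n) u) - f x)"] by simp
    also have "\<dots> \<le> a n"
      unfolding a_def
    proof (rule integral_mono[OF _ a_int])
      show "integrable lborel (\<lambda>u. \<bar>\<psi> u * (f (x - scale (h n) u) - f x)\<bar>)"
        using fint \<psi> by (simp add: right_diff_distrib)
      fix u
      have "\<bar>f (x - scale (h n) u) - f x\<bar> \<le> Lf * norm (scale (h n) u)"
        using f_lip[of "x - scale (h n) u" x] by simp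
      also have "\<dots> \<le> Lf * (norm (h n) * norm u)" using Lf norm_scale_le by (intro mult_left_mono)
      finally have "\<bar>f (x - scale (h n) u) - f x\<bar> \<le> Lf * (norm (h n) * norm u)" .
      moreover have "\<bar>f (x - scale (h n) u) - f x\<bar> \<le> 2 * Bf"
        using f_bdd[of x] f_bdd[of "x - scale (h n) u"] f_nonneg[of x] f_nonneg[of "x - scale (h n) u"] by linarith
      ultimately show "\<bar>\<psi> u * (f (x - scale (h n) u) - f x)\<bar> \<le> \<bar>\<psi> u\<bar> * min (2 * Bf) (Lf * (norm (h n) * norm u))"
        by (simp add: abs_mult mult_left_mono)
    qed
    finally show ?thesis .
  qed
  ultimately show ?thesis by blast
qed

lemma mean_limit: "\<exists>a. a \<longlonglongrightarrow> 0 \<and> (\<forall>n x. \<bar>mean n x - f x\<bar> \<le> a n)"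
  using smoothing_limit[OF K_L1] unfolding mean_def K_one by simp

lemma msq_limit: "\<exists>a. a \<longlonglongrightarrow> 0 \<and> (\<forall>n x. \<bar>msq n x - f x * \<kappa>2\<bar> \<le> a n)"
  using smoothing_limit[OF Ksq_int] unfolding msq_def \<kappa>2_def by simp

lemma msq_le: "msq n x \<le> Bf * \<kappa>2"
proof -
  have [measurable]: "(\<lambda>u. x - scale (h n) u) \<in> borel_measurable borel"
    by (intro borel_measurable_continuous_onI continuous_intros)
  have Bf: "0 \<le> Bf" using f_nonneg f_bdd order_trans by blast
  have "integrable lborel (\<lambda>u. (K u)\<^sup>2 * f (x - scale (h n) u))"
    by (rule shift_int[OF Ksq_int])
  then have "msq n x \<le> (\<integral>u. (K u)\<^sup>2 * Bf \<partial>lborel)"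
    unfolding msq_def using Ksq_int f_bdd by (intro integral_mono) (auto intro!: mult_left_mono)
  then show ?thesis by (simp add: \<kappa>2_def mult.commute)
qed

text \<open>Tonelli and translation invariance, the density \<open>f\<close> having mass 1. This
  controls the region far from the level set when the weight is merely bounded.\<close>

lemma nn_integral_msq: "(\<integral>\<^sup>+x. ennreal (msq n x) \<partial>lborel) \<le> ennreal \<kappa>2"
proof -
  have tot: "(\<integral>\<^sup>+x. ennreal (f x) \<partial>lborel) = 1"
  proof -
    interpret D: prob_space "distr P lborel (X 0)" by (rule prob_space_distr) simp
    have "prob_space (density lborel (\<lambda>x. ennreal (f x)))"
      using D.prob_space_axioms density[of 0] by (simp add: distributed_distr_eq_density)
    from prob_space.emeasure_space_1[OF this] show ?thesis by (simp add: emeasure_density)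
  qed
  have "(\<integral>\<^sup>+x. ennreal (msq n x) \<partial>lborel) \<le> (\<integral>\<^sup>+x. \<integral>\<^sup>+u. ennreal ((K u)\<^sup>2) * ennreal (f (x - scale (h n) u)) \<partial>lborel \<partial>lborel)"
  proof (rule nn_integral_mono)
    fix x
    have "ennreal (msq n x) \<le> (\<integral>\<^sup>+u. ennreal (norm ((K u)\<^sup>2 * f (x - scale (h n) u))) \<partial>lborel)"
      using integral_norm_bound_ennreal[of lborel "\<lambda>u. (K u)\<^sup>2 * f (x - scale (h n) u)"] msq_nonneg[of n x]
      unfolding msq_def by (cases "integrable lborel (\<lambda>u. (K u)\<^sup>2 * f (x - scale (h n) u))") (auto simp: not_integrable_integral_eq)
    then show "ennreal (msq n x) \<le> (\<integral>\<^sup>+u. ennreal ((K u)\<^sup>2) * ennreal (f (x - scale (h n) u)) \<partial>lborel)"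
      using f_nonneg by (simp add: ennreal_mult'[symmetric] abs_mult)
  qed
  also have "\<dots> = (\<integral>\<^sup>+u. \<integral>\<^sup>+x. ennreal ((K u)\<^sup>2) * ennreal (f (x - scale (h n) u)) \<partial>lborel \<partial>lborel)"
    by (rule lborel_pair.Fubini') measurable
  also have "\<dots> = (\<integral>\<^sup>+u. ennreal ((K u)\<^sup>2) \<partial>lborel)"
  proof (rule nn_integral_cong)
    fix u
    have "(\<integral>\<^sup>+x. ennreal (f (x - scale (h n) u)) \<partial>lborel) = (\<integral>\<^sup>+x. ennreal (f x) \<partial>distr lborel borel ((+) (- scale (h n) u)))"
      by (subst nn_integral_distr) auto
    also have "\<dots> = 1" by (simp add: lborel_distr_plus tot)
    finally show "(\<integral>\<^sup>+x. ennreal ((K u)\<^sup>2) * ennreal (f (x - scale (h n) u)) \<partial>lborel) = ennreal ((K u)\<^sup>2)"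
      by (subst nn_integral_cmult) auto
  qed
  also have "\<dots> = ennreal \<kappa>2" unfolding \<kappa>2_def using Ksq_int by (intro nn_integral_eq_integral) auto
  finally show ?thesis .
qed

lemma vol_lim: "vol \<longlonglongrightarrow> 0"
proof -
  fix i :: 'd
  have "vol n \<le> norm (h n) ^ CARD('d)" for n
  proof -
    have "vol n \<le> (\<Prod>j\<in>(UNIV::'d set). norm (h n))"
      unfolding vol_def using h_pos component_le_norm_cart[of "h n"] by (intro prod_mono) (auto simp: less_imp_le intro: order_trans[OF abs_ge_self])
    then show ?thesis by simp
  qed
  moreover have "(\<lambda>n. norm (h n) ^ CARD('d)) \<longlonglongrightarrow> 0" 
  proof -
    have z: "(0::real) ^ CARD('d) = 0" by simp
    show ?thesis using tendsto_power[OF h_lim, of "CARD('d)"] unfolding z .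
  qed
  ultimately show ?thesis
    using vol_pos by (intro tendsto_sandwich[of "\<lambda>_. 0" vol sequentially "\<lambda>n. norm (h n) ^ CARD('d)"]) (auto simp: less_imp_le intro!: always_eventually)
qed

text \<open>The points vary with n, which is what uniformity will require. Convergence of f (x n) to
  \<open>c\<close> makes the normalized variance tend to 1; the exact mean is kept, so that its
  expansion remains a separate matter.\<close>

lemma clt_at_sequence:
  assumes x: "(\<lambda>n. f (x n)) \<longlonglongrightarrow> c" and e: "0 < e"
  shows "\<forall>\<^sub>F n in sequentially. \<bar>prob {\<omega>\<in>space P. c \<le> fh n (x n) \<omega>} - \<Phi>N ((mean n (x n) - c) / sd n)\<bar> \<le> e"
proof -
  \<comment> \<open>The normalizing factor. Its square is c * \<kappa>2 * n * vol n, which diverges,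
    so the bounded summands become uniformly small.\<close>
  define a where "a n = real n * vol n * sd n" for n
  have a_pos: "0 < a n" if "0 < n" for n unfolding a_def using that vol_pos[of n] sd_pos[of n] by simp
  have a_sq: "(a n)\<^sup>2 = c * \<kappa>2 * (real n * vol n)" for n
  proof -
    have "(a n)\<^sup>2 = (real n * vol n)\<^sup>2 * (sd n)\<^sup>2" by (simp add: a_def power_mult_distrib)
    also have "\<dots> = (real n * vol n)\<^sup>2 * (c * \<kappa>2 / (real n * vol n))" by (simp only: sd_sq)
    also have "\<dots> = c * \<kappa>2 * (real n * vol n)"
      by (cases "real n * vol n = 0") (auto simp: power2_eq_square)
    finally show ?thesis .
  qed
  \<comment> \<open>The sign is reversed so that the event c \<le> fh turns into an upper bound on
    the sum, which is a value of the distribution function with equality included.\<close>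
  define Z where "Z n i \<omega> = - Y n (x n) i \<omega> / a n" for n i \<omega>
  have "weak_conv_m (\<lambda>n. distr P borel (\<lambda>\<omega>. \<Sum>i<n. Z n i \<omega>)) std_normal_distribution"
  proof (rule clt_row_iid)
    show "indep_vars (\<lambda>_. borel) (Z n) UNIV" for n
      unfolding Z_def by (rule indep_vars_compose2[OF Y_indep]) measurable
    show "distr P borel (Z n i) = distr P borel (Z n 0)" for n i
    proof -
      have "distr (distr P borel (Y n (x n) i)) borel (\<lambda>y. - y / a n) = distr (distr P borel (Y n (x n) 0)) borel (\<lambda>y. - y / a n)"
        by (simp only: Y_distr[of n "x n" i])
      then show ?thesis by (subst (asm) (1 2) distr_distr) (auto simp: Z_def[abs_def] comp_def)
    qed
    show "expectation (Z n 0) = 0" for n unfolding Z_def using Y_mean by simp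
    show "\<bar>Z n 0 \<omega>\<bar> \<le> 2 * B / a n" for n \<omega>
      unfolding Z_def using Y_bdd[of n "x n" 0 \<omega>] a_pos[of n] by (cases "n = 0") (auto simp: a_def abs_divide divide_right_mono)
    have a_lim: "LIM n sequentially. a n :> at_top"
    proof -
      have "a n = sqrt (c * \<kappa>2 * (real n * vol n))" for n
        using a_sq[of n] a_pos[of n] by (cases "n = 0") (auto simp: a_def real_sqrt_unique less_imp_le)
      moreover have "LIM n sequentially. sqrt (c * \<kappa>2 * (real n * vol n)) :> at_top"
        using c_pos \<kappa>2_pos N_lim unfolding vol_def
        by (intro filterlim_compose[OF sqrt_at_top] filterlim_tendsto_pos_mult_at_top[OF tendsto_const]) auto
      ultimately show ?thesis by presburger
    qed
    then show "(\<lambda>n. 2 * B / a n) \<longlonglongrightarrow> 0"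
      by (intro real_tendsto_divide_at_top[OF tendsto_const])
    show "(\<lambda>n. real n * expectation (\<lambda>\<omega>. (Z n 0 \<omega>)\<^sup>2)) \<longlonglongrightarrow> 1"
    proof -
      obtain b where b: "b \<longlonglongrightarrow> 0" "\<And>n x. \<bar>msq n x - f x * \<kappa>2\<bar> \<le> b n" using msq_limit by blast
      have "(\<lambda>n. msq n (x n) - f (x n) * \<kappa>2) \<longlonglongrightarrow> 0"
        by (rule Lim_null_comparison[OF _ b(1)]) (use b(2) in auto)
      from tendsto_add[OF this tendsto_mult_right[OF x, of \<kappa>2]] have ms: "(\<lambda>n. msq n (x n)) \<longlonglongrightarrow> c * \<kappa>2" by simp
      obtain b' where b': "b' \<longlonglongrightarrow> 0" "\<And>n x. \<bar>mean n x - f x\<bar> \<le> b' n" using mean_limit by blast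
      have "(\<lambda>n. mean n (x n) - f (x n)) \<longlonglongrightarrow> 0"
        by (rule Lim_null_comparison[OF _ b'(1)]) (use b'(2) in auto)
      from tendsto_add[OF this x] have mn: "(\<lambda>n. mean n (x n)) \<longlonglongrightarrow> c" by simp
      have "(\<lambda>n. (msq n (x n) - vol n * (mean n (x n))\<^sup>2) / (c * \<kappa>2)) \<longlonglongrightarrow> (c * \<kappa>2 - 0 * c\<^sup>2) / (c * \<kappa>2)"
        using c_pos \<kappa>2_pos by (intro tendsto_intros ms mn vol_lim) auto
      then have lim: "(\<lambda>n. (msq n (x n) - vol n * (mean n (x n))\<^sup>2) / (c * \<kappa>2)) \<longlonglongrightarrow> 1" using c_pos \<kappa>2_pos by simp
      have key: "real n * expectation (\<lambda>\<omega>. (Z n 0 \<omega>)\<^sup>2) = (msq n (x n) - vol n * (mean n (x n))\<^sup>2) / (c * \<kappa>2)" if n: "0 < n" for n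
      proof -
        have "expectation (\<lambda>\<omega>. (Z n 0 \<omega>)\<^sup>2) = (vol n * msq n (x n) - (vol n * mean n (x n))\<^sup>2) / (a n)\<^sup>2"
          by (simp add: Z_def power_divide Y_var)
        also have "real n * \<dots> = (real n * vol n) * (msq n (x n) - vol n * (mean n (x n))\<^sup>2) / ((real n * vol n) * (c * \<kappa>2))"
          unfolding a_sq by (simp add: power_mult_distrib power2_eq_square algebra_simps)
        also have "\<dots> = (msq n (x n) - vol n * (mean n (x n))\<^sup>2) / (c * \<kappa>2)"
          using n vol_pos[of n] by (intro nonzero_mult_divide_mult_cancel_left) auto
        finally show ?thesis .
      qed
      have "\<forall>\<^sub>F n in sequentially. (msq n (x n) - vol n * (mean n (x n))\<^sup>2) / (c * \<kappa>2) = real n * expectation (\<lambda>\<omega>. (Z n 0 \<omega>)\<^sup>2)"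
        using eventually_gt_at_top[of 0] by eventually_elim (use key in simp)
      with lim show ?thesis by (rule Lim_transform_eventually)
    qed
  qed
  from cdf_uniform_convergence[OF _ _ this isCont_Phi e]
  have ev: "\<forall>\<^sub>F n in sequentially. \<forall>t. \<bar>cdf (distr P borel (\<lambda>\<omega>. \<Sum>i<n. Z n i \<omega>)) t - \<Phi>N t\<bar> \<le> e"
    by (simp add: Z_def real_distribution_distr real_dist_normal_dist)
  show ?thesis
    using ev eventually_gt_at_top[of 0]
  proof eventually_elim
    case (elim n)
    have [measurable]: "(\<lambda>\<omega>. \<Sum>i<n. Z n i \<omega>) \<in> borel_measurable P" unfolding Z_def by measurable
    have "c \<le> fh n (x n) \<omega> \<longleftrightarrow> (\<Sum>i<n. Z n i \<omega>) \<le> (mean n (x n) - c) / sd n" for \<omega>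
    proof -
      have s: "0 < sd n" using elim sd_pos by simp
      have "(\<Sum>i<n. Z n i \<omega>) = - ((\<Sum>i<n. Y n (x n) i \<omega>) / (real n * vol n)) / sd n"
        unfolding Z_def a_def by (simp add: sum_divide_distrib[symmetric] sum_negf)
      also have "\<dots> = - (fh n (x n) \<omega> - mean n (x n)) / sd n" using elim by (simp add: fh_centered)
      finally show ?thesis using s by (simp add: divide_le_cancel)
    qed
    then have "prob {\<omega>\<in>space P. c \<le> fh n (x n) \<omega>} = cdf (distr P borel (\<lambda>\<omega>. \<Sum>i<n. Z n i \<omega>)) ((mean n (x n) - c) / sd n)"
      by (simp add: cdf_def measure_distr vimage_def Collect_conj_eq Int_commute)
    then show ?case using elim by simp
  qed
qed

text \<open>A sequence of almost worst points reduces uniformity to the limit along a sequence.\<close>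

lemma clt_uniform:
  assumes A: "\<And>n x. x \<in> A n \<Longrightarrow> \<bar>f x - c\<bar> \<le> r n" and r: "r \<longlonglongrightarrow> 0" and e: "0 < e" and c_val: "f x0 = c"
  shows "\<forall>\<^sub>F n in sequentially. \<forall>x\<in>A n. \<bar>prob {\<omega>\<in>space P. c \<le> fh n x \<omega>} - \<Phi>N ((mean n x - c) / sd n)\<bar> \<le> e"
proof -
  let ?d = "\<lambda>n x. \<bar>prob {\<omega>\<in>space P. c \<le> fh n x \<omega>} - \<Phi>N ((mean n x - c) / sd n)\<bar>"
  \<comment> \<open>If no point is bad, \<open>x0\<close> is taken; it lies on the level set, so f
    (x n) tends to \<open>c\<close> in either case.\<close>
  define x where "x n = (if \<exists>x\<in>A n. e < ?d n x then SOME x. x \<in> A n \<and> e < ?d n x else x0)" for n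
  have x: "\<bar>f (x n) - c\<bar> \<le> \<bar>r n\<bar>" and bad: "(\<exists>x\<in>A n. e < ?d n x) \<Longrightarrow> e < ?d n (x n)" for n
  proof -
    have "(\<exists>x\<in>A n. e < ?d n x) \<Longrightarrow> x n \<in> A n \<and> e < ?d n (x n)"
      unfolding x_def using someI_ex[of "\<lambda>x. x \<in> A n \<and> e < ?d n x"] by auto
    moreover have "\<not> (\<exists>x\<in>A n. e < ?d n x) \<Longrightarrow> x n = x0" by (simp add: x_def)
    ultimately show "\<bar>f (x n) - c\<bar> \<le> \<bar>r n\<bar>" "(\<exists>x\<in>A n. e < ?d n x) \<Longrightarrow> e < ?d n (x n)"
      using A[of "x n" n] c_val by fastforce+
  qed
  have "(\<lambda>n. f (x n) - c) \<longlonglongrightarrow> 0"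
    by (rule Lim_null_comparison[OF _ tendsto_rabs_zero[OF r]]) (use x in auto)
  then have "(\<lambda>n. f (x n)) \<longlonglongrightarrow> c" by (simp add: LIM_zero_iff)
  from clt_at_sequence[OF this e] show ?thesis
    by eventually_elim (use bad in \<open>meson not_le\<close>)
qed

end

subsection \<open>Gaussian misclassification probabilities\<close>

text \<open>The limiting probability that \<open>x\<close> with \<open>f x - c = v\<close> is misclassified, for bias \<open>b\<close> and deviation \<open>s\<close>.\<close>

definition err_prob :: "real \<Rightarrow> real \<Rightarrow> real \<Rightarrow> real" where
  "err_prob s b v = (if v < 0 then \<Phi>N ((v + b) / s) else 1 - \<Phi>N ((v + b) / s))"

text \<open>The integral of \<open>err_prob s b\<close> over all levels, which equals E|s Z - b| for
  a standard normal Z.\<close>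

definition err_mass :: "real \<Rightarrow> real \<Rightarrow> real" where
  "err_mass s b = s * gamma_fn (\<bar>b\<bar> / s)"

interpretation std_normal: real_distribution std_normal_distribution
  by (rule real_dist_normal_dist)

lemma PhiN_mono: "x \<le> y \<Longrightarrow> \<Phi>N x \<le> \<Phi>N y" by (rule std_normal.cdf_nondecreasing)

lemma PhiN_bounds: "0 \<le> \<Phi>N x" "\<Phi>N x \<le> 1" by (rule std_normal.cdf_nonneg, rule std_normal.cdf_bounded_prob)

lemma PhiN_measurable [measurable]: "\<Phi>N \<in> borel_measurable borel"
  by (intro borel_measurable_mono monoI PhiN_mono)

lemma err_prob_bounds: "0 \<le> err_prob s b v" "err_prob s b v \<le> 1"
  using PhiN_bounds[of "(v + b) / s"] by (auto simp: err_prob_def)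

lemma err_prob_measurable [measurable]: "err_prob s b \<in> borel_measurable borel"
  unfolding err_prob_def by measurable

text \<open>With v + b - s * z as the estimated excess over \<open>c\<close>, a point is
  misclassified exactly if \<open>v\<close> lies between 0 and s * z - b.\<close>

lemma err_prob_eq:
  assumes s: "0 < s"
  shows "err_prob s b v = measure std_normal_distribution {z. v < 0 \<and> s * z - b \<le> v \<or> 0 \<le> v \<and> v < s * z - b}"
proof (cases "v < 0")
  case True
  have "{z. v < 0 \<and> s * z - b \<le> v \<or> 0 \<le> v \<and> v < s * z - b} = {..(v + b) / s}"
    using True s by (auto simp: field_simps)
  then show ?thesis using True by (simp add: err_prob_def cdf_def)
next
  case False
  have "{z. v < 0 \<and> s * z - b \<le> v \<or> 0 \<le> v \<and> v < s * z - b} = space std_normal_distribution - {..(v + b) / s}"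
    using False s by (auto simp: field_simps)
  then show ?thesis using False std_normal.prob_compl[of "{..(v + b) / s}"] by (simp add: err_prob_def cdf_def)
qed

text \<open>Tonelli: for fixed \<open>z\<close> the misclassified levels form an interval with
  endpoints 0 and s * z - b.\<close>

lemma nn_integral_err_prob_eq:
  assumes s: "0 < s"
  shows "(\<integral>\<^sup>+v. ennreal (err_prob s b v) \<partial>lborel) = (\<integral>\<^sup>+z. ennreal \<bar>s * z - b\<bar> \<partial>std_normal_distribution)"
proof -
  interpret P: pair_sigma_finite lborel std_normal_distribution ..
  let ?S = "{(v, z). v < 0 \<and> s * z - b \<le> v \<or> 0 \<le> v \<and> v < s * z - b}"
  have S [measurable]: "?S \<in> sets (borel \<Otimes>\<^sub>M borel)"
  proof -
    have "{x \<in> space (borel \<Otimes>\<^sub>M borel). fst x < 0 \<and> s * snd x - b \<le> fst x \<or> 0 \<le> fst x \<and> fst x < s * snd x - b} \<in> sets (borel \<Otimes>\<^sub>M borel)"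
      by measurable
    also have "{x \<in> space (borel \<Otimes>\<^sub>M borel). fst x < 0 \<and> s * snd x - b \<le> fst x \<or> 0 \<le> fst x \<and> fst x < s * snd x - b} = ?S"
      by (auto simp: space_pair_measure)
    finally show ?thesis .
  qed
  have "(\<integral>\<^sup>+v. ennreal (err_prob s b v) \<partial>lborel) = (\<integral>\<^sup>+v. \<integral>\<^sup>+z. indicator ?S (v, z) \<partial>std_normal_distribution \<partial>lborel)"
  proof (rule nn_integral_cong)
    fix v
    have "(\<integral>\<^sup>+z. indicator ?S (v, z) \<partial>std_normal_distribution) =
      (\<integral>\<^sup>+z. indicator {z. v < 0 \<and> s * z - b \<le> v \<or> 0 \<le> v \<and> v < s * z - b} z \<partial>std_normal_distribution)"
      by (intro nn_integral_cong) (auto simp: indicator_def)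
    also have "\<dots> = emeasure std_normal_distribution {z. v < 0 \<and> s * z - b \<le> v \<or> 0 \<le> v \<and> v < s * z - b}"
      by (rule nn_integral_indicator) measurable
    finally show "ennreal (err_prob s b v) = (\<integral>\<^sup>+z. indicator ?S (v, z) \<partial>std_normal_distribution)"
      by (simp add: err_prob_eq[OF s] std_normal.emeasure_eq_measure)
  qed
  also have "\<dots> = (\<integral>\<^sup>+z. \<integral>\<^sup>+v. indicator ?S (v, z) \<partial>lborel \<partial>std_normal_distribution)"
    by (rule P.Fubini'[symmetric]) (simp add: split_beta')
  also have "\<dots> = (\<integral>\<^sup>+z. ennreal \<bar>s * z - b\<bar> \<partial>std_normal_distribution)"
  proof (rule nn_integral_cong)
    fix z
    let ?w = "s * z - b"
    have "(\<integral>\<^sup>+v. indicator ?S (v, z) \<partial>lborel) = (\<integral>\<^sup>+v. indicator (if ?w < 0 then {?w..<0} else {0..<?w}) v \<partial>lborel)"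
      by (intro nn_integral_cong) (auto simp: indicator_def)
    also have "\<dots> = ennreal \<bar>?w\<bar>" by simp
    finally show "(\<integral>\<^sup>+v. indicator ?S (v, z) \<partial>lborel) = ennreal \<bar>?w\<bar>" .
  qed
  finally show ?thesis .
qed

text \<open>This is E max(|Z|, a). The part |z| < a gives the term with the integral in
  \<open>gamma_fn\<close>; on the rest, z times the normal density has minus the density as
  primitive.\<close>

lemma nn_integral_abs_half_gaussian:
  assumes a: "0 \<le> a"
  shows "(\<integral>\<^sup>+z. ennreal (max \<bar>z\<bar> a) * ennreal (std_normal_density z) \<partial>lborel) = ennreal (gamma_fn a)"
proof -
  let ?p = std_normal_density
  let ?f = "\<lambda>z. ennreal (max \<bar>z\<bar> a) * ennreal (?p z)"
  define I where "I = integral {0..a} (\<lambda>t. exp (- t\<^sup>2 / 2))"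
  have hasI: "((\<lambda>t. exp (- t\<^sup>2 / 2)) has_integral I) {0..a}"
    unfolding I_def by (intro integrable_integral integrable_continuous_real continuous_intros) auto
  have I0: "0 \<le> I" using hasI by (rule has_integral_nonneg) auto
  have half: "(\<integral>\<^sup>+z. ?f z * indicator {0..} z \<partial>lborel) = ennreal ((a * I + exp (- a\<^sup>2 / 2)) / sqrt (2 * pi))"
  proof -
    have "(\<integral>\<^sup>+z. ?f z * indicator {0..} z \<partial>lborel) =
      (\<integral>\<^sup>+z. ennreal (a / sqrt (2 * pi)) * (ennreal (indicator {0..a} z * exp (- z\<^sup>2 / 2))) + ennreal (z * ?p z) * indicator {a..} z \<partial>lborel)"
    proof (rule nn_integral_cong_AE, rule AE_mp[OF AE_lborel_singleton[of a]], rule AE_I2, rule impI)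
      fix z assume "z \<noteq> a"
      then show "?f z * indicator {0..} z = ennreal (a / sqrt (2 * pi)) * (ennreal (indicator {0..a} z * exp (- z\<^sup>2 / 2))) + ennreal (z * ?p z) * indicator {a..} z"
        using a by (auto simp: indicator_def ennreal_mult'[symmetric] std_normal_density_def max_def mult_ac)
    qed
    also have "\<dots> = ennreal (a / sqrt (2 * pi)) * (\<integral>\<^sup>+z. ennreal (indicator {0..a} z * exp (- z\<^sup>2 / 2)) \<partial>lborel) + (\<integral>\<^sup>+z. ennreal (z * ?p z) * indicator {a..} z \<partial>lborel)"
      by (subst nn_integral_add) (auto simp: nn_integral_cmult)
    also have "(\<integral>\<^sup>+z. ennreal (indicator {0..a} z * exp (- z\<^sup>2 / 2)) \<partial>lborel) = ennreal I"
      using nn_integral_has_integral_lebesgue[OF _ hasI] by (simp add: mult.commute)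
    also have "(\<integral>\<^sup>+z. ennreal (z * ?p z) * indicator {a..} z \<partial>lborel) = ennreal (0 - - ?p a)"
    proof (rule nn_integral_FTC_atLeast)
      show "((\<lambda>z. - ?p z) \<longlongrightarrow> 0) at_top"
        unfolding std_normal_density_def by real_asymp
      fix z assume "a \<le> z"
      then show "0 \<le> z * ?p z" using a by simp
      show "DERIV (\<lambda>z. - ?p z) z :> z * ?p z"
      proof -
        have "DERIV (\<lambda>z. - (k * exp (- z\<^sup>2 / 2))) z :> z * (k * exp (- z\<^sup>2 / 2))" for k :: real
          by (auto intro!: derivative_eq_intros)
        then show ?thesis unfolding std_normal_density_def .
      qed
    qed auto
    finally show ?thesis using a I0 by (simp add: ennreal_mult'[symmetric] ennreal_plus[symmetric] std_normal_density_def add_divide_distrib del: ennreal_plus)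
  qed
  have neg: "(\<integral>\<^sup>+z. ?f z * indicator {..<0} z \<partial>lborel) = (\<integral>\<^sup>+z. ?f z * indicator {0..} z \<partial>lborel)"
  proof -
    have "(\<integral>\<^sup>+z. ?f z * indicator {..<0} z \<partial>lborel) = (\<integral>\<^sup>+z. ?f z * indicator {..<0} z \<partial>distr lborel borel uminus)"
      by (simp add: lborel_distr_uminus)
    also have "\<dots> = (\<integral>\<^sup>+z. ?f (- z) * indicator {..<0} (- z) \<partial>lborel)" by (rule nn_integral_distr) auto
    also have "\<dots> = (\<integral>\<^sup>+z. ?f z * indicator {0..} z \<partial>lborel)"
      by (rule nn_integral_cong_AE, rule AE_mp[OF AE_lborel_singleton[of 0]], rule AE_I2) (auto simp: indicator_def std_normal_density_def)
    finally show ?thesis .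
  qed
  have "(\<integral>\<^sup>+z. ?f z \<partial>lborel) = (\<integral>\<^sup>+z. ?f z * indicator {0..} z + ?f z * indicator {..<0} z \<partial>lborel)"
    by (intro nn_integral_cong) (auto simp: indicator_def)
  also have "\<dots> = (\<integral>\<^sup>+z. ?f z * indicator {0..} z \<partial>lborel) + (\<integral>\<^sup>+z. ?f z * indicator {..<0} z \<partial>lborel)"
    by (rule nn_integral_add) auto
  also have "\<dots> = ennreal (2 * ((a * I + exp (- a\<^sup>2 / 2)) / sqrt (2 * pi)))"
    unfolding neg half using a I0 by (simp add: ennreal_plus[symmetric] del: ennreal_plus)
  also have "2 * ((a * I + exp (- a\<^sup>2 / 2)) / sqrt (2 * pi)) = gamma_fn a"
  proof -
    have "sqrt (2 / pi) = 2 / sqrt (2 * pi)"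
      by (simp add: real_sqrt_divide real_sqrt_mult field_simps)
    then show ?thesis by (simp add: gamma_fn_def I_def)
  qed
  finally show ?thesis .
qed

text \<open>Averaging over z and - z: since |z - a| + |z + a| = 2 * max |z| |a|, one has E|Z - a| =
  E max(|Z|, |a|).\<close>

lemma nn_integral_abs_gaussian:
  "(\<integral>\<^sup>+z. ennreal \<bar>z - a\<bar> \<partial>std_normal_distribution) = ennreal (gamma_fn \<bar>a\<bar>)"
proof -
  let ?p = std_normal_density
  define A where "A a = (\<integral>\<^sup>+z. ennreal \<bar>z - a\<bar> * ennreal (?p z) \<partial>lborel)" for a
  have std: "(\<integral>\<^sup>+z. ennreal \<bar>z - a\<bar> \<partial>std_normal_distribution) = A a"
    unfolding A_def by (subst nn_integral_density) (auto simp: mult.commute)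
  have refl: "A (- a) = A a"
  proof -
    have "A (- a) = (\<integral>\<^sup>+z. ennreal \<bar>z + a\<bar> * ennreal (?p z) \<partial>distr lborel borel uminus)"
      by (simp add: A_def lborel_distr_uminus)
    also have "\<dots> = (\<integral>\<^sup>+z. ennreal \<bar>- z + a\<bar> * ennreal (?p (- z)) \<partial>lborel)" by (rule nn_integral_distr) auto
    also have "\<dots> = A a" unfolding A_def by (intro nn_integral_cong) (auto simp: std_normal_density_def abs_minus_commute)
    finally show ?thesis .
  qed
  have "2 * A a = A a + A (- a)" by (simp add: refl mult_2)
  also have "\<dots> = (\<integral>\<^sup>+z. ennreal \<bar>z - a\<bar> * ennreal (?p z) + ennreal \<bar>z - - a\<bar> * ennreal (?p z) \<partial>lborel)"
    unfolding A_def by (rule nn_integral_add[symmetric]) auto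
  also have "\<dots> = (\<integral>\<^sup>+z. 2 * (ennreal (max \<bar>z\<bar> \<bar>a\<bar>) * ennreal (?p z)) \<partial>lborel)"
  proof (rule nn_integral_cong)
    fix z :: real
    have "\<bar>z - a\<bar> + \<bar>z - - a\<bar> = 2 * max \<bar>z\<bar> \<bar>a\<bar>" by (auto simp: max_def abs_if)
    then have "ennreal \<bar>z - a\<bar> + ennreal \<bar>z - - a\<bar> = 2 * ennreal (max \<bar>z\<bar> \<bar>a\<bar>)"
      by (simp add: ennreal_plus[symmetric] ennreal_mult' del: ennreal_plus)
    then show "ennreal \<bar>z - a\<bar> * ennreal (?p z) + ennreal \<bar>z - - a\<bar> * ennreal (?p z) = 2 * (ennreal (max \<bar>z\<bar> \<bar>a\<bar>) * ennreal (?p z))"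
      by (simp only: distrib_right[symmetric] mult.assoc)
  qed
  also have "\<dots> = 2 * ennreal (gamma_fn \<bar>a\<bar>)"
    by (subst nn_integral_cmult) (auto simp: nn_integral_abs_half_gaussian)
  finally have "2 * A a = 2 * ennreal (gamma_fn \<bar>a\<bar>)" .
  then have "A a = ennreal (gamma_fn \<bar>a\<bar>)" by (simp add: ennreal_mult_cancel_left)
  then show ?thesis by (simp add: std)
qed

lemma gamma_fn_nonneg: "0 \<le> a \<Longrightarrow> 0 \<le> gamma_fn a"
  unfolding gamma_fn_def by (intro mult_nonneg_nonneg add_nonneg_nonneg integral_nonneg integrable_continuous_real continuous_intros) auto

lemma err_mass_nonneg: "0 \<le> s \<Longrightarrow> 0 \<le> err_mass s b"
  unfolding err_mass_def by (simp add: gamma_fn_nonneg)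

lemma nn_integral_abs_affine_gaussian:
  assumes s: "0 < s"
  shows "(\<integral>\<^sup>+z. ennreal \<bar>s * z - b\<bar> \<partial>std_normal_distribution) = ennreal (err_mass s b)"
proof -
  have "(\<integral>\<^sup>+z. ennreal \<bar>s * z - b\<bar> \<partial>std_normal_distribution) = (\<integral>\<^sup>+z. ennreal s * ennreal \<bar>z - b / s\<bar> \<partial>std_normal_distribution)"
  proof (rule nn_integral_cong)
    fix z
    have "s * z - b = s * (z - b / s)" using s by (simp add: right_diff_distrib)
    then show "ennreal \<bar>s * z - b\<bar> = ennreal s * ennreal \<bar>z - b / s\<bar>" using s by (simp add: abs_mult ennreal_mult'[symmetric])
  qed
  also have "\<dots> = ennreal s * ennreal (gamma_fn \<bar>b / s\<bar>)"
    by (subst nn_integral_cmult) (auto simp: nn_integral_abs_gaussian)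
  finally show ?thesis using s by (simp add: err_mass_def ennreal_mult'[symmetric] abs_divide)
qed

lemma nn_integral_err_prob: "0 < s \<Longrightarrow> (\<integral>\<^sup>+v. ennreal (err_prob s b v) \<partial>lborel) = ennreal (err_mass s b)"
  by (simp add: nn_integral_err_prob_eq nn_integral_abs_affine_gaussian)

lemma err_mass_integral:
  assumes s: "0 < s"
  shows "integrable std_normal_distribution (\<lambda>z. \<bar>s * z - b\<bar>)" "(\<integral>z. \<bar>s * z - b\<bar> \<partial>std_normal_distribution) = err_mass s b"
proof -
  have n: "(\<integral>\<^sup>+z. ennreal \<bar>s * z - b\<bar> \<partial>std_normal_distribution) = ennreal (err_mass s b)"
    by (rule nn_integral_abs_affine_gaussian[OF s])
  have "integrable std_normal_distribution (\<lambda>z. \<bar>s * z - b\<bar>) \<and> (\<integral>z. \<bar>s * z - b\<bar> \<partial>std_normal_distribution) = err_mass s b"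
    using n err_mass_nonneg[of s b] s by (subst nn_integral_eq_integrable[symmetric]) auto
  then show "integrable std_normal_distribution (\<lambda>z. \<bar>s * z - b\<bar>)" "(\<integral>z. \<bar>s * z - b\<bar> \<partial>std_normal_distribution) = err_mass s b"
    by auto
qed

lemma std_normal_moments:
  "integrable std_normal_distribution (\<lambda>z. z\<^sup>2)" "(\<integral>z. z\<^sup>2 \<partial>std_normal_distribution) = 1"
  using integrable_std_normal_distribution_moment[of 2] std_normal_distribution_even_moments[of 1] by simp_all

text \<open>Immediate from the form E|s Z - b|. The constant does not depend on \<open>s\<close>, so
  the bias may be frozen whatever its ratio to the deviation.\<close>

lemma err_mass_lipschitz:
  assumes s: "0 < s"
  shows "\<bar>err_mass s b - err_mass s b'\<bar> \<le> \<bar>b - b'\<bar>"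
proof -
  have "\<bar>err_mass s b - err_mass s b'\<bar> = \<bar>\<integral>z. \<bar>s * z - b\<bar> - \<bar>s * z - b'\<bar> \<partial>std_normal_distribution\<bar>"
    using err_mass_integral[OF s] by simp
  also have "\<dots> \<le> (\<integral>z. \<bar>\<bar>s * z - b\<bar> - \<bar>s * z - b'\<bar>\<bar> \<partial>std_normal_distribution)"
    using integral_norm_bound[of std_normal_distribution "\<lambda>z. \<bar>s * z - b\<bar> - \<bar>s * z - b'\<bar>"] by simp
  also have "\<dots> \<le> (\<integral>z. \<bar>b - b'\<bar> \<partial>std_normal_distribution)"
    using err_mass_integral(1)[OF s] by (intro integral_mono) auto
  also have "\<dots> = \<bar>b - b'\<bar>" using std_normal.prob_space by simp
  finally show ?thesis .
qed

lemma err_mass_le: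
  assumes s: "0 < s"
  shows "err_mass s b \<le> s + \<bar>b\<bar>"
proof -
  have "(\<integral>z. \<bar>s * z - b\<bar> \<partial>std_normal_distribution) \<le> (\<integral>z. s * (1 + z\<^sup>2) / 2 + \<bar>b\<bar> \<partial>std_normal_distribution)"
  proof (rule integral_mono)
    fix z :: real
    \<comment> \<open>This bounds E|Z| by 1 through the second moment alone.\<close>
    have "2 * \<bar>z\<bar> \<le> 1 + z\<^sup>2" using zero_le_power2[of "\<bar>z\<bar> - 1"] by (simp add: power2_diff)
    then have "s * \<bar>z\<bar> \<le> s * ((1 + z\<^sup>2) / 2)" using s by (intro mult_left_mono) auto
    moreover have "\<bar>s * z - b\<bar> \<le> s * \<bar>z\<bar> + \<bar>b\<bar>" using s abs_triangle_ineq4[of "s * z" b] by (simp add: abs_mult)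
    ultimately show "\<bar>s * z - b\<bar> \<le> s * (1 + z\<^sup>2) / 2 + \<bar>b\<bar>" by simp
  qed (use err_mass_integral(1)[OF s] std_normal_moments in auto)
  also have "\<dots> = s + \<bar>b\<bar>" using std_normal_moments std_normal.prob_space by simp
  finally show ?thesis by (simp add: err_mass_integral[OF s])
qed

lemma std_normal_tail:
  assumes t: "0 < t"
  shows "\<Phi>N (- t) \<le> 1 / t\<^sup>2" "1 - \<Phi>N t \<le> 1 / t\<^sup>2"
proof -
  have cheb: "measure std_normal_distribution {z. t \<le> \<bar>z\<bar>} \<le> 1 / t\<^sup>2"
    using std_normal.second_moment_method[of "\<lambda>z. z" t] t std_normal_moments by simp
  have [measurable]: "{z::real. t \<le> \<bar>z\<bar>} \<in> sets borel" by measurable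
  have "\<Phi>N (- t) \<le> measure std_normal_distribution {z. t \<le> \<bar>z\<bar>}"
    unfolding cdf_def by (intro std_normal.finite_measure_mono) auto
  with cheb show "\<Phi>N (- t) \<le> 1 / t\<^sup>2" by linarith
  have "1 - \<Phi>N t = measure std_normal_distribution (space std_normal_distribution - {..t})"
    using std_normal.prob_compl[of "{..t}"] by (simp add: cdf_def)
  also have "\<dots> \<le> measure std_normal_distribution {z. t \<le> \<bar>z\<bar>}"
    by (intro std_normal.finite_measure_mono) auto
  finally show "1 - \<Phi>N t \<le> 1 / t\<^sup>2" using cheb by linarith
qed

text \<open>The bias takes up at most half of |v|, and Chebyshev's inequality applies to the other
  half. Quadratic decay matches the tail available for the estimator itself.\<close>

lemma err_prob_tail:
  assumes s: "0 < s" and b: "2 * \<bar>b\<bar> \<le> \<bar>v\<bar>" and v: "v \<noteq> 0"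
  shows "err_prob s b v \<le> 4 * s\<^sup>2 / v\<^sup>2"
proof -
  let ?t = "\<bar>v\<bar> / 2 / s"
  have t: "0 < ?t" using s v by simp
  have "err_prob s b v \<le> 1 / ?t\<^sup>2"
  proof (cases "v < 0")
    case True
    have "v + b \<le> - (\<bar>v\<bar> / 2)" using True b by linarith
    from divide_right_mono[OF this less_imp_le[OF s]] have "(v + b) / s \<le> - ?t" by (simp only: minus_divide_left)
    then have "\<Phi>N ((v + b) / s) \<le> \<Phi>N (- ?t)" by (rule PhiN_mono)
    then show ?thesis using True std_normal_tail(1)[OF t] by (simp add: err_prob_def)
  next
    case False
    have "?t \<le> (v + b) / s" using False b s by (intro divide_right_mono) auto
    then have "\<Phi>N ?t \<le> \<Phi>N ((v + b) / s)" by (rule PhiN_mono)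
    then show ?thesis using False std_normal_tail(2)[OF t] by (simp add: err_prob_def)
  qed
  also have "1 / ?t\<^sup>2 = 4 * s\<^sup>2 / v\<^sup>2" using s v by (simp add: power_divide)
  finally show ?thesis .
qed

text \<open>Tonelli: for each \<open>z\<close> the levels from s * z - b' to s * z - b have length
  b' - b. For small \<open>s\<close> the integrand may come close to 1, yet its integral does not
  depend on \<open>s\<close>.\<close>

lemma nn_integral_PhiN_shift:
  assumes s: "0 < s" and b: "b \<le> b'"
  shows "(\<integral>\<^sup>+v. ennreal (\<Phi>N ((v + b') / s) - \<Phi>N ((v + b) / s)) \<partial>lborel) = ennreal (b' - b)"
proof -
  interpret P: pair_sigma_finite lborel std_normal_distribution ..
  let ?S = "{(v, z). s * z - b' \<le> v \<and> v < s * z - b}"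
  have S [measurable]: "?S \<in> sets (borel \<Otimes>\<^sub>M borel)"
  proof -
    have "{x \<in> space (borel \<Otimes>\<^sub>M borel). s * snd x - b' \<le> fst x \<and> fst x < s * snd x - b} \<in> sets (borel \<Otimes>\<^sub>M borel)"
      by measurable
    also have "{x \<in> space (borel \<Otimes>\<^sub>M borel). s * snd x - b' \<le> fst x \<and> fst x < s * snd x - b} = ?S"
      by (auto simp: space_pair_measure)
    finally show ?thesis .
  qed
  have "(\<integral>\<^sup>+v. ennreal (\<Phi>N ((v + b') / s) - \<Phi>N ((v + b) / s)) \<partial>lborel) = (\<integral>\<^sup>+v. \<integral>\<^sup>+z. indicator ?S (v, z) \<partial>std_normal_distribution \<partial>lborel)"
  proof (rule nn_integral_cong)
    fix v
    have "(v + b) / s \<le> (v + b') / s" using s b by (simp add: divide_right_mono)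
    then have "\<Phi>N ((v + b') / s) - \<Phi>N ((v + b) / s) = measure std_normal_distribution {(v + b) / s<..(v + b') / s}"
      using std_normal.cdf_diff_eq[of "(v + b) / s" "(v + b') / s"] by (cases "(v + b) / s = (v + b') / s") auto
    also have "{(v + b) / s<..(v + b') / s} = {z. s * z - b' \<le> v \<and> v < s * z - b}" using s by (auto simp: field_simps)
    finally have 1: "\<Phi>N ((v + b') / s) - \<Phi>N ((v + b) / s) = measure std_normal_distribution {z. s * z - b' \<le> v \<and> v < s * z - b}" .
    have "(\<integral>\<^sup>+z. indicator ?S (v, z) \<partial>std_normal_distribution) =
      (\<integral>\<^sup>+z. indicator {z. s * z - b' \<le> v \<and> v < s * z - b} z \<partial>std_normal_distribution)"
      by (intro nn_integral_cong) (auto simp: indicator_def)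
    also have "\<dots> = emeasure std_normal_distribution {z. s * z - b' \<le> v \<and> v < s * z - b}"
      by (rule nn_integral_indicator) measurable
    finally show "ennreal (\<Phi>N ((v + b') / s) - \<Phi>N ((v + b) / s)) = (\<integral>\<^sup>+z. indicator ?S (v, z) \<partial>std_normal_distribution)"
      by (simp add: 1 std_normal.emeasure_eq_measure)
  qed
  also have "\<dots> = (\<integral>\<^sup>+z. \<integral>\<^sup>+v. indicator ?S (v, z) \<partial>lborel \<partial>std_normal_distribution)"
    by (rule P.Fubini'[symmetric]) (simp add: split_beta')
  also have "\<dots> = (\<integral>\<^sup>+z. ennreal (b' - b) \<partial>std_normal_distribution)"
  proof (rule nn_integral_cong)
    fix z
    have "(\<integral>\<^sup>+v. indicator ?S (v, z) \<partial>lborel) = (\<integral>\<^sup>+v. indicator {s * z - b'..<s * z - b} v \<partial>lborel)"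
      by (intro nn_integral_cong) (auto simp: indicator_def)
    also have "\<dots> = ennreal (b' - b)" using b by simp
    finally show "(\<integral>\<^sup>+v. indicator ?S (v, z) \<partial>lborel) = ennreal (b' - b)" .
  qed
  also have "\<dots> = ennreal (b' - b)" using std_normal.emeasure_space_1 by simp
  finally show ?thesis .
qed

lemma nn_integral_inverse_square_tail:
  assumes a: "0 < a"
  shows "(\<integral>\<^sup>+v. ennreal (1 / v\<^sup>2) * indicator {v. a < \<bar>v\<bar>} v \<partial>lborel) \<le> ennreal (2 / a)"
proof -
  have pos: "(\<integral>\<^sup>+v. ennreal (1 / v\<^sup>2) * indicator {a..} v \<partial>lborel) = ennreal (0 - - 1 / a)"
  proof (rule nn_integral_FTC_atLeast)
    show "((\<lambda>v::real. - 1 / v) \<longlongrightarrow> 0) at_top" by real_asymp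
    fix v assume "a \<le> v"
    then show "DERIV (\<lambda>v. - 1 / v) v :> 1 / v\<^sup>2" using a
      by (auto intro!: derivative_eq_intros simp: power2_eq_square)
  qed (use a in auto)
  have neg: "(\<integral>\<^sup>+v. ennreal (1 / v\<^sup>2) * indicator {..-a} v \<partial>lborel) = (\<integral>\<^sup>+v. ennreal (1 / v\<^sup>2) * indicator {a..} v \<partial>lborel)"
  proof -
    have "(\<integral>\<^sup>+v. ennreal (1 / v\<^sup>2) * indicator {..-a} v \<partial>lborel) = (\<integral>\<^sup>+v. ennreal (1 / v\<^sup>2) * indicator {..-a} v \<partial>distr lborel borel uminus)"
      by (simp add: lborel_distr_uminus)
    also have "\<dots> = (\<integral>\<^sup>+v. ennreal (1 / (- v)\<^sup>2) * indicator {..-a} (- v) \<partial>lborel)" by (rule nn_integral_distr) auto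
    also have "\<dots> = (\<integral>\<^sup>+v. ennreal (1 / v\<^sup>2) * indicator {a..} v \<partial>lborel)"
      by (intro nn_integral_cong) (auto simp: indicator_def)
    finally show ?thesis .
  qed
  have "(\<integral>\<^sup>+v. ennreal (1 / v\<^sup>2) * indicator {v. a < \<bar>v\<bar>} v \<partial>lborel) \<le>
      (\<integral>\<^sup>+v. ennreal (1 / v\<^sup>2) * indicator {a..} v + ennreal (1 / v\<^sup>2) * indicator {..-a} v \<partial>lborel)"
    by (intro nn_integral_mono) (auto simp: indicator_def)
  also have "\<dots> = (\<integral>\<^sup>+v. ennreal (1 / v\<^sup>2) * indicator {a..} v \<partial>lborel) + (\<integral>\<^sup>+v. ennreal (1 / v\<^sup>2) * indicator {..-a} v \<partial>lborel)"
    by (rule nn_integral_add) auto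
  also have "\<dots> = ennreal (2 / a)" unfolding neg pos using a by (simp add: ennreal_plus[symmetric] del: ennreal_plus)
  finally show ?thesis .
qed

subsection \<open>Expected risk\<close>

lemma measurable_cutoff:
  fixes a :: real
  shows "{v. \<bar>v\<bar> \<le> a} \<in> sets borel" "{v. a < \<bar>v\<bar>} \<in> sets borel"
  by measurable

section \<open>Misclassification probabilities and their integral near and away from the level
  set\<close>

locale level_set_kde = kde_sample K Kt \<nu> P X f c h B Bf Lf
  for K :: "real^'d::finite \<Rightarrow> real" and Kt \<nu> and P :: "'w measure" and X f c h B Bf Lf +
  fixes \<delta>0 :: real and x0 :: "real^'d"
  assumes f_smooth: "times_cont_diff \<nu> f"
    and f_partials: "\<And>is. length is \<le> \<nu> \<Longrightarrow> bounded (range (partials is f))"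
    and x0: "f x0 = c" and \<delta>0: "0 < \<delta>0"
    and grad_nz: "\<And>x. \<bar>f x - c\<bar> \<le> \<delta>0 \<Longrightarrow> grad f x \<noteq> 0"
begin

abbreviation "G \<equiv> grad f"
definition "hnu n = norm (h n) ^ \<nu>"
text \<open>The common error scale; up to a constant factor it is bounded by the rate of the
  theorem.\<close>

definition "tau n = hnu n + sd n"
definition "beta n x = bias_beta \<nu> Kt f (h n) x"
definition "miscl n x = prob {\<omega>\<in>space P. (c \<le> f x) \<noteq> (c \<le> fh n x \<omega>)}"
definition "\<Lambda> w = enn2real (coarea_integral f G c w)"
definition "\<H> = (hausdorff_measure (CARD('d) - 1) :: (real^'d) measure)"

lemma sets_\<H> [simp, measurable_cong]: "sets \<H> = sets borel" by (simp add: \<H>_def)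

lemma f_deriv: "(f has_derivative (\<lambda>v. G x \<bullet> v)) (at x)" and G_cont: "continuous_on UNIV G"
  using has_derivative_times_cont_diff[OF f_smooth] nu by auto

lemma G_meas [measurable]: "G \<in> borel_measurable borel" using G_cont by (rule borel_measurable_continuous_onI)

lemma hnu_nonneg: "0 \<le> hnu n" by (simp add: hnu_def)

lemma tau_ge: "hnu n \<le> tau n" "sd n \<le> tau n" "0 \<le> tau n"
  using hnu_nonneg[of n] sd_sq(2)[of n] by (auto simp: tau_def)

lemma tau_pos: "0 < n \<Longrightarrow> 0 < tau n" using hnu_nonneg[of n] sd_pos[of n] by (simp add: tau_def)

lemma hnu_lim: "hnu \<longlonglongrightarrow> 0"
proof -
  have z: "(0::real) ^ \<nu> = 0" using nu by simp
  show ?thesis using tendsto_power[OF h_lim, of \<nu>] unfolding z hnu_def[abs_def] .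
qed

lemma sd_lim: "sd \<longlonglongrightarrow> 0"
proof -
  have "(\<lambda>n. sqrt (c * \<kappa>2 / (real n * vol n))) \<longlonglongrightarrow> sqrt 0"
    using N_lim unfolding vol_def by (intro tendsto_real_sqrt real_tendsto_divide_at_top[OF tendsto_const])
  moreover have "sqrt (c * \<kappa>2 / (real n * vol n)) = sd n" for n
    using sd_sq[of n] by (metis real_sqrt_unique)
  ultimately show ?thesis by simp
qed

lemma tau_lim: "tau \<longlonglongrightarrow> 0"
  unfolding tau_def using tendsto_add[OF hnu_lim sd_lim] by simp

lemma beta_bound: "\<exists>C\<ge>0. \<forall>n x. \<bar>beta n x\<bar> \<le> C * hnu n"
proof -
  have "\<exists>B\<ge>0. \<forall>x. \<bar>partials (replicate \<nu> k) f x\<bar> \<le> B" for k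
    using f_partials[of "replicate \<nu> k"] unfolding bounded_pos by (auto intro: less_imp_le)
  then obtain b where b: "\<And>k. 0 \<le> b k" "\<And>k x. \<bar>partials (replicate \<nu> k) f x\<bar> \<le> b k" by metis
  let ?C = "\<bar>kappa \<nu> Kt / fact \<nu>\<bar> * (\<Sum>k\<in>UNIV. b k)"
  have "\<bar>beta n x\<bar> \<le> ?C * hnu n" for n x
  proof -
    have "\<bar>\<Sum>k\<in>UNIV. (h n $ k) ^ \<nu> * partials (replicate \<nu> k) f x\<bar> \<le> (\<Sum>k\<in>UNIV. \<bar>(h n $ k) ^ \<nu> * partials (replicate \<nu> k) f x\<bar>)"
      by (rule sum_abs)
    also have "\<dots> \<le> (\<Sum>k\<in>UNIV. hnu n * b k)"
    proof (rule sum_mono)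
      fix k
      have "\<bar>h n $ k\<bar> ^ \<nu> \<le> hnu n" unfolding hnu_def by (intro power_mono component_le_norm_cart) auto
      then show "\<bar>(h n $ k) ^ \<nu> * partials (replicate \<nu> k) f x\<bar> \<le> hnu n * b k"
        unfolding abs_mult power_abs using b by (intro mult_mono) (auto simp: hnu_nonneg)
    qed
    finally have "\<bar>kappa \<nu> Kt / fact \<nu>\<bar> * \<bar>\<Sum>k\<in>UNIV. (h n $ k) ^ \<nu> * partials (replicate \<nu> k) f x\<bar> \<le> \<bar>kappa \<nu> Kt / fact \<nu>\<bar> * (\<Sum>k\<in>UNIV. hnu n * b k)"
      by (rule mult_left_mono) simp
    then show ?thesis unfolding beta_def bias_beta_def abs_mult sum_distrib_left[symmetric]
      by (simp only: mult_ac)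
  qed
  then show ?thesis using b(1) by (intro exI[of _ ?C] conjI mult_nonneg_nonneg sum_nonneg) auto
qed

lemma bias_uniform:
  assumes C: "compact C" and e: "0 < e"
  shows "\<forall>\<^sub>F n in sequentially. \<forall>x\<in>C. \<bar>mean n x - f x - beta n x\<bar> \<le> e * hnu n"
proof -
  obtain d where d: "0 < d" "\<forall>h. (\<forall>j. 0 < h $ j) \<longrightarrow> norm h < d \<longrightarrow>
    (\<forall>x\<in>C. \<bar>(\<integral>u. K u * f (x - scale h u) \<partial>lborel) - f x - bias_beta \<nu> Kt f h x\<bar> \<le> e * norm h ^ \<nu>)"
    using bias_expansion[OF f_smooth f_partials C e] by blast
  show ?thesis using order_tendstoD(2)[OF h_lim d(1)]
    by eventually_elim (use d(2) h_pos in \<open>simp add: mean_def beta_def hnu_def\<close>)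
qed

lemma miscl_bounds: "0 \<le> miscl n x" "miscl n x \<le> 1" by (simp_all add: miscl_def)

lemma miscl_eq: "miscl n x = (if f x < c then prob {\<omega>\<in>space P. c \<le> fh n x \<omega>} else 1 - prob {\<omega>\<in>space P. c \<le> fh n x \<omega>})"
proof (cases "f x < c")
  case False
  have [measurable]: "{\<omega>\<in>space P. c \<le> fh n x \<omega>} \<in> sets P" by measurable
  have "{\<omega>\<in>space P. (c \<le> f x) \<noteq> (c \<le> fh n x \<omega>)} = space P - {\<omega>\<in>space P. c \<le> fh n x \<omega>}" using False by auto
  then show ?thesis using False prob_compl[of "{\<omega>\<in>space P. c \<le> fh n x \<omega>}"] by (simp add: miscl_def)
qed (simp add: miscl_def)

lemma fh_pair_meas: "(\<lambda>(\<omega>, x). fh n x \<omega>) \<in> borel_measurable (P \<Otimes>\<^sub>M lborel)"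
proof -
  have [measurable]: "inv_scale (h n) \<in> borel_measurable borel"
    by (intro borel_measurable_continuous_onI continuous_intros)
  show ?thesis unfolding fh_def kde_def by measurable
qed

lemma miscl_meas [measurable]: "miscl n \<in> borel_measurable borel"
proof -
  interpret Q: pair_sigma_finite lborel P ..
  have [measurable]: "(\<lambda>(x, \<omega>). fh n x \<omega>) \<in> borel_measurable (lborel \<Otimes>\<^sub>M P)"
  proof -
    have "(\<lambda>(x, \<omega>). (\<lambda>(\<omega>, x). fh n x \<omega>) (\<omega>, x)) \<in> borel_measurable (lborel \<Otimes>\<^sub>M P)"
      using fh_pair_meas by (intro measurable_pair_swap)
    then show ?thesis by simp
  qed
  note m = this[unfolded split_beta']
  note [measurable] = m
  let ?S = "{z\<in>space (lborel \<Otimes>\<^sub>M P). (c \<le> f (fst z)) \<noteq> (c \<le> fh n (fst z) (snd z))}"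
  have "?S \<in> sets (lborel \<Otimes>\<^sub>M P)" by measurable
  from measurable_emeasure_Pair[OF this]
  have "(\<lambda>x. enn2real (emeasure P (Pair x -` ?S))) \<in> borel_measurable lborel" by measurable
  also have "(\<lambda>x. enn2real (emeasure P (Pair x -` ?S))) = miscl n"
    by (auto simp: miscl_def measure_def fun_eq_iff space_pair_measure intro!: arg_cong[where f = "\<lambda>A. enn2real (emeasure P A)"])
  finally show ?thesis by simp
qed

text \<open>The mean lies on the same side of \<open>c\<close> as f x with margin at least
  \<open>a\<close>, so misclassification forces a fluctuation of at least \<open>a\<close>.\<close>

lemma miscl_chebyshev:
  assumes n: "0 < n" and a: "0 < a" and v: "\<bar>mean n x - f x\<bar> + a \<le> \<bar>f x - c\<bar>"
  shows "miscl n x \<le> msq n x * (sd n)\<^sup>2 / (c * \<kappa>2) / a\<^sup>2"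
proof -
  have [measurable]: "{\<omega>\<in>space P. a \<le> \<bar>fh n x \<omega> - mean n x\<bar>} \<in> sets P" by measurable
  have "miscl n x \<le> prob {\<omega>\<in>space P. a \<le> \<bar>fh n x \<omega> - mean n x\<bar>}"
    unfolding miscl_def
  proof (rule finite_measure_mono)
    show "{\<omega>\<in>space P. (c \<le> f x) \<noteq> (c \<le> fh n x \<omega>)} \<subseteq> {\<omega>\<in>space P. a \<le> \<bar>fh n x \<omega> - mean n x\<bar>}"
      using v by auto
  qed measurable
  also have "\<dots> \<le> msq n x / (real n * vol n) / a\<^sup>2" by (rule fh_chebyshev[OF n a])
  also have "msq n x / (real n * vol n) = msq n x * (sd n)\<^sup>2 / (c * \<kappa>2)"
    unfolding sd_sq using c_pos \<kappa>2_pos by simp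
  finally show ?thesis .
qed

lemma coarea_real:
  assumes w: "continuous_on UNIV w" "\<And>x. 0 \<le> w x" and C: "compact C" "\<And>x. x \<notin> C \<Longrightarrow> w x = 0"
    and CG: "\<And>x. x \<in> C \<Longrightarrow> \<bar>f x - c\<bar> \<le> \<delta>0" and e: "0 < e"
  obtains \<delta> where "0 < \<delta>" "\<And>k :: real \<Rightarrow> real. k \<in> borel_measurable borel \<Longrightarrow> (\<And>v. 0 \<le> k v) \<Longrightarrow> (\<And>v. \<delta> < \<bar>v\<bar> \<Longrightarrow> k v = 0) \<Longrightarrow>
     integrable lborel k \<Longrightarrow> integrable lborel (\<lambda>x. w x * k (f x - c)) \<and>
       \<bar>(\<integral>x. w x * k (f x - c) \<partial>lborel) - \<Lambda> w * (\<integral>v. k v \<partial>lborel)\<bar> \<le> e * (\<integral>v. k v \<partial>lborel)"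
proof -
  have fin: "coarea_integral f G c w < top"
    by (rule coarea_integral_finite[OF f_deriv G_cont C(1) _ w C(2)]) (use CG grad_nz in auto)
  then have L: "coarea_integral f G c w = ennreal (\<Lambda> w)" by (simp add: \<Lambda>_def)
  have L0: "0 \<le> \<Lambda> w" by (simp add: \<Lambda>_def)
  have "\<exists>\<delta>>0. \<forall>k\<in>borel_measurable borel. (\<forall>v. \<delta> < \<bar>v\<bar> \<longrightarrow> k v = 0) \<longrightarrow>
        (\<integral>\<^sup>+x. ennreal (w x) * k (f x - c) \<partial>lborel) \<le> (coarea_integral f G c w + ennreal e) * (\<integral>\<^sup>+v. k v \<partial>lborel) \<and>
        coarea_integral f G c w * (\<integral>\<^sup>+v. k v \<partial>lborel) \<le>
            (\<integral>\<^sup>+x. ennreal (w x) * k (f x - c) \<partial>lborel) + ennreal e * (\<integral>\<^sup>+v. k v \<partial>lborel)"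
    by (rule coarea_limit(2)[OF f_deriv G_cont C(1) _ w C(2) e]) (use CG grad_nz in auto)
  then obtain \<delta> where \<delta>: "0 < \<delta>" "\<And>k. k\<in>borel_measurable borel \<Longrightarrow> (\<forall>v. \<delta> < \<bar>v\<bar> \<longrightarrow> k v = 0) \<Longrightarrow>
        (\<integral>\<^sup>+x. ennreal (w x) * k (f x - c) \<partial>lborel) \<le> (ennreal (\<Lambda> w) + ennreal e) * (\<integral>\<^sup>+v. k v \<partial>lborel) \<and>
        ennreal (\<Lambda> w) * (\<integral>\<^sup>+v. k v \<partial>lborel) \<le>
            (\<integral>\<^sup>+x. ennreal (w x) * k (f x - c) \<partial>lborel) + ennreal e * (\<integral>\<^sup>+v. k v \<partial>lborel)"
    unfolding L by blast
  show thesis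
  proof (rule that[OF \<delta>(1)])
    fix k :: "real \<Rightarrow> real"
    assume k [measurable]: "k \<in> borel_measurable borel" and k0: "\<And>v. 0 \<le> k v" and ks: "\<And>v. \<delta> < \<bar>v\<bar> \<Longrightarrow> k v = 0" and ki: "integrable lborel k"
    have [measurable]: "w \<in> borel_measurable borel" using w(1) by (rule borel_measurable_continuous_onI)
    define I where "I = (\<integral>v. k v \<partial>lborel)"
    have I: "(\<integral>\<^sup>+v. ennreal (k v) \<partial>lborel) = ennreal I" "0 \<le> I"
      unfolding I_def using ki k0 by (auto intro!: nn_integral_eq_integral)
    define A where "A = (\<integral>\<^sup>+x. ennreal (w x) * ennreal (k (f x - c)) \<partial>lborel)"
    have A: "A \<le> ennreal ((\<Lambda> w + e) * I)" "ennreal (\<Lambda> w * I) \<le> A + ennreal (e * I)"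
      using \<delta>(2)[of "\<lambda>v. ennreal (k v)"] ks e L0 I unfolding A_def[symmetric]
      by (simp_all add: ennreal_mult'[symmetric] ennreal_plus[symmetric] del: ennreal_plus)
    have A': "A = (\<integral>\<^sup>+x. ennreal (w x * k (f x - c)) \<partial>lborel)"
      unfolding A_def using w(2) by (simp add: ennreal_mult')
    have "A < top" using A(1) by (rule le_less_trans) simp
    then have int: "integrable lborel (\<lambda>x. w x * k (f x - c))"
      using A' w(2) k0 by (intro integrableI_nonneg) auto
    have "A = ennreal (\<integral>x. w x * k (f x - c) \<partial>lborel)"
      unfolding A' using int w(2) k0 by (intro nn_integral_eq_integral) auto
    moreover have "0 \<le> (\<integral>x. w x * k (f x - c) \<partial>lborel)" using w(2) k0 by simp
    ultimately have "(\<integral>x. w x * k (f x - c) \<partial>lborel) \<le> (\<Lambda> w + e) * I"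
      "\<Lambda> w * I \<le> (\<integral>x. w x * k (f x - c) \<partial>lborel) + e * I"
      using A L0 e I by (simp_all add: ennreal_plus[symmetric] del: ennreal_plus)
    then show "integrable lborel (\<lambda>x. w x * k (f x - c)) \<and>
       \<bar>(\<integral>x. w x * k (f x - c) \<partial>lborel) - \<Lambda> w * (\<integral>v. k v \<partial>lborel)\<bar> \<le> e * (\<integral>v. k v \<partial>lborel)"
      using int unfolding I_def[symmetric] by (simp add: abs_le_iff distrib_right)
  qed
qed

lemma surface_integral:
  assumes w: "continuous_on UNIV w" "\<And>x. 0 \<le> w x" and C: "compact C" "\<And>x. x \<notin> C \<Longrightarrow> w x = 0"
    and CG: "\<And>x. x \<in> C \<Longrightarrow> \<bar>f x - c\<bar> \<le> \<delta>0"
  shows "integrable \<H> (\<lambda>x. w x / norm (G x) * indicator {x. f x = c} x)"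
    "(\<integral>x. w x / norm (G x) * indicator {x. f x = c} x \<partial>\<H>) = \<Lambda> w"
proof -
  have [measurable]: "w \<in> borel_measurable borel" using w(1) by (rule borel_measurable_continuous_onI)
  have [measurable]: "{x. f x = c} \<in> sets borel" by measurable
  have fin: "coarea_integral f G c w < top"
    by (rule coarea_integral_finite[OF f_deriv G_cont C(1) _ w C(2)]) (use CG grad_nz in auto)
  have "(\<integral>\<^sup>+x. ennreal (w x / norm (G x) * indicator {x. f x = c} x) \<partial>\<H>) = coarea_integral f G c w"
    unfolding coarea_integral_def \<H>_def using w(2) by (intro nn_integral_cong) (auto simp: indicator_def)
  then have "(\<integral>\<^sup>+x. ennreal (w x / norm (G x) * indicator {x. f x = c} x) \<partial>\<H>) = ennreal (\<Lambda> w)"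
    using fin by (simp add: \<Lambda>_def)
  then have "integrable \<H> (\<lambda>x. w x / norm (G x) * indicator {x. f x = c} x) \<and> (\<integral>x. w x / norm (G x) * indicator {x. f x = c} x \<partial>\<H>) = \<Lambda> w"
    using w(2) by (subst nn_integral_eq_integrable[symmetric]) (auto simp: \<Lambda>_def cong: measurable_cong_sets)
  then show "integrable \<H> (\<lambda>x. w x / norm (G x) * indicator {x. f x = c} x)"
    "(\<integral>x. w x / norm (G x) * indicator {x. f x = c} x \<partial>\<H>) = \<Lambda> w" by auto
qed

lemma cont_compact_integrable:
  fixes w :: "real^'d \<Rightarrow> real"
  assumes w: "continuous_on UNIV w" and C: "compact C" "\<And>x. x \<notin> C \<Longrightarrow> w x = 0"
  shows "integrable lborel w"
proof -
  have "integrable lborel (\<lambda>x. indicator C x *\<^sub>R w x)"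
    using C(1) w by (intro borel_integrable_compact) (auto intro: continuous_on_subset)
  moreover have "indicator C x *\<^sub>R w x = w x" for x using C(2)[of x] by (cases "x \<in> C") auto
  ultimately show ?thesis by (simp only:)
qed

text \<open>The bias takes up at most half of |f x - c| and leaves the other half to the
  fluctuation; the factor 4 is the inverse square of this half.\<close>

lemma far_bound:
  assumes e: "0 < e" and n: "0 < n" and b: "\<bar>mean n x - f x\<bar> \<le> C * hnu n" and v: "2 * C * hnu n \<le> \<bar>f x - c\<bar>" "f x \<noteq> c"
  shows "miscl n x \<le> 4 * Bf / c * ((sd n)\<^sup>2 / (f x - c)\<^sup>2)"
proof -
  let ?a = "\<bar>f x - c\<bar> / 2"
  have "\<bar>mean n x - f x\<bar> + ?a \<le> \<bar>f x - c\<bar>" using b v by simp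
  then have "miscl n x \<le> msq n x * (sd n)\<^sup>2 / (c * \<kappa>2) / ?a\<^sup>2" using n v(2) by (intro miscl_chebyshev) auto
  also have "\<dots> \<le> (Bf * \<kappa>2) * (sd n)\<^sup>2 / (c * \<kappa>2) / ?a\<^sup>2"
    using msq_le[of n x] c_pos \<kappa>2_pos by (intro divide_right_mono mult_right_mono) auto
  also have "\<dots> = 4 * Bf / c * ((sd n)\<^sup>2 / (f x - c)\<^sup>2)"
    using \<kappa>2_pos by (simp add: power_divide)
  finally show ?thesis .
qed

text \<open>The mean differs from f x + b n by at most 2 * \<epsilon> * hnu n, one half from the
  bias expansion and one from replacing beta n x by b n; monotonicity of the normal distribution
  function does the rest. The bound depends on \<open>x\<close> only through f x - c, as the coarea
  formula requires.\<close>

lemma zone_near: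
  assumes C: "compact C" and y: "\<And>n x. x \<in> C \<Longrightarrow> \<bar>beta n x - b n\<bar> \<le> \<epsilon> * hnu n" and \<epsilon>: "0 < \<epsilon>"
    and e1: "0 < e1"
  shows "\<forall>\<^sub>F n in sequentially. \<forall>x\<in>C. \<bar>f x - c\<bar> \<le> T * tau n \<longrightarrow>
     \<bar>miscl n x - err_prob (sd n) (b n) (f x - c)\<bar> \<le>
        e1 + (\<Phi>N ((f x - c + (b n + 2 * \<epsilon> * hnu n)) / sd n) - \<Phi>N ((f x - c + (b n - 2 * \<epsilon> * hnu n)) / sd n))"
proof -
  define A where "A n = {x\<in>C. \<bar>f x - c\<bar> \<le> T * tau n}" for n
  have Tt: "(\<lambda>n. T * tau n) \<longlonglongrightarrow> 0" using tendsto_mult_left[OF tau_lim, of T] by simp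
  have ev: "\<forall>\<^sub>F n in sequentially. \<forall>x\<in>A n. \<bar>prob {\<omega>\<in>space P. c \<le> fh n x \<omega>} - \<Phi>N ((mean n x - c) / sd n)\<bar> \<le> e1"
    by (rule clt_uniform[OF _ Tt e1 x0]) (auto simp: A_def)
  show ?thesis
    using ev bias_uniform[OF C \<epsilon>] eventually_gt_at_top[of 0]
  proof eventually_elim
    case (elim n)
    have s: "0 < sd n" using elim sd_pos by simp
    show ?case
    proof (intro ballI impI)
      fix x assume x: "x \<in> C" and near: "\<bar>f x - c\<bar> \<le> T * tau n"
      let ?v = "f x - c" and ?\<eta> = "2 * \<epsilon> * hnu n"
      have p: "\<bar>prob {\<omega>\<in>space P. c \<le> fh n x \<omega>} - \<Phi>N ((mean n x - c) / sd n)\<bar> \<le> e1"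
        using elim(1) x near by (simp add: A_def)
      have b1: "\<bar>mean n x - f x - beta n x\<bar> \<le> \<epsilon> * hnu n" using elim(2) x by blast
      have lo: "?v + (b n - ?\<eta>) \<le> mean n x - c" and hi: "mean n x - c \<le> ?v + (b n + ?\<eta>)"
        using b1 y[OF x, of n] unfolding abs_le_iff by linarith+
      have 1: "\<Phi>N ((?v + (b n - ?\<eta>)) / sd n) \<le> \<Phi>N ((mean n x - c) / sd n)"
        "\<Phi>N ((mean n x - c) / sd n) \<le> \<Phi>N ((?v + (b n + ?\<eta>)) / sd n)"
        using lo hi s by (auto intro!: PhiN_mono divide_right_mono)
      have \<eta>: "0 \<le> ?\<eta>" using \<epsilon> hnu_nonneg[of n] by simp
      have 2: "\<Phi>N ((?v + (b n - ?\<eta>)) / sd n) \<le> \<Phi>N ((?v + b n) / sd n)"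
        "\<Phi>N ((?v + b n) / sd n) \<le> \<Phi>N ((?v + (b n + ?\<eta>)) / sd n)"
        using \<eta> s by (auto intro!: PhiN_mono divide_right_mono)
      have "\<bar>miscl n x - err_prob (sd n) (b n) ?v\<bar> = \<bar>prob {\<omega>\<in>space P. c \<le> fh n x \<omega>} - \<Phi>N ((?v + b n) / sd n)\<bar>"
        unfolding miscl_eq err_prob_def by (auto simp: abs_minus_commute)
      also have "\<dots> \<le> e1 + (\<Phi>N ((?v + (b n + ?\<eta>)) / sd n) - \<Phi>N ((?v + (b n - ?\<eta>)) / sd n))"
        using p 1 2 unfolding abs_le_iff by linarith
      finally show "\<bar>miscl n x - err_prob (sd n) (b n) ?v\<bar> \<le> e1 + (\<Phi>N ((?v + (b n + ?\<eta>)) / sd n) - \<Phi>N ((?v + (b n - ?\<eta>)) / sd n))" .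
    qed
  qed
qed

text \<open>The three terms integrate separately: the error of the central limit theorem over a zone
  of length 2 * a, the bias shift independently of \<open>s\<close>, and the inverse square tail.
  The cut-off at \<open>\<delta>\<close> prepares for the coarea formula.\<close>

lemma majorant_integral:
  fixes s \<eta> a e1 C4 \<delta> b :: real
  assumes s: "0 < s" and \<eta>: "0 \<le> \<eta>" and a: "0 < a" and e1: "0 \<le> e1" and C4: "0 \<le> C4"
  defines "k \<equiv> \<lambda>v. indicator {v. \<bar>v\<bar> \<le> \<delta>} v * (indicator {v. \<bar>v\<bar> \<le> a} v * (e1 + (\<Phi>N ((v + (b + \<eta>)) / s) - \<Phi>N ((v + (b - \<eta>)) / s)))
     + indicator {v. a < \<bar>v\<bar>} v * (C4 * s\<^sup>2 / v\<^sup>2))"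
  shows "k \<in> borel_measurable borel" "\<And>v. 0 \<le> k v" "integrable lborel k"
    "(\<integral>v. k v \<partial>lborel) \<le> 2 * a * e1 + 2 * \<eta> + 2 * C4 * s\<^sup>2 / a"
proof -
  note [measurable] = measurable_cutoff
  show [measurable]: "k \<in> borel_measurable borel" unfolding k_def by measurable
  let ?d = "\<lambda>v. \<Phi>N ((v + (b + \<eta>)) / s) - \<Phi>N ((v + (b - \<eta>)) / s)"
  have d: "0 \<le> ?d v" for v using s \<eta> PhiN_mono[of "(v + (b - \<eta>)) / s" "(v + (b + \<eta>)) / s"] by (simp add: divide_right_mono)
  show k0: "0 \<le> k v" for v unfolding k_def using d e1 C4 by (auto simp: indicator_def)
  have "(\<integral>\<^sup>+v. ennreal (k v) \<partial>lborel) \<le> (\<integral>\<^sup>+v. (ennreal e1 * indicator {-a..a} v + ennreal (?d v)) + ennreal (C4 * s\<^sup>2) * (ennreal (1 / v\<^sup>2) * indicator {v. a < \<bar>v\<bar>} v) \<partial>lborel)"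
  proof (rule nn_integral_mono)
    fix v
    show "ennreal (k v) \<le> (ennreal e1 * indicator {-a..a} v + ennreal (?d v)) + ennreal (C4 * s\<^sup>2) * (ennreal (1 / v\<^sup>2) * indicator {v. a < \<bar>v\<bar>} v)"
    proof (cases "\<bar>v\<bar> \<le> a")
      case True
      then have "k v \<le> e1 + ?d v" unfolding k_def using d[of v] e1 by (auto simp: indicator_def)
      moreover have "v \<in> {-a..a}" "\<not> a < \<bar>v\<bar>" using True by auto
      ultimately show ?thesis using e1 d[of v] by (simp add: ennreal_plus[symmetric] ennreal_leI del: ennreal_plus)
    next
      case False
      then have "k v \<le> C4 * s\<^sup>2 * (1 / v\<^sup>2)" unfolding k_def using C4 by (auto simp: indicator_def)
      then have "ennreal (k v) \<le> ennreal (C4 * s\<^sup>2) * (ennreal (1 / v\<^sup>2) * indicator {v. a < \<bar>v\<bar>} v)"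
        using False C4 by (simp add: ennreal_mult'[symmetric] ennreal_leI)
      then show ?thesis by (rule order_trans) simp
    qed
  qed
  also have "\<dots> = (ennreal e1 * emeasure lborel {-a..a} + (\<integral>\<^sup>+v. ennreal (?d v) \<partial>lborel)) + ennreal (C4 * s\<^sup>2) * (\<integral>\<^sup>+v. ennreal (1 / v\<^sup>2) * indicator {v. a < \<bar>v\<bar>} v \<partial>lborel)"
    by (subst nn_integral_add, simp, simp, subst nn_integral_add, simp, simp, subst nn_integral_cmult, simp, subst nn_integral_cmult) auto
  also have "(\<integral>\<^sup>+v. ennreal (?d v) \<partial>lborel) = ennreal ((b + \<eta>) - (b - \<eta>))"
    using \<eta> by (intro nn_integral_PhiN_shift[OF s]) simp
  also have "ennreal e1 * emeasure lborel {-a..a} = ennreal (e1 * (2 * a))" using a e1 by (simp add: ennreal_mult'[symmetric])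
  also have "ennreal (e1 * (2 * a)) + ennreal ((b + \<eta>) - (b - \<eta>)) + ennreal (C4 * s\<^sup>2) * (\<integral>\<^sup>+v. ennreal (1 / v\<^sup>2) * indicator {v. a < \<bar>v\<bar>} v \<partial>lborel)
     \<le> ennreal (e1 * (2 * a)) + ennreal ((b + \<eta>) - (b - \<eta>)) + ennreal (C4 * s\<^sup>2) * ennreal (2 / a)"
    by (intro add_left_mono mult_left_mono nn_integral_inverse_square_tail a) simp
  also have "\<dots> = ennreal (2 * a * e1 + 2 * \<eta> + 2 * C4 * s\<^sup>2 / a)"
    using e1 a \<eta> C4 by (simp add: ennreal_mult'[symmetric] ennreal_plus[symmetric] mult_ac del: ennreal_plus)
  finally have le: "(\<integral>\<^sup>+v. ennreal (k v) \<partial>lborel) \<le> ennreal (2 * a * e1 + 2 * \<eta> + 2 * C4 * s\<^sup>2 / a)" .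
  then have "(\<integral>\<^sup>+v. ennreal (k v) \<partial>lborel) < top" by (rule le_less_trans) simp
  then show int: "integrable lborel k" using k0 by (intro integrableI_nonneg) auto
  have "(\<integral>\<^sup>+v. ennreal (k v) \<partial>lborel) = ennreal (\<integral>v. k v \<partial>lborel)" using int k0 by (intro nn_integral_eq_integral) auto
  then show "(\<integral>v. k v \<partial>lborel) \<le> 2 * a * e1 + 2 * \<eta> + 2 * C4 * s\<^sup>2 / a"
  proof -
    have "0 \<le> 2 * a * e1 + 2 * \<eta> + 2 * C4 * s\<^sup>2 / a" using e1 a \<eta> C4 by (intro add_nonneg_nonneg) auto
    moreover assume "(\<integral>\<^sup>+v. ennreal (k v) \<partial>lborel) = ennreal (\<integral>v. k v \<partial>lborel)"
    ultimately show ?thesis using le by (simp only: ennreal_le_iff)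
  qed
qed

text \<open>The coarea formula asks for support in |v| \<le> \<delta>. As |b| is at most \<delta> /
  2, the quadratic tail bound applies beyond, and the discarded mass is at most 8 * s^2 /
  \<delta>.\<close>

lemma err_prob_cutoff:
  fixes s b \<delta> :: real
  assumes s: "0 < s" and b: "2 * \<bar>b\<bar> \<le> \<delta>" and \<delta>: "0 < \<delta>"
  defines "k \<equiv> \<lambda>v. indicator {v. \<bar>v\<bar> \<le> \<delta>} v * err_prob s b v"
  shows "k \<in> borel_measurable borel" "\<And>v. 0 \<le> k v" "integrable lborel k"
    "(\<integral>v. k v \<partial>lborel) \<le> err_mass s b" "err_mass s b \<le> (\<integral>v. k v \<partial>lborel) + 8 * s\<^sup>2 / \<delta>"
proof -
  note [measurable] = measurable_cutoff
  show [measurable]: "k \<in> borel_measurable borel" unfolding k_def by measurable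
  show k0: "0 \<le> k v" for v unfolding k_def using err_prob_bounds by (auto simp: indicator_def)
  have total: "(\<integral>\<^sup>+v. ennreal (err_prob s b v) \<partial>lborel) = ennreal (err_mass s b)" by (rule nn_integral_err_prob[OF s])
  have m0: "0 \<le> err_mass s b" using s by (intro err_mass_nonneg) simp
  have le: "(\<integral>\<^sup>+v. ennreal (k v) \<partial>lborel) \<le> ennreal (err_mass s b)"
    unfolding total[symmetric] k_def by (intro nn_integral_mono ennreal_leI) (auto simp: indicator_def err_prob_bounds)
  then have "(\<integral>\<^sup>+v. ennreal (k v) \<partial>lborel) < top" by (rule le_less_trans) simp
  then show int: "integrable lborel k" using k0 by (intro integrableI_nonneg) auto
  have eq: "(\<integral>\<^sup>+v. ennreal (k v) \<partial>lborel) = ennreal (\<integral>v. k v \<partial>lborel)" using int k0 by (intro nn_integral_eq_integral) auto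
  have i0: "0 \<le> (\<integral>v. k v \<partial>lborel)" using k0 by simp
  show "(\<integral>v. k v \<partial>lborel) \<le> err_mass s b" using le m0 unfolding eq by (simp add: ennreal_le_iff)
  have "ennreal (err_mass s b) \<le> (\<integral>\<^sup>+v. ennreal (k v) + ennreal (4 * s\<^sup>2) * (ennreal (1 / v\<^sup>2) * indicator {v. \<delta> < \<bar>v\<bar>} v) \<partial>lborel)"
    unfolding total[symmetric]
  proof (rule nn_integral_mono)
    fix v
    show "ennreal (err_prob s b v) \<le> ennreal (k v) + ennreal (4 * s\<^sup>2) * (ennreal (1 / v\<^sup>2) * indicator {v. \<delta> < \<bar>v\<bar>} v)"
    proof (cases "\<bar>v\<bar> \<le> \<delta>")
      case False
      then have "err_prob s b v \<le> 4 * s\<^sup>2 / v\<^sup>2" using b \<delta> by (intro err_prob_tail[OF s]) auto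
      then show ?thesis using False by (simp add: k_def indicator_def ennreal_mult'[symmetric] ennreal_leI)
    qed (simp add: k_def)
  qed
  also have "\<dots> = (\<integral>\<^sup>+v. ennreal (k v) \<partial>lborel) + ennreal (4 * s\<^sup>2) * (\<integral>\<^sup>+v. ennreal (1 / v\<^sup>2) * indicator {v. \<delta> < \<bar>v\<bar>} v \<partial>lborel)"
    by (subst nn_integral_add, simp, simp, subst nn_integral_cmult) auto
  also have "\<dots> \<le> ennreal (\<integral>v. k v \<partial>lborel) + ennreal (4 * s\<^sup>2) * ennreal (2 / \<delta>)"
    unfolding eq by (intro add_left_mono mult_left_mono nn_integral_inverse_square_tail \<delta>) simp
  also have "\<dots> = ennreal ((\<integral>v. k v \<partial>lborel) + 8 * s\<^sup>2 / \<delta>)"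
    using i0 \<delta> by (simp add: ennreal_mult'[symmetric] ennreal_plus[symmetric] del: ennreal_plus)
  finally show "err_mass s b \<le> (\<integral>v. k v \<partial>lborel) + 8 * s\<^sup>2 / \<delta>"
  proof -
    assume le: "ennreal (err_mass s b) \<le> ennreal ((\<integral>v. k v \<partial>lborel) + 8 * s\<^sup>2 / \<delta>)"
    have "0 \<le> (\<integral>v. k v \<partial>lborel) + 8 * s\<^sup>2 / \<delta>" using i0 \<delta> by (intro add_nonneg_nonneg) auto
    then show ?thesis using le by (simp only: ennreal_le_iff)
  qed
qed

lemma err_mass_meas [measurable]: "0 < s \<Longrightarrow> (\<lambda>b. err_mass s b) \<in> borel_measurable borel"
proof (rule borel_measurable_continuous_onI)
  assume s: "0 < s"
  show "continuous_on UNIV (\<lambda>b. err_mass s b)"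
    using err_mass_lipschitz[OF s] by (intro lipschitz_on_continuous_on[of 1] lipschitz_onI) (auto simp: dist_real_def)
qed

lemma partials_cont: "continuous_on UNIV (partials (replicate \<nu> k) f)"
  using f_smooth unfolding times_cont_diff_def by simp

lemma beta_meas [measurable]: "beta n \<in> borel_measurable borel"
proof -
  have [measurable]: "partials (replicate \<nu> k) f \<in> borel_measurable borel" for k
    using partials_cont by (rule borel_measurable_continuous_onI)
  show ?thesis unfolding beta_def bias_beta_def by measurable
qed

text \<open>On the support of \<open>w\<close> the bias is within \<open>a\<close> of
  \<open>b\<close>, and \<open>err_mass\<close> is 1-Lipschitz in the bias, uniformly in the
  deviation.\<close>

lemma surface_mass:
  assumes w: "continuous_on UNIV w" "\<And>x. 0 \<le> w x" and C: "compact C" "\<And>x. x \<notin> C \<Longrightarrow> w x = 0"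
    and CG: "\<And>x. x \<in> C \<Longrightarrow> \<bar>f x - c\<bar> \<le> \<delta>0" and n: "0 < n"
  shows "integrable \<H> (\<lambda>x. w x / norm (G x) * indicator {x. f x = c} x * err_mass (sd n) (beta n x))"
    and "(\<And>x. x \<in> C \<Longrightarrow> \<bar>beta n x - b\<bar> \<le> a) \<Longrightarrow>
      \<bar>(\<integral>x. w x / norm (G x) * indicator {x. f x = c} x * err_mass (sd n) (beta n x) \<partial>\<H>) - \<Lambda> w * err_mass (sd n) b\<bar> \<le> a * \<Lambda> w"
proof -
  let ?S = "\<lambda>x. w x / norm (G x) * indicator {x. f x = c} x"
  have [measurable]: "w \<in> borel_measurable borel" using w(1) by (rule borel_measurable_continuous_onI)
  have [measurable]: "{x. f x = c} \<in> sets borel" by measurable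
  have s: "0 < sd n" using sd_pos[OF n] .
  note [measurable] = err_mass_meas[OF s]
  have Si: "integrable \<H> ?S" "(\<integral>x. ?S x \<partial>\<H>) = \<Lambda> w" using surface_integral[OF w C CG] by auto
  have S0: "0 \<le> ?S x" for x using w(2) by (simp add: indicator_def)
  obtain C1 where C1: "\<And>n x. \<bar>beta n x\<bar> \<le> C1 * hnu n" using beta_bound by blast
  have em: "0 \<le> err_mass (sd n) (beta n x)" "err_mass (sd n) (beta n x) \<le> sd n + C1 * hnu n" for x
    using err_mass_nonneg[of "sd n"] err_mass_le[OF s, of "beta n x"] C1[of n x] s by auto
  show int: "integrable \<H> (\<lambda>x. ?S x * err_mass (sd n) (beta n x))"
  proof (rule Bochner_Integration.integrable_bound[OF integrable_mult_right[OF Si(1), of "sd n + C1 * hnu n"]])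
    show "(\<lambda>x. ?S x * err_mass (sd n) (beta n x)) \<in> borel_measurable \<H>" by measurable
    show "AE x in \<H>. norm (?S x * err_mass (sd n) (beta n x)) \<le> norm ((sd n + C1 * hnu n) * ?S x)"
    proof (rule AE_I2)
      fix x
      have "?S x * err_mass (sd n) (beta n x) \<le> ?S x * (sd n + C1 * hnu n)" by (rule mult_left_mono[OF em(2) S0])
      moreover have "0 \<le> ?S x * err_mass (sd n) (beta n x)" by (rule mult_nonneg_nonneg[OF S0 em(1)])
      ultimately show "norm (?S x * err_mass (sd n) (beta n x)) \<le> norm ((sd n + C1 * hnu n) * ?S x)"
        unfolding real_norm_def mult.commute[of "sd n + C1 * hnu n"] by linarith
    qed
  qed
  assume b: "\<And>x. x \<in> C \<Longrightarrow> \<bar>beta n x - b\<bar> \<le> a"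
  have eq: "(\<integral>x. ?S x * err_mass (sd n) (beta n x) \<partial>\<H>) - \<Lambda> w * err_mass (sd n) b =
      (\<integral>x. ?S x * err_mass (sd n) (beta n x) - ?S x * err_mass (sd n) b \<partial>\<H>)"
    unfolding Bochner_Integration.integral_diff[OF int integrable_mult_left[OF Si(1)]] integral_mult_left_zero Si(2) by (rule refl)
  have "\<bar>(\<integral>x. ?S x * err_mass (sd n) (beta n x) \<partial>\<H>) - \<Lambda> w * err_mass (sd n) b\<bar> \<le> (\<integral>x. \<bar>?S x * err_mass (sd n) (beta n x) - ?S x * err_mass (sd n) b\<bar> \<partial>\<H>)"
    using integral_norm_bound[of \<H> "\<lambda>x. ?S x * err_mass (sd n) (beta n x) - ?S x * err_mass (sd n) b"] unfolding eq real_norm_def .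
  also have "\<dots> \<le> (\<integral>x. a * ?S x \<partial>\<H>)"
  proof (rule integral_mono)
    show "integrable \<H> (\<lambda>x. \<bar>?S x * err_mass (sd n) (beta n x) - ?S x * err_mass (sd n) b\<bar>)"
      by (rule integrable_abs[OF Bochner_Integration.integrable_diff[OF int integrable_mult_left[OF Si(1)]]])
    show "integrable \<H> (\<lambda>x. a * ?S x)" using Si(1) by (rule integrable_mult_right)
    fix x
    show "\<bar>?S x * err_mass (sd n) (beta n x) - ?S x * err_mass (sd n) b\<bar> \<le> a * ?S x"
    proof (cases "x \<in> C")
      case True
      have "\<bar>err_mass (sd n) (beta n x) - err_mass (sd n) b\<bar> \<le> a"
        using err_mass_lipschitz[OF s, of "beta n x" b] b[OF True] by linarith
      then have "?S x * \<bar>err_mass (sd n) (beta n x) - err_mass (sd n) b\<bar> \<le> ?S x * a" using S0[of x] by (rule mult_left_mono)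
      moreover have "?S x * err_mass (sd n) (beta n x) - ?S x * err_mass (sd n) b = ?S x * (err_mass (sd n) (beta n x) - err_mass (sd n) b)"
        by (rule right_diff_distrib[symmetric])
      ultimately show ?thesis unfolding abs_mult[of "?S x"] abs_of_nonneg[OF S0] mult.commute[of a] by (simp only: abs_mult[of "?S x"] abs_of_nonneg[OF S0])
    qed (simp add: C(2))
  qed
  also have "\<dots> = a * \<Lambda> w" unfolding integral_mult_right_zero Si(2) by (rule refl)
  finally show "\<bar>(\<integral>x. ?S x * err_mass (sd n) (beta n x) \<partial>\<H>) - \<Lambda> w * err_mass (sd n) b\<bar> \<le> a * \<Lambda> w" .
qed

text \<open>On the support of \<open>w\<close> the difference between \<open>miscl n\<close> and its Gaussian approximation is dominated by a
  function of \<open>f x - c\<close>: the error of the central limit theorem for \<open>\<bar>f x - c\<bar> \<le> T * tau n\<close>, and a Chebyshev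
  tail \<open>C4 * s\<^sup>2 / v\<^sup>2\<close> beyond. One first takes \<open>T\<close> large against the tail, then that error small against
  \<open>1 / T\<close>.\<close>

lemma piece_limit:
  assumes w: "continuous_on UNIV w" "\<And>x. 0 \<le> w x" and C: "compact C" "\<And>x. x \<notin> C \<Longrightarrow> w x = 0"
    and CG: "\<And>x. x \<in> C \<Longrightarrow> \<bar>f x - c\<bar> \<le> \<delta>0"
    and y: "\<And>n x. x \<in> C \<Longrightarrow> \<bar>beta n x - beta n y\<bar> \<le> \<epsilon> * hnu n" and \<epsilon>: "0 < \<epsilon>" "\<epsilon> \<le> 1" and e0: "0 < e0"
  shows "\<forall>\<^sub>F n in sequentially. \<bar>(\<integral>x. w x * miscl n x \<partial>lborel) -
     (\<integral>x. w x / norm (G x) * indicator {x. f x = c} x * err_mass (sd n) (beta n x) \<partial>\<H>)\<bar> \<le> (5 * \<epsilon> * \<Lambda> w + e0) * tau n"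
proof -
  have [measurable]: "w \<in> borel_measurable borel" using w(1) by (rule borel_measurable_continuous_onI)
  note [measurable] = measurable_cutoff
  define b where "b n = beta n y" for n
  have L0: "0 \<le> \<Lambda> w" by (simp add: \<Lambda>_def)
  have Bf: "0 \<le> Bf" using f_nonneg f_bdd order_trans by blast
  have w_int: "integrable lborel w" using cont_compact_integrable[OF w(1) C] .
  obtain C1 where C1: "0 \<le> C1" "\<And>n x. \<bar>beta n x\<bar> \<le> C1 * hnu n" using beta_bound by blast
  define C2 where "C2 = C1 + 1"
  \<comment> \<open>4 * Bf / c comes from Chebyshev's inequality for the estimator, 4 from the
    Gaussian tail.\<close>
  define C4 where "C4 = 4 * Bf / c + 4"
  have C4: "0 \<le> C4" "4 * Bf / c \<le> C4" using Bf c_pos by (auto simp: C4_def)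
  define A where "A = \<Lambda> w + 1"
  have A: "1 \<le> A" using L0 by (simp add: A_def)
  \<comment> \<open>T \<ge> 2 * C2 keeps the bias below half of |f x - c| outside the zone; the last
    bound makes the tail contribution at most e0 / 8.\<close>
  define T where "T = max (max 1 (2 * C2)) (16 * A * C4 / e0)"
  have T: "1 \<le> T" "2 * C2 \<le> T" "16 * A * C4 / e0 \<le> T" by (auto simp: T_def)
  have T4: "A * (2 * C4 / T) \<le> e0 / 8"
  proof -
    have "16 * A * C4 \<le> T * e0" using T(3) e0 by (simp add: field_simps)
    then show ?thesis using T(1) by (simp add: field_simps)
  qed
  define e1 where "e1 = e0 / (16 * A * T)"
  have e1: "0 < e1" "A * (2 * T * e1) = e0 / 8" using e0 A T(1) by (auto simp: e1_def)
  \<comment> \<open>The coarea error multiplies the integral of the cut-off Gaussian probability, at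
    most (1 + C1) * tau n, and the term 4 * \<epsilon> * tau n of the majorant; both products have
    to stay below e0 / 8 * tau n.\<close>
  define eCA where "eCA = min 1 (e0 / (32 * (1 + C1)))"
  have eCA: "0 < eCA" "eCA \<le> 1" "eCA * (1 + C1) \<le> e0 / 32" "4 * eCA \<le> e0 / 8"
  proof -
    show "0 < eCA" "eCA \<le> 1" using e0 C1 by (auto simp: eCA_def)
    have "eCA \<le> e0 / (32 * (1 + C1))" by (simp add: eCA_def)
    then show 1: "eCA * (1 + C1) \<le> e0 / 32" using C1(1) by (simp add: field_simps)
    have "eCA * 1 \<le> eCA * (1 + C1)" using C1(1) \<open>0 < eCA\<close> by (intro mult_left_mono) auto
    then show "4 * eCA \<le> e0 / 8" using 1 by simp
  qed
  obtain \<delta> where \<delta>: "0 < \<delta>" and CA: "\<And>k :: real \<Rightarrow> real. k \<in> borel_measurable borel \<Longrightarrow> (\<And>v. 0 \<le> k v) \<Longrightarrow> (\<And>v. \<delta> < \<bar>v\<bar> \<Longrightarrow> k v = 0) \<Longrightarrow>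
     integrable lborel k \<Longrightarrow> integrable lborel (\<lambda>x. w x * k (f x - c)) \<and>
       \<bar>(\<integral>x. w x * k (f x - c) \<partial>lborel) - \<Lambda> w * (\<integral>v. k v \<partial>lborel)\<bar> \<le> eCA * (\<integral>v. k v \<partial>lborel)"
    by (rule coarea_real[OF w C CG eCA(1)]) (assumption, assumption, rule that, assumption, blast)
  define W where "W = (\<integral>x. w x \<partial>lborel)"
  have W0: "0 \<le> W" using w(2) by (simp add: W_def)
  have sd_small: "\<forall>\<^sub>F n in sequentially. a * sd n \<le> e0 / 8" for a
  proof -
    have "(\<lambda>n. a * sd n) \<longlonglongrightarrow> 0" using tendsto_mult_left[OF sd_lim, of a] by simp
    from order_tendstoD(2)[OF this, of "e0 / 8"] show ?thesis using e0 by (auto elim: eventually_mono)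
  qed
  have "(\<lambda>n. 2 * C2 * hnu n) \<longlonglongrightarrow> 0" using tendsto_mult_left[OF hnu_lim, of "2 * C2"] by simp
  from order_tendstoD(2)[OF this \<delta>] have h_small: "\<forall>\<^sub>F n in sequentially. 2 * C2 * hnu n < \<delta>" .
  have near: "\<forall>\<^sub>F n in sequentially. \<forall>x\<in>C. \<bar>f x - c\<bar> \<le> T * tau n \<longrightarrow>
     \<bar>miscl n x - err_prob (sd n) (b n) (f x - c)\<bar> \<le>
        e1 + (\<Phi>N ((f x - c + (b n + 2 * \<epsilon> * hnu n)) / sd n) - \<Phi>N ((f x - c + (b n - 2 * \<epsilon> * hnu n)) / sd n))"
    using y unfolding b_def by (intro zone_near[OF C(1) _ \<epsilon>(1) e1(1)]) auto
  show ?thesis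
    using near bias_uniform[OF C(1) zero_less_one] eventually_gt_at_top[of 0] h_small sd_small[of "\<Lambda> w * (8 / \<delta>)"] sd_small[of "W * (4 * Bf / c) / \<delta>\<^sup>2"]
  proof eventually_elim
    case (elim n)
    define s where "s = sd n"
    have s: "0 < s" using elim(3) sd_pos by (simp add: s_def)
    have hn: "0 \<le> hnu n" by (rule hnu_nonneg)
    have st: "s \<le> tau n" "hnu n \<le> tau n" "0 < tau n" using tau_ge tau_pos elim(3) by (auto simp: s_def)
    have s2: "s\<^sup>2 \<le> s * tau n" using s st by (simp add: power2_eq_square)
    have meanC: "\<bar>mean n x - f x\<bar> \<le> C2 * hnu n" if "x \<in> C" for x
    proof -
      have "\<bar>mean n x - f x - beta n x\<bar> \<le> 1 * hnu n" using elim(2) that by blast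
      then show ?thesis using C1(2)[of n x] by (simp add: C2_def distrib_right)
    qed
    have bn: "\<bar>b n\<bar> \<le> C1 * hnu n" using C1(2) by (simp add: b_def)
    have bC2: "2 * \<bar>b n\<bar> \<le> 2 * C2 * hnu n" using bn hn by (simp add: C2_def distrib_right)
    have farm: "miscl n x \<le> 4 * Bf / c * (s\<^sup>2 / (f x - c)\<^sup>2)" if "x \<in> C" "2 * C2 * hnu n \<le> \<bar>f x - c\<bar>" "f x \<noteq> c" for x
      unfolding s_def by (rule far_bound[OF zero_less_one elim(3) meanC[OF that(1)] that(2,3)])
    define a where "a = T * tau n"
    have a: "0 < a" "2 * C2 * hnu n \<le> a"
    proof -
      show "0 < a" using T(1) st by (simp add: a_def)
      have "2 * C2 * hnu n \<le> T * tau n" using T st hn by (intro mult_mono) auto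
      then show "2 * C2 * hnu n \<le> a" by (simp add: a_def)
    qed
    define \<eta> where "\<eta> = 2 * \<epsilon> * hnu n"
    have \<eta>: "0 \<le> \<eta>" using \<epsilon> hn by (simp add: \<eta>_def)
    define k where "k v = indicator {v. \<bar>v\<bar> \<le> \<delta>} v * (indicator {v. \<bar>v\<bar> \<le> a} v * (e1 + (\<Phi>N ((v + (b n + \<eta>)) / s) - \<Phi>N ((v + (b n - \<eta>)) / s)))
      + indicator {v. a < \<bar>v\<bar>} v * (C4 * s\<^sup>2 / v\<^sup>2))" for v :: real
    have k: "k \<in> borel_measurable borel" "\<And>v. 0 \<le> k v" "integrable lborel k"
      "(\<integral>v. k v \<partial>lborel) \<le> 2 * a * e1 + 2 * \<eta> + 2 * C4 * s\<^sup>2 / a"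
      using majorant_integral[OF s \<eta> a(1) less_imp_le[OF e1(1)] C4(1), where b = "b n" and \<delta> = \<delta>] unfolding k_def[abs_def] by auto
    define q where "q v = indicator {v. \<bar>v\<bar> \<le> \<delta>} v * err_prob s (b n) v" for v :: real
    have bd: "2 * \<bar>b n\<bar> \<le> \<delta>" using bC2 elim(4) by linarith
    have q: "q \<in> borel_measurable borel" "\<And>v. 0 \<le> q v" "integrable lborel q"
      "(\<integral>v. q v \<partial>lborel) \<le> err_mass s (b n)" "err_mass s (b n) \<le> (\<integral>v. q v \<partial>lborel) + 8 * s\<^sup>2 / \<delta>"
      using err_prob_cutoff[OF s bd \<delta>] unfolding q_def[abs_def] by auto
    have kCA: "integrable lborel (\<lambda>x. w x * k (f x - c))"
      "\<bar>(\<integral>x. w x * k (f x - c) \<partial>lborel) - \<Lambda> w * (\<integral>v. k v \<partial>lborel)\<bar> \<le> eCA * (\<integral>v. k v \<partial>lborel)"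
      using CA[OF k(1,2) _ k(3)] by (auto simp: k_def)
    have qCA: "integrable lborel (\<lambda>x. w x * q (f x - c))"
      "\<bar>(\<integral>x. w x * q (f x - c) \<partial>lborel) - \<Lambda> w * (\<integral>v. q v \<partial>lborel)\<bar> \<le> eCA * (\<integral>v. q v \<partial>lborel)"
      using CA[OF q(1,2) _ q(3)] by (auto simp: q_def)
    \<comment> \<open>Three regimes of |f x - c|: the central limit zone up to \<open>a\<close>,
      quadratic tails up to \<open>\<delta>\<close>, and beyond \<open>\<delta>\<close>, where
      \<open>q\<close> vanishes, a constant of order s^2.\<close>
    have pt: "\<bar>w x * miscl n x - w x * q (f x - c)\<bar> \<le> w x * k (f x - c) + w x * (4 * Bf / c * (s\<^sup>2 / \<delta>\<^sup>2))" for x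
    proof (cases "x \<in> C")
      case True
      let ?v = "f x - c"
      have c0: "0 \<le> 4 * Bf / c * (s\<^sup>2 / \<delta>\<^sup>2)" using Bf c_pos by simp
      have "\<bar>miscl n x - q ?v\<bar> \<le> k ?v + 4 * Bf / c * (s\<^sup>2 / \<delta>\<^sup>2)"
      proof (cases "\<bar>?v\<bar> \<le> \<delta>")
        case in_\<delta>: True
        show ?thesis
        proof (cases "\<bar>?v\<bar> \<le> a")
          case True
          then have "\<bar>miscl n x - q ?v\<bar> \<le> k ?v"
            using elim(1) \<open>x \<in> C\<close> in_\<delta> by (simp add: k_def q_def a_def s_def \<eta>_def)
          then show ?thesis using c0 by linarith
        next
          case False
          then have v0: "?v \<noteq> 0" using a by auto
          have "miscl n x \<le> 4 * Bf / c * (s\<^sup>2 / ?v\<^sup>2)" using farm[OF \<open>x \<in> C\<close>] False a v0 by simp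
          moreover have "err_prob s (b n) ?v \<le> 4 * s\<^sup>2 / ?v\<^sup>2" using bC2 a False v0 by (intro err_prob_tail[OF s]) auto
          moreover have "4 * Bf / c * (s\<^sup>2 / ?v\<^sup>2) + 4 * s\<^sup>2 / ?v\<^sup>2 = C4 * s\<^sup>2 / ?v\<^sup>2" by (simp add: C4_def distrib_right add_divide_distrib)
          ultimately have "miscl n x + err_prob s (b n) ?v \<le> C4 * s\<^sup>2 / ?v\<^sup>2" by linarith
          moreover have "q ?v = err_prob s (b n) ?v" "k ?v = C4 * s\<^sup>2 / ?v\<^sup>2" using in_\<delta> False by (simp_all add: q_def k_def)
          ultimately show ?thesis using miscl_bounds(1)[of n x] err_prob_bounds(1)[of s "b n" ?v] c0 unfolding abs_le_iff by linarith
        qed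
      next
        case False
        then have v0: "?v \<noteq> 0" using \<delta> by auto
        have "miscl n x \<le> 4 * Bf / c * (s\<^sup>2 / ?v\<^sup>2)" using farm[OF \<open>x \<in> C\<close>] False elim(4) v0 by simp
        also have "\<dots> \<le> 4 * Bf / c * (s\<^sup>2 / \<delta>\<^sup>2)"
        proof (intro mult_left_mono divide_left_mono)
          show "\<delta>\<^sup>2 \<le> ?v\<^sup>2" using False \<delta> by (simp add: abs_le_square_iff[symmetric])
        qed (use Bf c_pos \<delta> v0 in auto)
        finally show ?thesis using False miscl_bounds(1)[of n x] k(2)[of ?v] by (simp add: q_def)
      qed
      from mult_left_mono[OF this w(2)[of x]] show ?thesis
        using w(2)[of x] by (simp only: right_diff_distrib[symmetric] abs_mult distrib_left[symmetric] abs_of_nonneg)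
    qed (simp add: C(2))
    have wm_int: "integrable lborel (\<lambda>x. w x * miscl n x)"
    proof (rule Bochner_Integration.integrable_bound[OF w_int])
      show "AE x in lborel. norm (w x * miscl n x) \<le> norm (w x)"
        using w(2) miscl_bounds[of n] by (intro AE_I2) (simp add: abs_mult mult_left_le)
    qed measurable
    let ?F = "4 * Bf / c * (s\<^sup>2 / \<delta>\<^sup>2)"
    have "\<bar>(\<integral>x. w x * miscl n x \<partial>lborel) - (\<integral>x. w x * q (f x - c) \<partial>lborel)\<bar> = \<bar>\<integral>x. w x * miscl n x - w x * q (f x - c) \<partial>lborel\<bar>"
      using wm_int qCA(1) by simp
    also have "\<dots> \<le> (\<integral>x. \<bar>w x * miscl n x - w x * q (f x - c)\<bar> \<partial>lborel)"
      using integral_norm_bound[of lborel "\<lambda>x. w x * miscl n x - w x * q (f x - c)"] by simp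
    also have "\<dots> \<le> (\<integral>x. w x * k (f x - c) + w x * ?F \<partial>lborel)"
      using wm_int qCA(1) kCA(1) w_int pt by (intro integral_mono) auto
    also have "\<dots> = (\<integral>x. w x * k (f x - c) \<partial>lborel) + W * ?F"
      using kCA(1) w_int by (simp add: W_def)
    finally have step1: "\<bar>(\<integral>x. w x * miscl n x \<partial>lborel) - (\<integral>x. w x * q (f x - c) \<partial>lborel)\<bar> \<le> (\<integral>x. w x * k (f x - c) \<partial>lborel) + W * ?F" .
    have kint: "(\<integral>v. k v \<partial>lborel) \<le> 2 * T * e1 * tau n + 4 * \<epsilon> * tau n + 2 * C4 / T * tau n"
    proof -
      have "2 * C4 * s\<^sup>2 / a \<le> 2 * C4 * (tau n * tau n) / a"
        using s st C4 a by (intro divide_right_mono mult_left_mono) (auto simp: power2_eq_square intro!: mult_mono)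
      also have "\<dots> = 2 * C4 / T * tau n" using st T(1) by (simp add: a_def)
      finally have "2 * C4 * s\<^sup>2 / a \<le> 2 * C4 / T * tau n" .
      moreover have "2 * \<eta> \<le> 4 * \<epsilon> * tau n" using \<epsilon> st by (simp add: \<eta>_def)
      moreover have "2 * a * e1 = 2 * T * e1 * tau n" by (simp add: a_def)
      ultimately show ?thesis using k(4) by linarith
    qed
    have k_int0: "0 \<le> (\<integral>v. k v \<partial>lborel)" using k(2) by simp
    have step2: "(\<integral>x. w x * k (f x - c) \<partial>lborel) \<le> (4 * \<epsilon> * \<Lambda> w + 3 * (e0 / 8)) * tau n"
    proof -
      have "(\<integral>x. w x * k (f x - c) \<partial>lborel) \<le> (\<Lambda> w + eCA) * (\<integral>v. k v \<partial>lborel)"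
        using kCA(2) unfolding abs_le_iff distrib_right by linarith
      also have "\<dots> \<le> (\<Lambda> w + eCA) * (2 * T * e1 * tau n + 4 * \<epsilon> * tau n + 2 * C4 / T * tau n)"
        using kint L0 eCA by (intro mult_left_mono) auto
      also have "\<dots> = ((\<Lambda> w + eCA) * (2 * T * e1) + (\<Lambda> w + eCA) * (2 * C4 / T) + 4 * \<epsilon> * \<Lambda> w + 4 * eCA * \<epsilon>) * tau n"
        by (simp add: algebra_simps)
      also have "\<dots> \<le> (e0 / 8 + e0 / 8 + 4 * \<epsilon> * \<Lambda> w + e0 / 8) * tau n"
      proof (intro mult_right_mono[of _ _ "tau n"] add_mono order_refl)
        have "(\<Lambda> w + eCA) * (2 * T * e1) \<le> A * (2 * T * e1)" using eCA T e1 by (intro mult_right_mono) (auto simp: A_def)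
        then show "(\<Lambda> w + eCA) * (2 * T * e1) \<le> e0 / 8" using e1 by simp
        have "(\<Lambda> w + eCA) * (2 * C4 / T) \<le> A * (2 * C4 / T)" using eCA T C4 by (intro mult_right_mono) (auto simp: A_def)
        then show "(\<Lambda> w + eCA) * (2 * C4 / T) \<le> e0 / 8" using T4 by linarith
        have "4 * eCA * \<epsilon> \<le> 4 * eCA * 1" using eCA \<epsilon> by (intro mult_left_mono) auto
        then show "4 * eCA * \<epsilon> \<le> e0 / 8" using eCA by linarith
      qed (use st \<epsilon> L0 in simp_all)
      finally show ?thesis by (simp add: algebra_simps)
    qed
    have step3: "W * ?F \<le> e0 / 8 * tau n"
    proof -
      have "W * ?F = W * (4 * Bf / c) / \<delta>\<^sup>2 * s\<^sup>2" by simp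
      also have "\<dots> \<le> W * (4 * Bf / c) / \<delta>\<^sup>2 * (s * tau n)" using s2 W0 Bf c_pos by (intro mult_left_mono) auto
      also have "\<dots> = (W * (4 * Bf / c) / \<delta>\<^sup>2 * sd n) * tau n" by (simp add: s_def)
      also have "\<dots> \<le> e0 / 8 * tau n" using elim(6) st by (intro mult_right_mono) auto
      finally show ?thesis .
    qed
    have em: "0 \<le> err_mass s (b n)" "err_mass s (b n) \<le> (1 + C1) * tau n"
    proof -
      show "0 \<le> err_mass s (b n)" using s by (intro err_mass_nonneg) simp
      have "err_mass s (b n) \<le> s + C1 * hnu n" using err_mass_le[OF s, of "b n"] bn by linarith
      also have "\<dots> \<le> tau n + C1 * tau n" using st C1(1) by (intro add_mono mult_left_mono) auto
      finally show "err_mass s (b n) \<le> (1 + C1) * tau n" by (simp add: distrib_right)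
    qed
    have step4: "\<bar>(\<integral>x. w x * q (f x - c) \<partial>lborel) - \<Lambda> w * (\<integral>v. q v \<partial>lborel)\<bar> \<le> e0 / 8 * tau n"
    proof -
      have "eCA * (\<integral>v. q v \<partial>lborel) \<le> eCA * ((1 + C1) * tau n)" using q(4) em eCA by (intro mult_left_mono) auto
      also have "\<dots> = (eCA * (1 + C1)) * tau n" by simp
      also have "\<dots> \<le> e0 / 8 * tau n" using eCA(3) e0 st by (intro mult_right_mono) auto
      finally show ?thesis using qCA(2) by linarith
    qed
    have step5: "\<bar>\<Lambda> w * (\<integral>v. q v \<partial>lborel) - \<Lambda> w * err_mass s (b n)\<bar> \<le> e0 / 8 * tau n"
    proof -
      have "\<bar>\<Lambda> w * (\<integral>v. q v \<partial>lborel) - \<Lambda> w * err_mass s (b n)\<bar> = \<Lambda> w * (err_mass s (b n) - (\<integral>v. q v \<partial>lborel))"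
        using q(4) L0 by (simp add: right_diff_distrib[symmetric] abs_mult)
      also have "\<dots> \<le> \<Lambda> w * (8 / \<delta> * s\<^sup>2)" using q(5) L0 by (intro mult_left_mono) auto
      also have "\<dots> \<le> \<Lambda> w * (8 / \<delta> * (s * tau n))" using s2 L0 \<delta> by (intro mult_left_mono) auto
      also have "\<dots> = (\<Lambda> w * (8 / \<delta>) * sd n) * tau n" by (simp add: s_def)
      also have "\<dots> \<le> e0 / 8 * tau n" using elim(5) st by (intro mult_right_mono) auto
      finally show ?thesis .
    qed
    have step6: "\<bar>(\<integral>x. w x / norm (G x) * indicator {x. f x = c} x * err_mass (sd n) (beta n x) \<partial>\<H>) - \<Lambda> w * err_mass s (b n)\<bar> \<le> \<epsilon> * \<Lambda> w * tau n"
    proof -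
      have "\<bar>(\<integral>x. w x / norm (G x) * indicator {x. f x = c} x * err_mass (sd n) (beta n x) \<partial>\<H>) - \<Lambda> w * err_mass (sd n) (b n)\<bar> \<le> (\<epsilon> * hnu n) * \<Lambda> w"
        using y[of _ n] unfolding b_def by (intro surface_mass(2)[OF w C CG elim(3)]) auto
      also have "\<dots> \<le> (\<epsilon> * tau n) * \<Lambda> w" using \<epsilon> st L0 by (intro mult_right_mono mult_left_mono) auto
      finally show ?thesis by (simp add: s_def mult_ac)
    qed
    \<comment> \<open>The bias shift contributes 4 * \<epsilon> * \<Lambda> w and the surface
      integral \<epsilon> * \<Lambda> w; the other six contributions are e0 / 8 each.\<close>
    have "(4 * \<epsilon> * \<Lambda> w + 3 * (e0 / 8)) * tau n + e0 / 8 * tau n + e0 / 8 * tau n + e0 / 8 * tau n + \<epsilon> * \<Lambda> w * tau n \<le> (5 * \<epsilon> * \<Lambda> w + e0) * tau n"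
      using st e0 by (simp add: algebra_simps)
    then show ?case using step1 step2 step3 step4 step5 step6 unfolding abs_le_iff by linarith
  qed
qed

text \<open>By the Lipschitz bound, a point with f x \<ge> a carries mass at least a / 2 * m in a
  ball of fixed radius. The mass of \<open>f\<close> outside large balls tends to 0, so such points
  stay in a bounded set.\<close>

lemma superlevel_compact:
  assumes a: "0 < a"
  shows "compact {x. a \<le> f x}"
proof -
  have f_int: "integrable lborel f" "(\<integral>x. f x \<partial>lborel) = 1"
  proof -
    have "(\<integral>\<^sup>+x. ennreal (f x) \<partial>lborel) = ennreal 1"
    proof -
      interpret D: prob_space "distr P lborel (X 0)" by (rule prob_space_distr) simp
      have "prob_space (density lborel (\<lambda>x. ennreal (f x)))"
        using D.prob_space_axioms density[of 0] by (simp add: distributed_distr_eq_density)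
      from prob_space.emeasure_space_1[OF this] show ?thesis by (simp add: emeasure_density)
    qed
    then have "integrable lborel f \<and> (\<integral>x. f x \<partial>lborel) = 1"
      using f_nonneg by (subst nn_integral_eq_integrable[symmetric]) auto
    then show "integrable lborel f" "(\<integral>x. f x \<partial>lborel) = 1" by auto
  qed
  define r where "r = a / 2 / (Lf + 1)"
  have r: "0 < r" "Lf * r \<le> a / 2"
  proof -
    show "0 < r" using a Lf by (simp add: r_def)
    have "Lf * r \<le> (Lf + 1) * r" using \<open>0 < r\<close> by (intro mult_right_mono) auto
    also have "\<dots> = a / 2"
    proof -
      have nz: "Lf + 1 \<noteq> 0" using Lf by simp
      have "(Lf + 1) * (a / 2 / (Lf + 1)) = a / 2" using nonzero_mult_div_cancel_left[OF nz, of "a / 2"] by (simp only: times_divide_eq_right)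
      then show ?thesis unfolding r_def .
    qed
    finally show "Lf * r \<le> a / 2" .
  qed
  define m where "m = measure lborel (ball (0::real^'d) r)"
  have m: "0 < m" "measure lborel (ball x r) = m" for x :: "real^'d"
    using r by (simp_all add: m_def measure_def emeasure_ball)
  have "(\<lambda>n. \<integral>x. f x * indicator {x. real n < norm x} x \<partial>lborel) \<longlonglongrightarrow> (\<integral>(x::real^'d). 0 \<partial>lborel)"
  proof (rule integral_dominated_convergence[where w = f])
    show "AE x in lborel. (\<lambda>n. f x * indicator {x. real n < norm x} x) \<longlonglongrightarrow> 0"
    proof (rule AE_I2)
      fix x :: "real^'d"
      obtain N :: nat where "norm x \<le> real N" using real_arch_simple by blast
      then have "\<forall>\<^sub>F n in sequentially. f x * indicator {x. real n < norm x} x = 0"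
        by (intro eventually_sequentiallyI[of N]) (auto simp: indicator_def)
      then show "(\<lambda>n. f x * indicator {x. real n < norm x} x) \<longlonglongrightarrow> 0" by (rule tendsto_eventually)
    qed
  qed (use f_int f_nonneg in \<open>auto simp: indicator_def\<close>)
  then have "(\<lambda>n. \<integral>x. f x * indicator {x. real n < norm x} x \<partial>lborel) \<longlonglongrightarrow> 0" by simp
  from order_tendstoD(2)[OF this, of "a / 2 * m"] a m obtain N where
    N: "(\<integral>x. f x * indicator {x. real N < norm x} x \<partial>lborel) < a / 2 * m" by (auto simp: eventually_sequentially)
  have "norm x \<le> real N + r" if x: "a \<le> f x" for x
  proof (rule ccontr)
    assume out: "\<not> norm x \<le> real N + r"
    have "a / 2 * m = (\<integral>z. a / 2 * indicator (ball x r) z \<partial>lborel)" by (simp add: m)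
    also have "\<dots> \<le> (\<integral>x. f x * indicator {x. real N < norm x} x \<partial>lborel)"
    proof (rule integral_mono)
      show "integrable lborel (\<lambda>x. f x * indicator {x. real N < norm x} x)"
        by (rule Bochner_Integration.integrable_bound[OF f_int(1)]) (auto simp: indicator_def)
      show "integrable lborel (\<lambda>z. a / 2 * indicator (ball x r) z)"
        by (intro integrable_mult_right integrable_real_indicator) (auto simp: emeasure_ball r(1) less_imp_le)
      fix z
      show "a / 2 * indicator (ball x r) z \<le> f z * indicator {x. real N < norm x} z"
      proof (cases "z \<in> ball x r")
        case True
        then have d: "norm (x - z) < r" by (simp add: dist_norm)
        have "\<bar>f x - f z\<bar> \<le> Lf * norm (x - z)" by (rule f_lip)
        also have "\<dots> \<le> Lf * r" using d Lf by (intro mult_left_mono) auto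
        finally have "a / 2 \<le> f z" using r(2) x by linarith
        moreover have "real N < norm z" using norm_triangle_ineq2[of x z] d out by linarith
        ultimately show ?thesis using True by simp
      qed (simp add: f_nonneg)
    qed
    finally show False using N by simp
  qed
  then have "bounded {x. a \<le> f x}" unfolding bounded_iff by blast
  moreover have "closed {x. a \<le> f x}" using f_cont by (intro closed_Collect_le continuous_intros)
  ultimately show ?thesis by (simp add: compact_eq_bounded_closed)
qed

text \<open>Chebyshev's inequality bounds miscl n x by a multiple of (sd n)^2 * msq n x here. If
  \<open>g\<close> is integrable, boundedness of \<open>msq\<close> suffices; if \<open>g\<close> is
  bounded, the integral of \<open>msq\<close> is at most \<kappa>2. Either way the region
  contributes order (sd n)^2, negligible against tau n.\<close>

lemma far_region:
  assumes [measurable]: "g \<in> borel_measurable borel" and g0: "\<And>x. 0 \<le> g x"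
    and g: "integrable lborel g \<or> (\<exists>Bg. \<forall>x. g x \<le> Bg)" and \<delta>: "0 < \<delta>"
  shows "\<exists>C\<ge>0. \<forall>\<^sub>F n in sequentially. (\<integral>\<^sup>+x. ennreal (g x * miscl n x * indicator {x. \<delta> < \<bar>f x - c\<bar>} x) \<partial>lborel) \<le> ennreal (C * (sd n)\<^sup>2)"
proof -
  have [measurable]: "{x. \<delta> < \<bar>f x - c\<bar>} \<in> sets borel" by measurable
  have Bf: "0 \<le> Bf" using f_nonneg f_bdd order_trans by blast
  obtain a where a: "a \<longlonglongrightarrow> 0" "\<And>n x. \<bar>mean n x - f x\<bar> \<le> a n" using mean_limit by blast
  define D where "D = 4 / (c * \<kappa>2 * \<delta>\<^sup>2)"
  have D: "0 \<le> D" using c_pos \<kappa>2_pos by (simp add: D_def)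
  have ev: "\<forall>\<^sub>F n in sequentially. \<forall>x. \<delta> < \<bar>f x - c\<bar> \<longrightarrow> miscl n x \<le> D * (sd n)\<^sup>2 * msq n x"
    using order_tendstoD(2)[OF a(1) half_gt_zero[OF \<delta>]] eventually_gt_at_top[of 0]
  proof eventually_elim
    case (elim n)
    show ?case
    proof (intro allI impI)
      fix x assume "\<delta> < \<bar>f x - c\<bar>"
      then have "\<bar>mean n x - f x\<bar> + \<delta> / 2 \<le> \<bar>f x - c\<bar>" using a(2)[of n x] elim by linarith
      then have "miscl n x \<le> msq n x * (sd n)\<^sup>2 / (c * \<kappa>2) / (\<delta> / 2)\<^sup>2"
        using elim \<delta> by (intro miscl_chebyshev) auto
      also have "\<dots> = D * (sd n)\<^sup>2 * msq n x" by (simp add: D_def power_divide)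
      finally show "miscl n x \<le> D * (sd n)\<^sup>2 * msq n x" .
    qed
  qed
  have m_meas [measurable]: "msq n \<in> borel_measurable borel" for n
  proof -
    have "(\<lambda>x. fst x - scale (h n) (snd x)) \<in> borel_measurable (borel \<Otimes>\<^sub>M lborel)" by measurable
    then have "(\<lambda>x. \<integral>u. (K u)\<^sup>2 * f (x - scale (h n) u) \<partial>lborel) \<in> borel_measurable borel" by measurable
    then show ?thesis by (simp add: msq_def[abs_def])
  qed
  from g show ?thesis
  proof
    assume gi: "integrable lborel g"
    let ?C = "D * (Bf * \<kappa>2) * (\<integral>x. g x \<partial>lborel)"
    have "0 \<le> ?C" using D Bf \<kappa>2_pos g0 by (intro mult_nonneg_nonneg) auto
    moreover have "\<forall>\<^sub>F n in sequentially. (\<integral>\<^sup>+x. ennreal (g x * miscl n x * indicator {x. \<delta> < \<bar>f x - c\<bar>} x) \<partial>lborel) \<le> ennreal (?C * (sd n)\<^sup>2)"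
      using ev
    proof eventually_elim
      case (elim n)
      have "g x * miscl n x * indicator {x. \<delta> < \<bar>f x - c\<bar>} x \<le> (D * (sd n)\<^sup>2 * (Bf * \<kappa>2)) * g x" for x
      proof (cases "\<delta> < \<bar>f x - c\<bar>")
        case True
        have "miscl n x \<le> D * (sd n)\<^sup>2 * msq n x" using elim True by blast
        also have "\<dots> \<le> D * (sd n)\<^sup>2 * (Bf * \<kappa>2)" using D msq_le by (intro mult_left_mono) auto
        finally have "g x * miscl n x \<le> g x * (D * (sd n)\<^sup>2 * (Bf * \<kappa>2))" using g0 by (intro mult_left_mono)
        then show ?thesis using True by (simp add: mult_ac)
      qed (use D Bf \<kappa>2_pos g0 in simp)
      then have "(\<integral>\<^sup>+x. ennreal (g x * miscl n x * indicator {x. \<delta> < \<bar>f x - c\<bar>} x) \<partial>lborel) \<le> (\<integral>\<^sup>+x. ennreal ((D * (sd n)\<^sup>2 * (Bf * \<kappa>2)) * g x) \<partial>lborel)"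
        by (intro nn_integral_mono ennreal_leI)
      also have "\<dots> = ennreal (\<integral>x. (D * (sd n)\<^sup>2 * (Bf * \<kappa>2)) * g x \<partial>lborel)"
        using gi g0 D Bf \<kappa>2_pos by (intro nn_integral_eq_integral) auto
      also have "(\<integral>x. (D * (sd n)\<^sup>2 * (Bf * \<kappa>2)) * g x \<partial>lborel) = ?C * (sd n)\<^sup>2" by simp
      finally show ?case .
    qed
    ultimately show ?thesis by blast
  next
    assume "\<exists>Bg. \<forall>x. g x \<le> Bg"
    then obtain Bg where Bg: "\<And>x. g x \<le> Bg" by blast
    have Bg0: "0 \<le> Bg" using g0 Bg order_trans by blast
    let ?C = "D * Bg * \<kappa>2"
    have "0 \<le> ?C" using D Bg0 \<kappa>2_pos by (intro mult_nonneg_nonneg) auto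
    moreover have "\<forall>\<^sub>F n in sequentially. (\<integral>\<^sup>+x. ennreal (g x * miscl n x * indicator {x. \<delta> < \<bar>f x - c\<bar>} x) \<partial>lborel) \<le> ennreal (?C * (sd n)\<^sup>2)"
      using ev
    proof eventually_elim
      case (elim n)
      have "g x * miscl n x * indicator {x. \<delta> < \<bar>f x - c\<bar>} x \<le> (D * (sd n)\<^sup>2 * Bg) * msq n x" for x
      proof (cases "\<delta> < \<bar>f x - c\<bar>")
        case True
        have "miscl n x \<le> D * (sd n)\<^sup>2 * msq n x" using elim True by blast
        then have "g x * miscl n x \<le> Bg * (D * (sd n)\<^sup>2 * msq n x)" using g0 Bg Bg0 miscl_bounds by (intro mult_mono)
        then show ?thesis using True by (simp add: mult_ac)
      qed (use D Bg0 msq_nonneg in simp)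
      then have "(\<integral>\<^sup>+x. ennreal (g x * miscl n x * indicator {x. \<delta> < \<bar>f x - c\<bar>} x) \<partial>lborel) \<le> (\<integral>\<^sup>+x. ennreal ((D * (sd n)\<^sup>2 * Bg) * msq n x) \<partial>lborel)"
        by (intro nn_integral_mono ennreal_leI)
      also have "\<dots> = ennreal (D * (sd n)\<^sup>2 * Bg) * (\<integral>\<^sup>+x. ennreal (msq n x) \<partial>lborel)"
        using D Bg0 by (subst nn_integral_cmult[symmetric]) (auto simp: ennreal_mult')
      also have "\<dots> \<le> ennreal (D * (sd n)\<^sup>2 * Bg) * ennreal \<kappa>2" by (intro mult_left_mono nn_integral_msq) simp
      also have "\<dots> = ennreal (?C * (sd n)\<^sup>2)" using D Bg0 by (subst ennreal_mult'[symmetric]) (simp_all add: mult_ac \<kappa>2_pos less_imp_le)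
      finally show ?case .
    qed
    ultimately show ?thesis by blast
  qed
qed

text \<open>beta n / hnu n is a combination of finitely many fixed continuous functions with
  coefficients bounded in n, hence equicontinuous on compact sets. So one \<open>\<rho>\<close>
  serves all n.\<close>

lemma beta_uniform:
  assumes C: "compact C" and e: "0 < e"
  shows "\<exists>\<rho>>0. \<forall>n. \<forall>x\<in>C. \<forall>y\<in>C. dist x y < \<rho> \<longrightarrow> \<bar>beta n x - beta n y\<bar> \<le> e * hnu n"
proof -
  define D :: "real^'d \<Rightarrow> real^'d" where "D x = (\<chi> k. partials (replicate \<nu> k) f x)" for x
  let ?k = "\<bar>kappa \<nu> Kt / fact \<nu>\<bar>"
  define e' where "e' = e / ((?k + 1) * real CARD('d))"
  have e': "0 < e'" "?k * (real CARD('d) * e') \<le> e"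
  proof -
    have pos: "0 < (?k + 1) * real CARD('d)" by (intro mult_pos_pos) (auto intro: add_nonneg_pos)
    then show "0 < e'" using e by (simp add: e'_def)
    have "?k * (real CARD('d) * e') \<le> (?k + 1) * (real CARD('d) * e')" using \<open>0 < e'\<close> by (intro mult_right_mono) auto
    also have "\<dots> = ((?k + 1) * real CARD('d)) * e'" by (rule mult.assoc[symmetric])
    also have "\<dots> = e" unfolding e'_def using pos by (metis nonzero_mult_div_cancel_left less_irrefl times_divide_eq_right)
    finally show "?k * (real CARD('d) * e') \<le> e" .
  qed
  have "continuous_on C D" unfolding D_def
    by (intro continuous_on_vec_lambda continuous_on_subset[OF partials_cont]) auto
  then have "uniformly_continuous_on C D" using C by (rule compact_uniformly_continuous)
  then obtain \<rho> where \<rho>: "0 < \<rho>" "\<And>x y. x \<in> C \<Longrightarrow> y \<in> C \<Longrightarrow> dist x y < \<rho> \<Longrightarrow> dist (D x) (D y) < e'"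
    unfolding uniformly_continuous_on_def using e'(1) by (metis dist_commute)
  have "\<bar>beta n x - beta n y\<bar> \<le> e * hnu n" if "x \<in> C" "y \<in> C" "dist x y < \<rho>" for n x y
  proof -
    have D: "\<bar>D x $ k - D y $ k\<bar> \<le> e'" for k
      using \<rho>(2)[OF that] component_le_norm_cart[of "D x - D y" k] by (simp add: dist_norm)
    have hk: "\<bar>(h n $ k) ^ \<nu>\<bar> \<le> hnu n" for k
      unfolding hnu_def power_abs by (intro power_mono component_le_norm_cart) auto
    have "beta n x - beta n y = kappa \<nu> Kt / fact \<nu> * (\<Sum>k\<in>UNIV. (h n $ k) ^ \<nu> * (D x $ k - D y $ k))"
      by (simp add: beta_def bias_beta_def D_def right_diff_distrib sum_subtractf)
    also have "\<bar>\<dots>\<bar> = ?k * \<bar>\<Sum>k\<in>UNIV. (h n $ k) ^ \<nu> * (D x $ k - D y $ k)\<bar>" by (rule abs_mult)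
    also have "\<dots> \<le> ?k * (\<Sum>k\<in>(UNIV :: 'd set). hnu n * e')"
    proof (rule mult_left_mono)
      have "\<bar>\<Sum>k\<in>UNIV. (h n $ k) ^ \<nu> * (D x $ k - D y $ k)\<bar> \<le> (\<Sum>k\<in>UNIV. \<bar>(h n $ k) ^ \<nu> * (D x $ k - D y $ k)\<bar>)"
        by (rule sum_abs)
      also have "\<dots> \<le> (\<Sum>k\<in>(UNIV :: 'd set). hnu n * e')"
        unfolding abs_mult using D hk hnu_nonneg by (intro sum_mono mult_mono) auto
      finally show "\<bar>\<Sum>k\<in>UNIV. (h n $ k) ^ \<nu> * (D x $ k - D y $ k)\<bar> \<le> (\<Sum>k\<in>(UNIV :: 'd set). hnu n * e')" .
    qed simp
    also have "\<dots> = (?k * (real CARD('d) * e')) * hnu n" by (simp add: mult_ac)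
    also have "\<dots> \<le> e * hnu n" using e'(2) hnu_nonneg by (rule mult_right_mono)
    finally show ?thesis .
  qed
  then show ?thesis using \<rho>(1) by blast
qed

text \<open>The bias error of a piece is weighted by its own surface integral \<Lambda> (w y). These
  add up to \<Lambda> v, so \<open>\<epsilon>\<close> can be fixed before the number of pieces is
  known, and only the residual e0 is divided among them.\<close>

lemma risk_expansion:
  assumes g: "continuous_on UNIV g" "\<And>x. 0 \<le> g x"
    and gb: "integrable lborel g \<or> (\<exists>Bg. \<forall>x. g x \<le> Bg)" and e: "0 < e"
  shows "\<forall>\<^sub>F n in sequentially. integrable lborel (\<lambda>x. g x * miscl n x) \<and>
    \<bar>(\<integral>x. g x * miscl n x \<partial>lborel) -
      (\<integral>x. g x / norm (G x) * indicator {x. f x = c} x * err_mass (sd n) (beta n x) \<partial>\<H>)\<bar> \<le> e * tau n"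
proof -
  have g_meas [measurable]: "g \<in> borel_measurable borel" using g(1) by (rule borel_measurable_continuous_onI)
  \<comment> \<open>Staying above c / 2 makes the band compact, and \<delta>1 \<le> \<delta>0 keeps
    the gradient nonzero on it.\<close>
  define \<delta>1 where "\<delta>1 = min \<delta>0 (c / 2)"
  have \<delta>1: "0 < \<delta>1" "\<delta>1 \<le> \<delta>0" "\<delta>1 \<le> c / 2" using \<delta>0 c_pos by (auto simp: \<delta>1_def)
  define C0 where "C0 = {x. \<bar>f x - c\<bar> \<le> \<delta>1}"
  have C0: "compact C0"
  proof -
    have "C0 = {x. c / 2 \<le> f x} \<inter> {x. \<bar>f x - c\<bar> \<le> \<delta>1}" using \<delta>1(3) by (auto simp: C0_def)
    moreover have "closed {x. \<bar>f x - c\<bar> \<le> \<delta>1}" using f_cont by (intro closed_Collect_le continuous_intros)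
    ultimately show ?thesis using superlevel_compact[of "c / 2"] c_pos by (simp only: compact_Int_closed half_gt_zero)
  qed
  \<comment> \<open>A cut-off equal to 1 for |f x - c| \<le> \<delta>1 / 2 and to 0 outside
    \<open>C0\<close>.\<close>
  define u where "u x = max 0 (min 1 (2 - 2 * \<bar>f x - c\<bar> / \<delta>1))" for x
  have u: "continuous_on UNIV u" "\<And>x. 0 \<le> u x" "\<And>x. u x \<le> 1"
    unfolding u_def using f_cont \<delta>1(1) by (auto intro!: continuous_intros)
  have u_out: "u x = 0" if "x \<notin> C0" for x
  proof -
    have "2 * \<delta>1 \<le> 2 * \<bar>f x - c\<bar>" using that by (simp add: C0_def)
    then have "2 \<le> 2 * \<bar>f x - c\<bar> / \<delta>1" using \<delta>1(1) by (simp add: pos_le_divide_eq)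
    then show ?thesis by (simp add: u_def)
  qed
  have u_in: "u x = 1" if "\<bar>f x - c\<bar> \<le> \<delta>1 / 2" for x
  proof -
    have "2 * \<bar>f x - c\<bar> / \<delta>1 \<le> 1" using that \<delta>1(1) by (simp add: pos_divide_le_eq)
    then show ?thesis by (simp add: u_def)
  qed
  have [measurable]: "u \<in> borel_measurable borel" using u(1) by (rule borel_measurable_continuous_onI)
  define v where "v x = u x * g x" for x
  have v: "continuous_on UNIV v" "\<And>x. 0 \<le> v x" "\<And>x. x \<notin> C0 \<Longrightarrow> v x = 0"
    using u(1,2) g u_out unfolding v_def by (auto intro!: continuous_intros)
  have L0: "0 \<le> \<Lambda> v" by (simp add: \<Lambda>_def)
  \<comment> \<open>5 * \<Lambda> v stems from the pieces; of the summand 2, one unit pays for their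
    residual errors e0 and one for the far region.\<close>
  define \<epsilon> where "\<epsilon> = min 1 (e / (5 * \<Lambda> v + 2))"
  have \<epsilon>: "0 < \<epsilon>" "\<epsilon> \<le> 1" "\<epsilon> * (5 * \<Lambda> v + 2) \<le> e"
  proof -
    have p: "0 < 5 * \<Lambda> v + 2" using L0 by simp
    then show "0 < \<epsilon>" "\<epsilon> \<le> 1" using e by (auto simp: \<epsilon>_def)
    have "\<epsilon> \<le> e / (5 * \<Lambda> v + 2)" by (simp add: \<epsilon>_def)
    then show "\<epsilon> * (5 * \<Lambda> v + 2) \<le> e" using p by (simp add: pos_le_divide_eq)
  qed
  obtain \<rho> where \<rho>: "0 < \<rho>" "\<And>n x y. x \<in> C0 \<Longrightarrow> y \<in> C0 \<Longrightarrow> dist x y < \<rho> \<Longrightarrow> \<bar>beta n x - beta n y\<bar> \<le> \<epsilon> * hnu n"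
    using beta_uniform[OF C0 \<epsilon>(1)] by blast
  obtain Y and p :: "real^'d \<Rightarrow> real^'d \<Rightarrow> real" where Y: "finite Y" "Y \<subseteq> C0"
    and p: "\<And>y. continuous_on UNIV (p y)" "\<And>y x. 0 \<le> p y x" "\<And>y x. p y x \<noteq> 0 \<Longrightarrow> dist y x < \<rho> / 2"
    and p1: "\<And>x. x \<in> C0 \<Longrightarrow> (\<Sum>y\<in>Y. p y x) = 1"
    using partition_of_unity_balls[OF C0, of "\<lambda>_. \<rho> / 2"] \<rho>(1) by (metis half_gt_zero)
  define w where "w y x = p y x * v x" for y x
  define C where "C y = C0 \<inter> cball y (\<rho> / 2)" for y
  have w: "continuous_on UNIV (w y)" "\<And>x. 0 \<le> w y x" "\<And>x. x \<notin> C y \<Longrightarrow> w y x = 0" for y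
  proof -
    show "continuous_on UNIV (w y)" unfolding w_def using p(1) v(1) by (intro continuous_intros)
    show "0 \<le> w y x" for x unfolding w_def using p(2) v(2) by (rule mult_nonneg_nonneg)
    show "w y x = 0" if "x \<notin> C y" for x using that p(3)[of y x] v(3)[of x] by (cases "x \<in> C0"; cases "p y x = 0") (auto simp: w_def C_def)
  qed
  have C: "compact (C y)" for y unfolding C_def using C0 by (intro compact_Int_closed) auto
  have CG: "\<bar>f x - c\<bar> \<le> \<delta>0" if "x \<in> C y" for x y using that \<delta>1(2) by (auto simp: C_def C0_def)
  have w_sum: "(\<Sum>y\<in>Y. w y x) = v x" for x
  proof (cases "x \<in> C0")
    case True
    then show ?thesis by (simp add: w_def sum_distrib_right[symmetric] p1)
  qed (simp add: w_def v(3))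
  have \<Lambda>_sum: "(\<Sum>y\<in>Y. \<Lambda> (w y)) = \<Lambda> v"
  proof -
    have "(\<Sum>y\<in>Y. \<Lambda> (w y)) = (\<Sum>y\<in>Y. \<integral>x. w y x / norm (G x) * indicator {x. f x = c} x \<partial>\<H>)"
      by (simp only: surface_integral(2)[OF w(1,2) C w(3) CG])
    also have "\<dots> = (\<integral>x. (\<Sum>y\<in>Y. w y x / norm (G x) * indicator {x. f x = c} x) \<partial>\<H>)"
      by (rule Bochner_Integration.integral_sum[symmetric]) (rule surface_integral(1)[OF w(1,2) C w(3) CG])
    also have "\<dots> = (\<integral>x. v x / norm (G x) * indicator {x. f x = c} x \<partial>\<H>)"
      by (simp only: sum_distrib_right[symmetric] sum_divide_distrib[symmetric] w_sum)
    also have "\<dots> = \<Lambda> v" using \<delta>1(2) by (intro surface_integral(2)[OF v(1,2) C0 v(3)]) (auto simp: C0_def)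
    finally show ?thesis .
  qed
  define e0 where "e0 = \<epsilon> / (real (card Y) + 1)"
  have e0: "0 < e0" "real (card Y) * e0 \<le> \<epsilon>"
  proof -
    show "0 < e0" using \<epsilon>(1) by (simp add: e0_def)
    have "real (card Y) * \<epsilon> \<le> \<epsilon> * (real (card Y) + 1)" using \<epsilon>(1) by (simp add: algebra_simps)
    then show "real (card Y) * e0 \<le> \<epsilon>" unfolding e0_def by (simp add: pos_divide_le_eq)
  qed
  let ?S = "\<lambda>n w x. w x / norm (G x) * indicator {x. f x = c} x * err_mass (sd n) (beta n x)"
  have pieces: "\<forall>\<^sub>F n in sequentially. \<forall>y\<in>Y. \<bar>(\<integral>x. w y x * miscl n x \<partial>lborel) - (\<integral>x. ?S n (w y) x \<partial>\<H>)\<bar> \<le> (5 * \<epsilon> * \<Lambda> (w y) + e0) * tau n"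
  proof (rule eventually_ball_finite[OF Y(1)], intro ballI)
    fix y assume y: "y \<in> Y"
    show "\<forall>\<^sub>F n in sequentially. \<bar>(\<integral>x. w y x * miscl n x \<partial>lborel) - (\<integral>x. ?S n (w y) x \<partial>\<H>)\<bar> \<le> (5 * \<epsilon> * \<Lambda> (w y) + e0) * tau n"
    proof (rule piece_limit[OF w(1,2) C w(3) CG _ \<epsilon>(1,2) e0(1)])
      fix n x assume x: "x \<in> C y"
      show "\<bar>beta n x - beta n y\<bar> \<le> \<epsilon> * hnu n"
        using x y Y(2) \<rho>(1) by (intro \<rho>(2)) (auto simp: C_def dist_commute)
    qed
  qed
  have \<delta>2: "0 < \<delta>1 / 2" using \<delta>1(1) by simp
  obtain D where D: "0 \<le> D" "\<forall>\<^sub>F n in sequentially. (\<integral>\<^sup>+x. ennreal (g x * miscl n x * indicator {x. \<delta>1 / 2 < \<bar>f x - c\<bar>} x) \<partial>lborel) \<le> ennreal (D * (sd n)\<^sup>2)"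
    using far_region[OF g_meas g(2) gb \<delta>2] by blast
  have sd_small: "\<forall>\<^sub>F n in sequentially. D * sd n < \<epsilon>"
  proof -
    have "(\<lambda>n. D * sd n) \<longlonglongrightarrow> 0" using tendsto_mult_left[OF sd_lim, of D] by simp
    from order_tendstoD(2)[OF this \<epsilon>(1)] show ?thesis .
  qed
  show ?thesis
    using pieces D(2) sd_small eventually_gt_at_top[of 0]
  proof eventually_elim
    case (elim n)
    have t: "0 \<le> tau n" "sd n \<le> tau n" "0 < sd n" using tau_ge sd_pos[OF elim(4)] by auto
    define R where "R x = (1 - u x) * g x * miscl n x" for x
    have R0: "0 \<le> R x" for x using u(3) g(2) miscl_bounds by (simp add: R_def)
    have [measurable]: "R \<in> borel_measurable borel" unfolding R_def by measurable
    have "R x \<le> g x * miscl n x * indicator {x. \<delta>1 / 2 < \<bar>f x - c\<bar>} x" for x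
    proof (cases "\<delta>1 / 2 < \<bar>f x - c\<bar>")
      case True
      have "(1 - u x) * (g x * miscl n x) \<le> 1 * (g x * miscl n x)"
        using u(2)[of x] g(2)[of x] miscl_bounds(1)[of n x] by (intro mult_right_mono) auto
      then show ?thesis using True by (simp add: R_def mult_ac)
    qed (simp add: R_def u_in)
    then have "(\<integral>\<^sup>+x. ennreal (R x) \<partial>lborel) \<le> (\<integral>\<^sup>+x. ennreal (g x * miscl n x * indicator {x. \<delta>1 / 2 < \<bar>f x - c\<bar>} x) \<partial>lborel)"
      by (intro nn_integral_mono ennreal_leI)
    then have Rle: "(\<integral>\<^sup>+x. ennreal (R x) \<partial>lborel) \<le> ennreal (D * (sd n)\<^sup>2)" using elim(2) by (rule order_trans)
    then have "(\<integral>\<^sup>+x. ennreal (R x) \<partial>lborel) < top" by (rule le_less_trans) simp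
    then have Ri: "integrable lborel R" using R0 by (intro integrableI_nonneg) auto
    have "(\<integral>\<^sup>+x. ennreal (R x) \<partial>lborel) = ennreal (\<integral>x. R x \<partial>lborel)" using Ri R0 by (intro nn_integral_eq_integral) auto
    then have R1: "(\<integral>x. R x \<partial>lborel) \<le> D * (sd n)\<^sup>2" using Rle D(1) by (simp add: ennreal_le_iff)
    have "D * (sd n)\<^sup>2 = (D * sd n) * sd n" by (simp add: power2_eq_square)
    also have "\<dots> \<le> \<epsilon> * tau n" using elim(3) t \<epsilon>(1) by (intro mult_mono) auto
    finally have R2: "(\<integral>x. R x \<partial>lborel) \<le> \<epsilon> * tau n" using R1 by linarith
    have R3: "0 \<le> (\<integral>x. R x \<partial>lborel)" using R0 by simp
    have wi: "integrable lborel (\<lambda>x. w y x * miscl n x)" for y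
    proof (rule Bochner_Integration.integrable_bound[OF cont_compact_integrable[OF w(1) C w(3)]])
      have "w y \<in> borel_measurable borel" using w(1) by (rule borel_measurable_continuous_onI)
      then show "(\<lambda>x. w y x * miscl n x) \<in> borel_measurable lborel" by measurable
      show "AE x in lborel. norm (w y x * miscl n x) \<le> norm (w y x)"
        using w(2)[of y] miscl_bounds[of n] by (intro AE_I2) (simp add: abs_mult mult_left_le)
    qed
    have split: "g x * miscl n x = (\<Sum>y\<in>Y. w y x * miscl n x) + R x" for x
      unfolding sum_distrib_right[symmetric] w_sum v_def R_def by (simp add: algebra_simps)
    have int: "integrable lborel (\<lambda>x. g x * miscl n x)"
      unfolding split using wi Ri by (intro Bochner_Integration.integrable_add Bochner_Integration.integrable_sum)
    have int_eq: "(\<integral>x. g x * miscl n x \<partial>lborel) = (\<Sum>y\<in>Y. \<integral>x. w y x * miscl n x \<partial>lborel) + (\<integral>x. R x \<partial>lborel)"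
      unfolding split using wi Ri
      by (subst Bochner_Integration.integral_add) (auto intro!: Bochner_Integration.integrable_sum Bochner_Integration.integral_sum)
    have surf: "(\<integral>x. ?S n g x \<partial>\<H>) = (\<Sum>y\<in>Y. \<integral>x. ?S n (w y) x \<partial>\<H>)"
    proof -
      have "?S n g x = (\<Sum>y\<in>Y. ?S n (w y) x)" for x
      proof (cases "f x = c")
        case True
        then have "u x = 1" using \<delta>1(1) by (intro u_in) simp
        then have "g x = v x" by (simp add: v_def)
        then show ?thesis by (simp only: sum_distrib_right[symmetric] sum_divide_distrib[symmetric] w_sum)
      qed simp
      then have "(\<integral>x. ?S n g x \<partial>\<H>) = (\<integral>x. (\<Sum>y\<in>Y. ?S n (w y) x) \<partial>\<H>)" by (simp only:)
      also have "\<dots> = (\<Sum>y\<in>Y. \<integral>x. ?S n (w y) x \<partial>\<H>)"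
        by (rule Bochner_Integration.integral_sum) (rule surface_mass(1)[OF w(1,2) C w(3) CG elim(4)])
      finally show ?thesis .
    qed
    have "\<bar>(\<Sum>y\<in>Y. \<integral>x. w y x * miscl n x \<partial>lborel) - (\<Sum>y\<in>Y. \<integral>x. ?S n (w y) x \<partial>\<H>)\<bar>
        \<le> (\<Sum>y\<in>Y. \<bar>(\<integral>x. w y x * miscl n x \<partial>lborel) - (\<integral>x. ?S n (w y) x \<partial>\<H>)\<bar>)"
      unfolding sum_subtractf[symmetric] by (rule sum_abs)
    also have "\<dots> \<le> (\<Sum>y\<in>Y. (5 * \<epsilon> * \<Lambda> (w y) + e0) * tau n)" using elim(1) by (intro sum_mono) blast
    also have "\<dots> = (5 * \<epsilon> * \<Lambda> v + real (card Y) * e0) * tau n"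
      by (simp add: sum_distrib_right[symmetric] sum.distrib sum_distrib_left[symmetric] \<Lambda>_sum)
    also have "\<dots> \<le> (5 * \<epsilon> * \<Lambda> v + \<epsilon>) * tau n" using e0(2) t by (intro mult_right_mono) auto
    finally have "\<bar>(\<integral>x. g x * miscl n x \<partial>lborel) - (\<integral>x. ?S n g x \<partial>\<H>)\<bar> \<le> (5 * \<epsilon> * \<Lambda> v + \<epsilon>) * tau n + \<epsilon> * tau n"
      unfolding int_eq surf using R2 R3 unfolding abs_le_iff by linarith
    also have "\<dots> = (\<epsilon> * (5 * \<Lambda> v + 2)) * tau n" by (simp add: algebra_simps)
    also have "\<dots> \<le> e * tau n" using \<epsilon>(3) t by (intro mult_right_mono)
    finally show ?case using int by blast
  qed
qed

text \<open>The integrand is nonnegative, so integrability of g * miscl gives joint integrability by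
  Tonelli, and Fubini exchanges expectation and integral.\<close>

lemma expected_risk:
  assumes [measurable]: "g \<in> borel_measurable borel" and g0: "\<And>x. 0 \<le> g x"
    and int: "integrable lborel (\<lambda>x. g x * miscl n x)"
  shows "(\<integral>\<omega>. lambda_meas g (({x. c \<le> f x} - {x. c \<le> fh n x \<omega>}) \<union> ({x. c \<le> fh n x \<omega>} - {x. c \<le> f x})) \<partial>P)
     = (\<integral>x. g x * miscl n x \<partial>lborel)"
proof -
  interpret Q: pair_sigma_finite P "lborel :: (real^'d) measure" ..
  define F where "F \<omega> x = g x * (if (c \<le> f x) \<noteq> (c \<le> fh n x \<omega>) then 1 else 0)" for \<omega> x
  have F0: "0 \<le> F \<omega> x" for \<omega> x using g0 by (simp add: F_def)
  note [measurable] = fh_pair_meas[unfolded split_beta']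
  have F_meas [measurable]: "(\<lambda>z. F (fst z) (snd z)) \<in> borel_measurable (P \<Otimes>\<^sub>M lborel)"
    unfolding F_def by measurable
  have inner: "integrable P (\<lambda>\<omega>. F \<omega> x)" "(\<integral>\<omega>. F \<omega> x \<partial>P) = g x * miscl n x" for x
  proof -
    let ?E = "{\<omega>\<in>space P. (c \<le> f x) \<noteq> (c \<le> fh n x \<omega>)}"
    have E: "?E \<in> sets P" by measurable
    have eq: "F \<omega> x = g x * indicator ?E \<omega>" if "\<omega> \<in> space P" for \<omega> using that by (simp add: F_def)
    have "integrable P (\<lambda>\<omega>. g x * indicator ?E \<omega>)"
      using E by (intro integrable_mult_right integrable_real_indicator) (auto simp: emeasure_eq_measure)
    then show "integrable P (\<lambda>\<omega>. F \<omega> x)" by (subst Bochner_Integration.integrable_cong[OF refl eq]) auto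
    have "(\<integral>\<omega>. F \<omega> x \<partial>P) = (\<integral>\<omega>. g x * indicator ?E \<omega> \<partial>P)" by (rule Bochner_Integration.integral_cong[OF refl eq])
    also have "\<dots> = g x * miscl n x" using E by (simp add: miscl_def)
    finally show "(\<integral>\<omega>. F \<omega> x \<partial>P) = g x * miscl n x" .
  qed
  have "(\<integral>\<^sup>+z. ennreal (F (fst z) (snd z)) \<partial>(P \<Otimes>\<^sub>M lborel)) = (\<integral>\<^sup>+x. (\<integral>\<^sup>+\<omega>. ennreal (F \<omega> x) \<partial>P) \<partial>lborel)"
    using Q.nn_integral_snd[of "\<lambda>z. ennreal (F (fst z) (snd z))"] by simp
  also have "\<dots> = (\<integral>\<^sup>+x. ennreal (g x * miscl n x) \<partial>lborel)"
    using inner F0 by (intro nn_integral_cong) (simp add: nn_integral_eq_integral)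
  also have "\<dots> = ennreal (\<integral>x. g x * miscl n x \<partial>lborel)"
    using int g0 miscl_bounds by (intro nn_integral_eq_integral) auto
  finally have "(\<integral>\<^sup>+z. ennreal (F (fst z) (snd z)) \<partial>(P \<Otimes>\<^sub>M lborel)) < top" by simp
  then have "integrable (P \<Otimes>\<^sub>M lborel) (\<lambda>z. F (fst z) (snd z))" using F0 by (intro integrableI_nonneg) auto
  then have "integrable (P \<Otimes>\<^sub>M lborel) (case_prod F)" by (simp add: split_beta')
  from Q.Fubini_integral[OF this] have "(\<integral>\<omega>. (\<integral>x. F \<omega> x \<partial>lborel) \<partial>P) = (\<integral>x. g x * miscl n x \<partial>lborel)"
    by (simp add: inner)
  moreover have "lambda_meas g (({x. c \<le> f x} - {x. c \<le> fh n x \<omega>}) \<union> ({x. c \<le> fh n x \<omega>} - {x. c \<le> f x})) = (\<integral>x. F \<omega> x \<partial>lborel)" for \<omega>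
    unfolding lambda_meas_def set_lebesgue_integral_def F_def
    by (intro Bochner_Integration.integral_cong) (auto simp: indicator_def)
  ultimately show ?thesis by simp
qed

lemma risk_asymptotics:
  assumes g: "continuous_on UNIV g" "\<And>x. 0 \<le> g x"
    and gb: "integrable lborel g \<or> (\<exists>Bg. \<forall>x. g x \<le> Bg)"
  shows "(\<lambda>n. (\<integral>\<omega>. lambda_meas g (({x. c \<le> f x} - {x. c \<le> fh n x \<omega>}) \<union> ({x. c \<le> fh n x \<omega>} - {x. c \<le> f x})) \<partial>P)
      - (LINT x:{x. f x = c}|hausdorff_measure (CARD('d) - 1). err_mass (sd n) (beta n x) / norm (G x) * g x))
    \<in> o(\<lambda>n. norm (h n) ^ \<nu> + 1 / sqrt (real n * (\<Prod>j\<in>UNIV. h n $ j)))"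
proof (rule landau_o.smallI)
  fix e :: real assume e: "0 < e"
  have gm: "g \<in> borel_measurable borel" using g(1) by (rule borel_measurable_continuous_onI)
  \<comment> \<open>sd n equals sqrt (c * \<kappa>2) / sqrt (n * vol n), so tau n is at most
    \<open>A\<close> times the rate of the claim.\<close>
  define A where "A = max 1 (sqrt (c * \<kappa>2))"
  have A: "1 \<le> A" "sqrt (c * \<kappa>2) \<le> A" by (auto simp: A_def)
  have tau_le: "tau n \<le> A * (norm (h n) ^ \<nu> + 1 / sqrt (real n * vol n))" for n
  proof -
    have p: "0 \<le> 1 / sqrt (real n * vol n)" using vol_pos[of n] by simp
    have "sd n = sqrt (c * \<kappa>2 / (real n * vol n))" using sd_sq[of n] by (metis real_sqrt_unique)
    then have "sd n = sqrt (c * \<kappa>2) * (1 / sqrt (real n * vol n))" by (simp only: real_sqrt_divide mult_1_right times_divide_eq_right)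
    also have "\<dots> \<le> A * (1 / sqrt (real n * vol n))" using A(2) p by (rule mult_right_mono)
    finally have "sd n \<le> A * (1 / sqrt (real n * vol n))" .
    moreover have "hnu n \<le> A * hnu n" using mult_right_mono[OF A(1) hnu_nonneg[of n]] by simp
    ultimately have "hnu n + sd n \<le> A * hnu n + A * (1 / sqrt (real n * vol n))" by (rule add_mono[rotated])
    then show ?thesis unfolding tau_def distrib_left by (simp only: hnu_def)
  qed
  have eA: "0 < e / A" using e A(1) by simp
  show "\<forall>\<^sub>F n in sequentially. norm ((\<integral>\<omega>. lambda_meas g (({x. c \<le> f x} - {x. c \<le> fh n x \<omega>}) \<union> ({x. c \<le> fh n x \<omega>} - {x. c \<le> f x})) \<partial>P)
      - (LINT x:{x. f x = c}|hausdorff_measure (CARD('d) - 1). err_mass (sd n) (beta n x) / norm (G x) * g x))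
    \<le> e * norm (norm (h n) ^ \<nu> + 1 / sqrt (real n * (\<Prod>j\<in>UNIV. h n $ j)))"
    using risk_expansion[OF g gb eA]
  proof eventually_elim
    case (elim n)
    have surf: "(LINT x:{x. f x = c}|hausdorff_measure (CARD('d) - 1). err_mass (sd n) (beta n x) / norm (G x) * g x)
        = (\<integral>x. g x / norm (G x) * indicator {x. f x = c} x * err_mass (sd n) (beta n x) \<partial>\<H>)"
      unfolding set_lebesgue_integral_def \<H>_def by (intro Bochner_Integration.integral_cong) auto
    have "e / A * tau n \<le> e / A * (A * (norm (h n) ^ \<nu> + 1 / sqrt (real n * vol n)))"
      using tau_le eA by (intro mult_left_mono) auto
    also have "\<dots> = e * (norm (h n) ^ \<nu> + 1 / sqrt (real n * vol n))" using A(1) by simp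
    also have "\<dots> \<le> e * norm (norm (h n) ^ \<nu> + 1 / sqrt (real n * vol n))" using e by (intro mult_left_mono) auto
    finally have "e / A * tau n \<le> e * norm (norm (h n) ^ \<nu> + 1 / sqrt (real n * vol n))" .
    moreover have "\<bar>(\<integral>x. g x * miscl n x \<partial>lborel) - (\<integral>x. g x / norm (G x) * indicator {x. f x = c} x * err_mass (sd n) (beta n x) \<partial>\<H>)\<bar> \<le> e / A * tau n"
      using elim by blast
    ultimately show ?case
      unfolding surf expected_risk[OF gm g(2) conjunct1[OF elim]] vol_def[symmetric] real_norm_def[of "_ - _"] by (rule order_trans[rotated])
  qed
qed

end

section \<open>From the hypotheses of the theorem to those of the locales\<close>

lemma rpow_mono: "0 \<le> a \<Longrightarrow> a \<le> b \<Longrightarrow> 0 \<le> r \<Longrightarrow> rpow a r \<le> rpow b r"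
  by (simp add: rpow_def powr_mono2)

lemma rpow_nonneg: "0 \<le> rpow a r"
  by (simp add: rpow_def)

text \<open>\<open>K u\<close> is the value at 0 of the class member with no derivative taken, unit
  bandwidths and x = u. This gives a bound at every point rather than almost everywhere.\<close>

lemma kernel_le_sup_norm:
  fixes K :: "real^'d::finite \<Rightarrow> real"
  assumes "sup_norm (envelope (kernel_class K)) < \<infinity>"
  shows "\<bar>K u\<bar> \<le> enn2real (sup_norm (envelope (kernel_class K)))"
proof -
  let ?\<phi> = "\<lambda>y. partials [] K (inv_scale (\<chi> j. 1) (u - y))"
  have "inv_scale (\<chi> j. 1) v = v" for v :: "real^'d" by (simp add: inv_scale_def vec_eq_iff)
  then have "ennreal \<bar>K u\<bar> = ennreal \<bar>?\<phi> 0\<bar>" by (simp add: partials_def)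
  also have "\<dots> \<le> envelope (kernel_class K) 0"
    unfolding envelope_def by (rule SUP_upper) (unfold kernel_class_def, intro CollectI exI[of _ "[]"] exI[of _ "\<chi> j. 1"] exI[of _ u], simp)
  also have "\<dots> \<le> sup_norm (envelope (kernel_class K))" unfolding sup_norm_def by (rule SUP_upper) simp
  finally have "enn2real (ennreal \<bar>K u\<bar>) \<le> enn2real (sup_norm (envelope (kernel_class K)))"
    using assms by (intro enn2real_mono) (auto simp: top_unique)
  then show ?thesis by simp
qed

lemma lipschitz_bounded_partials:
  fixes f :: "real^'d::finite \<Rightarrow> real"
  assumes f: "times_cont_diff k f" "1 \<le> k" and b: "\<And>i. bounded (range (partials [i] f))"
  shows "\<exists>L\<ge>0. \<forall>x y. \<bar>f x - f y\<bar> \<le> L * norm (x - y)"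
proof -
  have "\<exists>B. \<forall>x. \<bar>grad f x $ i\<bar> \<le> B" for i
    using b[of i] unfolding bounded_iff by (auto simp: partials_def grad_def)
  then obtain B where B: "\<And>i x. \<bar>grad f x $ i\<bar> \<le> B i" by metis
  have L: "norm (grad f x) \<le> (\<Sum>i\<in>UNIV. B i)" for x
    using norm_le_l1_cart[of "grad f x"] sum_mono[of UNIV "\<lambda>i. \<bar>grad f x $ i\<bar>" B] B by (auto intro: order_trans)
  have "norm (f x - f y) \<le> (\<Sum>i\<in>UNIV. B i) * norm (x - y)" for x y
  proof (rule differentiable_bound[of UNIV f "\<lambda>x v. grad f x \<bullet> v"])
    fix x
    show "(f has_derivative (\<lambda>v. grad f x \<bullet> v)) (at x within UNIV)"
      using has_derivative_times_cont_diff(1)[OF f] by simp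
    show "onorm (\<lambda>v. grad f x \<bullet> v) \<le> (\<Sum>i\<in>UNIV. B i)"
    proof (rule onorm_le)
      fix v
      have "norm (grad f x \<bullet> v) \<le> norm (grad f x) * norm v" using Cauchy_Schwarz_ineq2[of "grad f x" v] by simp
      also have "\<dots> \<le> (\<Sum>i\<in>UNIV. B i) * norm v" using L by (intro mult_right_mono) auto
      finally show "norm (grad f x \<bullet> v) \<le> (\<Sum>i\<in>UNIV. B i) * norm v" .
    qed
  qed auto
  moreover have "0 \<le> (\<Sum>i\<in>UNIV. B i)" using L norm_ge_zero order_trans by blast
  ultimately show ?thesis by auto
qed

text \<open>The range is connected and has values on both sides of \<open>c\<close>. The point found
  is the default in the choice of almost worst points.\<close>

lemma level_attained:
  fixes f :: "'a::real_normed_vector \<Rightarrow> real"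
  assumes f: "continuous_on UNIV f" "bounded (range f)" and c: "(INF x. f x) < c" "c < (SUP x. f x)"
  shows "\<exists>x. f x = c"
proof -
  have "bdd_below (range f)" "bdd_above (range f)"
    using f(2) by (simp_all add: bounded_imp_bdd_below bounded_imp_bdd_above)
  then obtain a b where "f a < c" "c < f b" using c by (auto simp: cINF_less_iff less_cSUP_iff)
  then have "c \<in> {f a..f b}" by simp
  moreover have "connected (range f)" using f(1) by (intro connected_continuous_image connected_UNIV)
  ultimately have "c \<in> range f" using connected_contains_Icc[of "range f" "f a" "f b"] by blast
  then show ?thesis by auto
qed

text \<open>Eventually ln (ln n) is positive and the quotient is at least 1, so - ln (norm (h n)) is
  at least ln (ln n), which diverges.\<close>

lemma bandwidth_vanishes:
  fixes h :: "nat \<Rightarrow> real^'d::finite"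
  assumes h: "\<And>n j. 0 < h n $ j"
    and lim: "filterlim (\<lambda>n. ln (1 / norm (h n)) / ln (ln (real n))) at_top sequentially"
  shows "(\<lambda>n. norm (h n)) \<longlonglongrightarrow> 0"
proof -
  have pos: "0 < norm (h n)" for n using h[of n undefined] component_le_norm_cart[of "h n" undefined] by linarith
  have ll: "filterlim (\<lambda>n::nat. ln (ln (real n))) at_top sequentially" by real_asymp
  have "filterlim (\<lambda>n. - ln (norm (h n))) at_top sequentially"
  proof (rule filterlim_at_top_mono[OF ll])
    show "\<forall>\<^sub>F n in sequentially. ln (ln (real n)) \<le> - ln (norm (h n))"
      using eventually_compose_filterlim[OF eventually_ge_at_top[of 1] lim] eventually_compose_filterlim[OF eventually_gt_at_top[of 0] ll]
    proof eventually_elim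
      case (elim n)
      then have "ln (ln (real n)) \<le> ln (1 / norm (h n))" by (simp add: pos_le_divide_eq)
      then show ?case using pos[of n] by (simp add: ln_div)
    qed
  qed
  then have "filterlim (\<lambda>n. ln (norm (h n))) at_bot sequentially" by (simp add: filterlim_uminus_at_bot)
  from filterlim_compose[OF exp_at_bot this] show ?thesis using pos by simp
qed

text \<open>Once ln n \<ge> 1 and the quotient is nonnegative, \<open>a n\<close> dominates the
  diverging quotient.\<close>

lemma effective_size_diverges:
  fixes a :: "nat \<Rightarrow> real"
  assumes lim: "filterlim (\<lambda>n. inverse (ln (real n)) * a n) at_top sequentially"
  shows "filterlim a at_top sequentially"
proof (rule filterlim_at_top_mono[OF lim])
  have "\<forall>\<^sub>F n in sequentially. 1 \<le> ln (real n)" by real_asymp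
  then show "\<forall>\<^sub>F n in sequentially. inverse (ln (real n)) * a n \<le> a n"
    using eventually_compose_filterlim[OF eventually_ge_at_top[of 0] lim]
  proof eventually_elim
    case (elim n)
    have "0 \<le> a n" using elim by (simp add: zero_le_mult_iff)
    moreover have "inverse (ln (real n)) \<le> 1" using elim by (simp add: inverse_le_1_iff)
    ultimately show ?case using mult_right_mono[of "inverse (ln (real n))" 1 "a n"] by simp
  qed
qed

theorem corollary3p1:
  fixes P :: "'w measure"
    and X :: "nat \<Rightarrow> 'w \<Rightarrow> real^'d::finite"
    and f g K :: "real^'d \<Rightarrow> real"
    and Kt :: "real \<Rightarrow> real"
    and h :: "nat \<Rightarrow> real^'d"
    and c :: real
    and \<nu> :: nat
  defines "L \<equiv> {x. f x \<ge> c}"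
    and "Lhat \<equiv> \<lambda>n \<omega>. {x. kde K (h n) n (\<lambda>i. X i \<omega>) x \<ge> c}"
    and "M \<equiv> {x. f x = c}"
  assumes nu: "\<nu> \<ge> 2"
    and h_pos: "\<And>n j. 0 < h n $ j"
    \<comment> \<open>i.i.d. sample with density f\<close>
    and P: "prob_space P"
    and indep: "prob_space.indep_vars P (\<lambda>_. borel) X UNIV"
    and f_nonneg: "\<And>x. 0 \<le> f x"
    and density: "\<And>i. distributed P lborel (X i) (\<lambda>x. ennreal (f x))"
    \<comment> \<open>(i)\<close>
    and f_smooth: "times_cont_diff \<nu> f"
    and f_bdd: "\<And>is. length is \<le> \<nu> \<Longrightarrow> bounded (range (partials is f))"
    and c_level: "(INF x. f x) < c" "c < (SUP x. f x)"
    and f_grad: "\<exists>\<delta>\<^sub>0>0. \<exists>\<epsilon>\<^sub>0>0. \<forall>x. \<bar>f x - c\<bar> \<le> \<delta>\<^sub>0 \<longrightarrow> norm (grad f x) > \<epsilon>\<^sub>0"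
    \<comment> \<open>(ii)\<close>
    and g_nonneg: "\<And>x. 0 \<le> g x"
    and g_cont: "continuous_on UNIV g"
    and g_form: "integrable lborel g \<or>
       (\<exists>r\<ge>0. \<exists>q\<ge>0. g = (\<lambda>x. rpow (f x) r * rpow \<bar>f x - c\<bar> q))"
    and g_pos: "\<And>x. x \<in> M \<Longrightarrow> 0 < g x"
    and g_bdd: "bounded (g ` M)"
    and g_unif: "((\<lambda>s. SUP x\<in>M. ennreal \<bar>g (zeta f x s) - g x\<bar>) \<longlongrightarrow> 0) (at 0)"
    \<comment> \<open>(iii)\<close>
    and K_prod: "\<And>u. K u = (\<Prod>j\<in>UNIV. Kt (u $ j))"
    and K_sym: "\<And>u. K (- u) = K u"
    and K_order: "kernel_order \<nu> Kt"
    and K_L1: "integrable lborel K"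
    and K_Linf: "\<exists>B. AE u in lborel. \<bar>K u\<bar> \<le> B"
    \<comment> \<open>(iv)\<close>
    and K_smooth: "times_cont_diff 2 K"
    and F_bdd: "sup_norm (envelope (kernel_class K)) < \<infinity>"
    and K_entropy: "\<exists>C\<^sub>0>0. \<exists>\<eta>>0. \<forall>\<epsilon>. 0 < \<epsilon> \<and> \<epsilon> < 1 \<longrightarrow>
       (SUP Q\<in>borel_prob_measures. ereal_of_enat (covering_number Q (kernel_class K)
            (\<epsilon> * enn2real (sup_norm (envelope (kernel_class K))))))
         \<le> ereal (C\<^sub>0 * \<epsilon> powr (- \<eta>))"
    \<comment> \<open>(v)\<close>
    and h_large: "filterlim (\<lambda>n. inverse (ln (real n)) * (real n * (\<Prod>j\<in>UNIV. h n $ j))) at_top sequentially"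
    and h_small: "filterlim (\<lambda>n. ln (1 / norm (h n)) / ln (ln (real n))) at_top sequentially"
    and h_comp: "CARD('d) \<ge> 2 \<Longrightarrow> \<forall>i j. order_comparable (\<lambda>n. h n $ i) (\<lambda>n. h n $ j)"
  shows "(\<lambda>n. (\<integral>\<omega>. lambda_meas g ((L - Lhat n \<omega>) \<union> (Lhat n \<omega> - L)) \<partial>P)
            - (LINT x:M|hausdorff_measure (CARD('d) - 1).
                 s_dev c K (h n) n * gamma_fn (\<bar>bias_beta \<nu> Kt f (h n) x\<bar> / s_dev c K (h n) n)
                   / norm (grad f x) * g x))
         \<in> o(\<lambda>n. norm (h n) ^ \<nu> + 1 / sqrt (real n * (\<Prod>j\<in>UNIV. h n $ j)))"
proof -
  have bf: "bounded (range f)" using f_bdd[of "[]"] by (simp add: partials_def)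
  then obtain Bf where Bf: "\<And>x. f x \<le> Bf" unfolding bounded_iff by (metis abs_le_D1 rangeI real_norm_def)
  obtain Lf where Lf: "0 \<le> Lf" "\<And>x y. \<bar>f x - f y\<bar> \<le> Lf * norm (x - y)"
    using lipschitz_bounded_partials[OF f_smooth _ f_bdd] nu by auto
  have f_cont: "continuous_on UNIV f" using f_smooth by (auto simp: times_cont_diff_def partials_def dest: spec[of _ "[]"])
  obtain x0 where x0: "f x0 = c" using level_attained[OF f_cont bf c_level] by blast
  \<comment> \<open>The infimum of a density is nonnegative and lies strictly below
    \<open>c\<close>; positivity of \<open>c\<close> makes s_n positive.\<close>
  have c_pos: "0 < c"
  proof -
    have "0 \<le> (INF x. f x)" using f_nonneg by (intro cINF_greatest) auto
    then show ?thesis using c_level(1) by linarith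
  qed
  obtain \<delta>0 where \<delta>0: "0 < \<delta>0" "\<And>x. \<bar>f x - c\<bar> \<le> \<delta>0 \<Longrightarrow> grad f x \<noteq> 0"
    using f_grad by (metis less_irrefl less_trans norm_zero)
  interpret prob_space P by (rule P)
  interpret level_set_kde K Kt \<nu> P X f c h "enn2real (sup_norm (envelope (kernel_class K)))" Bf Lf \<delta>0 x0
    by unfold_locales
      (fact nu K_prod K_sym K_order K_L1 indep f_nonneg density kernel_le_sup_norm[OF F_bdd] Bf Lf c_pos h_pos
        bandwidth_vanishes[OF h_pos h_small] effective_size_diverges[OF h_large] f_smooth f_bdd x0 \<delta>0)+
  \<comment> \<open>A weight of the second form is bounded because \<open>f\<close> is, so both
    forms fall under the alternative treated in \<open>far_region\<close>.\<close>
  have gb: "integrable lborel g \<or> (\<exists>Bg. \<forall>x. g x \<le> Bg)"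
    using g_form
  proof
    assume "\<exists>r\<ge>0. \<exists>q\<ge>0. g = (\<lambda>x. rpow (f x) r * rpow \<bar>f x - c\<bar> q)"
    then obtain r q where rq: "0 \<le> r" "0 \<le> q" "g = (\<lambda>x. rpow (f x) r * rpow \<bar>f x - c\<bar> q)" by blast
    have "g x \<le> rpow Bf r * rpow (Bf + c) q" for x
      unfolding rq(3) using rq(1,2) f_nonneg[of x] Bf[of x] c_pos by (intro mult_mono rpow_mono rpow_nonneg) auto
    then show ?thesis by blast
  qed simp
  show ?thesis
    using risk_asymptotics[OF g_cont g_nonneg gb]
    unfolding L_def Lhat_def M_def fh_def sd_def beta_def err_mass_def by simp
qed

end
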